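(* The $\Phi_{\mathrm{ex}}$-exact (locally small) categories, of any size, are precisely the finitely complete Barr-exact categories.
   Context: All categories are ordinary locally small categories ($\mathcal V=\mathbf{Set}$); lex means finite-limit-preserving between finitely complete categories. A class of lex-weights $\Phi$ is a collection of functors $\phi:\mathcal K^{op}\to\mathbf{Set}$ with each $\mathcal K$ small and finitely complete. A $\Phi$-lex-colimit is a weighted colimit $\phi\star D$ with $\phi:\mathcal K^{op}\to\mathbf{Set}$ in $\Phi$ and $D$ a lex functor with domain $\mathcal K$. $\mathcal P\mathcal C$ is the category of small presheaves on $\mathcal C$ (presheaves that are left Kan extensions of their restriction to some small full subcategory); it is finitely complete if $\mathcal C$ is. For finitely complete $\mathcal C$, $\Phi_l\mathcal C$ is the smallest full replete subcategory of $\mathcal P\mathcal C$ containing the representables and closed under finite limits and $\Phi$-lex-colimits, and $W:\mathcal C\to\Phi_l\mathcal C$ is the restricted Yoneda embedding. $\mathcal C$ is $\Phi$-exact if it is finitely complete and $W$ has a finite-limit-preserving left adjoint. The class $\Phi_{\mathrm{ex}}$ consists of the single functor $\phi:\mathcal K^{op}\to\mathbf{Set}$, where $\mathcal K$ is the free category with finite limits generated by an equivalence relation $(s,t):R\rightarrowtail X\times X$, and $\phi$ is the coequaliser in $[\mathcal K^{op},\mathbf{Set}]$ of $\mathcal K(-,s)$ and $\mathcal K(-,t)$. (A finitely complete category has all $\Phi_{\mathrm{ex}}$-lex-colimits just when it has coequalisers of equivalence relations.) A finitely complete category is Barr-exact if it is regular (has coequalisers of kernel-pairs, and regular epimorphisms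 are stable under pullback) and every equivalence relation in it is the kernel-pair of some map. *)

theory Defs
  imports "HOL-Library.FuncSet"
begin

unbundle cardinal_syntax

section \<open>Size\<close>

text \<open>
  The category of sets is modelled by a universe type \<open>'u\<close>: a set of any type is small when its
  cardinality is strictly below that of \<open>'u\<close>, and \<open>Set\<close> has the small subsets of \<open>'u\<close> as objects.
  The predicate \<open>set_universe\<close> says that the cardinality of \<open>'u\<close> is an (uncountable) inaccessible,
  i.e. that \<open>'u\<close> plays the role of a Grothendieck universe. A set of size at most that of \<open>'u\<close>
  that is not small plays the role of a proper class.
\<close>

definition small :: "'u itself \<Rightarrow> 'a set \<Rightarrow> bool" where
  "small U A \<longleftrightarrow> |A| <o |UNIV :: 'u set|"

definition set_universe :: "'u itself \<Rightarrow> bool" where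
  "set_universe U \<longleftrightarrow>
     small U (UNIV :: nat set) \<and>
     (\<forall>A :: 'u set. small U A \<longrightarrow> small U (Pow A)) \<and>
     (\<forall>(I :: 'u set) (A :: 'u \<Rightarrow> 'u set).
        small U I \<longrightarrow> (\<forall>i\<in>I. small U (A i)) \<longrightarrow> small U (\<Union>i\<in>I. A i))"


section \<open>Categories, functors, natural transformations\<close>

text \<open>
  Categories are given by hom-sets, which need not be disjoint; hence composition and the action
  of functors on arrows carry the objects as arguments. \<open>Comp C a b c g f\<close> is the composite
  of \<open>f : a \<rightarrow> b\<close> followed by \<open>g : b \<rightarrow> c\<close>. All components are only meaningful on \<open>Ob C\<close> and the
  hom-sets between such objects.
\<close>

record ('o, 'm) cat =
  Ob :: "'o set"
  Hom :: "'o \<Rightarrow> 'o \<Rightarrow> 'm set"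
  idn :: "'o \<Rightarrow> 'm"
  Comp :: "'o \<Rightarrow> 'o \<Rightarrow> 'o \<Rightarrow> 'm \<Rightarrow> 'm \<Rightarrow> 'm"

definition category :: "('o, 'm) cat \<Rightarrow> bool" where
  "category C \<longleftrightarrow>
     (\<forall>a\<in>Ob C. idn C a \<in> Hom C a a) \<and>
     (\<forall>a\<in>Ob C. \<forall>b\<in>Ob C. \<forall>c\<in>Ob C. \<forall>f\<in>Hom C a b. \<forall>g\<in>Hom C b c.
        Comp C a b c g f \<in> Hom C a c) \<and>
     (\<forall>a\<in>Ob C. \<forall>b\<in>Ob C. \<forall>f\<in>Hom C a b.
        Comp C a a b f (idn C a) = f \<and> Comp C a b b (idn C b) f = f) \<and>
     (\<forall>a\<in>Ob C. \<forall>b\<in>Ob C. \<forall>c\<in>Ob C. \<forall>d\<in>Ob C.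
        \<forall>f\<in>Hom C a b. \<forall>g\<in>Hom C b c. \<forall>h\<in>Hom C c d.
        Comp C a c d h (Comp C a b c g f) = Comp C a b d (Comp C b c d h g) f)"

text \<open>The arrows of a locally small category are taken in the universe type itself, so that
  representable presheaves are literally functors into \<open>Set\<close>; up to isomorphism of categories
  this is no restriction. The type of objects is arbitrary.\<close>

definition locally_small :: "('o, 'u) cat \<Rightarrow> bool" where
  "locally_small C \<longleftrightarrow> category C \<and> (\<forall>a\<in>Ob C. \<forall>b\<in>Ob C. small TYPE('u) (Hom C a b))"

definition small_category :: "('o, 'u) cat \<Rightarrow> bool" where
  "small_category C \<longleftrightarrow> locally_small C \<and> small TYPE('u) (Ob C)"

definition finite_category :: "('o, 'm) cat \<Rightarrow> bool" where
  "finite_category J \<longleftrightarrow>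
     category J \<and> finite (Ob J) \<and> (\<forall>a\<in>Ob J. \<forall>b\<in>Ob J. finite (Hom J a b))"

definition op_cat :: "('o, 'm) cat \<Rightarrow> ('o, 'm) cat" where
  "op_cat C = \<lparr>Ob = Ob C, Hom = (\<lambda>a b. Hom C b a), idn = idn C,
     Comp = (\<lambda>a b c g f. Comp C c b a f g)\<rparr>"

definition full_subcat :: "('o, 'm) cat \<Rightarrow> 'o set \<Rightarrow> ('o, 'm) cat" where
  "full_subcat C S = C\<lparr>Ob := S\<rparr>"

definition set_cat :: "('u set, 'u \<Rightarrow> 'u) cat" where
  "set_cat = \<lparr>Ob = {A. small TYPE('u) A}, Hom = (\<lambda>A B. A \<rightarrow>\<^sub>E B), idn = (\<lambda>A. \<lambda>x\<in>A. x),
     Comp = (\<lambda>A B C g f. compose A g f)\<rparr>"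

definition is_iso :: "('o, 'm) cat \<Rightarrow> 'o \<Rightarrow> 'o \<Rightarrow> 'm \<Rightarrow> bool" where
  "is_iso C a b f \<longleftrightarrow> f \<in> Hom C a b \<and>
     (\<exists>g\<in>Hom C b a. Comp C a b a g f = idn C a \<and> Comp C b a b f g = idn C b)"

definition isomorphic :: "('o, 'm) cat \<Rightarrow> 'o \<Rightarrow> 'o \<Rightarrow> bool" where
  "isomorphic C a b \<longleftrightarrow> (\<exists>f. is_iso C a b f)"

record ('o, 'm, 'p, 'n) ftor =
  fob :: "'o \<Rightarrow> 'p"
  fmap :: "'o \<Rightarrow> 'o \<Rightarrow> 'm \<Rightarrow> 'n"

definition is_functor :: "('o, 'm) cat \<Rightarrow> ('p, 'n) cat \<Rightarrow> ('o, 'm, 'p, 'n) ftor \<Rightarrow> bool" where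
  "is_functor A B F \<longleftrightarrow>
     (\<forall>a\<in>Ob A. fob F a \<in> Ob B) \<and>
     (\<forall>a\<in>Ob A. \<forall>b\<in>Ob A. \<forall>f\<in>Hom A a b. fmap F a b f \<in> Hom B (fob F a) (fob F b)) \<and>
     (\<forall>a\<in>Ob A. fmap F a a (idn A a) = idn B (fob F a)) \<and>
     (\<forall>a\<in>Ob A. \<forall>b\<in>Ob A. \<forall>c\<in>Ob A. \<forall>f\<in>Hom A a b. \<forall>g\<in>Hom A b c.
        fmap F a c (Comp A a b c g f) =
        Comp B (fob F a) (fob F b) (fob F c) (fmap F b c g) (fmap F a b f))"

definition inclusion_functor :: "('o, 'm, 'o, 'm) ftor" where
  "inclusion_functor = \<lparr>fob = (\<lambda>a. a), fmap = (\<lambda>a b f. f)\<rparr>"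

definition fcomp :: "('p, 'n, 'q, 'k) ftor \<Rightarrow> ('o, 'm, 'p, 'n) ftor \<Rightarrow> ('o, 'm, 'q, 'k) ftor" where
  "fcomp G F = \<lparr>fob = (\<lambda>a. fob G (fob F a)),
     fmap = (\<lambda>a b f. fmap G (fob F a) (fob F b) (fmap F a b f))\<rparr>"

definition nat_trans ::
  "('o, 'm) cat \<Rightarrow> ('p, 'n) cat \<Rightarrow> ('o, 'm, 'p, 'n) ftor \<Rightarrow> ('o, 'm, 'p, 'n) ftor \<Rightarrow> ('o \<Rightarrow> 'n) \<Rightarrow> bool"
where
  "nat_trans A B F G \<alpha> \<longleftrightarrow>
     (\<forall>a\<in>Ob A. \<alpha> a \<in> Hom B (fob F a) (fob G a)) \<and>
     (\<forall>a\<in>Ob A. \<forall>b\<in>Ob A. \<forall>f\<in>Hom A a b.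
        Comp B (fob F a) (fob F b) (fob G b) (\<alpha> b) (fmap F a b f) =
        Comp B (fob F a) (fob G a) (fob G b) (fmap G a b f) (\<alpha> a))"

text \<open>Natural transformations are made extensional so that equality of arrows is the right one.
  Functors agreeing on the objects and arrows of \<open>A\<close> may still differ elsewhere; they are then
  distinct but isomorphic objects.\<close>

definition fun_cat ::
  "('o, 'm) cat \<Rightarrow> ('p, 'n) cat \<Rightarrow> (('o, 'm, 'p, 'n) ftor, 'o \<Rightarrow> 'n) cat" where
  "fun_cat A B = \<lparr>Ob = {F. is_functor A B F},
     Hom = (\<lambda>F G. {\<alpha> \<in> extensional (Ob A). nat_trans A B F G \<alpha>}),
     idn = (\<lambda>F. \<lambda>a\<in>Ob A. idn B (fob F a)),
     Comp = (\<lambda>F G H \<beta> \<alpha>. \<lambda>a\<in>Ob A. Comp B (fob F a) (fob G a) (fob H a) (\<beta> a) (\<alpha> a))\<rparr>"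

definition is_equivalence ::
  "('o, 'm) cat \<Rightarrow> ('p, 'n) cat \<Rightarrow> ('o, 'm, 'p, 'n) ftor \<Rightarrow> bool" where
  "is_equivalence A B F \<longleftrightarrow> is_functor A B F \<and>
     (\<forall>a\<in>Ob A. \<forall>b\<in>Ob A. bij_betw (fmap F a b) (Hom A a b) (Hom B (fob F a) (fob F b))) \<and>
     (\<forall>b\<in>Ob B. \<exists>a\<in>Ob A. isomorphic B (fob F a) b)"

text \<open>\<open>L : A \<rightarrow> B\<close> is left adjoint to \<open>R : B \<rightarrow> A\<close>.\<close>

definition is_left_adjoint ::
  "('o, 'm) cat \<Rightarrow> ('p, 'n) cat \<Rightarrow> ('o, 'm, 'p, 'n) ftor \<Rightarrow> ('p, 'n, 'o, 'm) ftor \<Rightarrow> bool" where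
  "is_left_adjoint A B L R \<longleftrightarrow> is_functor A B L \<and> is_functor B A R \<and>
     (\<exists>\<theta> :: 'o \<Rightarrow> 'p \<Rightarrow> 'n \<Rightarrow> 'm.
        (\<forall>a\<in>Ob A. \<forall>b\<in>Ob B. bij_betw (\<theta> a b) (Hom B (fob L a) b) (Hom A a (fob R b))) \<and>
        (\<forall>a\<in>Ob A. \<forall>a'\<in>Ob A. \<forall>b\<in>Ob B. \<forall>b'\<in>Ob B.
           \<forall>u\<in>Hom A a' a. \<forall>v\<in>Hom B b b'. \<forall>h\<in>Hom B (fob L a) b.
           \<theta> a' b' (Comp B (fob L a') b b' v (Comp B (fob L a') (fob L a) b h (fmap L a' a u))) =
           Comp A a' (fob R b) (fob R b') (fmap R b b' v)
             (Comp A a' a (fob R b) (\<theta> a b h) u)))"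


section \<open>Limits and coequalisers\<close>

definition is_cone ::
  "('j, 'i) cat \<Rightarrow> ('o, 'm) cat \<Rightarrow> ('j, 'i, 'o, 'm) ftor \<Rightarrow> 'o \<Rightarrow> ('j \<Rightarrow> 'm) \<Rightarrow> bool" where
  "is_cone J C D c \<pi> \<longleftrightarrow> c \<in> Ob C \<and>
     (\<forall>j\<in>Ob J. \<pi> j \<in> Hom C c (fob D j)) \<and>
     (\<forall>i\<in>Ob J. \<forall>j\<in>Ob J. \<forall>f\<in>Hom J i j.
        Comp C c (fob D i) (fob D j) (fmap D i j f) (\<pi> i) = \<pi> j)"

definition is_limit ::
  "('j, 'i) cat \<Rightarrow> ('o, 'm) cat \<Rightarrow> ('j, 'i, 'o, 'm) ftor \<Rightarrow> 'o \<Rightarrow> ('j \<Rightarrow> 'm) \<Rightarrow> bool" where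
  "is_limit J C D c \<pi> \<longleftrightarrow> is_cone J C D c \<pi> \<and>
     (\<forall>c' \<pi>'. is_cone J C D c' \<pi>' \<longrightarrow>
        (\<exists>!h. h \<in> Hom C c' c \<and> (\<forall>j\<in>Ob J. Comp C c' c (fob D j) (\<pi> j) h = \<pi>' j)))"

text \<open>Every finite category is isomorphic to one whose objects and arrows are natural numbers.\<close>

definition finitely_complete :: "('o, 'm) cat \<Rightarrow> bool" where
  "finitely_complete C \<longleftrightarrow> category C \<and>
     (\<forall>(J :: (nat, nat) cat) D. finite_category J \<longrightarrow> is_functor J C D \<longrightarrow>
        (\<exists>c \<pi>. is_limit J C D c \<pi>))"

definition lex_functor :: "('o, 'm) cat \<Rightarrow> ('p, 'n) cat \<Rightarrow> ('o, 'm, 'p, 'n) ftor \<Rightarrow> bool" where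
  "lex_functor A B F \<longleftrightarrow> finitely_complete A \<and> finitely_complete B \<and> is_functor A B F \<and>
     (\<forall>(J :: (nat, nat) cat) D c \<pi>.
        finite_category J \<longrightarrow> is_functor J A D \<longrightarrow> is_limit J A D c \<pi> \<longrightarrow>
        is_limit J B (fcomp F D) (fob F c) (\<lambda>j. fmap F c (fob D j) (\<pi> j)))"

definition is_pullback ::
  "('o, 'm) cat \<Rightarrow> 'o \<Rightarrow> 'o \<Rightarrow> 'o \<Rightarrow> 'm \<Rightarrow> 'm \<Rightarrow> 'o \<Rightarrow> 'm \<Rightarrow> 'm \<Rightarrow> bool" where
  "is_pullback C a b c f g p p1 p2 \<longleftrightarrow>
     a \<in> Ob C \<and> b \<in> Ob C \<and> c \<in> Ob C \<and> p \<in> Ob C \<and>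
     f \<in> Hom C a c \<and> g \<in> Hom C b c \<and> p1 \<in> Hom C p a \<and> p2 \<in> Hom C p b \<and>
     Comp C p a c f p1 = Comp C p b c g p2 \<and>
     (\<forall>z\<in>Ob C. \<forall>u\<in>Hom C z a. \<forall>v\<in>Hom C z b. Comp C z a c f u = Comp C z b c g v \<longrightarrow>
        (\<exists>!h. h \<in> Hom C z p \<and> Comp C z p a p1 h = u \<and> Comp C z p b p2 h = v))"

text \<open>\<open>e : b \<rightarrow> q\<close> is a coequaliser of \<open>f, g : a \<rightarrow> b\<close>.\<close>

definition is_coequaliser ::
  "('o, 'm) cat \<Rightarrow> 'o \<Rightarrow> 'o \<Rightarrow> 'm \<Rightarrow> 'm \<Rightarrow> 'o \<Rightarrow> 'm \<Rightarrow> bool" where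
  "is_coequaliser C a b f g q e \<longleftrightarrow>
     a \<in> Ob C \<and> b \<in> Ob C \<and> q \<in> Ob C \<and>
     f \<in> Hom C a b \<and> g \<in> Hom C a b \<and> e \<in> Hom C b q \<and>
     Comp C a b q e f = Comp C a b q e g \<and>
     (\<forall>z\<in>Ob C. \<forall>u\<in>Hom C b z. Comp C a b z u f = Comp C a b z u g \<longrightarrow>
        (\<exists>!h. h \<in> Hom C q z \<and> Comp C b q z h e = u))"


section \<open>Barr-exact categories\<close>

text \<open>\<open>s, t : r \<rightarrow> x\<close> is the kernel-pair of \<open>f : x \<rightarrow> y\<close>.\<close>

definition is_kernel_pair :: "('o, 'm) cat \<Rightarrow> 'o \<Rightarrow> 'o \<Rightarrow> 'm \<Rightarrow> 'o \<Rightarrow> 'm \<Rightarrow> 'm \<Rightarrow> bool" where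
  "is_kernel_pair C x y f r s t \<longleftrightarrow> is_pullback C x x y f f r s t"

definition regular_epi :: "('o, 'm) cat \<Rightarrow> 'o \<Rightarrow> 'o \<Rightarrow> 'm \<Rightarrow> bool" where
  "regular_epi C b q e \<longleftrightarrow> (\<exists>a f g. is_coequaliser C a b f g q e)"

text \<open>\<open>(s, t) : r \<rightarrow> x \<times> x\<close> is a monomorphism which induces an equivalence relation
  on \<open>C(z, x)\<close> for every \<open>z\<close>.\<close>

definition equivalence_relation :: "('o, 'm) cat \<Rightarrow> 'o \<Rightarrow> 'o \<Rightarrow> 'm \<Rightarrow> 'm \<Rightarrow> bool" where
  "equivalence_relation C r x s t \<longleftrightarrow>
     r \<in> Ob C \<and> x \<in> Ob C \<and> s \<in> Hom C r x \<and> t \<in> Hom C r x \<and>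
     (\<forall>z\<in>Ob C. inj_on (\<lambda>f. (Comp C z r x s f, Comp C z r x t f)) (Hom C z r) \<and>
        equiv (Hom C z x) ((\<lambda>f. (Comp C z r x s f, Comp C z r x t f)) ` Hom C z r))"

definition regular_category :: "('o, 'm) cat \<Rightarrow> bool" where
  "regular_category C \<longleftrightarrow> finitely_complete C \<and>
     (\<forall>x y f r s t. is_kernel_pair C x y f r s t \<longrightarrow> (\<exists>q e. is_coequaliser C r x s t q e)) \<and>
     (\<forall>a b c f g p p1 p2. is_pullback C a b c f g p p1 p2 \<longrightarrow> regular_epi C a c f \<longrightarrow>
        regular_epi C p b p2)"

definition barr_exact :: "('o, 'm) cat \<Rightarrow> bool" where
  "barr_exact C \<longleftrightarrow> regular_category C \<and>
     (\<forall>r x s t. equivalence_relation C r x s t \<longrightarrow> (\<exists>y f. is_kernel_pair C x y f r s t))"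


section \<open>Presheaves\<close>

type_synonym ('o, 'u) presheaf = "('o, 'u, 'u set, 'u \<Rightarrow> 'u) ftor"

definition psh :: "('o, 'u) cat \<Rightarrow> (('o, 'u) presheaf, 'o \<Rightarrow> 'u \<Rightarrow> 'u) cat" where
  "psh C = fun_cat (op_cat C) set_cat"

definition yoneda :: "('o, 'u) cat \<Rightarrow> ('o, 'u, ('o, 'u) presheaf, 'o \<Rightarrow> 'u \<Rightarrow> 'u) ftor" where
  "yoneda C = \<lparr>
     fob = (\<lambda>c. \<lparr>fob = (\<lambda>a. Hom C a c), fmap = (\<lambda>a b f. \<lambda>x\<in>Hom C a c. Comp C b a c x f)\<rparr>),
     fmap = (\<lambda>c d g. \<lambda>a\<in>Ob C. \<lambda>x\<in>Hom C a c. Comp C a c d g x)\<rparr>"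

text \<open>\<open>L : B \<rightarrow> E\<close> with \<open>\<eta> : H \<rightarrow> L J\<close> is the left Kan extension of \<open>H : A \<rightarrow> E\<close> along \<open>J : A \<rightarrow> B\<close>.\<close>

definition is_left_kan_extension ::
  "('a, 'k) cat \<Rightarrow> ('b, 'l) cat \<Rightarrow> ('e, 'm) cat \<Rightarrow> ('a, 'k, 'b, 'l) ftor \<Rightarrow> ('a, 'k, 'e, 'm) ftor \<Rightarrow>
   ('b, 'l, 'e, 'm) ftor \<Rightarrow> ('a \<Rightarrow> 'm) \<Rightarrow> bool" where
  "is_left_kan_extension A B E J H L \<eta> \<longleftrightarrow>
     is_functor A B J \<and> is_functor A E H \<and> is_functor B E L \<and> nat_trans A E H (fcomp L J) \<eta> \<and>
     (\<forall>G \<theta>. is_functor B E G \<longrightarrow> nat_trans A E H (fcomp G J) \<theta> \<longrightarrow>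
        (\<exists>!\<alpha>. \<alpha> \<in> Hom (fun_cat B E) L G \<and>
           (\<forall>a\<in>Ob A. Comp E (fob H a) (fob L (fob J a)) (fob G (fob J a))
              (\<alpha> (fob J a)) (\<eta> a) = \<theta> a)))"

definition small_presheaf :: "('o, 'u) cat \<Rightarrow> ('o, 'u) presheaf \<Rightarrow> bool" where
  "small_presheaf C F \<longleftrightarrow> is_functor (op_cat C) set_cat F \<and>
     (\<exists>B \<subseteq> Ob C. small TYPE('u) B \<and>
        is_left_kan_extension (full_subcat (op_cat C) B) (op_cat C) set_cat
          inclusion_functor (fcomp F inclusion_functor) F (\<lambda>b. idn set_cat (fob F b)))"

definition small_psh :: "('o, 'u) cat \<Rightarrow> (('o, 'u) presheaf, 'o \<Rightarrow> 'u \<Rightarrow> 'u) cat" where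
  "small_psh C = full_subcat (psh C) {F. small_presheaf C F}"


section \<open>Lex-colimits and exactness\<close>

text \<open>A natural transformation \<open>\<phi> \<rightarrow> E(D -, e)\<close>. It is spelled out since the hom-sets of \<open>E\<close>
  need not lie in the universe type.\<close>

definition is_cocylinder ::
  "('k, 'u) cat \<Rightarrow> ('k, 'u) presheaf \<Rightarrow> ('o, 'm) cat \<Rightarrow> ('k, 'u, 'o, 'm) ftor \<Rightarrow> 'o \<Rightarrow>
   ('k \<Rightarrow> 'u \<Rightarrow> 'm) \<Rightarrow> bool" where
  "is_cocylinder K \<phi> E D e \<alpha> \<longleftrightarrow> e \<in> Ob E \<and>
     (\<forall>k\<in>Ob K. \<forall>x\<in>fob \<phi> k. \<alpha> k x \<in> Hom E (fob D k) e) \<and>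
     (\<forall>k\<in>Ob K. \<forall>l\<in>Ob K. \<forall>f\<in>Hom K k l. \<forall>x\<in>fob \<phi> l.
        \<alpha> k (fmap \<phi> l k f x) = Comp E (fob D k) (fob D l) e (\<alpha> l x) (fmap D k l f))"

text \<open>\<open>c\<close> is the weighted colimit \<open>\<phi> \<star> D\<close>, with unit \<open>\<eta> : \<phi> \<rightarrow> E(D -, c)\<close>: composition with \<open>\<eta>\<close>
  is a bijection between \<open>E(c, e)\<close> and the natural transformations \<open>\<phi> \<rightarrow> E(D -, e)\<close>.\<close>

definition is_weighted_colimit ::
  "('k, 'u) cat \<Rightarrow> ('k, 'u) presheaf \<Rightarrow> ('o, 'm) cat \<Rightarrow> ('k, 'u, 'o, 'm) ftor \<Rightarrow> 'o \<Rightarrow>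
   ('k \<Rightarrow> 'u \<Rightarrow> 'm) \<Rightarrow> bool" where
  "is_weighted_colimit K \<phi> E D c \<eta> \<longleftrightarrow> is_cocylinder K \<phi> E D c \<eta> \<and>
     (\<forall>e \<alpha>. is_cocylinder K \<phi> E D e \<alpha> \<longrightarrow>
        (\<exists>!h. h \<in> Hom E c e \<and>
           (\<forall>k\<in>Ob K. \<forall>x\<in>fob \<phi> k. Comp E (fob D k) c e h (\<eta> k x) = \<alpha> k x)))"

text \<open>A lex-weight is a functor \<open>\<phi> : K\<^sup>o\<^sup>p \<rightarrow> Set\<close> together with its domain \<open>K\<close>.\<close>

type_synonym 'u lex_weight = "('u, 'u) cat \<times> ('u, 'u) presheaf"

definition lex_weight_class :: "'u lex_weight set \<Rightarrow> bool" where
  "lex_weight_class \<Phi> \<longleftrightarrow>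
     (\<forall>(K, \<phi>) \<in> \<Phi>. small_category K \<and> finitely_complete K \<and> \<phi> \<in> Ob (psh K))"

definition replete :: "('o, 'm) cat \<Rightarrow> 'o set \<Rightarrow> bool" where
  "replete P S \<longleftrightarrow> (\<forall>a\<in>S. \<forall>b\<in>Ob P. isomorphic P a b \<longrightarrow> b \<in> S)"

definition closed_finite_limits :: "('o, 'm) cat \<Rightarrow> 'o set \<Rightarrow> bool" where
  "closed_finite_limits P S \<longleftrightarrow>
     (\<forall>(J :: (nat, nat) cat) D c \<pi>. finite_category J \<longrightarrow> is_functor J P D \<longrightarrow>
        fob D ` Ob J \<subseteq> S \<longrightarrow> is_limit J P D c \<pi> \<longrightarrow> c \<in> S)"

definition closed_lex_colimits :: "'u lex_weight set \<Rightarrow> ('o, 'm) cat \<Rightarrow> 'o set \<Rightarrow> bool" where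
  "closed_lex_colimits \<Phi> P S \<longleftrightarrow>
     (\<forall>(K, \<phi>) \<in> \<Phi>. \<forall>D c \<eta>. lex_functor K P D \<longrightarrow> fob D ` Ob K \<subseteq> S \<longrightarrow>
        is_weighted_colimit K \<phi> P D c \<eta> \<longrightarrow> c \<in> S)"

definition Phi_l_objects :: "'u lex_weight set \<Rightarrow> ('o, 'u) cat \<Rightarrow> ('o, 'u) presheaf set" where
  "Phi_l_objects \<Phi> C = \<Inter>{S. S \<subseteq> Ob (small_psh C) \<and> replete (small_psh C) S \<and>
     fob (yoneda C) ` Ob C \<subseteq> S \<and>
     closed_finite_limits (small_psh C) S \<and> closed_lex_colimits \<Phi> (small_psh C) S}"

definition Phi_l ::
  "'u lex_weight set \<Rightarrow> ('o, 'u) cat \<Rightarrow> (('o, 'u) presheaf, 'o \<Rightarrow> 'u \<Rightarrow> 'u) cat" where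
  "Phi_l \<Phi> C = full_subcat (small_psh C) (Phi_l_objects \<Phi> C)"

definition Phi_exact :: "'u lex_weight set \<Rightarrow> ('o, 'u) cat \<Rightarrow> bool" where
  "Phi_exact \<Phi> C \<longleftrightarrow> finitely_complete C \<and>
     (\<exists>L. lex_functor (Phi_l \<Phi> C) C L \<and> is_left_adjoint (Phi_l \<Phi> C) C L (yoneda C))"


section \<open>The class of lex-weights for exactness\<close>

text \<open>The category of equivalence relations in \<open>E\<close>: an arrow from \<open>(r, x, s, t)\<close> to \<open>(r', x', s', t')\<close>
  is a pair of arrows \<open>r \<rightarrow> r'\<close> and \<open>x \<rightarrow> x'\<close> commuting with the projections.\<close>

definition eqrel_cat :: "('o, 'm) cat \<Rightarrow> ('o \<times> 'o \<times> 'm \<times> 'm, 'm \<times> 'm) cat" where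
  "eqrel_cat E = \<lparr>
     Ob = {(r, x, s, t). equivalence_relation E r x s t},
     Hom = (\<lambda>(r, x, s, t) (r', x', s', t').
        {(g, f). g \<in> Hom E r r' \<and> f \<in> Hom E x x' \<and>
           Comp E r r' x' s' g = Comp E r x x' f s \<and> Comp E r r' x' t' g = Comp E r x x' f t}),
     idn = (\<lambda>(r, x, s, t). (idn E r, idn E x)),
     Comp = (\<lambda>(r, x, s, t) (r', x', s', t') (r'', x'', s'', t'') (g', f') (g, f).
        (Comp E r r' r'' g' g, Comp E x x' x'' f' f))\<rparr>"

definition lex_cat :: "('k, 'l) cat \<Rightarrow> ('o, 'm) cat \<Rightarrow> (('k, 'l, 'o, 'm) ftor, 'k \<Rightarrow> 'm) cat" where
  "lex_cat K E = full_subcat (fun_cat K E) {F. lex_functor K E F}"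

definition eval_eqrel ::
  "'k \<Rightarrow> 'k \<Rightarrow> 'l \<Rightarrow> 'l \<Rightarrow>
   (('k, 'l, 'o, 'm) ftor, 'k \<Rightarrow> 'm, 'o \<times> 'o \<times> 'm \<times> 'm, 'm \<times> 'm) ftor" where
  "eval_eqrel r x s t = \<lparr>
     fob = (\<lambda>F. (fob F r, fob F x, fmap F r x s, fmap F r x t)),
     fmap = (\<lambda>F G \<alpha>. (\<alpha> r, \<alpha> x))\<rparr>"

text \<open>\<open>K\<close> is the free category with finite limits generated by the equivalence relation
  \<open>(s, t) : r \<rightarrow> x \<times> x\<close>: for every finitely complete \<open>E\<close>, evaluation at it is an equivalence from
  lex functors \<open>K \<rightarrow> E\<close> to equivalence relations in \<open>E\<close>. Here \<open>E\<close> ranges over all locally small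
  categories with a class of objects, i.e. at most as many as the universe type has elements.\<close>

definition free_on_equivalence_relation ::
  "('u, 'u) cat \<Rightarrow> 'u \<Rightarrow> 'u \<Rightarrow> 'u \<Rightarrow> 'u \<Rightarrow> bool" where
  "free_on_equivalence_relation K r x s t \<longleftrightarrow>
     small_category K \<and> finitely_complete K \<and> equivalence_relation K r x s t \<and>
     (\<forall>E :: ('u, 'u) cat. locally_small E \<longrightarrow> finitely_complete E \<longrightarrow>
        is_equivalence (lex_cat K E) (eqrel_cat E) (eval_eqrel r x s t))"

text \<open>The category \<open>K\<close> is determined up to equivalence and \<open>\<phi>\<close> up to isomorphism, so this is a
  predicate holding of every choice of the one-element class.\<close>

definition is_Phi_ex :: "'u lex_weight set \<Rightarrow> bool" where
  "is_Phi_ex \<Phi> \<longleftrightarrow> (\<exists>K r x s t \<phi> q.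
     free_on_equivalence_relation K r x s t \<and>
     is_coequaliser (psh K) (fob (yoneda K) r) (fob (yoneda K) x)
       (fmap (yoneda K) r x s) (fmap (yoneda K) r x t) \<phi> q \<and>
     \<Phi> = {(K, \<phi>)})"

lemma lex_weight_class_Phi_ex: "is_Phi_ex \<Phi> \<Longrightarrow> lex_weight_class \<Phi>"
  by (auto simp: is_Phi_ex_def lex_weight_class_def free_on_equivalence_relation_def
      is_coequaliser_def)

end

theory Submission
  imports Defs
begin

text \<open>
  Let \<open>W\<close> be the Yoneda embedding and let \<open>C\<close> be finitely complete.

  If \<open>C\<close> is Barr-exact, call a map of presheaves \<open>F \<rightarrow> W c\<close> locally bijective when it is so for the topology
  whose covers are the single regular epimorphisms. Representables are sheaves, so such a map is a
  universal arrow from \<open>F\<close> to \<open>W\<close>. The presheaves admitting one are closed under finite limits (take the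
  limit of the maps, refining finitely many covers) and under quotients of equivalence relations (which
  reflect to equivalence relations in \<open>C\<close>, and these are effective). Hence they contain \<open>\<Phi>\<^sub>l C\<close>, and the
  resulting reflection preserves finite limits, again because limits of locally bijective maps
  are locally bijective.

  Conversely, let \<open>W : C \<rightarrow> \<Phi>\<^sub>l C\<close> have a lex left adjoint. The pointwise quotient \<open>Q\<close> of \<open>W x\<close> by an
  equivalence relation \<open>W r\<close> is the lex-colimit of a lex functor factoring through \<open>C\<close>, hence lies in
  \<open>\<Phi>\<^sub>l C\<close>. Its reflection is the coequaliser of \<open>r \<rightarrow> x \<times> x\<close>, and reflecting the kernel-pair
  of \<open>W x \<rightarrow> Q\<close> shows that \<open>r\<close> is effective. Regular epimorphisms are stable since a regular
  epimorphism \<open>x \<rightarrow> c\<close> is the reflection of \<open>Q \<rightarrow> W c\<close> and the latter can be pulled back in \<open>\<Phi>\<^sub>l C\<close>.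

  For this the category of small presheaves must have finite limits. A presheaf is small iff it has a small
  set of generators between which all equalities are witnessed by a small set of spans; once the objects
  involved are closed under finite limits in \<open>C\<close>, this condition passes to finite limits and quotients.
\<close>

section \<open>Small sets\<close>

text \<open>The sheaf associated with a presheaf is never constructed: over a large \<open>C\<close>
  a plus construction would range over all covers of an object, which need not form a small set. A
  locally bijective map \<open>F \<rightarrow> W c\<close> instead certifies that \<open>c\<close>
  represents this sheaf, and closure properties and left exactness can be checked on elements after
  passing to a cover. What makes this work is finiteness: finitely many covers of an object have a
  common refinement, because regular epimorphisms are stable under pullback and compose.

  Two features of the setting shape the rest. Presheaves take values in subsets of
  \<open>'u\<close>, so limits and quotients are built in another type and injected; afterwards they
  are handled only through properties of their elements. And the free category \<open>K\<close> is
  accessible only through its universal property. Hence a colimit weighted by \<open>\<phi>\<close>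
  is only ever used as a coequaliser of \<open>D s\<close> and \<open>D t\<close>, and lex functors
  out of \<open>K\<close> are obtained only from essential surjectivity of evaluation at the generic
  equivalence relation.\<close>

lemma small_inj:
  assumes "small TYPE('u) (A :: 'a set)"
  obtains e :: "'a \<Rightarrow> 'u" where "inj_on e A"
proof -
  have "|A| \<le>o |UNIV :: 'u set|"
    using assms ordLess_imp_ordLeq unfolding small_def by blast
  then show ?thesis
    using that card_of_ordLeq by metis
qed

lemma small_inj_on:
  assumes "inj_on f A" "f ` A \<subseteq> B" "small TYPE('u) B"
  shows "small TYPE('u) A"
  using assms card_of_ordLeqI[of f A B] ordLeq_ordLess_trans unfolding small_def by blast

lemma small_subset: "small TYPE('u) B \<Longrightarrow> A \<subseteq> B \<Longrightarrow> small TYPE('u) A"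
  by (rule small_inj_on[of id]) auto

lemma small_image: "small TYPE('u) A \<Longrightarrow> small TYPE('u) (f ` A)"
  using card_of_image[of f A] ordLeq_ordLess_trans unfolding small_def by blast

locale universe =
  fixes U :: "'u itself"
  assumes set_universe: "set_universe TYPE('u)"
begin

lemma infinite_universe: "infinite (UNIV :: 'u set)"
proof
  assume "finite (UNIV :: 'u set)"
  moreover have "|UNIV :: nat set| \<le>o |UNIV :: 'u set|"
    using set_universe ordLess_imp_ordLeq unfolding set_universe_def small_def by blast
  ultimately show False
    using card_of_ordLeq_finite infinite_UNIV_nat by blast
qed

lemma small_nat: "small TYPE('u) (UNIV :: nat set)"
  using set_universe unfolding set_universe_def by blast

lemma small_finite:
  assumes "finite A" shows "small TYPE('u) A"
proof -
  obtain f :: "_ \<Rightarrow> nat" where "inj_on f A"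
    using finite_imp_inj_to_nat_seg[OF assms] by blast
  then show ?thesis by (rule small_inj_on[OF _ subset_UNIV small_nat])
qed

lemma small_Union_universe:
  fixes A :: "'u \<Rightarrow> 'u set"
  shows "small TYPE('u) I \<Longrightarrow> \<forall>i\<in>I. small TYPE('u) (A i) \<Longrightarrow> small TYPE('u) (\<Union>i\<in>I. A i)"
  using set_universe unfolding set_universe_def by simp

text \<open>An infinite cardinal equals its square. The pairing codes a small family of small sets
  as a family of subsets of \<open>'u\<close> itself, the only kind about which
  \<open>set_universe\<close> speaks.\<close>

lemma pairing: obtains p :: "'u \<times> 'u \<Rightarrow> 'u" where "inj p"
proof -
  have "|(UNIV :: 'u set) \<times> (UNIV :: 'u set)| =o |UNIV :: 'u set|"
    using card_of_Times_same_infinite infinite_universe by blast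
  then obtain p :: "'u \<times> 'u \<Rightarrow> 'u" where "bij_betw p (UNIV \<times> UNIV) UNIV"
    using card_of_ordIso by blast
  then show ?thesis by (intro that[of p]) (simp add: bij_betw_def)
qed

text \<open>After coding indices and fibres by injections into \<open>'u\<close>, the sum maps
  injectively into a union of small subsets of \<open>'u\<close> indexed by a small subset of
  \<open>'u\<close>, and such unions are small by the definition of a universe.\<close>

lemma small_Sigma:
  assumes I: "small TYPE('u) I" and A: "\<And>i. i \<in> I \<Longrightarrow> small TYPE('u) (A i)"
  shows "small TYPE('u) (Sigma I A)"
proof -
  obtain p :: "'u \<times> 'u \<Rightarrow> 'u" where p: "inj p" by (rule pairing)
  obtain e :: "_ => 'u" where e: "inj_on e I" using I by (rule small_inj)
  have "\<forall>i\<in>I. \<exists>e' :: _ \<Rightarrow> 'u. inj_on e' (A i)"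
    using A small_inj by meson
  then obtain e' where e': "\<forall>i\<in>I. inj_on (e' i :: _ \<Rightarrow> 'u) (A i)" by metis
  let ?f = "\<lambda>(i, a). p (e i, e' i a)"
  let ?B = "\<lambda>k. (\<lambda>a. p (k, e' (the_inv_into I e k) a)) ` A (the_inv_into I e k)"
  have "\<forall>k\<in>e ` I. small TYPE('u) (?B k)"
    using the_inv_into_f_f[OF e] by (simp add: A small_image)
  then have *: "small TYPE('u) (\<Union>k\<in>e ` I. ?B k)"
    using small_Union_universe[OF small_image[OF I]] by simp
  have "?f ` Sigma I A \<subseteq> (\<Union>k\<in>e ` I. ?B k)"
    using the_inv_into_f_f[OF e] by fastforce
  moreover have "inj_on ?f (Sigma I A)"
  proof (rule inj_onI, clarify)
    fix i a j b assume "i \<in> I" "a \<in> A i" "j \<in> I" "b \<in> A j" "p (e i, e' i a) = p (e j, e' j b)"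
    then show "i = j \<and> a = b"
      using injD[OF p] inj_onD[OF e] e' by (metis Pair_inject inj_onD)
  qed
  ultimately show ?thesis using small_inj_on[OF _ _ *] by simp
qed

lemma small_Union:
  assumes "small TYPE('u) I" and "\<And>i. i \<in> I \<Longrightarrow> small TYPE('u) (A i)"
  shows "small TYPE('u) (\<Union>i\<in>I. A i)"
proof -
  have "(\<Union>i\<in>I. A i) = snd ` Sigma I A" by force
  then show ?thesis by (simp add: small_image small_Sigma assms)
qed

lemma small_Times: "small TYPE('u) A \<Longrightarrow> small TYPE('u) B \<Longrightarrow> small TYPE('u) (A \<times> B)"
  by (rule small_Sigma)

lemma small_Un:
  assumes "small TYPE('u) A" "small TYPE('u) B" shows "small TYPE('u) (A \<union> B)"
proof -
  have "A \<union> B = (\<Union>b\<in>UNIV. if b then A else B)" by (simp add: UNIV_bool Un_commute)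
  moreover have "small TYPE('u) \<dots>"
    using assms by (intro small_Union) (auto intro: small_finite[of UNIV])
  ultimately show ?thesis by simp
qed

lemma small_Pow:
  assumes "small TYPE('u) A" shows "small TYPE('u) (Pow A)"
proof -
  obtain e :: "_ => 'u" where e: "inj_on e A" using assms by (rule small_inj)
  have "small TYPE('u) (Pow (e ` A))"
    using set_universe small_image[OF assms, of e] unfolding set_universe_def by simp
  moreover have "inj_on ((`) e) (Pow A)"
    using e by (meson inj_on_image_Pow)
  ultimately show ?thesis
    by (intro small_inj_on[of "(`) e" "Pow A" "Pow (e ` A)"]) auto
qed

text \<open>An extensional function on \<open>I\<close> is determined by its graph, a subset of the
  small set \<open>Sigma I A\<close>.\<close>

lemma small_PiE:
  assumes "small TYPE('u) I" and "\<And>i. i \<in> I \<Longrightarrow> small TYPE('u) (A i)"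
  shows "small TYPE('u) (Pi\<^sub>E I A)"
proof (rule small_inj_on)
  show "small TYPE('u) (Pow (Sigma I A))"
    using assms by (intro small_Pow small_Sigma)
  show "inj_on (\<lambda>f. (\<lambda>i. (i, f i)) ` I) (Pi\<^sub>E I A)"
  proof (rule inj_onI)
    fix f g assume *: "f \<in> Pi\<^sub>E I A" "g \<in> Pi\<^sub>E I A"
      and eq: "(\<lambda>i. (i, f i)) ` I = (\<lambda>i. (i, g i)) ` I"
    have "f i = g i" if "i \<in> I" for i
    proof -
      have "(i, f i) \<in> (\<lambda>i. (i, g i)) ` I" using eq that by blast
      then show ?thesis by auto
    qed
    then show "f = g" using * by (meson PiE_ext)
  qed
  show "(\<lambda>f. (\<lambda>i. (i, f i)) ` I) ` Pi\<^sub>E I A \<subseteq> Pow (Sigma I A)"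
    by auto
qed

end

section \<open>Finite limits\<close>

locale cat_base =
  fixes C :: "('o, 'm) cat"
  assumes category: "category C"
begin

lemma idn_in [simp]: "a \<in> Ob C \<Longrightarrow> idn C a \<in> Hom C a a"
  using category unfolding category_def by blast

lemma Comp_in [simp]:
  "\<lbrakk>f \<in> Hom C a b; g \<in> Hom C b c; a \<in> Ob C; b \<in> Ob C; c \<in> Ob C\<rbrakk> \<Longrightarrow> Comp C a b c g f \<in> Hom C a c"
  using category unfolding category_def by blast

lemma Comp_idn [simp]:
  "\<lbrakk>f \<in> Hom C a b; a \<in> Ob C; b \<in> Ob C\<rbrakk> \<Longrightarrow> Comp C a a b f (idn C a) = f"
  "\<lbrakk>f \<in> Hom C a b; a \<in> Ob C; b \<in> Ob C\<rbrakk> \<Longrightarrow> Comp C a b b (idn C b) f = f"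
  using category unfolding category_def by blast+

lemma assoc:
  "\<lbrakk>f \<in> Hom C a b; g \<in> Hom C b c; h \<in> Hom C c d; a \<in> Ob C; b \<in> Ob C; c \<in> Ob C; d \<in> Ob C\<rbrakk> \<Longrightarrow>
     Comp C a c d h (Comp C a b c g f) = Comp C a b d (Comp C b c d h g) f"
  using category unfolding category_def by blast

end

lemma full_subcat_simps [simp]:
  "Ob (full_subcat C S) = S" "Hom (full_subcat C S) = Hom C" "idn (full_subcat C S) = idn C"
  "Comp (full_subcat C S) = Comp C"
  by (simp_all add: full_subcat_def)

lemma category_full_subcat: "category C \<Longrightarrow> S \<subseteq> Ob C \<Longrightarrow> category (full_subcat C S)"
  unfolding category_def by (simp add: subset_iff)

lemma functor_ob: "is_functor A B F \<Longrightarrow> a \<in> Ob A \<Longrightarrow> fob F a \<in> Ob B"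
  by (simp add: is_functor_def)

lemma functor_hom:
  "is_functor A B F \<Longrightarrow> f \<in> Hom A a b \<Longrightarrow> a \<in> Ob A \<Longrightarrow> b \<in> Ob A \<Longrightarrow> fmap F a b f \<in> Hom B (fob F a) (fob F b)"
  by (simp add: is_functor_def)

lemma functor_idn: "is_functor A B F \<Longrightarrow> a \<in> Ob A \<Longrightarrow> fmap F a a (idn A a) = idn B (fob F a)"
  by (simp add: is_functor_def)

lemma functor_Comp:
  "is_functor A B F \<Longrightarrow> f \<in> Hom A a b \<Longrightarrow> g \<in> Hom A b c \<Longrightarrow> a \<in> Ob A \<Longrightarrow> b \<in> Ob A \<Longrightarrow> c \<in> Ob A \<Longrightarrow>
     fmap F a c (Comp A a b c g f) =
     Comp B (fob F a) (fob F b) (fob F c) (fmap F b c g) (fmap F a b f)"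
  by (simp add: is_functor_def)

lemma fcomp_simps [simp]:
  "fob (fcomp G F) a = fob G (fob F a)"
  "fmap (fcomp G F) a b f = fmap G (fob F a) (fob F b) (fmap F a b f)"
  by (simp_all add: fcomp_def)

lemma fcomp_assoc: "fcomp H (fcomp G F) = fcomp (fcomp H G) F"
  by (simp add: fcomp_def)

lemma is_functor_fcomp: "is_functor A B F \<Longrightarrow> is_functor B C G \<Longrightarrow> is_functor A C (fcomp G F)"
  unfolding is_functor_def by simp

lemma is_functor_full_subcat:
  "is_functor J (full_subcat C S) D \<Longrightarrow> S \<subseteq> Ob C \<Longrightarrow> is_functor J C D"
  unfolding is_functor_def by auto

lemma functor_to_full_subcat:
  "is_functor J C D \<Longrightarrow> fob D ` Ob J \<subseteq> S \<Longrightarrow> is_functor J (full_subcat C S) D"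
  unfolding is_functor_def by auto

lemma is_cone_cong:
  assumes "\<And>j. j \<in> Ob J \<Longrightarrow> \<pi> j = \<pi>' j" "\<And>j. j \<in> Ob J \<Longrightarrow> fob D j = fob D' j"
    "\<And>i j f. i \<in> Ob J \<Longrightarrow> j \<in> Ob J \<Longrightarrow> f \<in> Hom J i j \<Longrightarrow> fmap D i j f = fmap D' i j f"
  shows "is_cone J C D c \<pi> \<longleftrightarrow> is_cone J C D' c \<pi>'"
  using assms unfolding is_cone_def by (auto cong: ball_cong)

text \<open>A functor is constrained only on the objects and arrows of its domain, so a composite
  such as \<open>fcomp F D\<close> may equal the intended diagram only there. Limits do not see the
  difference.\<close>

lemma is_limit_cong:
  assumes "\<And>j. j \<in> Ob J \<Longrightarrow> \<pi> j = \<pi>' j" "\<And>j. j \<in> Ob J \<Longrightarrow> fob D j = fob D' j"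
    "\<And>i j f. i \<in> Ob J \<Longrightarrow> j \<in> Ob J \<Longrightarrow> f \<in> Hom J i j \<Longrightarrow> fmap D i j f = fmap D' i j f"
  shows "is_limit J C D c \<pi> \<longleftrightarrow> is_limit J C D' c \<pi>'"
proof -
  have "is_cone J C D c' \<tau> \<longleftrightarrow> is_cone J C D' c' \<tau>" for c' \<tau>
    by (rule is_cone_cong) (use assms in auto)
  moreover have "is_cone J C D c \<pi> \<longleftrightarrow> is_cone J C D' c \<pi>'"
    by (rule is_cone_cong) (use assms in auto)
  ultimately show ?thesis
    using assms(1,2) unfolding is_limit_def by (auto cong: ball_cong)
qed

lemma is_limitI:
  assumes "is_cone J C D c \<pi>"
    and "\<And>z \<tau>. is_cone J C D z \<tau> \<Longrightarrow> \<exists>h\<in>Hom C z c. \<forall>j\<in>Ob J. Comp C z c (fob D j) (\<pi> j) h = \<tau> j"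
    and "\<And>z h h'. \<lbrakk>z \<in> Ob C; h \<in> Hom C z c; h' \<in> Hom C z c;
      \<forall>j\<in>Ob J. Comp C z c (fob D j) (\<pi> j) h = Comp C z c (fob D j) (\<pi> j) h'\<rbrakk> \<Longrightarrow> h = h'"
  shows "is_limit J C D c \<pi>"
  unfolding is_limit_def
proof (intro conjI allI impI)
  fix z \<tau> assume *: "is_cone J C D z \<tau>"
  then have "z \<in> Ob C" by (simp add: is_cone_def)
  then show "\<exists>!h. h \<in> Hom C z c \<and> (\<forall>j\<in>Ob J. Comp C z c (fob D j) (\<pi> j) h = \<tau> j)"
    using assms(2)[OF *] assms(3)[of z] by (metis (no_types, lifting))
qed (fact assms(1))

lemma is_limit_cone: "is_limit J C D c \<pi> \<Longrightarrow> is_cone J C D c \<pi>"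
  by (simp add: is_limit_def)

lemma is_limit_ex:
  assumes "is_limit J C D c \<pi>" "is_cone J C D z \<tau>"
  shows "\<exists>h\<in>Hom C z c. \<forall>j\<in>Ob J. Comp C z c (fob D j) (\<pi> j) h = \<tau> j"
  using assms unfolding is_limit_def by blast

lemma (in cat_base) cone_Comp:
  assumes D: "is_functor J C D" and c: "is_cone J C D c \<pi>" and h: "h \<in> Hom C z c" "z \<in> Ob C"
  shows "is_cone J C D z (\<lambda>j. Comp C z c (fob D j) (\<pi> j) h)"
  using assms functor_ob[OF D] functor_hom[OF D] by (auto simp: is_cone_def assoc)

lemma (in cat_base) is_limit_uniq:
  assumes D: "is_functor J C D" and l: "is_limit J C D c \<pi>"
    and h: "h \<in> Hom C z c" "h' \<in> Hom C z c" "z \<in> Ob C"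
    and eq: "\<forall>j\<in>Ob J. Comp C z c (fob D j) (\<pi> j) h = Comp C z c (fob D j) (\<pi> j) h'"
  shows "h = h'"
proof -
  have "is_cone J C D z (\<lambda>j. Comp C z c (fob D j) (\<pi> j) h)"
    using cone_Comp[OF D is_limit_cone[OF l] h(1,3)] .
  then have "\<exists>!k. k \<in> Hom C z c \<and> (\<forall>j\<in>Ob J. Comp C z c (fob D j) (\<pi> j) k = Comp C z c (fob D j) (\<pi> j) h)"
    using l unfolding is_limit_def by blast
  then show ?thesis using h eq by metis
qed

lemma (in cat_base) is_limit_unique:
  assumes D: "is_functor J C D" and l: "is_limit J C D c \<pi>" and l': "is_limit J C D c' \<pi>'"
  obtains k where "is_iso C c' c k" "\<forall>j\<in>Ob J. Comp C c' c (fob D j) (\<pi> j) k = \<pi>' j"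
proof -
  note cs = is_limit_cone[OF l] is_limit_cone[OF l']
  have ob: "c \<in> Ob C" "c' \<in> Ob C" "\<And>j. j \<in> Ob J \<Longrightarrow> fob D j \<in> Ob C"
    "\<And>j. j \<in> Ob J \<Longrightarrow> \<pi> j \<in> Hom C c (fob D j)" "\<And>j. j \<in> Ob J \<Longrightarrow> \<pi>' j \<in> Hom C c' (fob D j)"
    using cs functor_ob[OF D] by (auto simp: is_cone_def)
  obtain k where k: "k \<in> Hom C c' c" "\<forall>j\<in>Ob J. Comp C c' c (fob D j) (\<pi> j) k = \<pi>' j"
    using is_limit_ex[OF l cs(2)] by blast
  obtain m where m: "m \<in> Hom C c c'" "\<forall>j\<in>Ob J. Comp C c c' (fob D j) (\<pi>' j) m = \<pi> j"
    using is_limit_ex[OF l' cs(1)] by blast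
  have "Comp C c c' c k m = idn C c"
    by (rule is_limit_uniq[OF D l, of _ c]) (use ob k m in \<open>simp_all add: assoc\<close>)
  moreover have "Comp C c' c c' m k = idn C c'"
    by (rule is_limit_uniq[OF D l', of _ c']) (use ob k m in \<open>simp_all add: assoc\<close>)
  ultimately have "is_iso C c' c k" using k(1) m(1) unfolding is_iso_def by blast
  then show ?thesis using k(2) that by blast
qed

text \<open>Reduces the preservation of all limit cones over a diagram to a comparison with a single
  one; \<open>induced_lex\<close> and the left exactness of the reflection rest on it.\<close>

lemma (in cat_base) is_limit_iso:
  assumes D: "is_functor J C D" and l: "is_limit J C D c \<pi>" and k: "is_iso C c' c k" "c' \<in> Ob C"
    and eq: "\<forall>j\<in>Ob J. Comp C c' c (fob D j) (\<pi> j) k = \<pi>' j"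
  shows "is_limit J C D c' \<pi>'"
proof -
  have ob: "c \<in> Ob C" "\<And>j. j \<in> Ob J \<Longrightarrow> fob D j \<in> Ob C"
    "\<And>j. j \<in> Ob J \<Longrightarrow> \<pi> j \<in> Hom C c (fob D j)"
    using is_limit_cone[OF l] functor_ob[OF D] by (auto simp: is_cone_def)
  obtain m where k': "k \<in> Hom C c' c" and m: "m \<in> Hom C c c'" "Comp C c c' c k m = idn C c"
    "Comp C c' c c' m k = idn C c'"
    using k(1) unfolding is_iso_def by blast
  show ?thesis
  proof (rule is_limitI)
    have "is_cone J C D c' (\<lambda>j. Comp C c' c (fob D j) (\<pi> j) k)"
      using cone_Comp[OF D is_limit_cone[OF l] k' k(2)] .
    then show "is_cone J C D c' \<pi>'"
      using eq is_cone_cong[of J "\<lambda>j. Comp C c' c (fob D j) (\<pi> j) k" \<pi>' D D] by simp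
  next
    fix z \<tau> assume z: "is_cone J C D z \<tau>"
    then have zo: "z \<in> Ob C" by (simp add: is_cone_def)
    obtain h where h: "h \<in> Hom C z c" "\<forall>j\<in>Ob J. Comp C z c (fob D j) (\<pi> j) h = \<tau> j"
      using is_limit_ex[OF l z] by blast
    have "\<forall>j\<in>Ob J. Comp C z c' (fob D j) (\<pi>' j) (Comp C z c c' m h) = \<tau> j"
    proof
      fix j assume j: "j \<in> Ob J"
      have "Comp C z c' (fob D j) (\<pi>' j) (Comp C z c c' m h)
        = Comp C z c' (fob D j) (Comp C c' c (fob D j) (\<pi> j) k) (Comp C z c c' m h)"
        using eq j by simp
      also have "\<dots> = Comp C z c (fob D j) (\<pi> j) (Comp C z c c (Comp C c c' c k m) h)"
        using ob j zo h(1) k' m(1) k(2) by (simp add: assoc del: m)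
      finally show "Comp C z c' (fob D j) (\<pi>' j) (Comp C z c c' m h) = \<tau> j"
        using m h zo ob j by simp
    qed
    then show "\<exists>h\<in>Hom C z c'. \<forall>j\<in>Ob J. Comp C z c' (fob D j) (\<pi>' j) h = \<tau> j"
      using Comp_in[OF h(1) m(1) zo ob(1) k(2)] by blast
  next
    fix z h h' assume z: "z \<in> Ob C" and h: "h \<in> Hom C z c'" "h' \<in> Hom C z c'"
      and e: "\<forall>j\<in>Ob J. Comp C z c' (fob D j) (\<pi>' j) h = Comp C z c' (fob D j) (\<pi>' j) h'"
    have *: "Comp C z c (fob D j) (\<pi> j) (Comp C z c' c k x) = Comp C z c' (fob D j) (\<pi>' j) x"
      if "x \<in> Hom C z c'" "j \<in> Ob J" for x j
      using that ob z k' k(2) eq by (simp add: assoc)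
    have "Comp C z c' c k h = Comp C z c' c k h'"
      by (rule is_limit_uniq[OF D l, of _ z]) (use * h e z k' k(2) ob in simp_all)
    then have "Comp C z c c' m (Comp C z c' c k h) = Comp C z c c' m (Comp C z c' c k h')" by simp
    then show "h = h'" using h z k' k(2) m ob by (simp add: assoc)
  qed
qed

subsection \<open>Pullbacks, equalisers and terminal objects\<close>

definition terminal :: "('o, 'm) cat \<Rightarrow> 'o \<Rightarrow> bool" where
  "terminal C t \<longleftrightarrow> t \<in> Ob C \<and> (\<forall>a\<in>Ob C. \<exists>!h. h \<in> Hom C a t)"

definition is_product :: "('o, 'm) cat \<Rightarrow> 'o \<Rightarrow> 'o \<Rightarrow> 'o \<Rightarrow> 'm \<Rightarrow> 'm \<Rightarrow> bool" where
  "is_product C a b p p1 p2 \<longleftrightarrow> a \<in> Ob C \<and> b \<in> Ob C \<and> p \<in> Ob C \<and> p1 \<in> Hom C p a \<and> p2 \<in> Hom C p b \<and>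
     (\<forall>z\<in>Ob C. \<forall>u\<in>Hom C z a. \<forall>v\<in>Hom C z b.
        \<exists>!h. h \<in> Hom C z p \<and> Comp C z p a p1 h = u \<and> Comp C z p b p2 h = v)"

definition is_equaliser :: "('o, 'm) cat \<Rightarrow> 'o \<Rightarrow> 'o \<Rightarrow> 'm \<Rightarrow> 'm \<Rightarrow> 'o \<Rightarrow> 'm \<Rightarrow> bool" where
  "is_equaliser C a b f g e k \<longleftrightarrow> a \<in> Ob C \<and> b \<in> Ob C \<and> e \<in> Ob C \<and>
     f \<in> Hom C a b \<and> g \<in> Hom C a b \<and> k \<in> Hom C e a \<and> Comp C e a b f k = Comp C e a b g k \<and>
     (\<forall>z\<in>Ob C. \<forall>u\<in>Hom C z a. Comp C z a b f u = Comp C z a b g u \<longrightarrow>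
        (\<exists>!h. h \<in> Hom C z e \<and> Comp C z e a k h = u))"

lemma pullback_in:
  assumes "is_pullback C a b c f g p p1 p2"
  shows "a \<in> Ob C" "b \<in> Ob C" "c \<in> Ob C" "p \<in> Ob C" "f \<in> Hom C a c" "g \<in> Hom C b c"
    "p1 \<in> Hom C p a" "p2 \<in> Hom C p b" "Comp C p a c f p1 = Comp C p b c g p2"
  using assms by (auto simp: is_pullback_def)

lemma pullback_ex:
  assumes "is_pullback C a b c f g p p1 p2" "z \<in> Ob C" "u \<in> Hom C z a" "v \<in> Hom C z b"
    "Comp C z a c f u = Comp C z b c g v"
  obtains h where "h \<in> Hom C z p" "Comp C z p a p1 h = u" "Comp C z p b p2 h = v"
  using assms unfolding is_pullback_def by blast

lemma (in cat_base) pullback_uniq: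
  assumes p: "is_pullback C a b c f g p p1 p2" and z: "z \<in> Ob C" "h \<in> Hom C z p" "h' \<in> Hom C z p"
    "Comp C z p a p1 h = Comp C z p a p1 h'" "Comp C z p b p2 h = Comp C z p b p2 h'"
  shows "h = h'"
proof -
  note pin = pullback_in[OF p]
  have "Comp C z a c f (Comp C z p a p1 h) = Comp C z b c g (Comp C z p b p2 h)"
    using pin z by (simp add: assoc)
  moreover have "Comp C z p a p1 h \<in> Hom C z a" "Comp C z p b p2 h \<in> Hom C z b"
    using pin z by auto
  ultimately have "\<exists>!k. k \<in> Hom C z p \<and> Comp C z p a p1 k = Comp C z p a p1 h
      \<and> Comp C z p b p2 k = Comp C z p b p2 h"
    using p z unfolding is_pullback_def by blast
  then show ?thesis using z by metis
qed

lemma is_pullbackI: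
  assumes "a \<in> Ob C" "b \<in> Ob C" "c \<in> Ob C" "p \<in> Ob C" "f \<in> Hom C a c" "g \<in> Hom C b c"
    "p1 \<in> Hom C p a" "p2 \<in> Hom C p b" "Comp C p a c f p1 = Comp C p b c g p2"
    and "\<And>z u v. \<lbrakk>z \<in> Ob C; u \<in> Hom C z a; v \<in> Hom C z b; Comp C z a c f u = Comp C z b c g v\<rbrakk> \<Longrightarrow>
      \<exists>h\<in>Hom C z p. Comp C z p a p1 h = u \<and> Comp C z p b p2 h = v"
    and "\<And>z h h'. \<lbrakk>z \<in> Ob C; h \<in> Hom C z p; h' \<in> Hom C z p;
      Comp C z p a p1 h = Comp C z p a p1 h'; Comp C z p b p2 h = Comp C z p b p2 h'\<rbrakk> \<Longrightarrow> h = h'"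
  shows "is_pullback C a b c f g p p1 p2"
  unfolding is_pullback_def using assms(1-9)
  by (auto intro!: ex_ex1I[where P = "\<lambda>h. h \<in> _ \<and> _ h"] dest: assms(10) intro: assms(11))

text \<open>For a reflexive and transitive \<open>R\<close> this is the preorder on \<open>A\<close>
  as a category, with 0 as the only arrow. Shapes have to live on natural numbers because
  \<open>finitely_complete\<close> and \<open>lex_functor\<close> quantify over such shapes.\<close>

definition pos_cat :: "nat set \<Rightarrow> (nat \<Rightarrow> nat \<Rightarrow> bool) \<Rightarrow> (nat, nat) cat" where
  "pos_cat A R = \<lparr>Ob = A, Hom = \<lambda>i j. if R i j then {0} else {}, idn = \<lambda>_. 0, Comp = \<lambda>_ _ _ _ _. 0\<rparr>"

lemma finite_pos_cat:
  assumes "finite A" "\<And>i. R i i" "\<And>i j k. R i j \<Longrightarrow> R j k \<Longrightarrow> R i k"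
  shows "finite_category (pos_cat A R)"
  using assms unfolding finite_category_def category_def pos_cat_def by auto

abbreviation cospan :: "(nat, nat) cat" where
  "cospan \<equiv> pos_cat {0, 1, 2} (\<lambda>i j. i = j \<or> j = 2)"

definition cospan_dia :: "('o, 'm) cat \<Rightarrow> 'o \<Rightarrow> 'o \<Rightarrow> 'o \<Rightarrow> 'm \<Rightarrow> 'm \<Rightarrow> (nat, nat, 'o, 'm) ftor" where
  "cospan_dia C a b c f g = \<lparr>fob = \<lambda>i. if i = 0 then a else if i = 1 then b else c,
     fmap = \<lambda>i j _. if i = j then idn C (if i = 0 then a else if i = 1 then b else c)
       else if i = 0 then f else g\<rparr>"

lemma finite_cospan: "finite_category cospan"
  by (rule finite_pos_cat) auto

context cat_base
begin

lemma cospan_functor: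
  assumes "a \<in> Ob C" "b \<in> Ob C" "c \<in> Ob C" "f \<in> Hom C a c" "g \<in> Hom C b c"
  shows "is_functor cospan C (cospan_dia C a b c f g)"
  using assms by (auto simp: is_functor_def cospan_dia_def pos_cat_def)

lemma cospan_cone:
  assumes "a \<in> Ob C" "b \<in> Ob C" "c \<in> Ob C" "f \<in> Hom C a c" "g \<in> Hom C b c"
  shows "is_cone cospan C (cospan_dia C a b c f g) z \<pi> \<longleftrightarrow> z \<in> Ob C \<and> \<pi> 0 \<in> Hom C z a \<and>
    \<pi> 1 \<in> Hom C z b \<and> \<pi> 2 = Comp C z a c f (\<pi> 0) \<and> \<pi> 2 = Comp C z b c g (\<pi> 1)"
  using assms by (auto simp: is_cone_def cospan_dia_def pos_cat_def)

lemma limit_imp_pullback: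
  assumes "a \<in> Ob C" "b \<in> Ob C" "c \<in> Ob C" "f \<in> Hom C a c" "g \<in> Hom C b c"
    and l: "is_limit cospan C (cospan_dia C a b c f g) p \<pi>"
  shows "is_pullback C a b c f g p (\<pi> 0) (\<pi> 1)"
proof -
  note cc = cospan_cone[OF assms(1-5)]
  have p: "p \<in> Ob C" "\<pi> 0 \<in> Hom C p a" "\<pi> 1 \<in> Hom C p b" "\<pi> 2 = Comp C p a c f (\<pi> 0)"
    "\<pi> 2 = Comp C p b c g (\<pi> 1)"
    using is_limit_cone[OF l] cc by auto
  show ?thesis
  proof (rule is_pullbackI)
    fix z u v assume *: "z \<in> Ob C" "u \<in> Hom C z a" "v \<in> Hom C z b"
      "Comp C z a c f u = Comp C z b c g v"
    have "is_cone cospan C (cospan_dia C a b c f g) z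
      (\<lambda>i. if i = 0 then u else if i = 1 then v else Comp C z a c f u)"
      using * cc by simp
    from is_limit_ex[OF l this] show "\<exists>h\<in>Hom C z p. Comp C z p a (\<pi> 0) h = u \<and> Comp C z p b (\<pi> 1) h = v"
      by (auto simp: pos_cat_def cospan_dia_def)
  next
    fix z h h' assume *: "z \<in> Ob C" "h \<in> Hom C z p" "h' \<in> Hom C z p"
      "Comp C z p a (\<pi> 0) h = Comp C z p a (\<pi> 0) h'" "Comp C z p b (\<pi> 1) h = Comp C z p b (\<pi> 1) h'"
    have "Comp C z p c (Comp C p a c f (\<pi> 0)) h = Comp C z p c (Comp C p a c f (\<pi> 0)) h'"
      using assoc[of h z p "\<pi> 0" a f c] assoc[of h' z p "\<pi> 0" a f c] * p assms by metis
    then show "h = h'"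
      using is_limit_uniq[OF cospan_functor[OF assms(1-5)] l, of h z h'] * p(4)
      by (simp add: pos_cat_def cospan_dia_def)
  qed (use assms p in auto)
qed

lemma pullback_imp_limit:
  assumes "is_pullback C a b c f g p p1 p2"
  shows "is_limit cospan C (cospan_dia C a b c f g) p
    (\<lambda>i. if i = 0 then p1 else if i = 1 then p2 else Comp C p a c f p1)"
proof (rule is_limitI)
  note pin = pullback_in[OF assms]
  note cc = cospan_cone[OF pin(1,2,3,5,6)]
  show "is_cone cospan C (cospan_dia C a b c f g) p
    (\<lambda>i. if i = 0 then p1 else if i = 1 then p2 else Comp C p a c f p1)"
    using cc pin by simp
  show "\<exists>h\<in>Hom C z p. \<forall>j\<in>Ob cospan. Comp C z p (fob (cospan_dia C a b c f g) j)
         (if j = 0 then p1 else if j = 1 then p2 else Comp C p a c f p1) h = \<tau> j"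
    if *: "is_cone cospan C (cospan_dia C a b c f g) z \<tau>" for z \<tau>
  proof -
    have t: "z \<in> Ob C" "\<tau> 0 \<in> Hom C z a" "\<tau> 1 \<in> Hom C z b" "\<tau> 2 = Comp C z a c f (\<tau> 0)"
      "\<tau> 2 = Comp C z b c g (\<tau> 1)"
      using * cc by auto
    have "Comp C z a c f (\<tau> 0) = Comp C z b c g (\<tau> 1)" using t by simp
    then obtain h where "h \<in> Hom C z p" "Comp C z p a p1 h = \<tau> 0" "Comp C z p b p2 h = \<tau> 1"
      using pullback_ex[OF assms t(1-3)] by blast
    moreover from this have "Comp C z p c (Comp C p a c f p1) h = \<tau> 2"
      using assoc[of h z p p1 a f c] t pin by simp
    ultimately show ?thesis
      by (auto simp: pos_cat_def cospan_dia_def intro!: bexI[of _ h])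
  qed
  show "h = h'" if "z \<in> Ob C" "h \<in> Hom C z p" "h' \<in> Hom C z p"
    "\<forall>j\<in>Ob cospan. Comp C z p (fob (cospan_dia C a b c f g) j)
         (if j = 0 then p1 else if j = 1 then p2 else Comp C p a c f p1) h =
      Comp C z p (fob (cospan_dia C a b c f g) j)
         (if j = 0 then p1 else if j = 1 then p2 else Comp C p a c f p1) h'" for z h h'
    using pullback_uniq[OF assms that(1-3)] that(4) by (simp add: pos_cat_def cospan_dia_def)
qed

end

lemma finitely_complete_pullback:
  assumes C: "finitely_complete C" and ob: "a \<in> Ob C" "b \<in> Ob C" "c \<in> Ob C" "f \<in> Hom C a c" "g \<in> Hom C b c"
  obtains p p1 p2 where "is_pullback C a b c f g p p1 p2"
proof -
  interpret cat_base C using C by unfold_locales (simp add: finitely_complete_def)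
  obtain p \<pi> where "is_limit cospan C (cospan_dia C a b c f g) p \<pi>"
    using C finite_cospan cospan_functor[OF ob] unfolding finitely_complete_def by blast
  then show ?thesis using limit_imp_pullback[OF ob] that by blast
qed

lemma finitely_complete_terminal:
  assumes C: "finitely_complete C"
  obtains t where "terminal C t"
proof -
  \<comment> \<open>The empty shape. \<open>undefined\<close> can serve as the diagram, since a
    functor on this shape has no values to be constrained.\<close>
  let ?J = "pos_cat {} (=)" and ?D = "undefined :: (nat, nat, _, _) ftor"
  have J: "finite_category ?J" by (rule finite_pos_cat) auto
  have D: "is_functor ?J C ?D" by (simp add: is_functor_def pos_cat_def)
  obtain t \<pi> where *: "is_limit ?J C ?D t \<pi>"
    using C J D unfolding finitely_complete_def by blast
  have "is_cone ?J C ?D c \<pi>' \<longleftrightarrow> c \<in> Ob C" for c \<pi>'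
    by (simp add: is_cone_def pos_cat_def)
  with * have "terminal C t"
    unfolding terminal_def is_limit_def by (simp add: pos_cat_def)
  then show ?thesis by (rule that)
qed

lemma lex_functor_pullback:
  assumes F: "lex_functor A B F" and p: "is_pullback A a b c f g p p1 p2"
  shows "is_pullback B (fob F a) (fob F b) (fob F c) (fmap F a c f) (fmap F b c g) (fob F p)
    (fmap F p a p1) (fmap F p b p2)"
proof -
  note pin = pullback_in[OF p]
  have fA: "is_functor A B F" and "category A" "category B"
    using F by (auto simp: lex_functor_def finitely_complete_def)
  interpret A: cat_base A by unfold_locales fact
  interpret B: cat_base B by unfold_locales fact
  have "is_limit cospan B (fcomp F (cospan_dia A a b c f g)) (fob F p)
     (\<lambda>j. fmap F p (fob (cospan_dia A a b c f g) j) (if j = 0 then p1 else if j = 1 then p2 else Comp A p a c f p1))"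
    using F A.pullback_imp_limit[OF p] A.cospan_functor[OF pin(1,2,3,5,6)] finite_cospan
    unfolding lex_functor_def by blast
  also have "?this \<longleftrightarrow> is_limit cospan B (cospan_dia B (fob F a) (fob F b) (fob F c) (fmap F a c f) (fmap F b c g)) (fob F p)
     (\<lambda>j. if j = 0 then fmap F p a p1 else if j = 1 then fmap F p b p2 else fmap F p c (Comp A p a c f p1))"
    by (rule is_limit_cong) (use pin functor_idn[OF fA] in \<open>auto simp: cospan_dia_def pos_cat_def\<close>)
  finally have l: "is_limit cospan B (cospan_dia B (fob F a) (fob F b) (fob F c) (fmap F a c f) (fmap F b c g)) (fob F p)
     (\<lambda>j. if j = 0 then fmap F p a p1 else if j = 1 then fmap F p b p2 else fmap F p c (Comp A p a c f p1))" .
  show ?thesis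
    using B.limit_imp_pullback[OF _ _ _ _ _ l] pin functor_ob[OF fA] functor_hom[OF fA] by simp
qed

subsection \<open>Limits from pullbacks and a terminal object\<close>

text \<open>Only one terminal object and one pullback for each cospan have to lie in
  \<open>B\<close>, not all isomorphic copies; with all copies, a small \<open>B\<close> around
  given objects would in general not exist in a large category.\<close>

definition lex_closed :: "('o, 'm) cat \<Rightarrow> 'o set \<Rightarrow> bool" where
  "lex_closed C B \<longleftrightarrow> B \<subseteq> Ob C \<and> (\<exists>t\<in>B. terminal C t) \<and>
     (\<forall>a\<in>B. \<forall>b\<in>B. \<forall>c\<in>B. \<forall>f\<in>Hom C a c. \<forall>g\<in>Hom C b c. \<exists>p\<in>B. \<exists>p1 p2. is_pullback C a b c f g p p1 p2)"

lemma product_in: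
  assumes "is_product C a b p p1 p2"
  shows "a \<in> Ob C" "b \<in> Ob C" "p \<in> Ob C" "p1 \<in> Hom C p a" "p2 \<in> Hom C p b"
  using assms by (auto simp: is_product_def)

lemma product_ex:
  assumes "is_product C a b p p1 p2" "z \<in> Ob C" "u \<in> Hom C z a" "v \<in> Hom C z b"
  obtains h where "h \<in> Hom C z p" "Comp C z p a p1 h = u" "Comp C z p b p2 h = v"
  using assms unfolding is_product_def by blast

lemma (in cat_base) product_uniq:
  assumes p: "is_product C a b p p1 p2" and z: "z \<in> Ob C" "h \<in> Hom C z p" "h' \<in> Hom C z p"
    "Comp C z p a p1 h = Comp C z p a p1 h'" "Comp C z p b p2 h = Comp C z p b p2 h'"
  shows "h = h'"
proof -
  note pin = product_in[OF p]
  have "Comp C z p a p1 h \<in> Hom C z a" "Comp C z p b p2 h \<in> Hom C z b"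
    using pin z by auto
  then have "\<exists>!k. k \<in> Hom C z p \<and> Comp C z p a p1 k = Comp C z p a p1 h
      \<and> Comp C z p b p2 k = Comp C z p b p2 h"
    using p z unfolding is_product_def by blast
  then show ?thesis using z by metis
qed

lemma equaliser_in:
  assumes "is_equaliser C a b f g e k"
  shows "a \<in> Ob C" "b \<in> Ob C" "e \<in> Ob C" "f \<in> Hom C a b" "g \<in> Hom C a b" "k \<in> Hom C e a"
    "Comp C e a b f k = Comp C e a b g k"
  using assms by (auto simp: is_equaliser_def)

lemma equaliser_ex:
  assumes "is_equaliser C a b f g e k" "z \<in> Ob C" "u \<in> Hom C z a" "Comp C z a b f u = Comp C z a b g u"
  obtains h where "h \<in> Hom C z e" "Comp C z e a k h = u"
  using assms unfolding is_equaliser_def by blast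

lemma (in cat_base) equaliser_uniq:
  assumes e: "is_equaliser C a b f g e k" and z: "z \<in> Ob C" "h \<in> Hom C z e" "h' \<in> Hom C z e"
    "Comp C z e a k h = Comp C z e a k h'"
  shows "h = h'"
proof -
  note ein = equaliser_in[OF e]
  have "Comp C z e a k h \<in> Hom C z a"
    "Comp C z a b f (Comp C z e a k h) = Comp C z a b g (Comp C z e a k h)"
    using ein z by (auto simp: assoc)
  then have "\<exists>!m. m \<in> Hom C z e \<and> Comp C z e a k m = Comp C z e a k h"
    using e z unfolding is_equaliser_def by blast
  then show ?thesis using z by metis
qed

locale lexc = cat_base C for C :: "('o, 'm) cat" +
  fixes B :: "'o set"
  assumes lex_closed: "lex_closed C B"
begin

lemma B_Ob: "b \<in> B \<Longrightarrow> b \<in> Ob C"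
  using lex_closed by (auto simp: lex_closed_def)

lemma pullback:
  assumes "a \<in> B" "b \<in> B" "c \<in> B" "f \<in> Hom C a c" "g \<in> Hom C b c"
  obtains p p1 p2 where "p \<in> B" "is_pullback C a b c f g p p1 p2"
  using assms lex_closed unfolding lex_closed_def by meson

lemma terminal:
  obtains t where "t \<in> B" "terminal C t"
  using lex_closed unfolding lex_closed_def by blast

lemma product:
  assumes ab: "a \<in> B" "b \<in> B"
  obtains p p1 p2 where "p \<in> B" "is_product C a b p p1 p2"
proof -
  obtain t where t: "t \<in> B" "terminal C t" by (rule terminal)
  obtain ta tb where tab: "ta \<in> Hom C a t" "tb \<in> Hom C b t"
    using t ab B_Ob unfolding terminal_def by meson
  obtain p p1 p2 where p: "p \<in> B" "is_pullback C a b t ta tb p p1 p2"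
    using pullback[OF ab t(1) tab] by blast
  have "is_product C a b p p1 p2"
    unfolding is_product_def
  proof (intro conjI ballI)
    fix z u v assume z: "z \<in> Ob C" "u \<in> Hom C z a" "v \<in> Hom C z b"
    have "Comp C z a t ta u \<in> Hom C z t" "Comp C z b t tb v \<in> Hom C z t"
      using z ab tab B_Ob[OF t(1)] B_Ob by auto
    then have "Comp C z a t ta u = Comp C z b t tb v"
      using t(2) z(1) unfolding terminal_def by blast
    then show "\<exists>!h. h \<in> Hom C z p \<and> Comp C z p a p1 h = u \<and> Comp C z p b p2 h = v"
      using p(2) z unfolding is_pullback_def by blast
  qed (use pullback_in[OF p(2)] in auto)
  then show ?thesis using p(1) that by blast
qed

text \<open>The equaliser of \<open>f\<close> and \<open>g\<close> is the pullback of the pairing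
  \<open>m : a \<rightarrow> b \<times> b\<close> along the diagonal \<open>d\<close>.\<close>

lemma equaliser:
  assumes ab: "a \<in> B" "b \<in> B" and fg: "f \<in> Hom C a b" "g \<in> Hom C a b"
  obtains e k where "e \<in> B" "is_equaliser C a b f g e k"
proof -
  note o = B_Ob[OF ab(1)] B_Ob[OF ab(2)]
  obtain q q1 q2 where q: "q \<in> B" "is_product C b b q q1 q2" using product[OF ab(2) ab(2)] .
  note qin = product_in[OF q(2)]
  obtain d where d: "d \<in> Hom C b q" "Comp C b q b q1 d = idn C b" "Comp C b q b q2 d = idn C b"
    using product_ex[OF q(2)] o by (metis idn_in)
  obtain m where m: "m \<in> Hom C a q" "Comp C a q b q1 m = f" "Comp C a q b q2 m = g"
    using product_ex[OF q(2) o(1) fg] .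
  obtain e k k2 where e: "e \<in> B" "is_pullback C a b q m d e k k2"
    using pullback[OF ab q(1) m(1) d(1)] .
  note ein = pullback_in[OF e(2)]
  have "Comp C e q b q1 (Comp C e a q m k) = Comp C e a b f k"
    "Comp C e q b q2 (Comp C e a q m k) = Comp C e a b g k"
    "Comp C e q b q1 (Comp C e b q d k2) = k2"
    "Comp C e q b q2 (Comp C e b q d k2) = k2"
    using ein(1-8) qin d m by (simp_all add: assoc)
  then have fk: "Comp C e a b f k = k2" "Comp C e a b g k = k2" using ein(9) by simp_all
  have "is_equaliser C a b f g e k"
    unfolding is_equaliser_def
  proof (intro conjI ballI impI)
    fix z u assume z: "z \<in> Ob C" "u \<in> Hom C z a" and eq: "Comp C z a b f u = Comp C z a b g u"
    have "Comp C z q b q1 (Comp C z b q d w) = w" "Comp C z q b q2 (Comp C z b q d w) = w"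
      if "w \<in> Hom C z b" for w
      using that z(1) d qin o by (simp_all add: assoc)
    moreover have "Comp C z q b q1 (Comp C z a q m u) = Comp C z a b f u"
      "Comp C z q b q2 (Comp C z a q m u) = Comp C z a b f u"
      using z m qin o eq by (simp_all add: assoc)
    moreover have "Comp C z a q m u \<in> Hom C z q" "Comp C z a b f u \<in> Hom C z b"
      "Comp C z b q d (Comp C z a b f u) \<in> Hom C z q"
      using z m d qin o fg by simp_all
    ultimately have "Comp C z a q m u = Comp C z b q d (Comp C z a b f u)"
      using product_uniq[OF q(2) z(1)] by simp
    then obtain h where h: "h \<in> Hom C z e" "Comp C z e a k h = u"
      using pullback_ex[OF e(2) z, of "Comp C z a b f u"] z o fg by auto
    show "\<exists>!h. h \<in> Hom C z e \<and> Comp C z e a k h = u"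
    proof (rule ex1I[of _ h])
      fix h' assume h': "h' \<in> Hom C z e \<and> Comp C z e a k h' = u"
      have "Comp C z e b k2 x = Comp C z a b f (Comp C z e a k x)" if "x \<in> Hom C z e" for x
        using that ein z fk(1) fg o by (simp add: assoc)
      then show "h' = h"
        using pullback_uniq[OF e(2) z(1), of h' h] h h' by simp
    qed (use h in simp)
  qed (use ein fg fk in auto)
  then show ?thesis using e(1) that by blast
qed

text \<open>Spelled out through projections, existence and uniqueness instead of
  \<open>is_limit\<close>, so that the induction can add one index at a time by multiplying with one
  more factor.\<close>

lemma finite_product:
  assumes "finite A" "X ` A \<subseteq> B"
  obtains p \<rho> where "p \<in> B" "\<forall>j\<in>A. \<rho> j \<in> Hom C p (X j)"
    "\<forall>z\<in>Ob C. \<forall>\<tau>. (\<forall>j\<in>A. \<tau> j \<in> Hom C z (X j)) \<longrightarrow> (\<exists>h\<in>Hom C z p. \<forall>j\<in>A. Comp C z p (X j) (\<rho> j) h = \<tau> j)"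
    "\<forall>z\<in>Ob C. \<forall>h\<in>Hom C z p. \<forall>h'\<in>Hom C z p.
       (\<forall>j\<in>A. Comp C z p (X j) (\<rho> j) h = Comp C z p (X j) (\<rho> j) h') \<longrightarrow> h = h'"
proof -
  have "\<exists>p \<rho>. p \<in> B \<and> (\<forall>j\<in>A. \<rho> j \<in> Hom C p (X j)) \<and>
    (\<forall>z\<in>Ob C. \<forall>\<tau>. (\<forall>j\<in>A. \<tau> j \<in> Hom C z (X j)) \<longrightarrow> (\<exists>h\<in>Hom C z p. \<forall>j\<in>A. Comp C z p (X j) (\<rho> j) h = \<tau> j)) \<and>
    (\<forall>z\<in>Ob C. \<forall>h\<in>Hom C z p. \<forall>h'\<in>Hom C z p.
       (\<forall>j\<in>A. Comp C z p (X j) (\<rho> j) h = Comp C z p (X j) (\<rho> j) h') \<longrightarrow> h = h')"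
    using assms
  proof (induction A rule: finite_induct)
    case empty
    obtain t where t: "t \<in> B" "terminal C t" by (rule terminal)
    show ?case
      by (rule exI[of _ t]) (use t in \<open>auto simp: terminal_def\<close>)
  next
    case (insert i A)
    then obtain p \<rho> where p: "p \<in> B" "\<forall>j\<in>A. \<rho> j \<in> Hom C p (X j)"
      and ex: "\<forall>z\<in>Ob C. \<forall>\<tau>. (\<forall>j\<in>A. \<tau> j \<in> Hom C z (X j)) \<longrightarrow> (\<exists>h\<in>Hom C z p. \<forall>j\<in>A. Comp C z p (X j) (\<rho> j) h = \<tau> j)"
      and un: "\<forall>z\<in>Ob C. \<forall>h\<in>Hom C z p. \<forall>h'\<in>Hom C z p.
       (\<forall>j\<in>A. Comp C z p (X j) (\<rho> j) h = Comp C z p (X j) (\<rho> j) h') \<longrightarrow> h = h'"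
      by auto
    have Xi: "X i \<in> B" using insert by auto
    obtain q q1 q2 where q: "q \<in> B" "is_product C p (X i) q q1 q2" using product[OF p(1) Xi] .
    note qin = product_in[OF q(2)]
    have X: "X j \<in> Ob C" if "j \<in> A" for j using that insert B_Ob by auto
    let ?\<rho> = "\<lambda>j. if j = i then q2 else Comp C q p (X j) (\<rho> j) q1"
    have *: "Comp C z q (X j) (?\<rho> j) h = Comp C z p (X j) (\<rho> j) (Comp C z q p q1 h)"
      if "h \<in> Hom C z q" "z \<in> Ob C" "j \<in> A" for h z j
    proof -
      have "j \<noteq> i" using that insert by auto
      then show ?thesis using that qin p X by (simp add: assoc)
    qed
    show ?case
    proof (intro exI[of _ q] exI[of _ ?\<rho>] conjI ballI allI impI)
      fix z \<tau> assume z: "z \<in> Ob C" and \<tau>: "\<forall>j\<in>insert i A. \<tau> j \<in> Hom C z (X j)"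
      obtain h where h: "h \<in> Hom C z p" "\<forall>j\<in>A. Comp C z p (X j) (\<rho> j) h = \<tau> j"
        using ex z \<tau> by (metis insertCI)
      obtain k where k: "k \<in> Hom C z q" "Comp C z q p q1 k = h" "Comp C z q (X i) q2 k = \<tau> i"
        using product_ex[OF q(2) z h(1)] \<tau> by (metis insertCI)
      have "Comp C z q (X j) (?\<rho> j) k = \<tau> j" if "j \<in> insert i A" for j
      proof (cases "j = i")
        case False
        then have "j \<in> A" using that by simp
        from *[OF k(1) z this] this h k show ?thesis by simp
      qed (use k in simp)
      then show "\<exists>h\<in>Hom C z q. \<forall>j\<in>insert i A. Comp C z q (X j) (?\<rho> j) h = \<tau> j"
        using k(1) by blast
    next
      fix z h h' assume z: "z \<in> Ob C" and h: "h \<in> Hom C z q" "h' \<in> Hom C z q"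
        and e: "\<forall>j\<in>insert i A. Comp C z q (X j) (?\<rho> j) h = Comp C z q (X j) (?\<rho> j) h'"
      have "\<forall>j\<in>A. Comp C z p (X j) (\<rho> j) (Comp C z q p q1 h) = Comp C z p (X j) (\<rho> j) (Comp C z q p q1 h')"
        using e * h z by (metis insertCI)
      then have "Comp C z q p q1 h = Comp C z q p q1 h'"
        using un z h qin by simp
      moreover have "Comp C z q (X i) q2 h = Comp C z q (X i) q2 h'" using e by simp
      ultimately show "h = h'" using product_uniq[OF q(2) z h] by simp
    qed (use q qin p X in auto)
  qed
  then show ?thesis using that by blast
qed

text \<open>One more pair is imposed by restricting it along the monomorphism \<open>k\<close> found
  so far and taking an equaliser. The targets \<open>c\<close> may vary, as they do for the
  equations that cut a limit out of a product.\<close>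

lemma finite_equaliser:
  assumes "finite A" "p \<in> B" "\<forall>(c, u, v)\<in>A. c \<in> B \<and> u \<in> Hom C p c \<and> v \<in> Hom C p c"
  obtains e k where "e \<in> B" "k \<in> Hom C e p" "\<forall>(c, u, v)\<in>A. Comp C e p c u k = Comp C e p c v k"
    "\<forall>z\<in>Ob C. \<forall>h\<in>Hom C z p. (\<forall>(c, u, v)\<in>A. Comp C z p c u h = Comp C z p c v h) \<longrightarrow>
       (\<exists>m\<in>Hom C z e. Comp C z e p k m = h)"
    "\<forall>z\<in>Ob C. \<forall>m\<in>Hom C z e. \<forall>m'\<in>Hom C z e. Comp C z e p k m = Comp C z e p k m' \<longrightarrow> m = m'"
proof -
  have po: "p \<in> Ob C" using assms(2) B_Ob by blast
  have "\<exists>e k. e \<in> B \<and> k \<in> Hom C e p \<and> (\<forall>(c, u, v)\<in>A. Comp C e p c u k = Comp C e p c v k) \<and>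
    (\<forall>z\<in>Ob C. \<forall>h\<in>Hom C z p. (\<forall>(c, u, v)\<in>A. Comp C z p c u h = Comp C z p c v h) \<longrightarrow>
       (\<exists>m\<in>Hom C z e. Comp C z e p k m = h)) \<and>
    (\<forall>z\<in>Ob C. \<forall>m\<in>Hom C z e. \<forall>m'\<in>Hom C z e. Comp C z e p k m = Comp C z e p k m' \<longrightarrow> m = m')"
    using assms(1,3)
  proof (induction A rule: finite_induct)
    case empty
    show ?case
      by (rule exI[of _ p], rule exI[of _ "idn C p"]) (use assms(2) po in auto)
  next
    case (insert x A)
    obtain c u v where x: "x = (c, u, v)" by (cases x)
    have cuv: "c \<in> B" "u \<in> Hom C p c" "v \<in> Hom C p c" using insert x by auto
    have A: "c' \<in> Ob C" "u' \<in> Hom C p c'" "v' \<in> Hom C p c'" if "(c', u', v') \<in> A" for c' u' v'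
      using that insert.prems B_Ob by auto
    obtain e k where e: "e \<in> B" "k \<in> Hom C e p" "\<forall>(c, u, v)\<in>A. Comp C e p c u k = Comp C e p c v k"
      and ex: "\<forall>z\<in>Ob C. \<forall>h\<in>Hom C z p. (\<forall>(c, u, v)\<in>A. Comp C z p c u h = Comp C z p c v h) \<longrightarrow>
       (\<exists>m\<in>Hom C z e. Comp C z e p k m = h)"
      and un: "\<forall>z\<in>Ob C. \<forall>m\<in>Hom C z e. \<forall>m'\<in>Hom C z e. Comp C z e p k m = Comp C z e p k m' \<longrightarrow> m = m'"
      using insert by auto
    have o: "e \<in> Ob C" "c \<in> Ob C" using e cuv B_Ob by auto
    obtain e' k' where e': "e' \<in> B" "is_equaliser C e c (Comp C e p c u k) (Comp C e p c v k) e' k'"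
      using equaliser[OF e(1) cuv(1) Comp_in[OF e(2) cuv(2)] Comp_in[OF e(2) cuv(3)]] o po by metis
    note ein = equaliser_in[OF e'(2)]
    show ?case
    proof (rule exI[of _ e'], rule exI[of _ "Comp C e' e p k k'"], intro conjI ballI impI)
      show "Comp C e' e p k k' \<in> Hom C e' p" using e ein po by simp
      fix y assume y: "y \<in> insert x A"
      show "case y of (c, u, v) \<Rightarrow> Comp C e' p c u (Comp C e' e p k k') = Comp C e' p c v (Comp C e' e p k k')"
      proof (cases "y = x")
        case True
        then show ?thesis using ein e cuv po x by (simp add: assoc)
      next
        case False
        obtain c' u' v' where y': "y = (c', u', v')" by (cases y)
        with False y have "(c', u', v') \<in> A" by simp
        from A[OF this] this show ?thesis using e(3) ein e po y' by (fastforce simp: assoc)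
      qed
    next
      fix z h assume z: "z \<in> Ob C" "h \<in> Hom C z p"
        and eq: "\<forall>(c, u, v)\<in>insert x A. Comp C z p c u h = Comp C z p c v h"
      have "\<forall>(c, u, v)\<in>A. Comp C z p c u h = Comp C z p c v h" using eq by simp
      then obtain m where m: "m \<in> Hom C z e" "Comp C z e p k m = h" using ex z by blast
      have "Comp C z e c (Comp C e p c u k) m = Comp C z e c (Comp C e p c v k) m"
        using assoc[of m z e k p u c] assoc[of m z e k p v c] m e cuv z o po eq x by auto
      then obtain n where n: "n \<in> Hom C z e'" "Comp C z e' e k' n = m"
        using equaliser_ex[OF e'(2) z(1) m(1)] by blast
      then show "\<exists>m\<in>Hom C z e'. Comp C z e' p (Comp C e' e p k k') m = h"
        using m(2) assoc[of n z e' k' e k p] z o po ein e by (intro bexI[of _ n]) auto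
    next
      fix z m m' assume z: "z \<in> Ob C" "m \<in> Hom C z e'" "m' \<in> Hom C z e'"
        and eq: "Comp C z e' p (Comp C e' e p k k') m = Comp C z e' p (Comp C e' e p k k') m'"
      have "Comp C z e p k (Comp C z e' e k' m) = Comp C z e p k (Comp C z e' e k' m')"
        using eq assoc[of m z e' k' e k p] assoc[of m' z e' k' e k p] z o po ein e by simp
      then have "Comp C z e' e k' m = Comp C z e' e k' m'"
        using un z ein by simp
      then show "m = m'" using equaliser_uniq[OF e'(2) z] by simp
    qed (use e' in simp)
  qed
  then show ?thesis using that by blast
qed

text \<open>The usual construction of a limit as a subobject of the product of all
  \<open>D j\<close>. Carrying it out by hand, instead of quoting completeness of \<open>C\<close>,
  keeps the vertex in \<open>B\<close>.\<close>

lemma finite_limit: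
  assumes J: "finite_category J" and D: "is_functor J C D" and DB: "fob D ` Ob J \<subseteq> B"
  obtains c \<pi> where "c \<in> B" "is_limit J C D c \<pi>"
proof -
  have fJ: "finite (Ob J)" using J by (simp add: finite_category_def)
  note Do = functor_ob[OF D] and Dh = functor_hom[OF D]
  obtain p \<rho> where p: "p \<in> B" "\<forall>j\<in>Ob J. \<rho> j \<in> Hom C p (fob D j)"
    and pex: "\<forall>z\<in>Ob C. \<forall>\<tau>. (\<forall>j\<in>Ob J. \<tau> j \<in> Hom C z (fob D j)) \<longrightarrow> (\<exists>h\<in>Hom C z p. \<forall>j\<in>Ob J. Comp C z p (fob D j) (\<rho> j) h = \<tau> j)"
    and pun: "\<forall>z\<in>Ob C. \<forall>h\<in>Hom C z p. \<forall>h'\<in>Hom C z p.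
       (\<forall>j\<in>Ob J. Comp C z p (fob D j) (\<rho> j) h = Comp C z p (fob D j) (\<rho> j) h') \<longrightarrow> h = h'"
    using finite_product[OF fJ DB] by blast
  have po: "p \<in> Ob C" using p B_Ob by blast
  \<comment> \<open>The equation belonging to an arrow \<open>f : i \<rightarrow> j\<close> of the
    shape: \<open>D f\<close> after the projection to \<open>i\<close> equals the projection to
    \<open>j\<close>.\<close>
  define A where "A = (\<Union>i\<in>Ob J. \<Union>j\<in>Ob J. (\<lambda>f. (fob D j, Comp C p (fob D i) (fob D j) (fmap D i j f) (\<rho> i), \<rho> j)) ` Hom J i j)"
  have A: "\<forall>(c, u, v)\<in>A. c \<in> B \<and> u \<in> Hom C p c \<and> v \<in> Hom C p c"
    using p po Do Dh DB unfolding A_def by auto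
  have "finite A" using J unfolding A_def finite_category_def by auto
  then obtain e k where e: "e \<in> B" "k \<in> Hom C e p" "\<forall>(c, u, v)\<in>A. Comp C e p c u k = Comp C e p c v k"
    and eex: "\<forall>z\<in>Ob C. \<forall>h\<in>Hom C z p. (\<forall>(c, u, v)\<in>A. Comp C z p c u h = Comp C z p c v h) \<longrightarrow>
       (\<exists>m\<in>Hom C z e. Comp C z e p k m = h)"
    and eun: "\<forall>z\<in>Ob C. \<forall>m\<in>Hom C z e. \<forall>m'\<in>Hom C z e. Comp C z e p k m = Comp C z e p k m' \<longrightarrow> m = m'"
    using finite_equaliser[OF _ p(1) A] by blast
  have eo: "e \<in> Ob C" using e B_Ob by blast
  let ?\<pi> = "\<lambda>j. Comp C e p (fob D j) (\<rho> j) k"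
  have \<pi>: "Comp C z e (fob D j) (?\<pi> j) m = Comp C z p (fob D j) (\<rho> j) (Comp C z e p k m)"
    if "j \<in> Ob J" "z \<in> Ob C" "m \<in> Hom C z e" for j z m
    using that Do p po e eo by (simp add: assoc)
  have "is_limit J C D e ?\<pi>"
  proof (rule is_limitI)
    show "is_cone J C D e ?\<pi>"
      unfolding is_cone_def
    proof (intro conjI ballI)
      fix i j f assume ijf: "i \<in> Ob J" "j \<in> Ob J" "f \<in> Hom J i j"
      then have "(fob D j, Comp C p (fob D i) (fob D j) (fmap D i j f) (\<rho> i), \<rho> j) \<in> A" unfolding A_def by blast
      then have "Comp C e p (fob D j) (Comp C p (fob D i) (fob D j) (fmap D i j f) (\<rho> i)) k = ?\<pi> j"
        using e(3) by blast
      then show "Comp C e (fob D i) (fob D j) (fmap D i j f) (?\<pi> i) = ?\<pi> j"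
        using ijf p po Do Dh e eo by (simp add: assoc)
    qed (use eo p po Do e in auto)
  next
    fix z \<tau> assume \<tau>: "is_cone J C D z \<tau>"
    then have z: "z \<in> Ob C" "\<forall>j\<in>Ob J. \<tau> j \<in> Hom C z (fob D j)" by (auto simp: is_cone_def)
    obtain h where h: "h \<in> Hom C z p" "\<forall>j\<in>Ob J. Comp C z p (fob D j) (\<rho> j) h = \<tau> j"
      using pex z by blast
    have "Comp C z p c u h = Comp C z p c v h" if cuv: "(c, u, v) \<in> A" for c u v
    proof -
      obtain i j f where ijf: "i \<in> Ob J" "j \<in> Ob J" "f \<in> Hom J i j" and c: "c = fob D j"
        "u = Comp C p (fob D i) (fob D j) (fmap D i j f) (\<rho> i)" "v = \<rho> j"
        using cuv unfolding A_def by blast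
      have "Comp C z p c u h = Comp C z (fob D i) (fob D j) (fmap D i j f) (\<tau> i)"
        using assoc[of h z p "\<rho> i" "fob D i" "fmap D i j f" "fob D j"] c ijf h z p po Do Dh by simp
      then show ?thesis using \<tau> ijf h c unfolding is_cone_def by simp
    qed
    then obtain m where m: "m \<in> Hom C z e" "Comp C z e p k m = h" using eex z h by blast
    then show "\<exists>h\<in>Hom C z e. \<forall>j\<in>Ob J. Comp C z e (fob D j) (?\<pi> j) h = \<tau> j"
      using \<pi> z h by (intro bexI[of _ m]) auto
  next
    fix z h h' assume z: "z \<in> Ob C" "h \<in> Hom C z e" "h' \<in> Hom C z e"
      and eq: "\<forall>j\<in>Ob J. Comp C z e (fob D j) (?\<pi> j) h = Comp C z e (fob D j) (?\<pi> j) h'"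
    then have "Comp C z e p k h = Comp C z e p k h'"
      using pun \<pi> e eo po by simp
    then show "h = h'" using eun z by blast
  qed
  then show ?thesis using e(1) that by blast
qed

end

subsection \<open>Induced categories\<close>

text \<open>The full subcategory on the objects \<open>I a\<close>, with the labels \<open>a\<close>
  as objects. Labels may have another type, which is needed to present a small subcategory of
  \<open>C\<close> as a category with objects in \<open>'u\<close>.\<close>

definition induced :: "('o, 'm) cat \<Rightarrow> ('p \<Rightarrow> 'o) \<Rightarrow> 'p set \<Rightarrow> ('p, 'm) cat" where
  "induced C I A = \<lparr>Ob = A, Hom = \<lambda>a b. Hom C (I a) (I b), idn = \<lambda>a. idn C (I a),
     Comp = \<lambda>a b c. Comp C (I a) (I b) (I c)\<rparr>"

definition induced_functor :: "('p \<Rightarrow> 'o) \<Rightarrow> ('p, 'm, 'o, 'm) ftor" where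
  "induced_functor I = \<lparr>fob = I, fmap = \<lambda>a b f. f\<rparr>"

lemma induced_simps [simp]:
  "Ob (induced C I A) = A" "Hom (induced C I A) a b = Hom C (I a) (I b)"
  "idn (induced C I A) a = idn C (I a)" "Comp (induced C I A) a b c = Comp C (I a) (I b) (I c)"
  "fob (induced_functor I) a = I a" "fmap (induced_functor I) a b f = f"
  by (simp_all add: induced_def induced_functor_def)

lemma full_subcat_induced: "full_subcat C S = induced C (\<lambda>a. a) S"
  by (cases C) (simp add: full_subcat_def induced_def)

lemma category_induced: "category C \<Longrightarrow> I ` A \<subseteq> Ob C \<Longrightarrow> category (induced C I A)"
  unfolding category_def by (simp add: image_subset_iff)

lemma is_functor_induced: "category C \<Longrightarrow> I ` A \<subseteq> Ob C \<Longrightarrow> is_functor (induced C I A) C (induced_functor I)"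
  unfolding is_functor_def by (simp add: image_subset_iff)

text \<open>\<open>induced_functor I\<close> is fully faithful and hence reflects limits: a limit in
  \<open>C\<close> with a vertex of the form \<open>I c\<close> is one in the induced category. Any
  other limit of the same diagram is isomorphic to it, so it is preserved as well.\<close>

lemma induced_lex:
  fixes C :: "('o, 'm) cat" and I :: "'p \<Rightarrow> 'o"
  assumes C: "category C" and I: "I ` A \<subseteq> Ob C"
    and lim: "\<And>(J :: (nat, nat) cat) D. finite_category J \<Longrightarrow> is_functor J (induced C I A) D \<Longrightarrow>
      \<exists>c\<in>A. \<exists>\<pi>. is_limit J C (fcomp (induced_functor I) D) (I c) \<pi>"
  shows "finitely_complete (induced C I A)"
    and "finitely_complete C \<Longrightarrow> lex_functor (induced C I A) C (induced_functor I)"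
proof -
  interpret C: cat_base C by unfold_locales fact
  let ?E = "induced C I A" and ?I = "induced_functor I :: ('p, 'm, 'o, 'm) ftor"
  have E: "category ?E" using C I by (rule category_induced)
  interpret E: cat_base ?E by unfold_locales fact
  have cone: "is_cone J C (fcomp ?I D) (I c) \<pi> \<longleftrightarrow> is_cone J ?E D c \<pi>" if "c \<in> A"
    for J :: "(nat, nat) cat" and D c \<pi>
    using that I by (auto simp: is_cone_def)
  have refl: "is_limit J ?E D c \<pi>" if "is_limit J C (fcomp ?I D) (I c) \<pi>" "c \<in> A"
    for J :: "(nat, nat) cat" and D c \<pi>
    unfolding is_limit_def
  proof (intro conjI allI impI)
    show "is_cone J ?E D c \<pi>" by (rule iffD1[OF cone[OF that(2)] is_limit_cone[OF that(1)]])
    fix z \<tau> assume z: "is_cone J ?E D z \<tau>"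
    then have "z \<in> A" by (simp add: is_cone_def)
    then have "is_cone J C (fcomp ?I D) (I z) \<tau>" by (rule iffD2[OF cone z])
    then show "\<exists>!h. h \<in> Hom ?E z c \<and> (\<forall>j\<in>Ob J. Comp ?E z c (fob D j) (\<pi> j) h = \<tau> j)"
      using that(1) unfolding is_limit_def by simp
  qed
  show fE: "finitely_complete ?E"
    unfolding finitely_complete_def using E lim refl by meson
  assume fC: "finitely_complete C"
  show "lex_functor ?E C ?I"
    unfolding lex_functor_def
  proof (intro conjI allI impI)
    fix J :: "(nat, nat) cat" and D c \<pi>
    assume J: "finite_category J" and D: "is_functor J ?E D" and l: "is_limit J ?E D c \<pi>"
    have c: "c \<in> A" using is_limit_cone[OF l] by (simp add: is_cone_def)
    obtain c' \<pi>' where c': "c' \<in> A" "is_limit J C (fcomp ?I D) (I c') \<pi>'" using lim[OF J D] by blast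
    obtain k where k: "is_iso ?E c c' k" "\<forall>j\<in>Ob J. Comp ?E c c' (fob D j) (\<pi>' j) k = \<pi> j"
      using E.is_limit_unique[OF D refl[OF c'(2,1)] l] by blast
    have DC: "is_functor J C (fcomp ?I D)"
      using is_functor_fcomp[OF D is_functor_induced[OF C I]] .
    have "is_limit J C (fcomp ?I D) (I c) \<pi>"
      by (rule C.is_limit_iso[OF DC c'(2), of _ k]) (use k c I in \<open>auto simp: is_iso_def\<close>)
    then show "is_limit J C (fcomp ?I D) (fob ?I c) (\<lambda>j. fmap ?I c (fob D j) (\<pi> j))"
      by simp
  qed (use fE fC is_functor_induced[OF C I] in auto)
qed

lemma lex_functor_fcomp:
  assumes F: "lex_functor A B F" and G: "lex_functor B C G"
  shows "lex_functor A C (fcomp G F)"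
  unfolding lex_functor_def
proof (intro conjI allI impI)
  fix J :: "(nat, nat) cat" and D c \<pi>
  assume J: "finite_category J" "is_functor J A D" "is_limit J A D c \<pi>"
  have "is_functor J B (fcomp F D)"
    using J F is_functor_fcomp unfolding lex_functor_def by blast
  moreover have "is_limit J B (fcomp F D) (fob F c) (\<lambda>j. fmap F c (fob D j) (\<pi> j))"
    using J F unfolding lex_functor_def by blast
  ultimately have "is_limit J C (fcomp G (fcomp F D)) (fob G (fob F c))
     (\<lambda>j. fmap G (fob F c) (fob (fcomp F D) j) (fmap F c (fob D j) (\<pi> j)))"
    using J G unfolding lex_functor_def by blast
  then show "is_limit J C (fcomp (fcomp G F) D) (fob (fcomp G F) c) (\<lambda>j. fmap (fcomp G F) c (fob D j) (\<pi> j))"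
    by (simp add: fcomp_assoc)
qed (use F G in \<open>auto simp: lex_functor_def intro: is_functor_fcomp\<close>)

subsection \<open>Equivalence relations and coequalisers\<close>

context cat_base
begin

text \<open>Reflexivity, symmetry and transitivity are internalised as arrows \<open>d\<close>,
  \<open>m\<close> and \<open>n\<close>, the last from the object of composable pairs. Equations and
  pullbacks are carried along by lex functors, whereas the defining condition quantifies over all
  objects \<open>z\<close> of the target.\<close>

lemma eqrelI:
  assumes o: "r \<in> Ob C" "x \<in> Ob C" "s \<in> Hom C r x" "t \<in> Hom C r x"
    and jm: "\<And>z h h'. \<lbrakk>z \<in> Ob C; h \<in> Hom C z r; h' \<in> Hom C z r; Comp C z r x s h = Comp C z r x s h';
      Comp C z r x t h = Comp C z r x t h'\<rbrakk> \<Longrightarrow> h = h'"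
    and rfl: "d \<in> Hom C x r" "Comp C x r x s d = idn C x" "Comp C x r x t d = idn C x"
    and sm: "m \<in> Hom C r r" "Comp C r r x s m = t" "Comp C r r x t m = s"
    and p: "is_pullback C r r x t s p p1 p2"
    and tr: "n \<in> Hom C p r" "Comp C p r x s n = Comp C p r x s p1" "Comp C p r x t n = Comp C p r x t p2"
  shows "equivalence_relation C r x s t"
  unfolding equivalence_relation_def
proof (intro conjI ballI)
  fix z assume z: "z \<in> Ob C"
  let ?f = "\<lambda>f. (Comp C z r x s f, Comp C z r x t f)"
  show "inj_on ?f (Hom C z r)"
    using jm[OF z] by (auto simp: inj_on_def)
  show "equiv (Hom C z x) (?f ` Hom C z r)"
  proof (rule equivI)
    show "?f ` Hom C z r \<subseteq> Hom C z x \<times> Hom C z x" using z o by auto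
    show "refl_on (Hom C z x) (?f ` Hom C z r)"
    proof (rule refl_onI)
      fix u assume u: "u \<in> Hom C z x"
      have "(u, u) = ?f (Comp C z x r d u)" using u z o rfl by (simp add: assoc)
      then show "(u, u) \<in> ?f ` Hom C z r" by (rule image_eqI) (use u z o rfl in simp)
    qed
    show "sym (?f ` Hom C z r)"
    proof (rule symI)
      fix u v assume "(u, v) \<in> ?f ` Hom C z r"
      then obtain h where h: "h \<in> Hom C z r" "u = Comp C z r x s h" "v = Comp C z r x t h" by auto
      have "(v, u) = ?f (Comp C z r r m h)" using h z o sm by (simp add: assoc)
      then show "(v, u) \<in> ?f ` Hom C z r" by (rule image_eqI) (use h z o sm in simp)
    qed
    show "trans (?f ` Hom C z r)"
    proof (rule transI)
      fix u v w assume "(u, v) \<in> ?f ` Hom C z r" "(v, w) \<in> ?f ` Hom C z r"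
      then obtain h k where h: "h \<in> Hom C z r" "u = Comp C z r x s h" "v = Comp C z r x t h"
        and k: "k \<in> Hom C z r" "v = Comp C z r x s k" "w = Comp C z r x t k" by auto
      obtain l where l: "l \<in> Hom C z p" "Comp C z p r p1 l = h" "Comp C z p r p2 l = k"
        using pullback_ex[OF p z h(1) k(1)] h k by metis
      note pin = pullback_in[OF p]
      have "Comp C z r x s (Comp C z p r n l) = Comp C z r x s (Comp C z p r p1 l)"
        "Comp C z r x t (Comp C z p r n l) = Comp C z r x t (Comp C z p r p2 l)"
        using l(1) z o tr pin by (simp_all add: assoc[of l])
      then have "(u, w) = ?f (Comp C z p r n l)" using l h k by simp
      then show "(u, w) \<in> ?f ` Hom C z r" by (rule image_eqI) (use l z o tr pin in simp)
    qed
  qed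
qed (use o in auto)

lemma eqrel_in:
  assumes "equivalence_relation C r x s t"
  shows "r \<in> Ob C" "x \<in> Ob C" "s \<in> Hom C r x" "t \<in> Hom C r x"
  using assms by (auto simp: equivalence_relation_def)

lemma eqrel_jm:
  assumes "equivalence_relation C r x s t" "z \<in> Ob C" "h \<in> Hom C z r" "h' \<in> Hom C z r"
    "Comp C z r x s h = Comp C z r x s h'" "Comp C z r x t h = Comp C z r x t h'"
  shows "h = h'"
  using assms unfolding equivalence_relation_def inj_on_def by blast

lemma eqrel_refl:
  assumes e: "equivalence_relation C r x s t" and z: "z \<in> Ob C" "u \<in> Hom C z x"
  obtains d where "d \<in> Hom C z r" "Comp C z r x s d = u" "Comp C z r x t d = u"
proof -
  have "(u, u) \<in> (\<lambda>f. (Comp C z r x s f, Comp C z r x t f)) ` Hom C z r"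
    using e z unfolding equivalence_relation_def equiv_def refl_on_def by blast
  then show ?thesis using that by auto
qed

lemma eqrel_sym:
  assumes e: "equivalence_relation C r x s t" and z: "z \<in> Ob C" "h \<in> Hom C z r"
  obtains m where "m \<in> Hom C z r" "Comp C z r x s m = Comp C z r x t h" "Comp C z r x t m = Comp C z r x s h"
proof -
  let ?R = "(\<lambda>f. (Comp C z r x s f, Comp C z r x t f)) ` Hom C z r"
  have "sym ?R" using e z unfolding equivalence_relation_def equiv_def by blast
  then have "(Comp C z r x t h, Comp C z r x s h) \<in> ?R"
    using z(2) symD by (metis (mono_tags, lifting) image_eqI)
  then show ?thesis using that by auto
qed

lemma eqrel_trans:
  assumes e: "equivalence_relation C r x s t" and z: "z \<in> Ob C" "h \<in> Hom C z r" "k \<in> Hom C z r"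
    and eq: "Comp C z r x t h = Comp C z r x s k"
  obtains m where "m \<in> Hom C z r" "Comp C z r x s m = Comp C z r x s h" "Comp C z r x t m = Comp C z r x t k"
proof -
  let ?R = "(\<lambda>f. (Comp C z r x s f, Comp C z r x t f)) ` Hom C z r"
  have "trans ?R" using e z unfolding equivalence_relation_def equiv_def by blast
  moreover have "(Comp C z r x s h, Comp C z r x t h) \<in> ?R" "(Comp C z r x t h, Comp C z r x t k) \<in> ?R"
    using z eq by auto
  ultimately have "(Comp C z r x s h, Comp C z r x t k) \<in> ?R" by (rule transD)
  then show ?thesis using that by auto
qed

end

text \<open>The arrows demanded by \<open>eqrelI\<close> arise in \<open>A\<close> from generic
  elements: the identity of \<open>x\<close>, the identity of \<open>r\<close>, and the two pullback
  projections. Joint monicity is not an equation, so it is rewritten as a limit.\<close>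

lemma lex_functor_eqrel:
  assumes F: "lex_functor A B F" and e: "equivalence_relation A r x s t"
  shows "equivalence_relation B (fob F r) (fob F x) (fmap F r x s) (fmap F r x t)"
proof -
  have FA: "is_functor A B F" and fA: "finitely_complete A" and "category A" "category B"
    using F by (auto simp: lex_functor_def finitely_complete_def)
  interpret A: cat_base A by unfold_locales fact
  interpret B: cat_base B by unfold_locales fact
  note o = A.eqrel_in[OF e] and Fo = functor_ob[OF FA] and Fh = functor_hom[OF FA]
  obtain d where d: "d \<in> Hom A x r" "Comp A x r x s d = idn A x" "Comp A x r x t d = idn A x"
    using A.eqrel_refl[OF e o(2)] o by (metis A.idn_in)
  obtain m where m: "m \<in> Hom A r r" "Comp A r r x s m = t" "Comp A r r x t m = s"
    using A.eqrel_sym[OF e o(1), of "idn A r"] o by auto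
  obtain p p1 p2 where p: "is_pullback A r r x t s p p1 p2"
    using finitely_complete_pullback[OF fA o(1,1,2,4,3)] .
  note pin = pullback_in[OF p]
  obtain n where n: "n \<in> Hom A p r" "Comp A p r x s n = Comp A p r x s p1"
    "Comp A p r x t n = Comp A p r x t p2"
    using A.eqrel_trans[OF e pin(4,7,8,9)] .
  \<comment> \<open>Two copies of \<open>r\<close> (at 0 and 1) over two copies of \<open>x\<close>
    (at 2 and 3), with \<open>s\<close> into 2 and \<open>t\<close> into 3. The pair
    \<open>s\<close>, \<open>t\<close> is jointly monic precisely when \<open>r\<close> with
    identities to both copies is a limit of this diagram.\<close>
  let ?J = "pos_cat {0, 1, 2, 3} (\<lambda>i j. i = j \<or> i < 2 \<and> j \<ge> 2)"
  let ?ob = "\<lambda>i::nat. if i < 2 then r else x"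
  let ?D = "\<lparr>fob = ?ob, fmap = \<lambda>i j _. if i = j then idn A (?ob i) else if j = 2 then s else t\<rparr> :: (nat, nat, _, _) ftor"
  let ?\<pi> = "\<lambda>i::nat. if i < 2 then idn A r else if i = 2 then s else t"
  have J: "finite_category ?J" by (rule finite_pos_cat) auto
  have D: "is_functor ?J A ?D" using o by (auto simp: is_functor_def pos_cat_def)
  have cone: "is_cone ?J A ?D z \<tau> \<longleftrightarrow> z \<in> Ob A \<and> \<tau> 0 \<in> Hom A z r \<and> \<tau> 1 \<in> Hom A z r \<and>
     \<tau> 2 = Comp A z r x s (\<tau> 0) \<and> \<tau> 2 = Comp A z r x s (\<tau> 1) \<and>
     \<tau> 3 = Comp A z r x t (\<tau> 0) \<and> \<tau> 3 = Comp A z r x t (\<tau> 1)" for z \<tau>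
    using o by (auto simp: is_cone_def pos_cat_def)
  have "is_limit ?J A ?D r ?\<pi>"
  proof (rule is_limitI)
    show "is_cone ?J A ?D r ?\<pi>" unfolding cone using o by simp
    fix z \<tau> assume z: "is_cone ?J A ?D z \<tau>"
    then have "\<tau> 0 = \<tau> 1" using A.eqrel_jm[OF e] unfolding cone by metis
    then show "\<exists>h\<in>Hom A z r. \<forall>j\<in>Ob ?J. Comp A z r (fob ?D j) (?\<pi> j) h = \<tau> j"
      using z o unfolding cone by (intro bexI[of _ "\<tau> 0"]) (auto simp: pos_cat_def)
  next
    fix z h h' assume "z \<in> Ob A" "h \<in> Hom A z r" "h' \<in> Hom A z r"
      "\<forall>j\<in>Ob ?J. Comp A z r (fob ?D j) (?\<pi> j) h = Comp A z r (fob ?D j) (?\<pi> j) h'"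
    then show "h = h'" using o by (simp add: pos_cat_def)
  qed
  then have l: "is_limit ?J B (fcomp F ?D) (fob F r) (\<lambda>j. fmap F r (fob ?D j) (?\<pi> j))"
    using F J D unfolding lex_functor_def by blast
  show ?thesis
  proof (rule B.eqrelI)
    fix z h h' assume z: "z \<in> Ob B" "h \<in> Hom B z (fob F r)" "h' \<in> Hom B z (fob F r)"
      "Comp B z (fob F r) (fob F x) (fmap F r x s) h = Comp B z (fob F r) (fob F x) (fmap F r x s) h'"
      "Comp B z (fob F r) (fob F x) (fmap F r x t) h = Comp B z (fob F r) (fob F x) (fmap F r x t) h'"
    \<comment> \<open>A cone with \<open>h\<close> at 0 and \<open>h'\<close> at 1; its mediating
      arrow equals both.\<close>
    let ?\<tau> = "\<lambda>i::nat. if i = 0 then h else if i = 1 then h' else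
      Comp B z (fob F r) (fob F x) (fmap F r x (if i = 2 then s else t)) h"
    have "is_cone ?J B (fcomp F ?D) z ?\<tau>"
      using z o Fo Fh functor_idn[OF FA] by (auto simp: is_cone_def pos_cat_def)
    from is_limit_ex[OF l this] obtain k where k: "k \<in> Hom B z (fob F r)"
      "\<forall>j\<in>Ob ?J. Comp B z (fob F r) (fob (fcomp F ?D) j) (fmap F r (fob ?D j) (?\<pi> j)) k = ?\<tau> j" by blast
    then have "k = h" "k = h'"
      using z o Fo functor_idn[OF FA] bspec[OF k(2), of 0] bspec[OF k(2), of 1] by (auto simp: pos_cat_def)
    then show "h = h'" by simp
  next
    show "fmap F x r d \<in> Hom B (fob F x) (fob F r)" using Fh o d by blast
    show "fmap F r r m \<in> Hom B (fob F r) (fob F r)" using Fh o m by blast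
    show "is_pullback B (fob F r) (fob F r) (fob F x) (fmap F r x t) (fmap F r x s) (fob F p)
      (fmap F p r p1) (fmap F p r p2)"
      by (rule lex_functor_pullback[OF F p])
    show "fmap F p r n \<in> Hom B (fob F p) (fob F r)" using Fh o n pin by blast
  qed (use o Fo Fh d m n pin in \<open>simp_all flip: functor_Comp[OF FA] functor_idn[OF FA]\<close>)
qed

lemma coequaliser_in:
  assumes "is_coequaliser C a b f g q e"
  shows "a \<in> Ob C" "b \<in> Ob C" "q \<in> Ob C" "f \<in> Hom C a b" "g \<in> Hom C a b" "e \<in> Hom C b q"
    "Comp C a b q e f = Comp C a b q e g"
  using assms by (auto simp: is_coequaliser_def)

lemma coequaliser_ex:
  assumes "is_coequaliser C a b f g q e" "z \<in> Ob C" "u \<in> Hom C b z" "Comp C a b z u f = Comp C a b z u g"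
  obtains h where "h \<in> Hom C q z" "Comp C b q z h e = u"
  using assms unfolding is_coequaliser_def by blast

lemma is_coequaliserI:
  assumes "a \<in> Ob C" "b \<in> Ob C" "q \<in> Ob C" "f \<in> Hom C a b" "g \<in> Hom C a b" "e \<in> Hom C b q"
    "Comp C a b q e f = Comp C a b q e g"
    and "\<And>z u. \<lbrakk>z \<in> Ob C; u \<in> Hom C b z; Comp C a b z u f = Comp C a b z u g\<rbrakk> \<Longrightarrow>
      \<exists>h\<in>Hom C q z. Comp C b q z h e = u"
    and "\<And>z h h'. \<lbrakk>z \<in> Ob C; h \<in> Hom C q z; h' \<in> Hom C q z; Comp C b q z h e = Comp C b q z h' e\<rbrakk> \<Longrightarrow> h = h'"
  shows "is_coequaliser C a b f g q e"
  unfolding is_coequaliser_def using assms(1-7)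
  by (auto intro!: ex_ex1I[where P = "\<lambda>h. h \<in> _ \<and> _ h"] dest: assms(8) intro: assms(9))

context cat_base
begin

lemma coequaliser_uniq:
  assumes c: "is_coequaliser C a b f g q e" and h: "z \<in> Ob C" "h \<in> Hom C q z" "h' \<in> Hom C q z"
    "Comp C b q z h e = Comp C b q z h' e"
  shows "h = h'"
proof -
  note cin = coequaliser_in[OF c]
  have "Comp C a b z (Comp C b q z h e) f = Comp C a b z (Comp C b q z h e) g"
    using cin h by (simp flip: assoc)
  moreover have "Comp C b q z h e \<in> Hom C b z" using cin h by simp
  ultimately have "\<exists>!k. k \<in> Hom C q z \<and> Comp C b q z k e = Comp C b q z h e"
    using c h(1) unfolding is_coequaliser_def by blast
  then show ?thesis using h by metis
qed

lemma coequaliser_unique: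
  assumes c: "is_coequaliser C a b f g q e" and c': "is_coequaliser C a b f g q' e'"
  obtains k where "is_iso C q q' k" "Comp C b q q' k e = e'"
proof -
  note i = coequaliser_in[OF c] and i' = coequaliser_in[OF c']
  obtain k where k: "k \<in> Hom C q q'" "Comp C b q q' k e = e'"
    using coequaliser_ex[OF c i'(3,6,7)] .
  obtain m where m: "m \<in> Hom C q' q" "Comp C b q' q m e' = e"
    using coequaliser_ex[OF c' i(3,6,7)] .
  have "Comp C q q' q m k = idn C q"
    by (rule coequaliser_uniq[OF c, of q]) (use i i' k m in \<open>simp_all flip: assoc\<close>)
  moreover have "Comp C q' q q' k m = idn C q'"
    by (rule coequaliser_uniq[OF c', of q']) (use i i' k m in \<open>simp_all flip: assoc\<close>)
  ultimately have "is_iso C q q' k" using k m unfolding is_iso_def by blast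
  then show ?thesis using k that by blast
qed

end

section \<open>Presheaves\<close>

lemma op_cat_simps [simp]:
  "Ob (op_cat C) = Ob C" "Hom (op_cat C) a b = Hom C b a" "idn (op_cat C) = idn C"
  "Comp (op_cat C) a b c g f = Comp C c b a f g"
  by (simp_all add: op_cat_def)

lemma set_cat_simps [simp]:
  "Ob (set_cat :: ('u set, 'u \<Rightarrow> 'u) cat) = {A. small TYPE('u) A}"
  "Hom set_cat A B = A \<rightarrow>\<^sub>E B" "idn set_cat A = (\<lambda>x\<in>A. x)"
  "Comp set_cat A B D g f = compose A g f"
  by (simp_all add: set_cat_def)

locale presheaves =
  fixes C :: "('o, 'u) cat"
  assumes set_universe: "set_universe TYPE('u)" and locally_small: "locally_small C"
begin

sublocale universe "TYPE('u)"
  by unfold_locales (fact set_universe)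

sublocale cat_base C
  by unfold_locales (use locally_small in \<open>simp add: locally_small_def\<close>)

lemma small_Hom: "a \<in> Ob C \<Longrightarrow> b \<in> Ob C \<Longrightarrow> small TYPE('u) (Hom C a b)"
  using locally_small by (simp add: locally_small_def)

abbreviation P :: "(('o, 'u) presheaf, 'o \<Rightarrow> 'u \<Rightarrow> 'u) cat" where "P \<equiv> psh C"

lemma psh_ObI:
  assumes "\<And>a. a \<in> Ob C \<Longrightarrow> small TYPE('u) (fob F a)"
    and "\<And>a b f. \<lbrakk>a \<in> Ob C; b \<in> Ob C; f \<in> Hom C a b\<rbrakk> \<Longrightarrow> fmap F b a f \<in> fob F b \<rightarrow>\<^sub>E fob F a"
    and "\<And>a x. \<lbrakk>a \<in> Ob C; x \<in> fob F a\<rbrakk> \<Longrightarrow> fmap F a a (idn C a) x = x"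
    and "\<And>a b c f g x. \<lbrakk>a \<in> Ob C; b \<in> Ob C; c \<in> Ob C; f \<in> Hom C a b; g \<in> Hom C b c; x \<in> fob F c\<rbrakk> \<Longrightarrow>
      fmap F c a (Comp C a b c g f) x = fmap F b a f (fmap F c b g x)"
  shows "F \<in> Ob P"
proof -
  have "fmap F a a (idn C a) = (\<lambda>x\<in>fob F a. x)" if "a \<in> Ob C" for a
  proof (rule extensionalityI)
    show "fmap F a a (idn C a) \<in> extensional (fob F a)"
      using assms(2)[of a a "idn C a"] that by (auto simp: PiE_def)
  qed (use assms(3) that in auto)
  moreover have "fmap F c a (Comp C a b c g f) = compose (fob F c) (fmap F b a f) (fmap F c b g)"
    if "a \<in> Ob C" "b \<in> Ob C" "c \<in> Ob C" "f \<in> Hom C a b" "g \<in> Hom C b c" for a b c f g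
  proof (rule extensionalityI)
    show "fmap F c a (Comp C a b c g f) \<in> extensional (fob F c)"
      using assms(2)[of a c "Comp C a b c g f"] that by (auto simp: PiE_def)
  qed (use assms(4) that in \<open>auto simp: compose_def\<close>)
  ultimately show ?thesis
    using assms(1,2) by (auto simp: psh_def fun_cat_def is_functor_def)
qed

lemma
  assumes "F \<in> Ob P"
  shows small_fob: "a \<in> Ob C \<Longrightarrow> small TYPE('u) (fob F a)"
    and act_PiE: "\<lbrakk>a \<in> Ob C; b \<in> Ob C; f \<in> Hom C a b\<rbrakk> \<Longrightarrow> fmap F b a f \<in> fob F b \<rightarrow>\<^sub>E fob F a"
    and act_in [simp]: "\<lbrakk>f \<in> Hom C a b; x \<in> fob F b; a \<in> Ob C; b \<in> Ob C\<rbrakk> \<Longrightarrow> fmap F b a f x \<in> fob F a"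
    and act_idn [simp]: "\<lbrakk>x \<in> fob F a; a \<in> Ob C\<rbrakk> \<Longrightarrow> fmap F a a (idn C a) x = x"
    and act_Comp: "\<lbrakk>f \<in> Hom C a b; g \<in> Hom C b c; x \<in> fob F c; a \<in> Ob C; b \<in> Ob C; c \<in> Ob C\<rbrakk> \<Longrightarrow>
      fmap F c a (Comp C a b c g f) x = fmap F b a f (fmap F c b g x)"
proof -
  have F: "is_functor (op_cat C) set_cat F" using assms by (simp add: psh_def fun_cat_def)
  show "a \<in> Ob C \<Longrightarrow> small TYPE('u) (fob F a)" for a using F by (simp add: is_functor_def)
  show *: "\<lbrakk>a \<in> Ob C; b \<in> Ob C; f \<in> Hom C a b\<rbrakk> \<Longrightarrow> fmap F b a f \<in> fob F b \<rightarrow>\<^sub>E fob F a" for a b f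
    using F by (simp add: is_functor_def)
  show "\<lbrakk>f \<in> Hom C a b; x \<in> fob F b; a \<in> Ob C; b \<in> Ob C\<rbrakk> \<Longrightarrow> fmap F b a f x \<in> fob F a"
    using *[of a b f] by auto
  show "\<lbrakk>x \<in> fob F a; a \<in> Ob C\<rbrakk> \<Longrightarrow> fmap F a a (idn C a) x = x"
    using functor_idn[OF F, of a] by simp
  show "\<lbrakk>f \<in> Hom C a b; g \<in> Hom C b c; x \<in> fob F c; a \<in> Ob C; b \<in> Ob C; c \<in> Ob C\<rbrakk> \<Longrightarrow>
      fmap F c a (Comp C a b c g f) x = fmap F b a f (fmap F c b g x)"
    using functor_Comp[OF F, of g c b f a] by (simp add: compose_def)
qed

lemma psh_HomI:
  assumes "\<alpha> \<in> extensional (Ob C)"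
    and "\<And>a. a \<in> Ob C \<Longrightarrow> \<alpha> a \<in> fob F a \<rightarrow>\<^sub>E fob G a"
    and "\<And>a b f x. \<lbrakk>a \<in> Ob C; b \<in> Ob C; f \<in> Hom C a b; x \<in> fob F b\<rbrakk> \<Longrightarrow>
      \<alpha> a (fmap F b a f x) = fmap G b a f (\<alpha> b x)"
  shows "\<alpha> \<in> Hom P F G"
  using assms by (auto simp: psh_def fun_cat_def nat_trans_def compose_def intro!: restrict_ext)

lemma
  assumes "\<alpha> \<in> Hom P F G"
  shows hom_ext1: "\<alpha> \<in> extensional (Ob C)"
    and hom_PiE: "a \<in> Ob C \<Longrightarrow> \<alpha> a \<in> fob F a \<rightarrow>\<^sub>E fob G a"
    and hom_in [simp]: "\<lbrakk>a \<in> Ob C; x \<in> fob F a\<rbrakk> \<Longrightarrow> \<alpha> a x \<in> fob G a"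
    and hom_act: "\<lbrakk>f \<in> Hom C a b; x \<in> fob F b; a \<in> Ob C; b \<in> Ob C\<rbrakk> \<Longrightarrow>
      \<alpha> a (fmap F b a f x) = fmap G b a f (\<alpha> b x)"
proof -
  have n: "\<alpha> \<in> extensional (Ob C)" "nat_trans (op_cat C) set_cat F G \<alpha>"
    using assms by (auto simp: psh_def fun_cat_def)
  show "\<alpha> \<in> extensional (Ob C)" by (fact n)
  show *: "a \<in> Ob C \<Longrightarrow> \<alpha> a \<in> fob F a \<rightarrow>\<^sub>E fob G a" for a using n(2) by (simp add: nat_trans_def)
  show "\<lbrakk>a \<in> Ob C; x \<in> fob F a\<rbrakk> \<Longrightarrow> \<alpha> a x \<in> fob G a" using *[of a] by auto
  show "\<alpha> a (fmap F b a f x) = fmap G b a f (\<alpha> b x)"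
    if "f \<in> Hom C a b" "x \<in> fob F b" "a \<in> Ob C" "b \<in> Ob C"
  proof -
    have "compose (fob F b) (\<alpha> a) (fmap F b a f) x = compose (fob F b) (fmap G b a f) (\<alpha> b) x"
      using n(2) that unfolding nat_trans_def by simp
    then show ?thesis using that by (simp add: compose_def)
  qed
qed

lemma hom_eqI:
  assumes \<alpha>: "\<alpha> \<in> Hom P F G" and \<beta>: "\<beta> \<in> Hom P F G"
    and eq: "\<And>a x. \<lbrakk>a \<in> Ob C; x \<in> fob F a\<rbrakk> \<Longrightarrow> \<alpha> a x = \<beta> a x"
  shows "\<alpha> = \<beta>"
proof (rule extensionalityI[OF hom_ext1[OF \<alpha>] hom_ext1[OF \<beta>]])
  fix a assume a: "a \<in> Ob C"
  show "\<alpha> a = \<beta> a"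
    by (rule PiE_ext[OF hom_PiE[OF \<alpha> a] hom_PiE[OF \<beta> a] eq[OF a]])
qed

text \<open>Hom-sets of \<open>psh C\<close> contain only families that are extensional both in the
  object and in the element; the double restriction turns any elementwise prescription into such a
  family.\<close>

definition mk_hom :: "('o, 'u) presheaf \<Rightarrow> ('o \<Rightarrow> 'u \<Rightarrow> 'u) \<Rightarrow> 'o \<Rightarrow> 'u \<Rightarrow> 'u" where
  "mk_hom F t = (\<lambda>a\<in>Ob C. \<lambda>x\<in>fob F a. t a x)"

lemma mk_hom_app [simp]: "\<lbrakk>a \<in> Ob C; x \<in> fob F a\<rbrakk> \<Longrightarrow> mk_hom F t a x = t a x"
  by (simp add: mk_hom_def)

lemma mk_hom:
  assumes F: "F \<in> Ob P" and "\<And>a x. \<lbrakk>a \<in> Ob C; x \<in> fob F a\<rbrakk> \<Longrightarrow> t a x \<in> fob G a"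
    and "\<And>a b f x. \<lbrakk>a \<in> Ob C; b \<in> Ob C; f \<in> Hom C a b; x \<in> fob F b\<rbrakk> \<Longrightarrow>
      t a (fmap F b a f x) = fmap G b a f (t b x)"
  shows "mk_hom F t \<in> Hom P F G"
proof (rule psh_HomI)
  show "mk_hom F t \<in> extensional (Ob C)" by (simp add: mk_hom_def)
qed (use assms in \<open>auto simp: mk_hom_def\<close>)

lemma psh_Comp_app [simp]:
  "\<lbrakk>a \<in> Ob C; x \<in> fob F a\<rbrakk> \<Longrightarrow> Comp P F G H \<beta> \<alpha> a x = \<beta> a (\<alpha> a x)"
  by (simp add: psh_def fun_cat_def compose_def)

lemma psh_idn_app [simp]: "\<lbrakk>a \<in> Ob C; x \<in> fob F a\<rbrakk> \<Longrightarrow> idn P F a x = x"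
  by (simp add: psh_def fun_cat_def)

lemma psh_Comp_in:
  assumes \<alpha>: "\<alpha> \<in> Hom P F G" and \<beta>: "\<beta> \<in> Hom P G H" and F: "F \<in> Ob P"
  shows "Comp P F G H \<beta> \<alpha> \<in> Hom P F H"
proof (rule psh_HomI)
  show "Comp P F G H \<beta> \<alpha> \<in> extensional (Ob C)" by (simp add: psh_def fun_cat_def)
  show "Comp P F G H \<beta> \<alpha> a \<in> fob F a \<rightarrow>\<^sub>E fob H a" if "a \<in> Ob C" for a
    using that \<alpha> \<beta> by (auto simp: psh_def fun_cat_def compose_def)
qed (use \<alpha> \<beta> F in \<open>simp add: hom_act[OF \<alpha>] hom_act[OF \<beta>]\<close>)

lemma psh_idn_in: "F \<in> Ob P \<Longrightarrow> idn P F \<in> Hom P F F"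
  by (rule psh_HomI) (auto simp: psh_def fun_cat_def)

lemma category_psh: "category P"
  unfolding category_def
proof (intro conjI ballI)
  show "idn P F \<in> Hom P F F" if "F \<in> Ob P" for F using that by (rule psh_idn_in)
  fix F G assume FG: "F \<in> Ob P" "G \<in> Ob P"
  show "Comp P F F G \<alpha> (idn P F) = \<alpha>" if "\<alpha> \<in> Hom P F G" for \<alpha>
    by (rule hom_eqI) (use that FG psh_Comp_in[OF psh_idn_in that] in auto)
  show "Comp P F G G (idn P G) \<alpha> = \<alpha>" if "\<alpha> \<in> Hom P F G" for \<alpha>
    by (rule hom_eqI) (use that FG psh_Comp_in[OF that psh_idn_in] in auto)
  fix H assume H: "H \<in> Ob P"
  fix \<alpha> \<beta> assume \<alpha>\<beta>: "\<alpha> \<in> Hom P F G" "\<beta> \<in> Hom P G H"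
  show "Comp P F G H \<beta> \<alpha> \<in> Hom P F H" by (rule psh_Comp_in) fact+
  fix K \<gamma> assume K: "K \<in> Ob P" "\<gamma> \<in> Hom P H K"
  have "Comp P F G H \<beta> \<alpha> \<in> Hom P F H" "Comp P G H K \<gamma> \<beta> \<in> Hom P G K"
    using \<alpha>\<beta> K FG by (auto intro: psh_Comp_in)
  then have "Comp P F H K \<gamma> (Comp P F G H \<beta> \<alpha>) \<in> Hom P F K"
    "Comp P F G K (Comp P G H K \<gamma> \<beta>) \<alpha> \<in> Hom P F K"
    using \<alpha>\<beta> K FG by (auto intro: psh_Comp_in)
  then show "Comp P F H K \<gamma> (Comp P F G H \<beta> \<alpha>) = Comp P F G K (Comp P G H K \<gamma> \<beta>) \<alpha>"
    by (rule hom_eqI) (use \<alpha>\<beta> in auto)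
qed

sublocale P: cat_base P by unfold_locales (rule category_psh)

lemma iso_app:
  assumes "is_iso P F G \<alpha>"
  obtains \<beta> where "\<alpha> \<in> Hom P F G" "\<beta> \<in> Hom P G F"
    "\<And>a x. \<lbrakk>a \<in> Ob C; x \<in> fob F a\<rbrakk> \<Longrightarrow> \<beta> a (\<alpha> a x) = x"
    "\<And>a x. \<lbrakk>a \<in> Ob C; x \<in> fob G a\<rbrakk> \<Longrightarrow> \<alpha> a (\<beta> a x) = x"
proof -
  obtain \<beta> where *: "\<alpha> \<in> Hom P F G" "\<beta> \<in> Hom P G F" "Comp P F G F \<beta> \<alpha> = idn P F"
    "Comp P G F G \<alpha> \<beta> = idn P G"
    using assms unfolding is_iso_def by blast
  show ?thesis
  proof (rule that[of \<beta>])
    show "\<beta> a (\<alpha> a x) = x" if "a \<in> Ob C" "x \<in> fob F a" for a x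
      using that fun_cong[OF fun_cong[OF *(3)], of a x] by simp
    show "\<alpha> a (\<beta> a x) = x" if "a \<in> Ob C" "x \<in> fob G a" for a x
      using that fun_cong[OF fun_cong[OF *(4)], of a x] by simp
  qed (use * in auto)
qed

subsection \<open>The Yoneda embedding\<close>

abbreviation W :: "'o \<Rightarrow> ('o, 'u) presheaf" where "W \<equiv> fob (yoneda C)"

lemma W_simps [simp]:
  "fob (W c) a = Hom C a c"
  "f \<in> Hom C b c \<Longrightarrow> fmap (W c) b a g f = Comp C a b c f g"
  by (simp_all add: yoneda_def)

lemma W_Ob [simp]: "c \<in> Ob C \<Longrightarrow> W c \<in> Ob P"
proof (rule psh_ObI)
  show "fmap (W c) b a f \<in> fob (W c) b \<rightarrow>\<^sub>E fob (W c) a"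
    if "c \<in> Ob C" "a \<in> Ob C" "b \<in> Ob C" "f \<in> Hom C a b" for a b f
    using that by (auto simp: yoneda_def)
qed (auto simp: small_Hom assoc)

lemma yoneda_app [simp]:
  "\<lbrakk>a \<in> Ob C; f \<in> Hom C a c\<rbrakk> \<Longrightarrow> fmap (yoneda C) c d g a f = Comp C a c d g f"
  by (simp add: yoneda_def)

lemma yoneda_in [simp]:
  "\<lbrakk>c \<in> Ob C; d \<in> Ob C; g \<in> Hom C c d\<rbrakk> \<Longrightarrow> fmap (yoneda C) c d g \<in> Hom P (W c) (W d)"
proof (rule psh_HomI)
  show "fmap (yoneda C) c d g a \<in> fob (W c) a \<rightarrow>\<^sub>E fob (W d) a"
    if "c \<in> Ob C" "d \<in> Ob C" "g \<in> Hom C c d" "a \<in> Ob C" for a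
    using that by (auto simp: yoneda_def)
qed (auto simp: yoneda_def assoc)

lemma yoneda_functor: "is_functor C P (yoneda C)"
  unfolding is_functor_def
proof (intro conjI ballI)
  show "fmap (yoneda C) a a (idn C a) = idn P (W a)" if "a \<in> Ob C" for a
    by (rule hom_eqI[of _ "W a" "W a"]) (use that in \<open>auto intro: psh_idn_in\<close>)
  show "fmap (yoneda C) a c (Comp C a b c g f) =
      Comp P (W a) (W b) (W c) (fmap (yoneda C) b c g) (fmap (yoneda C) a b f)"
    if "a \<in> Ob C" "b \<in> Ob C" "c \<in> Ob C" "f \<in> Hom C a b" "g \<in> Hom C b c" for a b c f g
    by (rule hom_eqI[of _ "W a" "W c"]) (use that in \<open>auto simp: assoc\<close>)
qed auto

text \<open>The arrow \<open>W c \<rightarrow> F\<close> that corresponds to the element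
  \<open>x\<close> of \<open>F c\<close> under the Yoneda lemma.\<close>

definition yel :: "('o, 'u) presheaf \<Rightarrow> 'o \<Rightarrow> 'u \<Rightarrow> 'o \<Rightarrow> 'u \<Rightarrow> 'u" where
  "yel F c x = mk_hom (W c) (\<lambda>a f. fmap F c a f x)"

lemma yel_app [simp]: "\<lbrakk>a \<in> Ob C; f \<in> Hom C a c\<rbrakk> \<Longrightarrow> yel F c x a f = fmap F c a f x"
  by (simp add: yel_def)

lemma yel_in [simp]:
  assumes F: "F \<in> Ob P" and c: "c \<in> Ob C" "x \<in> fob F c"
  shows "yel F c x \<in> Hom P (W c) F"
  unfolding yel_def by (rule mk_hom) (use assms in \<open>auto simp: act_Comp[OF F]\<close>)

lemma yoneda_lemma:
  assumes \<alpha>: "\<alpha> \<in> Hom P (W c) F" and o: "c \<in> Ob C" "a \<in> Ob C" "f \<in> Hom C a c"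
  shows "\<alpha> a f = fmap F c a f (\<alpha> c (idn C c))"
  using hom_act[OF \<alpha> o(3), of "idn C c"] o by simp

subsection \<open>Constructing presheaves\<close>

text \<open>Presheaves take values in subsets of the universe type, so a pointwise construction with
  values in small sets of another type has to be transported along injections.\<close>

lemma realise:
  fixes X :: "'o \<Rightarrow> 'x set"
  assumes sm: "\<And>a. a \<in> Ob C \<Longrightarrow> small TYPE('u) (X a)"
    and cl: "\<And>a b f x. \<lbrakk>a \<in> Ob C; b \<in> Ob C; f \<in> Hom C a b; x \<in> X b\<rbrakk> \<Longrightarrow> A b a f x \<in> X a"
    and id: "\<And>a x. \<lbrakk>a \<in> Ob C; x \<in> X a\<rbrakk> \<Longrightarrow> A a a (idn C a) x = x"
    and co: "\<And>a b c f g x. \<lbrakk>a \<in> Ob C; b \<in> Ob C; c \<in> Ob C; f \<in> Hom C a b; g \<in> Hom C b c; x \<in> X c\<rbrakk> \<Longrightarrow>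
      A c a (Comp C a b c g f) x = A b a f (A c b g x)"
  obtains F e where "F \<in> Ob P" "\<And>a. a \<in> Ob C \<Longrightarrow> bij_betw (e a) (X a) (fob F a)"
    "\<And>a b f x. \<lbrakk>a \<in> Ob C; b \<in> Ob C; f \<in> Hom C a b; x \<in> X b\<rbrakk> \<Longrightarrow> fmap F b a f (e b x) = e a (A b a f x)"
proof -
  have "\<forall>a. \<exists>e :: 'x \<Rightarrow> 'u. a \<in> Ob C \<longrightarrow> inj_on e (X a)"
    using sm small_inj by metis
  then obtain e :: "'o \<Rightarrow> 'x \<Rightarrow> 'u" where e: "\<And>a. a \<in> Ob C \<Longrightarrow> inj_on (e a) (X a)" by metis
  define F :: "('o, 'u) presheaf" where "F = \<lparr>fob = \<lambda>a. e a ` X a,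
    fmap = \<lambda>b a f. \<lambda>y\<in>e b ` X b. e a (A b a f (the_inv_into (X b) (e b) y))\<rparr>"
  have Fm: "fmap F b a f (e b x) = e a (A b a f x)" if "b \<in> Ob C" "x \<in> X b" for a b f x
    using that e by (auto simp: F_def the_inv_into_f_f)
  have "F \<in> Ob P"
  proof (rule psh_ObI)
    show "small TYPE('u) (fob F a)" if "a \<in> Ob C" for a
      using sm[OF that] by (simp add: F_def small_image)
    show "fmap F b a f \<in> fob F b \<rightarrow>\<^sub>E fob F a" if "a \<in> Ob C" "b \<in> Ob C" "f \<in> Hom C a b" for a b f
      using Fm cl that by (auto simp: F_def)
    show "fmap F a a (idn C a) x = x" if "a \<in> Ob C" "x \<in> fob F a" for a x
    proof -
      obtain y where "x = e a y" "y \<in> X a" using \<open>x \<in> fob F a\<close> by (auto simp: F_def)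
      then show ?thesis using that Fm id by simp
    qed
    show "fmap F c a (Comp C a b c g f) x = fmap F b a f (fmap F c b g x)"
      if "a \<in> Ob C" "b \<in> Ob C" "c \<in> Ob C" "f \<in> Hom C a b" "g \<in> Hom C b c" "x \<in> fob F c" for a b c f g x
    proof -
      obtain y where "x = e c y" "y \<in> X c" using \<open>x \<in> fob F c\<close> by (auto simp: F_def)
      then show ?thesis using that Fm co cl by simp
    qed
  qed
  moreover have "bij_betw (e a) (X a) (fob F a)" if "a \<in> Ob C" for a
    using e[OF that] by (simp add: bij_betw_def F_def)
  ultimately show ?thesis using Fm by (intro that[of F e])
qed

text \<open>A map that is constant on the fibres of a pointwise surjection can be computed on any
  preimage. Naturality is inherited because the restriction of a preimage is a preimage of the
  restriction.\<close>

lemma factor_surj: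
  assumes q: "q \<in> Hom P F Q" and F: "F \<in> Ob P" "Q \<in> Ob P" and s: "\<And>a. a \<in> Ob C \<Longrightarrow> q a ` fob F a = fob Q a"
    and \<beta>: "\<beta> \<in> Hom P F G"
    and k: "\<And>a x y. \<lbrakk>a \<in> Ob C; x \<in> fob F a; y \<in> fob F a; q a x = q a y\<rbrakk> \<Longrightarrow> \<beta> a x = \<beta> a y"
  obtains h where "h \<in> Hom P Q G" "Comp P F Q G h q = \<beta>"
    "\<And>a x. \<lbrakk>a \<in> Ob C; x \<in> fob F a\<rbrakk> \<Longrightarrow> h a (q a x) = \<beta> a x"
proof -
  let ?t = "\<lambda>a z. \<beta> a (SOME x. x \<in> fob F a \<and> q a x = z)"
  have t: "?t a (q a x) = \<beta> a x" if "a \<in> Ob C" "x \<in> fob F a" for a x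
  proof (rule someI2[of "\<lambda>y. y \<in> fob F a \<and> q a y = q a x"])
    show "x \<in> fob F a \<and> q a x = q a x" using that by simp
    show "\<beta> a y = \<beta> a x" if "y \<in> fob F a \<and> q a y = q a x" for y
      using k[of a y x] that \<open>a \<in> Ob C\<close> \<open>x \<in> fob F a\<close> by simp
  qed
  have h: "mk_hom Q ?t \<in> Hom P Q G"
  proof (rule mk_hom[OF F(2)])
    fix a z assume a: "a \<in> Ob C" and "z \<in> fob Q a"
    then obtain x where "z = q a x" "x \<in> fob F a" using s by blast
    then show "?t a z \<in> fob G a" using t a \<beta> by simp
  next
    fix a b f z assume ab: "a \<in> Ob C" "b \<in> Ob C" "f \<in> Hom C a b" and "z \<in> fob Q b"
    then obtain x where x: "z = q b x" "x \<in> fob F b" using s by blast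
    have "?t a (fmap Q b a f z) = ?t a (q a (fmap F b a f x))"
      using x ab hom_act[OF q] by simp
    also have "\<dots> = fmap G b a f (?t b z)"
      using x ab t hom_act[OF \<beta>] F by simp
    finally show "?t a (fmap Q b a f z) = fmap G b a f (?t b z)" .
  qed
  have app: "mk_hom Q ?t a (q a x) = \<beta> a x" if "a \<in> Ob C" "x \<in> fob F a" for a x
    using that t q by simp
  have "Comp P F Q G (mk_hom Q ?t) q = \<beta>"
    by (rule hom_eqI[OF psh_Comp_in[OF q h F(1)] \<beta>]) (use app in simp)
  with h app show ?thesis using that by blast
qed

lemma surj_epi:
  assumes q: "q \<in> Hom P F Q" and s: "\<And>a. a \<in> Ob C \<Longrightarrow> q a ` fob F a = fob Q a"
    and h: "h \<in> Hom P Q G" "h' \<in> Hom P Q G" "Comp P F Q G h q = Comp P F Q G h' q"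
  shows "h = h'"
proof (rule hom_eqI[OF h(1,2)])
  fix a z assume a: "a \<in> Ob C" and "z \<in> fob Q a"
  then obtain x where x: "z = q a x" "x \<in> fob F a" using s by blast
  then show "h a z = h' a z" using fun_cong[OF fun_cong[OF h(3)], of a x] a by simp
qed

text \<open>\<open>q : X \<rightarrow> Q\<close> is the pointwise quotient by the image of \<open>(\<sigma>, \<tau>) : R \<rightarrow> X \<times> X\<close>, which is
  thereby required to be an equivalence relation at each stage.\<close>

definition pointwise_quotient ::
  "('o, 'u) presheaf \<Rightarrow> ('o, 'u) presheaf \<Rightarrow> ('o \<Rightarrow> 'u \<Rightarrow> 'u) \<Rightarrow> ('o \<Rightarrow> 'u \<Rightarrow> 'u) \<Rightarrow> ('o, 'u) presheaf \<Rightarrow>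
    ('o \<Rightarrow> 'u \<Rightarrow> 'u) \<Rightarrow> bool" where
  "pointwise_quotient R X \<sigma> \<tau> Q q \<longleftrightarrow> R \<in> Ob P \<and> X \<in> Ob P \<and> Q \<in> Ob P \<and>
     \<sigma> \<in> Hom P R X \<and> \<tau> \<in> Hom P R X \<and> q \<in> Hom P X Q \<and>
     (\<forall>a\<in>Ob C. q a ` fob X a = fob Q a \<and>
       (\<forall>x\<in>fob X a. \<forall>y\<in>fob X a. q a x = q a y \<longleftrightarrow> (\<exists>w\<in>fob R a. \<sigma> a w = x \<and> \<tau> a w = y)))"

lemma quotient_presheaf:
  assumes X: "X \<in> Ob P" and eq: "\<And>a. a \<in> Ob C \<Longrightarrow> equiv (fob X a) (R a)"
    and st: "\<And>a b f x y. \<lbrakk>a \<in> Ob C; b \<in> Ob C; f \<in> Hom C a b; (x, y) \<in> R b\<rbrakk> \<Longrightarrow>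
      (fmap X b a f x, fmap X b a f y) \<in> R a"
  obtains Q q where "Q \<in> Ob P" "q \<in> Hom P X Q" "\<And>a. a \<in> Ob C \<Longrightarrow> q a ` fob X a = fob Q a"
    "\<And>a x y. \<lbrakk>a \<in> Ob C; x \<in> fob X a; y \<in> fob X a\<rbrakk> \<Longrightarrow> q a x = q a y \<longleftrightarrow> (x, y) \<in> R a"
proof -
  \<comment> \<open>Restriction of a class \<open>S\<close> along \<open>f\<close>: all its members
    are restricted and the result is saturated under \<open>R a\<close>. No representative is
    chosen, and the class of \<open>x\<close> is taken to the class of the restriction of
    \<open>x\<close>.\<close>
  let ?A = "\<lambda>b a f S. R a `` (fmap X b a f ` S)"
  have A: "?A b a f (R b `` {x}) = R a `` {fmap X b a f x}"
    if "a \<in> Ob C" "b \<in> Ob C" "f \<in> Hom C a b" "x \<in> fob X b" for a b f x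
  proof
    have Ra: "trans (R a)" "refl_on (fob X b) (R b)"
      using eq that unfolding equiv_def by blast+
    show "?A b a f (R b `` {x}) \<subseteq> R a `` {fmap X b a f x}"
    proof
      fix z assume "z \<in> ?A b a f (R b `` {x})"
      then obtain y where y: "(x, y) \<in> R b" "(fmap X b a f y, z) \<in> R a" by blast
      have "(fmap X b a f x, z) \<in> R a" by (rule transD[OF Ra(1) st[OF that(1-3) y(1)] y(2)])
      then show "z \<in> R a `` {fmap X b a f x}" by blast
    qed
    have "(x, x) \<in> R b" using Ra(2) that(4) by (rule refl_onD)
    then show "R a `` {fmap X b a f x} \<subseteq> ?A b a f (R b `` {x})" by blast
  qed
  have q: "\<exists>x\<in>fob X a. S = R a `` {x}" if "S \<in> fob X a // R a" for a S
    using that by (rule quotientE) blast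
  obtain Q e where Q: "Q \<in> Ob P" and e: "\<And>a. a \<in> Ob C \<Longrightarrow> bij_betw (e a) (fob X a // R a) (fob Q a)"
    and eA: "\<And>a b f S. \<lbrakk>a \<in> Ob C; b \<in> Ob C; f \<in> Hom C a b; S \<in> fob X b // R b\<rbrakk> \<Longrightarrow>
      fmap Q b a f (e b S) = e a (?A b a f S)"
  proof (rule realise[of "\<lambda>a. fob X a // R a" ?A])
    show "small TYPE('u) (fob X a // R a)" if "a \<in> Ob C" for a
    proof -
      have "fob X a // R a = (\<lambda>x. R a `` {x}) ` fob X a" unfolding quotient_def by blast
      then show ?thesis using small_fob[OF X that] by (simp add: small_image)
    qed
    show "?A b a f S \<in> fob X a // R a" if "a \<in> Ob C" "b \<in> Ob C" "f \<in> Hom C a b" and S: "S \<in> fob X b // R b" for a b f S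
    proof -
      obtain x where x: "x \<in> fob X b" "S = R b `` {x}" using q[OF S] by blast
      then show ?thesis unfolding x(2) A[OF that(1-3) x(1)]
        by (intro quotientI act_in[OF X that(3) x(1) that(1,2)])
    qed
    show "?A a a (idn C a) S = S" if "a \<in> Ob C" and S: "S \<in> fob X a // R a" for a S
    proof -
      obtain x where x: "x \<in> fob X a" "S = R a `` {x}" using q[OF S] by blast
      show ?thesis unfolding x(2) A[OF that(1,1) idn_in[OF that(1)] x(1)]
        using act_idn[OF X x(1) that(1)] by simp
    qed
    show "?A c a (Comp C a b c g f) S = ?A b a f (?A c b g S)"
      if o: "a \<in> Ob C" "b \<in> Ob C" "c \<in> Ob C" and fg: "f \<in> Hom C a b" "g \<in> Hom C b c"
      and S: "S \<in> fob X c // R c" for a b c f g S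
    proof -
      obtain x where x: "x \<in> fob X c" "S = R c `` {x}" using q[OF S] by blast
      show ?thesis
        unfolding x(2) A[OF o(1,3) Comp_in[OF fg o] x(1)] A[OF o(2,3) fg(2) x(1)]
          A[OF o(1,2) fg(1) act_in[OF X fg(2) x(1) o(2,3)]]
        using act_Comp[OF X fg x(1) o] by simp
    qed
  qed blast
  define q where "q = mk_hom X (\<lambda>a x. e a (R a `` {x}))"
  have qa: "q a x = e a (R a `` {x})" if "a \<in> Ob C" "x \<in> fob X a" for a x
    using that by (simp add: q_def)
  have qin: "q \<in> Hom P X Q"
    unfolding q_def
  proof (rule mk_hom[OF X])
    show "e a (R a `` {x}) \<in> fob Q a" if "a \<in> Ob C" "x \<in> fob X a" for a x
      using bij_betwE[OF e[OF that(1)]] quotientI[OF that(2)] by blast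
    show "e a (R a `` {fmap X b a f x}) = fmap Q b a f (e b (R b `` {x}))"
      if "a \<in> Ob C" "b \<in> Ob C" "f \<in> Hom C a b" "x \<in> fob X b" for a b f x
      using eA[OF that(1-3) quotientI[OF that(4)]] A[OF that] by simp
  qed
  have "q a ` fob X a = fob Q a" if "a \<in> Ob C" for a
  proof -
    have "fob Q a = e a ` (fob X a // R a)" using e[OF that] by (simp add: bij_betw_def)
    also have "\<dots> = (\<lambda>x. e a (R a `` {x})) ` fob X a" unfolding quotient_def by blast
    finally show ?thesis using qa[OF that] by (auto intro!: image_cong)
  qed
  moreover have "q a x = q a y \<longleftrightarrow> (x, y) \<in> R a"
    if "a \<in> Ob C" "x \<in> fob X a" "y \<in> fob X a" for a x y
  proof -
    have "q a x = q a y \<longleftrightarrow> R a `` {x} = R a `` {y}"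
      unfolding qa[OF that(1,2)] qa[OF that(1,3)]
      by (rule inj_on_eq_iff[OF bij_betw_imp_inj_on[OF e[OF that(1)]] quotientI[OF that(2)] quotientI[OF that(3)]])
    also have "\<dots> \<longleftrightarrow> (x, y) \<in> R a" using eq_equiv_class_iff[OF eq[OF that(1)] that(2,3)] .
    finally show ?thesis .
  qed
  ultimately show ?thesis using that[OF Q qin] by blast
qed

lemma pointwise_quotient_ex:
  assumes R: "R \<in> Ob P" and X: "X \<in> Ob P" and \<sigma>: "\<sigma> \<in> Hom P R X" and \<tau>: "\<tau> \<in> Hom P R X"
    and eq: "\<And>a. a \<in> Ob C \<Longrightarrow> equiv (fob X a) ((\<lambda>w. (\<sigma> a w, \<tau> a w)) ` fob R a)"
  obtains Q q where "pointwise_quotient R X \<sigma> \<tau> Q q"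
proof -
  let ?R = "\<lambda>a. (\<lambda>w. (\<sigma> a w, \<tau> a w)) ` fob R a"
  have st: "(fmap X b a f x, fmap X b a f y) \<in> ?R a"
    if "a \<in> Ob C" "b \<in> Ob C" "f \<in> Hom C a b" "(x, y) \<in> ?R b" for a b f x y
  proof -
    obtain w where w: "w \<in> fob R b" "x = \<sigma> b w" "y = \<tau> b w" using \<open>(x, y) \<in> ?R b\<close> by auto
    have "(fmap X b a f x, fmap X b a f y) = (\<sigma> a (fmap R b a f w), \<tau> a (fmap R b a f w))"
      using that(1-3) w hom_act[OF \<sigma>] hom_act[OF \<tau>] by simp
    then show ?thesis by (rule image_eqI) (use w that R in simp)
  qed
  show ?thesis
  proof (rule quotient_presheaf[OF X eq st])
    fix Q q assume "Q \<in> Ob P" "q \<in> Hom P X Q" "\<And>a. a \<in> Ob C \<Longrightarrow> q a ` fob X a = fob Q a"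
      "\<And>a x y. \<lbrakk>a \<in> Ob C; x \<in> fob X a; y \<in> fob X a\<rbrakk> \<Longrightarrow> q a x = q a y \<longleftrightarrow> (x, y) \<in> ?R a"
    then have "pointwise_quotient R X \<sigma> \<tau> Q q"
      unfolding pointwise_quotient_def using R X \<sigma> \<tau> by (auto simp: image_iff)
    then show ?thesis by (rule that)
  qed
qed

subsection \<open>Pointwise limits and quotients\<close>

text \<open>The points of the limit of the sets \<open>D j a\<close>; values outside
  \<open>Ob J\<close> are left free.\<close>

definition compatible ::
  "('j, 'i) cat \<Rightarrow> ('j, 'i, ('o, 'u) presheaf, 'o \<Rightarrow> 'u \<Rightarrow> 'u) ftor \<Rightarrow> 'o \<Rightarrow> ('j \<Rightarrow> 'u) \<Rightarrow> bool" where
  "compatible J D a y \<longleftrightarrow> (\<forall>j\<in>Ob J. y j \<in> fob (fob D j) a) \<and>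
     (\<forall>i\<in>Ob J. \<forall>j\<in>Ob J. \<forall>u\<in>Hom J i j. fmap D i j u a (y i) = y j)"

text \<open>Evaluation at \<open>a\<close> turns \<open>F\<close> into a limit of sets. That
  \<open>\<pi>\<close> is a cone is stated separately where this is used.\<close>

definition pointwise_limit ::
  "('j, 'i) cat \<Rightarrow> ('j, 'i, ('o, 'u) presheaf, 'o \<Rightarrow> 'u \<Rightarrow> 'u) ftor \<Rightarrow> ('o, 'u) presheaf \<Rightarrow>
    ('j \<Rightarrow> 'o \<Rightarrow> 'u \<Rightarrow> 'u) \<Rightarrow> bool" where
  "pointwise_limit J D F \<pi> \<longleftrightarrow> (\<forall>a\<in>Ob C.
     (\<forall>y. compatible J D a y \<longrightarrow> (\<exists>x\<in>fob F a. \<forall>j\<in>Ob J. \<pi> j a x = y j)) \<and>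
     (\<forall>x\<in>fob F a. \<forall>x'\<in>fob F a. (\<forall>j\<in>Ob J. \<pi> j a x = \<pi> j a x') \<longrightarrow> x = x'))"

lemma pointwise_limit_imp_limit:
  assumes S: "S \<subseteq> Ob P" and D: "is_functor J (full_subcat P S) D"
    and c: "is_cone J (full_subcat P S) D F \<pi>" and p: "pointwise_limit J D F \<pi>"
  shows "is_limit J (full_subcat P S) D F \<pi>"
proof (rule is_limitI)
  have F: "F \<in> Ob P" using c S by (auto simp: is_cone_def)
  have Dj: "fob D j \<in> Ob P" if "j \<in> Ob J" for j
    using functor_ob[OF D that] S by auto
  have \<pi>: "\<pi> j \<in> Hom P F (fob D j)" if "j \<in> Ob J" for j
    using c that by (simp add: is_cone_def)
  fix G \<tau> assume G: "is_cone J (full_subcat P S) D G \<tau>"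
  then have GO: "G \<in> Ob P" using S by (auto simp: is_cone_def)
  have \<tau>: "\<tau> j \<in> Hom P G (fob D j)" if "j \<in> Ob J" for j
    using G that by (simp add: is_cone_def)
  have "compatible J D a (\<lambda>j. \<tau> j a x)" if ax: "a \<in> Ob C" "x \<in> fob G a" for a x
    unfolding compatible_def
  proof (intro conjI ballI)
    fix i j u assume ij: "i \<in> Ob J" "j \<in> Ob J" "u \<in> Hom J i j"
    then have "Comp P G (fob D i) (fob D j) (fmap D i j u) (\<tau> i) = \<tau> j"
      using G by (simp add: is_cone_def)
    from fun_cong[OF fun_cong[OF this], of a x] show "fmap D i j u a (\<tau> i a x) = \<tau> j a x"
      using ax by simp
  qed (rule hom_in[OF \<tau> ax])
  then have "\<forall>a x. \<exists>z. a \<in> Ob C \<and> x \<in> fob G a \<longrightarrow> z \<in> fob F a \<and> (\<forall>j\<in>Ob J. \<pi> j a z = \<tau> j a x)"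
    using p unfolding pointwise_limit_def by blast
  then obtain t where t: "\<And>a x. \<lbrakk>a \<in> Ob C; x \<in> fob G a\<rbrakk> \<Longrightarrow> t a x \<in> fob F a"
    and \<pi>t: "\<And>a x j. \<lbrakk>a \<in> Ob C; x \<in> fob G a; j \<in> Ob J\<rbrakk> \<Longrightarrow> \<pi> j a (t a x) = \<tau> j a x"
    by metis
  have h: "mk_hom G t \<in> Hom P G F"
  proof (rule mk_hom[OF GO])
    show "t a (fmap G b a f x) = fmap F b a f (t b x)"
      if o: "a \<in> Ob C" "b \<in> Ob C" "f \<in> Hom C a b" "x \<in> fob G b" for a b f x
    proof -
      have 1: "fmap G b a f x \<in> fob G a" using o GO by simp
      have "\<pi> j a (t a (fmap G b a f x)) = \<pi> j a (fmap F b a f (t b x))" if j: "j \<in> Ob J" for j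
        using \<pi>t[OF o(1) 1 j] \<pi>t[OF o(2,4) j] hom_act[OF \<pi>[OF j] o(3) t[OF o(2,4)] o(1,2)]
          hom_act[OF \<tau>[OF j] o(3,4,1,2)] by simp
      moreover have "t a (fmap G b a f x) \<in> fob F a" "fmap F b a f (t b x) \<in> fob F a"
        using o t 1 F by auto
      ultimately show ?thesis using p o(1) unfolding pointwise_limit_def by blast
    qed
  qed (use t in simp)
  have "Comp P G F (fob D j) (\<pi> j) (mk_hom G t) = \<tau> j" if j: "j \<in> Ob J" for j
    by (rule hom_eqI[OF psh_Comp_in[OF h \<pi>[OF j] GO] \<tau>[OF j]]) (use \<pi>t j in simp)
  then show "\<exists>h\<in>Hom (full_subcat P S) G F. \<forall>j\<in>Ob J. Comp (full_subcat P S) G F (fob D j) (\<pi> j) h = \<tau> j"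
    using h by auto
next
  have F: "F \<in> Ob P" using c S by (auto simp: is_cone_def)
  fix G h h' assume "G \<in> Ob (full_subcat P S)" and h: "h \<in> Hom (full_subcat P S) G F" "h' \<in> Hom (full_subcat P S) G F"
    and eq: "\<forall>j\<in>Ob J. Comp (full_subcat P S) G F (fob D j) (\<pi> j) h = Comp (full_subcat P S) G F (fob D j) (\<pi> j) h'"
  have h': "h \<in> Hom P G F" "h' \<in> Hom P G F" using h by simp_all
  show "h = h'"
  proof (rule hom_eqI[OF h'])
    fix a x assume ax: "a \<in> Ob C" "x \<in> fob G a"
    have "\<pi> j a (h a x) = \<pi> j a (h' a x)" if "j \<in> Ob J" for j
    proof -
      have "Comp P G F (fob D j) (\<pi> j) h = Comp P G F (fob D j) (\<pi> j) h'" using eq that by simp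
      from fun_cong[OF fun_cong[OF this], of a x] show ?thesis using ax by simp
    qed
    then show "h a x = h' a x"
      using p ax hom_in[OF h'(1) ax] hom_in[OF h'(2) ax] unfolding pointwise_limit_def by blast
  qed
qed (fact c)

text \<open>By the Yoneda lemma a compatible family at \<open>a\<close> is a cone with vertex
  \<open>W a\<close>, and elements of \<open>F a\<close> are arrows
  \<open>W a \<rightarrow> F\<close>. As \<open>S\<close> contains the representables, such cones
  can be tested inside the subcategory, whatever else \<open>S\<close> consists of.\<close>

lemma limit_imp_pointwise_limit:
  assumes S: "S \<subseteq> Ob P" "W ` Ob C \<subseteq> S" and D: "is_functor J (full_subcat P S) D"
    and l: "is_limit J (full_subcat P S) D F \<pi>"
  shows "pointwise_limit J D F \<pi>"
  unfolding pointwise_limit_def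
proof (intro ballI conjI allI impI)
  interpret S: cat_base "full_subcat P S"
    by unfold_locales (rule category_full_subcat[OF category_psh S(1)])
  have c: "is_cone J (full_subcat P S) D F \<pi>" using l by (rule is_limit_cone)
  have F: "F \<in> Ob P" using c S by (auto simp: is_cone_def)
  have Dj: "fob D j \<in> Ob P" if "j \<in> Ob J" for j
    using functor_ob[OF D that] S by auto
  have \<pi>: "\<pi> j \<in> Hom P F (fob D j)" if "j \<in> Ob J" for j
    using c that by (simp add: is_cone_def)
  fix a assume a: "a \<in> Ob C"
  have Wa: "W a \<in> S" using a S by blast
  {
    fix y assume y: "compatible J D a y"
    have yj: "y j \<in> fob (fob D j) a" if "j \<in> Ob J" for j using y that by (simp add: compatible_def)
    have "is_cone J (full_subcat P S) D (W a) (\<lambda>j. yel (fob D j) a (y j))"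
      unfolding is_cone_def
    proof (intro conjI ballI)
      fix i j u assume ij: "i \<in> Ob J" "j \<in> Ob J" "u \<in> Hom J i j"
      have u: "fmap D i j u \<in> Hom P (fob D i) (fob D j)" using functor_hom[OF D ij(3,1,2)] by simp
      note yi = yel_in[OF Dj[OF ij(1)] a yj[OF ij(1)]] and yj' = yel_in[OF Dj[OF ij(2)] a yj[OF ij(2)]]
      have "Comp P (W a) (fob D i) (fob D j) (fmap D i j u) (yel (fob D i) a (y i)) = yel (fob D j) a (y j)"
      proof (rule hom_eqI[OF psh_Comp_in[OF yi u W_Ob[OF a]] yj'])
        fix b f assume b: "b \<in> Ob C" "f \<in> fob (W a) b"
        have "fmap D i j u a (y i) = y j" using y ij by (simp add: compatible_def)
        then show "Comp P (W a) (fob D i) (fob D j) (fmap D i j u) (yel (fob D i) a (y i)) b f = yel (fob D j) a (y j) b f"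
          using b hom_act[OF u, of f b a "y i"] yj[OF ij(1)] a by simp
      qed
      then show "Comp (full_subcat P S) (W a) (fob D i) (fob D j) (fmap D i j u) (yel (fob D i) a (y i)) = yel (fob D j) a (y j)"
        by simp
    qed (use Wa Dj yj a in auto)
    from is_limit_ex[OF l this] obtain h where h: "h \<in> Hom P (W a) F"
      "\<forall>j\<in>Ob J. Comp P (W a) F (fob D j) (\<pi> j) h = yel (fob D j) a (y j)" by auto
    have "\<pi> j a (h a (idn C a)) = y j" if j: "j \<in> Ob J" for j
      using fun_cong[OF fun_cong[OF bspec[OF h(2) j]], of a "idn C a"] a yj[OF j] Dj[OF j] by simp
    moreover have "h a (idn C a) \<in> fob F a" using h(1) a by simp
    ultimately show "\<exists>x\<in>fob F a. \<forall>j\<in>Ob J. \<pi> j a x = y j" by blast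
  }
  fix x x' assume x: "x \<in> fob F a" "x' \<in> fob F a" and eq: "\<forall>j\<in>Ob J. \<pi> j a x = \<pi> j a x'"
  have "yel F a x = yel F a x'"
  proof (rule S.is_limit_uniq[OF D l])
    show "\<forall>j\<in>Ob J. Comp (full_subcat P S) (W a) F (fob D j) (\<pi> j) (yel F a x)
      = Comp (full_subcat P S) (W a) F (fob D j) (\<pi> j) (yel F a x')"
    proof
      fix j assume j: "j \<in> Ob J"
      have "Comp P (W a) F (fob D j) (\<pi> j) (yel F a x) = Comp P (W a) F (fob D j) (\<pi> j) (yel F a x')"
        by (rule hom_eqI[of _ "W a" "fob D j"])
          (use j a x F \<pi> eq hom_act[OF \<pi>[OF j]] in \<open>auto intro!: psh_Comp_in[of _ _ F]\<close>)
      then show "Comp (full_subcat P S) (W a) F (fob D j) (\<pi> j) (yel F a x)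
        = Comp (full_subcat P S) (W a) F (fob D j) (\<pi> j) (yel F a x')" by simp
    qed
  qed (use F a x Wa in auto)
  then have "yel F a x a (idn C a) = yel F a x' a (idn C a)" by simp
  then show "x = x'" using F a x by simp
qed

text \<open>The defining condition of an equivalence relation at the object \<open>W a\<close> of
  the subcategory, read through the bijection between elements at \<open>a\<close> and arrows out of
  \<open>W a\<close>.\<close>

lemma eqrel_imp_pointwise:
  assumes S: "S \<subseteq> Ob P" "W ` Ob C \<subseteq> S" and e: "equivalence_relation (full_subcat P S) R X \<sigma> \<tau>"
    and a: "a \<in> Ob C"
  shows "inj_on (\<lambda>w. (\<sigma> a w, \<tau> a w)) (fob R a)"
    and "equiv (fob X a) ((\<lambda>w. (\<sigma> a w, \<tau> a w)) ` fob R a)"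
proof -
  have RX: "R \<in> S" "X \<in> S" "\<sigma> \<in> Hom P R X" "\<tau> \<in> Hom P R X"
    using e by (auto simp: equivalence_relation_def)
  then have RXP: "R \<in> Ob P" "X \<in> Ob P" using S by auto
  let ?f = "\<lambda>h. (Comp P (W a) R X \<sigma> h, Comp P (W a) R X \<tau> h)"
  let ?ev = "\<lambda>h. h a (idn C a)"
  have Wa: "W a \<in> S" using a S by blast
  then have inj: "inj_on ?f (Hom P (W a) R)" and eq: "equiv (Hom P (W a) X) (?f ` Hom P (W a) R)"
    using e by (simp_all add: equivalence_relation_def)
  have ev: "yel F a (?ev h) = h" if "h \<in> Hom P (W a) F" "F \<in> Ob P" for h F
    by (rule hom_eqI[of _ "W a" F]) (use that a in \<open>auto simp flip: yoneda_lemma[OF that(1) a]\<close>)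
  have cy: "Comp P (W a) R X \<rho> (yel R a w) = yel X a (\<rho> a w)"
    if "w \<in> fob R a" "\<rho> \<in> Hom P R X" for \<rho> w
    by (rule hom_eqI[of _ "W a" X])
      (use that a RXP hom_act[OF that(2)] in \<open>auto intro!: psh_Comp_in[of _ _ R]\<close>)
  show "inj_on (\<lambda>w. (\<sigma> a w, \<tau> a w)) (fob R a)"
  proof (rule inj_onI)
    fix w w' assume w: "w \<in> fob R a" "w' \<in> fob R a" "(\<sigma> a w, \<tau> a w) = (\<sigma> a w', \<tau> a w')"
    then have "?f (yel R a w) = ?f (yel R a w')" using cy RX by simp
    then have "yel R a w = yel R a w'" using inj w a RXP by (simp add: inj_on_def)
    then have "?ev (yel R a w) = ?ev (yel R a w')" by simp
    then show "w = w'" using w a RXP by simp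
  qed
  let ?E = "(\<lambda>w. (\<sigma> a w, \<tau> a w)) ` fob R a" and ?H = "?f ` Hom P (W a) R"
  have E: "(x, y) \<in> ?E \<longleftrightarrow> (yel X a x, yel X a y) \<in> ?H" if "x \<in> fob X a" "y \<in> fob X a" for x y
  proof
    assume "(x, y) \<in> ?E"
    then obtain w where w: "w \<in> fob R a" "x = \<sigma> a w" "y = \<tau> a w" by auto
    have "(yel X a x, yel X a y) = ?f (yel R a w)" using w cy RX by simp
    then show "(yel X a x, yel X a y) \<in> ?H"
      by (rule image_eqI[of _ ?f "yel R a w"]) (use w RXP a in simp)
  next
    assume "(yel X a x, yel X a y) \<in> ?H"
    then obtain h where h: "h \<in> Hom P (W a) R" "yel X a x = Comp P (W a) R X \<sigma> h"
      "yel X a y = Comp P (W a) R X \<tau> h" by blast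
    have "(x, y) = (\<sigma> a (?ev h), \<tau> a (?ev h))"
      using fun_cong[OF fun_cong[OF h(2)], of a "idn C a"] fun_cong[OF fun_cong[OF h(3)], of a "idn C a"]
        that a RXP by simp
    then show "(x, y) \<in> ?E"
      by (rule image_eqI[of _ "\<lambda>w. (\<sigma> a w, \<tau> a w)" "?ev h"]) (use h a in simp)
  qed
  have sub: "?E \<subseteq> fob X a \<times> fob X a" using RX a by auto
  show "equiv (fob X a) ?E"
  proof (rule equivI[OF sub])
    show "refl_on (fob X a) ?E"
    proof (rule refl_onI)
      fix x assume x: "x \<in> fob X a"
      have "(yel X a x, yel X a x) \<in> ?H"
        using eq yel_in[OF RXP(2) a x] unfolding equiv_def by (meson refl_onD)
      then show "(x, x) \<in> ?E" using E[OF x x] by blast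
    qed
    show "sym ?E"
    proof (rule symI)
      fix x y assume xy: "(x, y) \<in> ?E"
      then have o: "x \<in> fob X a" "y \<in> fob X a" using sub by blast+
      have "(yel X a y, yel X a x) \<in> ?H"
        using eq E[OF o] xy unfolding equiv_def by (meson symD)
      then show "(y, x) \<in> ?E" using E[OF o(2,1)] by blast
    qed
    show "trans ?E"
    proof (rule transI)
      fix x y z assume xy: "(x, y) \<in> ?E" and yz: "(y, z) \<in> ?E"
      then have o: "x \<in> fob X a" "y \<in> fob X a" "z \<in> fob X a" using sub by blast+
      have "(yel X a x, yel X a z) \<in> ?H"
        using eq E[OF o(1,2)] xy E[OF o(2,3)] yz unfolding equiv_def by (meson transD)
      then show "(x, z) \<in> ?E" using E[OF o(1,3)] by blast
    qed
  qed
qed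

lemma pointwise_quotient_coequaliser:
  assumes q: "pointwise_quotient R X \<sigma> \<tau> Q q" and S: "R \<in> S" "X \<in> S" "Q \<in> S" "S \<subseteq> Ob P"
  shows "is_coequaliser (full_subcat P S) R X \<sigma> \<tau> Q q"
proof (rule is_coequaliserI)
  have i: "R \<in> Ob P" "X \<in> Ob P" "Q \<in> Ob P" "\<sigma> \<in> Hom P R X" "\<tau> \<in> Hom P R X" "q \<in> Hom P X Q"
    and s: "\<And>a. a \<in> Ob C \<Longrightarrow> q a ` fob X a = fob Q a"
    and k: "\<And>a x y. \<lbrakk>a \<in> Ob C; x \<in> fob X a; y \<in> fob X a\<rbrakk> \<Longrightarrow> q a x = q a y \<longleftrightarrow> (\<exists>w\<in>fob R a. \<sigma> a w = x \<and> \<tau> a w = y)"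
    using q unfolding pointwise_quotient_def by blast+
  show "\<sigma> \<in> Hom (full_subcat P S) R X" "\<tau> \<in> Hom (full_subcat P S) R X" "q \<in> Hom (full_subcat P S) X Q"
    using i by auto
  have "Comp P R X Q q \<sigma> = Comp P R X Q q \<tau>"
    by (rule hom_eqI[of _ R Q]) (use i in \<open>auto intro!: psh_Comp_in[of _ _ X] iffD2[OF k]\<close>)
  then show "Comp (full_subcat P S) R X Q q \<sigma> = Comp (full_subcat P S) R X Q q \<tau>" by simp
  fix G assume "G \<in> Ob (full_subcat P S)"
  {
    fix \<beta> assume \<beta>: "\<beta> \<in> Hom (full_subcat P S) X G"
      and eq: "Comp (full_subcat P S) R X G \<beta> \<sigma> = Comp (full_subcat P S) R X G \<beta> \<tau>"
    then have \<beta>': "\<beta> \<in> Hom P X G" and eq': "Comp P R X G \<beta> \<sigma> = Comp P R X G \<beta> \<tau>" by simp_all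
    have "\<beta> a x = \<beta> a y" if "a \<in> Ob C" "x \<in> fob X a" "y \<in> fob X a" and qe: "q a x = q a y" for a x y
    proof -
      obtain w where "w \<in> fob R a" "\<sigma> a w = x" "\<tau> a w = y"
        using iffD1[OF k qe] \<open>a \<in> Ob C\<close> \<open>x \<in> fob X a\<close> \<open>y \<in> fob X a\<close> by blast
      then show ?thesis using fun_cong[OF fun_cong[OF eq'], of a w] that by simp
    qed
    then obtain h where "h \<in> Hom P Q G" "Comp P X Q G h q = \<beta>"
      using factor_surj[OF i(6,2,3) s \<beta>'] by metis
    then show "\<exists>h\<in>Hom (full_subcat P S) Q G. Comp (full_subcat P S) X Q G h q = \<beta>" by auto
  }
  fix h h' assume "h \<in> Hom (full_subcat P S) Q G" "h' \<in> Hom (full_subcat P S) Q G"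
    "Comp (full_subcat P S) X Q G h q = Comp (full_subcat P S) X Q G h' q"
  then show "h = h'" using surj_epi[OF i(6) s] by simp
qed (use S in auto)

subsection \<open>Small presheaves\<close>

lemma compose_eq_iff: "compose A g f = compose A g' f' \<longleftrightarrow> (\<forall>x\<in>A. g (f x) = g' (f' x))"
  by (auto simp: compose_def fun_eq_iff restrict_def split: if_splits)

lemma compose_restrict_id_eq:
  "\<theta> \<in> extensional A \<Longrightarrow> compose A g (\<lambda>x\<in>A. x) = \<theta> \<longleftrightarrow> (\<forall>x\<in>A. g x = \<theta> x)"
  by (auto simp: compose_def fun_eq_iff restrict_def extensional_def split: if_splits)

text \<open>Along a full inclusion, with identities as unit, the Kan extension property says that a
  family natural on \<open>B\<close> extends uniquely to all of \<open>F\<close>. Existence and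
  uniqueness are separated here, and \<open>\<theta>\<close> is freed from the extensionality that
  arrows of \<open>set_cat\<close> carry.\<close>

lemma small_presheaf_iff:
  "small_presheaf C F \<longleftrightarrow> F \<in> Ob P \<and> (\<exists>B \<subseteq> Ob C. small TYPE('u) B \<and>
    (\<forall>G\<in>Ob P. \<forall>\<theta>. (\<forall>b\<in>B. \<forall>y\<in>fob F b. \<theta> b y \<in> fob G b) \<longrightarrow>
       (\<forall>b\<in>B. \<forall>b'\<in>B. \<forall>f\<in>Hom C b b'. \<forall>y\<in>fob F b'. \<theta> b (fmap F b' b f y) = fmap G b' b f (\<theta> b' y)) \<longrightarrow>
       (\<exists>\<alpha>\<in>Hom P F G. \<forall>b\<in>B. \<forall>y\<in>fob F b. \<alpha> b y = \<theta> b y)) \<and>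
    (\<forall>G\<in>Ob P. \<forall>\<alpha>\<in>Hom P F G. \<forall>\<alpha>'\<in>Hom P F G. (\<forall>b\<in>B. \<forall>y\<in>fob F b. \<alpha> b y = \<alpha>' b y) \<longrightarrow> \<alpha> = \<alpha>'))"
    (is "_ \<longleftrightarrow> _ \<and> (\<exists>B \<subseteq> Ob C. _ \<and> ?ex B \<and> ?un B)")
proof -
  have "is_left_kan_extension (full_subcat (op_cat C) B) (op_cat C) set_cat
          inclusion_functor (fcomp F inclusion_functor) F (\<lambda>b. idn set_cat (fob F b)) \<longleftrightarrow> ?ex B \<and> ?un B"
    (is "?kan \<longleftrightarrow> _") if B: "B \<subseteq> Ob C" and F: "F \<in> Ob P" for B
  proof -
    let ?B = "full_subcat (op_cat C) B" and ?I = "inclusion_functor :: ('o, 'u, 'o, 'u) ftor"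
    have I: "is_functor ?B (op_cat C) ?I"
      using B by (auto simp: is_functor_def inclusion_functor_def)
    have Pf: "G \<in> Ob P \<longleftrightarrow> is_functor (op_cat C) set_cat G" for G
      by (simp add: psh_def fun_cat_def)
    have FI: "is_functor ?B set_cat (fcomp F ?I)" using is_functor_fcomp[OF I] F Pf by blast
    have fI: "fob (fcomp G ?I) b = fob G b" "fmap (fcomp G ?I) b b' f = fmap G b b' f" for G :: "('o, 'u) presheaf" and b b' f
      by (simp_all add: inclusion_functor_def)
    have Io: "fob ?I b = b" for b by (simp add: inclusion_functor_def)
    have FE: "fmap F b' b f \<in> fob F b' \<rightarrow>\<^sub>E fob F b" if "b \<in> B" "b' \<in> B" "f \<in> Hom C b b'" for b b' f
      using act_PiE[OF F] that B by blast
    have nid: "nat_trans ?B set_cat (fcomp F ?I) (fcomp F ?I) (\<lambda>b. idn set_cat (fob F b))"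
      unfolding nat_trans_def fI using FE by (auto simp: compose_eq_iff dest: PiE_mem)
    have nt: "nat_trans ?B set_cat (fcomp F ?I) (fcomp G ?I) \<theta> \<longleftrightarrow> (\<forall>b\<in>B. \<theta> b \<in> fob F b \<rightarrow>\<^sub>E fob G b) \<and>
      (\<forall>b\<in>B. \<forall>b'\<in>B. \<forall>f\<in>Hom C b b'. \<forall>y\<in>fob F b'. \<theta> b (fmap F b' b f y) = fmap G b' b f (\<theta> b' y))" for G \<theta>
      unfolding nat_trans_def fI by (simp add: compose_eq_iff) blast
    have ev: "(\<forall>b\<in>B. Comp set_cat (fob F b) (fob F b) (fob G b) (\<alpha> b) (idn set_cat (fob F b)) = \<theta> b) \<longleftrightarrow>
       (\<forall>b\<in>B. \<forall>y\<in>fob F b. \<alpha> b y = \<theta> b y)" if "\<forall>b\<in>B. \<theta> b \<in> fob F b \<rightarrow>\<^sub>E fob G b" for G :: "('o, 'u) presheaf" and \<alpha> \<theta>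
      using that by (simp add: compose_restrict_id_eq PiE_iff)
    have "?kan \<longleftrightarrow> (\<forall>G \<theta>. G \<in> Ob P \<longrightarrow> nat_trans ?B set_cat (fcomp F ?I) (fcomp G ?I) \<theta> \<longrightarrow>
        (\<exists>!\<alpha>. \<alpha> \<in> Hom P F G \<and> (\<forall>b\<in>B. Comp set_cat (fob F b) (fob F b) (fob G b) (\<alpha> b) (idn set_cat (fob F b)) = \<theta> b)))"
      unfolding is_left_kan_extension_def
      using I FI F nid by (simp add: Pf fI Io flip: psh_def)
    also have "\<dots> \<longleftrightarrow> (\<forall>G \<theta>. G \<in> Ob P \<longrightarrow> nat_trans ?B set_cat (fcomp F ?I) (fcomp G ?I) \<theta> \<longrightarrow>
        (\<exists>!\<alpha>. \<alpha> \<in> Hom P F G \<and> (\<forall>b\<in>B. \<forall>y\<in>fob F b. \<alpha> b y = \<theta> b y)))"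
    proof (intro iff_allI imp_cong refl)
      fix G \<theta> assume "nat_trans ?B set_cat (fcomp F ?I) (fcomp G ?I) \<theta>"
      then have *: "\<forall>b\<in>B. \<theta> b \<in> fob F b \<rightarrow>\<^sub>E fob G b" unfolding nt by blast
      show "(\<exists>!\<alpha>. \<alpha> \<in> Hom P F G \<and> (\<forall>b\<in>B. Comp set_cat (fob F b) (fob F b) (fob G b) (\<alpha> b) (idn set_cat (fob F b)) = \<theta> b))
        \<longleftrightarrow> (\<exists>!\<alpha>. \<alpha> \<in> Hom P F G \<and> (\<forall>b\<in>B. \<forall>y\<in>fob F b. \<alpha> b y = \<theta> b y))"
        unfolding ev[OF *] by (rule refl)
    qed
    also have "\<dots> \<longleftrightarrow> ?ex B \<and> ?un B"
    proof (intro iffI conjI ballI allI impI)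
      fix G \<theta> assume L: "\<forall>G \<theta>. G \<in> Ob P \<longrightarrow> nat_trans ?B set_cat (fcomp F ?I) (fcomp G ?I) \<theta> \<longrightarrow>
        (\<exists>!\<alpha>. \<alpha> \<in> Hom P F G \<and> (\<forall>b\<in>B. \<forall>y\<in>fob F b. \<alpha> b y = \<theta> b y))"
      and G: "G \<in> Ob P" and \<theta>: "\<forall>b\<in>B. \<forall>y\<in>fob F b. \<theta> b y \<in> fob G b"
      and n: "\<forall>b\<in>B. \<forall>b'\<in>B. \<forall>f\<in>Hom C b b'. \<forall>y\<in>fob F b'. \<theta> b (fmap F b' b f y) = fmap G b' b f (\<theta> b' y)"
      have "nat_trans ?B set_cat (fcomp F ?I) (fcomp G ?I) (\<lambda>b. restrict (\<theta> b) (fob F b))"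
        unfolding nt
      proof (intro conjI ballI)
        show "restrict (\<theta> b) (fob F b) \<in> fob F b \<rightarrow>\<^sub>E fob G b" if "b \<in> B" for b using \<theta> that by auto
        fix b b' f y assume *: "b \<in> B" "b' \<in> B" "f \<in> Hom C b b'" "y \<in> fob F b'"
        then show "restrict (\<theta> b) (fob F b) (fmap F b' b f y) = fmap G b' b f (restrict (\<theta> b') (fob F b') y)"
          using n PiE_mem[OF FE[OF *(1-3)] *(4)] by simp
      qed
      from ex1_implies_ex[OF L[rule_format, OF G this]]
      show "\<exists>\<alpha>\<in>Hom P F G. \<forall>b\<in>B. \<forall>y\<in>fob F b. \<alpha> b y = \<theta> b y" by auto
    next
      fix G \<alpha> \<alpha>' assume L: "\<forall>G \<theta>. G \<in> Ob P \<longrightarrow> nat_trans ?B set_cat (fcomp F ?I) (fcomp G ?I) \<theta> \<longrightarrow>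
        (\<exists>!\<alpha>. \<alpha> \<in> Hom P F G \<and> (\<forall>b\<in>B. \<forall>y\<in>fob F b. \<alpha> b y = \<theta> b y))"
      and G: "G \<in> Ob P" and \<alpha>: "\<alpha> \<in> Hom P F G" "\<alpha>' \<in> Hom P F G" "\<forall>b\<in>B. \<forall>y\<in>fob F b. \<alpha> b y = \<alpha>' b y"
      have "nat_trans ?B set_cat (fcomp F ?I) (fcomp G ?I) \<alpha>'"
        unfolding nt using subsetD[OF B] by (intro conjI ballI hom_PiE[OF \<alpha>(2)] hom_act[OF \<alpha>(2)])
      from ex1_implies_ex[OF L[rule_format, OF G this]] L[rule_format, OF G this]
      show "\<alpha> = \<alpha>'" using \<alpha> by blast
    next
      fix G \<theta> assume R: "?ex B \<and> ?un B" and G: "G \<in> Ob P"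
        and \<theta>: "nat_trans ?B set_cat (fcomp F ?I) (fcomp G ?I) \<theta>"
      have 1: "\<forall>b\<in>B. \<forall>y\<in>fob F b. \<theta> b y \<in> fob G b" using \<theta> unfolding nt by auto
      have 2: "\<forall>b\<in>B. \<forall>b'\<in>B. \<forall>f\<in>Hom C b b'. \<forall>y\<in>fob F b'. \<theta> b (fmap F b' b f y) = fmap G b' b f (\<theta> b' y)"
        using \<theta> unfolding nt by blast
      obtain \<alpha> where \<alpha>: "\<alpha> \<in> Hom P F G" "\<forall>b\<in>B. \<forall>y\<in>fob F b. \<alpha> b y = \<theta> b y"
        by (rule bexE[OF spec[OF bspec[OF conjunct1[OF R] G], THEN mp, THEN mp, OF 1 2]])
      have un: "\<forall>\<alpha>\<in>Hom P F G. \<forall>\<alpha>'\<in>Hom P F G. (\<forall>b\<in>B. \<forall>y\<in>fob F b. \<alpha> b y = \<alpha>' b y) \<longrightarrow> \<alpha> = \<alpha>'"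
        by (rule bspec[OF conjunct2[OF R] G])
      show "\<exists>!\<alpha>. \<alpha> \<in> Hom P F G \<and> (\<forall>b\<in>B. \<forall>y\<in>fob F b. \<alpha> b y = \<theta> b y)"
      proof (rule ex1I[of _ \<alpha>])
        fix \<alpha>' assume \<alpha>': "\<alpha>' \<in> Hom P F G \<and> (\<forall>b\<in>B. \<forall>y\<in>fob F b. \<alpha>' b y = \<theta> b y)"
        show "\<alpha>' = \<alpha>" by (rule un[rule_format]) (use \<alpha> \<alpha>' in simp_all)
      qed (use \<alpha> in blast)
    qed
    finally show ?thesis .
  qed
  note * = this
  have Pf: "is_functor (op_cat C) set_cat F \<longleftrightarrow> F \<in> Ob P" by (simp add: psh_def fun_cat_def)
  show ?thesis
    unfolding small_presheaf_def Pf by (intro conj_cong ex_cong1 refl *)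
qed

section \<open>Presentations of presheaves by generators and spans\<close>

text \<open>A single span suffices where the general colimit formula has a zigzag, because spans
  compose by pullback inside a lex-closed \<open>B\<close>. There are two sets because the
  generators \<open>A\<close> supplied by a Kan extension need not be closed under limits, so that
  the vertices of spans are sought in a larger set.\<close>

definition presented :: "'o set \<Rightarrow> 'o set \<Rightarrow> ('o, 'u) presheaf \<Rightarrow> bool" where
  "presented A B F \<longleftrightarrow> F \<in> Ob P \<and>
     (\<forall>c\<in>Ob C. \<forall>z\<in>fob F c. \<exists>b\<in>A. \<exists>f\<in>Hom C c b. \<exists>y\<in>fob F b. z = fmap F b c f y) \<and>
     (\<forall>c\<in>Ob C. \<forall>b\<in>A. \<forall>b'\<in>A. \<forall>f\<in>Hom C c b. \<forall>g\<in>Hom C c b'. \<forall>y\<in>fob F b. \<forall>y'\<in>fob F b'.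
        fmap F b c f y = fmap F b' c g y' \<longrightarrow>
        (\<exists>r\<in>B. \<exists>s\<in>Hom C r b. \<exists>t\<in>Hom C r b'. \<exists>h\<in>Hom C c r. f = Comp C c r b s h \<and>
           g = Comp C c r b' t h \<and> fmap F b r s y = fmap F b' r t y'))"

lemma presented_Ob: "presented A B F \<Longrightarrow> F \<in> Ob P"
  by (simp add: presented_def)

lemma presented_gen:
  assumes "presented A B F" "c \<in> Ob C" "z \<in> fob F c"
  obtains b f y where "b \<in> A" "f \<in> Hom C c b" "y \<in> fob F b" "z = fmap F b c f y"
  using assms unfolding presented_def by blast

lemma presented_rel:
  assumes "presented A B F" "c \<in> Ob C" "b \<in> A" "b' \<in> A" "f \<in> Hom C c b" "g \<in> Hom C c b'"
    "y \<in> fob F b" "y' \<in> fob F b'" "fmap F b c f y = fmap F b' c g y'"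
  obtains r s t h where "r \<in> B" "s \<in> Hom C r b" "t \<in> Hom C r b'" "h \<in> Hom C c r"
    "f = Comp C c r b s h" "g = Comp C c r b' t h" "fmap F b r s y = fmap F b' r t y'"
  using assms unfolding presented_def by (elim conjE) (drule (1) bspec, drule (1) bspec, drule (1) bspec, blast)

text \<open>Elements over \<open>B\<close> are themselves restrictions of generators over
  \<open>A\<close>, along \<open>k\<close> and \<open>k'\<close>. A span witnessing the resulting
  equation between generators is pulled back along \<open>k\<close> and along \<open>k'\<close>; the
  new vertex is the fibre product of \<open>b\<close>, \<open>r\<close> and \<open>b'\<close> over
  \<open>d\<close> and \<open>d'\<close>.\<close>

lemma presented_mono:
  assumes F: "presented A A' F" and B: "A \<subseteq> B" "A' \<subseteq> B" "lex_closed C B"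
  shows "presented B B F"
  unfolding presented_def
proof (intro conjI ballI impI)
  interpret B: lexc C B by unfold_locales (fact B(3))
  have FO: "F \<in> Ob P" using F by (rule presented_Ob)
  then show "F \<in> Ob P" .
  show "\<exists>b\<in>B. \<exists>f\<in>Hom C c b. \<exists>y\<in>fob F b. z = fmap F b c f y" if z: "c \<in> Ob C" "z \<in> fob F c" for c z
    using presented_gen[OF F z] B(1) by blast
  fix c b b' f g y y' assume c: "c \<in> Ob C" and b: "b \<in> B" "b' \<in> B" and f: "f \<in> Hom C c b"
    and g: "g \<in> Hom C c b'" and y: "y \<in> fob F b" "y' \<in> fob F b'"
    and eq: "fmap F b c f y = fmap F b' c g y'"
  have bO: "b \<in> Ob C" "b' \<in> Ob C" using b B.B_Ob by auto
  obtain d k x where d: "d \<in> A" "k \<in> Hom C b d" "x \<in> fob F d" "y = fmap F d b k x"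
    using presented_gen[OF F bO(1) y(1)] .
  obtain d' k' x' where d': "d' \<in> A" "k' \<in> Hom C b' d'" "x' \<in> fob F d'" "y' = fmap F d' b' k' x'"
    using presented_gen[OF F bO(2) y(2)] .
  have dB: "d \<in> B" "d' \<in> B" and dO: "d \<in> Ob C" "d' \<in> Ob C" using d d' B(1) B.B_Ob by auto
  have kf: "Comp C c b d k f \<in> Hom C c d" "Comp C c b' d' k' g \<in> Hom C c d'"
    using c bO dO f g d d' by auto
  have "fmap F d c (Comp C c b d k f) x = fmap F d' c (Comp C c b' d' k' g) x'"
    using eq d d' act_Comp[OF FO] f g c bO dO by simp
  then obtain r s t h where r: "r \<in> A'" "s \<in> Hom C r d" "t \<in> Hom C r d'" "h \<in> Hom C c r"
    "Comp C c b d k f = Comp C c r d s h" "Comp C c b' d' k' g = Comp C c r d' t h"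
    "fmap F d r s x = fmap F d' r t x'"
    using presented_rel[OF F c d(1) d'(1) kf d(3) d'(3)] by metis
  have rB: "r \<in> B" and rO: "r \<in> Ob C" using r B(2) B.B_Ob by auto
  obtain p p1 p2 where p: "p \<in> B" "is_pullback C b r d k s p p1 p2"
    using B.pullback[OF b(1) rB dB(1) d(2) r(2)] .
  note pin = pullback_in[OF p(2)]
  have tp: "Comp C p r d' t p2 \<in> Hom C p d'" using r dO pin by simp
  obtain e e1 e2 where e: "e \<in> B" "is_pullback C p b' d' (Comp C p r d' t p2) k' e e1 e2"
    using B.pullback[OF p(1) b(2) dB(2) tp d'(2)] .
  note ein = pullback_in[OF e(2)]
  obtain l where l: "l \<in> Hom C c p" "Comp C c p b p1 l = f" "Comp C c p r p2 l = h"
    using pullback_ex[OF p(2) c f r(4,5)] .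
  have "Comp C c p d' (Comp C p r d' t p2) l = Comp C c b' d' k' g"
    using l r dO pin c by (simp flip: assoc)
  then obtain m where m: "m \<in> Hom C c e" "Comp C c e p e1 m = l" "Comp C c e b' e2 m = g"
    using pullback_ex[OF e(2) c l(1) g] by blast
  have s: "Comp C e p b p1 e1 \<in> Hom C e b" using ein pin by simp
  have "fmap F b e (Comp C e p b p1 e1) y = fmap F p e e1 (fmap F b p p1 (fmap F d b k x))"
    using act_Comp[OF FO ein(7) pin(7)] y(1) d(4) ein pin by simp
  also have "fmap F b p p1 (fmap F d b k x) = fmap F d p (Comp C p b d k p1) x"
    using act_Comp[OF FO pin(7) d(2,3)] pin by simp
  also have "\<dots> = fmap F r p p2 (fmap F d r s x)"
    using act_Comp[OF FO pin(8) r(2) d(3)] pin by simp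
  also have "\<dots> = fmap F d' p (Comp C p r d' t p2) x'"
    using act_Comp[OF FO pin(8) r(3) d'(3)] pin dO r by simp
  also have "fmap F p e e1 (fmap F d' p (Comp C p r d' t p2) x') = fmap F d' e (Comp C e b' d' k' e2) x'"
    using act_Comp[OF FO ein(7) tp d'(3)] pin dO ein by simp
  also have "\<dots> = fmap F b' e e2 y'"
    using act_Comp[OF FO ein(8) d'(2,3)] d'(4) ein by simp
  finally have "fmap F b e (Comp C e p b p1 e1) y = fmap F b' e e2 y'" .
  moreover have "f = Comp C c e b (Comp C e p b p1 e1) m"
    using l(2) m(2) assoc[OF m(1) ein(7) pin(7)] c ein pin by simp
  ultimately show "\<exists>r\<in>B. \<exists>s\<in>Hom C r b. \<exists>t\<in>Hom C r b'. \<exists>h\<in>Hom C c r. f = Comp C c r b s h \<and>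
      g = Comp C c r b' t h \<and> fmap F b r s y = fmap F b' r t y'"
    using e(1) s ein(8) m(1,3) by metis
qed

text \<open>A family \<open>\<theta>\<close> natural on \<open>B\<close> is extended by sending the
  restriction of \<open>y\<close> along \<open>f\<close> to the restriction of
  \<open>\<theta> b y\<close>. Two descriptions of the same element give the same value, because
  they are related by a span whose vertex lies in \<open>B\<close>, where \<open>\<theta>\<close> is
  natural.\<close>

lemma presented_imp_small:
  assumes B: "B \<subseteq> Ob C" "small TYPE('u) B" and F: "presented B B F"
  shows "small_presheaf C F"
proof -
  have FO: "F \<in> Ob P" using F by (rule presented_Ob)
  have ex: "\<exists>\<alpha>\<in>Hom P F G. \<forall>b\<in>B. \<forall>y\<in>fob F b. \<alpha> b y = \<theta> b y"
    if G: "G \<in> Ob P" and \<theta>: "\<forall>b\<in>B. \<forall>y\<in>fob F b. \<theta> b y \<in> fob G b"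
      and n: "\<forall>b\<in>B. \<forall>b'\<in>B. \<forall>f\<in>Hom C b b'. \<forall>y\<in>fob F b'. \<theta> b (fmap F b' b f y) = fmap G b' b f (\<theta> b' y)" for G \<theta>
  proof -
    have wd: "fmap G b c f (\<theta> b y) = fmap G b' c g (\<theta> b' y')"
      if c: "c \<in> Ob C" and b: "b \<in> B" "b' \<in> B" and f: "f \<in> Hom C c b" "g \<in> Hom C c b'"
        and y: "y \<in> fob F b" "y' \<in> fob F b'" and eq: "fmap F b c f y = fmap F b' c g y'" for c b b' f g y y'
    proof -
      obtain r s t h where r: "r \<in> B" "s \<in> Hom C r b" "t \<in> Hom C r b'" "h \<in> Hom C c r"
        "f = Comp C c r b s h" "g = Comp C c r b' t h" "fmap F b r s y = fmap F b' r t y'"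
        using presented_rel[OF F c b f y eq] .
      have o: "r \<in> Ob C" "b \<in> Ob C" "b' \<in> Ob C" using r b B by auto
      have "fmap G b c f (\<theta> b y) = fmap G r c h (\<theta> r (fmap F b r s y))"
        using n r(1-6) b y \<theta> act_Comp[OF G r(4,2)] c o by simp
      also have "\<dots> = fmap G b' c g (\<theta> b' y')"
        using n r b y \<theta> act_Comp[OF G r(4,3)] c o by simp
      finally show ?thesis .
    qed
    let ?t = "\<lambda>c z. SOME w. \<exists>b\<in>B. \<exists>f\<in>Hom C c b. \<exists>y\<in>fob F b. z = fmap F b c f y \<and> w = fmap G b c f (\<theta> b y)"
    have t: "?t c (fmap F b c f y) = fmap G b c f (\<theta> b y)"
      if c: "c \<in> Ob C" and b: "b \<in> B" "f \<in> Hom C c b" "y \<in> fob F b" for c b f y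
    proof (rule someI2)
      show "\<exists>b'\<in>B. \<exists>g\<in>Hom C c b'. \<exists>y'\<in>fob F b'. fmap F b c f y = fmap F b' c g y' \<and> fmap G b c f (\<theta> b y) = fmap G b' c g (\<theta> b' y')"
        using b by blast
    next
      fix w assume "\<exists>b'\<in>B. \<exists>g\<in>Hom C c b'. \<exists>y'\<in>fob F b'. fmap F b c f y = fmap F b' c g y' \<and> w = fmap G b' c g (\<theta> b' y')"
      then obtain b' g y' where *: "b' \<in> B" "g \<in> Hom C c b'" "y' \<in> fob F b'" "fmap F b c f y = fmap F b' c g y'"
        "w = fmap G b' c g (\<theta> b' y')" by blast
      show "w = fmap G b c f (\<theta> b y)"
        unfolding *(5) by (rule wd[OF c b(1) *(1) b(2) *(2) b(3) *(3,4), symmetric])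
    qed
    have "mk_hom F ?t \<in> Hom P F G"
    proof (rule mk_hom[OF FO])
      fix c z assume c: "c \<in> Ob C" and "z \<in> fob F c"
      then obtain b f y where b: "b \<in> B" "f \<in> Hom C c b" "y \<in> fob F b" "z = fmap F b c f y"
        using presented_gen[OF F] by blast
      have "b \<in> Ob C" using b B by blast
      then show "?t c z \<in> fob G c"
        unfolding b(4) t[OF c b(1-3)] using G c b \<theta> by simp
    next
      fix a c k z assume a: "a \<in> Ob C" and c: "c \<in> Ob C" and k: "k \<in> Hom C a c" and "z \<in> fob F c"
      then obtain b f y where b: "b \<in> B" "f \<in> Hom C c b" "y \<in> fob F b" "z = fmap F b c f y"
        using presented_gen[OF F c] by blast
      have bO: "b \<in> Ob C" using b B by blast
      have fk: "Comp C a c b f k \<in> Hom C a b" using k b a c bO by simp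
      have "fmap F c a k z = fmap F b a (Comp C a c b f k) y"
        unfolding b(4) by (rule act_Comp[OF FO k b(2,3) a c bO, symmetric])
      then have "?t a (fmap F c a k z) = fmap G b a (Comp C a c b f k) (\<theta> b y)"
        using t[OF a b(1) fk b(3)] by simp
      also have "\<dots> = fmap G c a k (fmap G b c f (\<theta> b y))"
        using act_Comp[OF G k b(2)] \<theta> b a c bO by simp
      also have "fmap G b c f (\<theta> b y) = ?t c z" unfolding b(4) t[OF c b(1-3)] ..
      finally show "?t a (fmap F c a k z) = fmap G c a k (?t c z)" .
    qed
    moreover have "mk_hom F ?t b y = \<theta> b y" if b: "b \<in> B" "y \<in> fob F b" for b y
    proof -
      have bO: "b \<in> Ob C" using b B by blast
      have "mk_hom F ?t b y = ?t b y" using b bO by simp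
      also have "\<dots> = ?t b (fmap F b b (idn C b) y)" using FO b bO by simp
      also have "\<dots> = fmap G b b (idn C b) (\<theta> b y)" by (rule t) (use b bO in auto)
      finally show ?thesis using G b bO \<theta> by simp
    qed
    ultimately show ?thesis by (intro bexI[of _ "mk_hom F ?t"]) auto
  qed
  have un: "\<alpha> = \<alpha>'" if \<alpha>: "\<alpha> \<in> Hom P F G" "\<alpha>' \<in> Hom P F G" and eq: "\<forall>b\<in>B. \<forall>y\<in>fob F b. \<alpha> b y = \<alpha>' b y" for G \<alpha> \<alpha>'
  proof (rule hom_eqI[OF \<alpha>])
    fix c z assume c: "c \<in> Ob C" and "z \<in> fob F c"
    then obtain b f y where b: "b \<in> B" "f \<in> Hom C c b" "y \<in> fob F b" "z = fmap F b c f y"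
      using presented_gen[OF F] by blast
    have "b \<in> Ob C" using b B by blast
    then show "\<alpha> c z = \<alpha>' c z"
      using hom_act[OF \<alpha>(1) b(2,3) c] hom_act[OF \<alpha>(2) b(2,3) c] eq b by simp
  qed
  show ?thesis
    unfolding small_presheaf_iff
    by (intro conjI exI[of _ B] ballI allI impI FO B ex un) auto
qed

text \<open>One chosen pullback is added for each cospan, countably many times. Every stage stays
  small because hom-sets are small, and the union is closed because a cospan involves only three
  objects, which lie in a common stage.\<close>

lemma small_lex_closure:
  assumes fc: "finitely_complete C" and A: "A \<subseteq> Ob C" "small TYPE('u) A"
  obtains B where "A \<subseteq> B" "small TYPE('u) B" "lex_closed C B"
proof -
  obtain t where t: "terminal C t" using finitely_complete_terminal[OF fc] .
  have tO: "t \<in> Ob C" using t by (simp add: terminal_def)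
  have "\<forall>a b c f g. \<exists>p. a \<in> Ob C \<and> b \<in> Ob C \<and> c \<in> Ob C \<and> f \<in> Hom C a c \<and> g \<in> Hom C b c \<longrightarrow>
    (\<exists>p1 p2. is_pullback C a b c f g p p1 p2)"
    using finitely_complete_pullback[OF fc] by metis
  then obtain pb where pb: "\<And>a b c f g. \<lbrakk>a \<in> Ob C; b \<in> Ob C; c \<in> Ob C; f \<in> Hom C a c; g \<in> Hom C b c\<rbrakk> \<Longrightarrow>
    \<exists>p1 p2. is_pullback C a b c f g (pb a b c f g) p1 p2"
    by metis
  define step where "step X = X \<union> (\<Union>a\<in>X. \<Union>b\<in>X. \<Union>c\<in>X. \<Union>f\<in>Hom C a c. pb a b c f ` Hom C b c)" for X
  define N where "N n = (step ^^ n) (insert t A)" for n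
  have N0: "N 0 = insert t A" and NS: "N (Suc n) = step (N n)" for n by (simp_all add: N_def)
  have sub: "N n \<subseteq> Ob C \<and> small TYPE('u) (N n)" for n
  proof (induction n)
    case 0
    have "small TYPE('u) ({t} \<union> A)" by (intro small_Un A small_finite) simp
    then show ?case using A tO by (simp add: N0)
  next
    case (Suc n)
    have N: "a \<in> Ob C" if "a \<in> N n" for a using Suc that by blast
    have "small TYPE('u) (step (N n))"
      unfolding step_def using Suc N by (intro small_Un small_Union small_image small_Hom) auto
    moreover have "pb a b c f g \<in> Ob C"
      if "a \<in> N n" "b \<in> N n" "c \<in> N n" "f \<in> Hom C a c" "g \<in> Hom C b c" for a b c f g
      using pb[of a b c f g] N that pullback_in(4) by metis
    then have "step (N n) \<subseteq> Ob C"
      unfolding step_def using N by blast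
    ultimately show ?case by (simp add: NS)
  qed
  have mono: "m \<le> n \<Longrightarrow> N m \<subseteq> N n" for m n
    by (induction rule: dec_induct) (auto simp: NS step_def)
  show ?thesis
  proof (rule that[of "\<Union>n. N n"])
    show "A \<subseteq> (\<Union>n. N n)" using N0 by blast
    show "small TYPE('u) (\<Union>n. N n)" using sub by (intro small_Union small_nat) blast
    show "lex_closed C (\<Union>n. N n)"
      unfolding lex_closed_def
    proof (intro conjI ballI)
      show "(\<Union>n. N n) \<subseteq> Ob C" using sub by blast
      have "t \<in> (\<Union>n. N n)" using N0 by blast
      then show "\<exists>t\<in>\<Union>n. N n. terminal C t" using t by blast
      fix a b c f g assume "a \<in> (\<Union>n. N n)" "b \<in> (\<Union>n. N n)" "c \<in> (\<Union>n. N n)" and fg: "f \<in> Hom C a c" "g \<in> Hom C b c"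
      then obtain i j k where ijk: "a \<in> N i" "b \<in> N j" "c \<in> N k" by blast
      let ?n = "i + j + k"
      have n: "a \<in> N ?n" "b \<in> N ?n" "c \<in> N ?n"
        using ijk mono[of i ?n] mono[of j ?n] mono[of k ?n] by auto
      then have "pb a b c f g \<in> N (Suc ?n)" using fg unfolding NS step_def by blast
      moreover have "\<exists>p1 p2. is_pullback C a b c f g (pb a b c f g) p1 p2"
        using pb fg n sub by blast
      ultimately show "\<exists>p\<in>\<Union>n. N n. \<exists>p1 p2. is_pullback C a b c f g p p1 p2" by blast
    qed
  qed
qed

text \<open>The left Kan extension property is tested against the presheaf of formal elements \<open>(b, f, y)\<close>
  with \<open>f : c \<rightarrow> b\<close> and \<open>y \<in> F b\<close>, modulo equality witnessed by a span in a lex-closed set \<open>B\<close>.\<close>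

lemma small_imp_presented:
  assumes fc: "finitely_complete C" and F: "small_presheaf C F"
  obtains A B where "A \<subseteq> B" "small TYPE('u) B" "lex_closed C B" "presented A B F"
proof -
  obtain A where FO: "F \<in> Ob P" and A: "A \<subseteq> Ob C" "small TYPE('u) A"
    and ex: "\<forall>G\<in>Ob P. \<forall>\<theta>. (\<forall>b\<in>A. \<forall>y\<in>fob F b. \<theta> b y \<in> fob G b) \<longrightarrow>
       (\<forall>b\<in>A. \<forall>b'\<in>A. \<forall>f\<in>Hom C b b'. \<forall>y\<in>fob F b'. \<theta> b (fmap F b' b f y) = fmap G b' b f (\<theta> b' y)) \<longrightarrow>
       (\<exists>\<alpha>\<in>Hom P F G. \<forall>b\<in>A. \<forall>y\<in>fob F b. \<alpha> b y = \<theta> b y)"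
    and un: "\<forall>G\<in>Ob P. \<forall>\<alpha>\<in>Hom P F G. \<forall>\<alpha>'\<in>Hom P F G. (\<forall>b\<in>A. \<forall>y\<in>fob F b. \<alpha> b y = \<alpha>' b y) \<longrightarrow> \<alpha> = \<alpha>'"
    using F unfolding small_presheaf_iff by blast
  obtain B where B: "A \<subseteq> B" "small TYPE('u) B" "lex_closed C B"
    using small_lex_closure[OF fc A] .
  interpret B: lexc C B by unfold_locales (fact B(3))
  have AO: "b \<in> Ob C" if "b \<in> A" for b using that A by blast
  define X where "X c = (SIGMA b:A. Hom C c b \<times> fob F b)" for c
  define act :: "'o \<Rightarrow> 'o \<Rightarrow> 'u \<Rightarrow> 'o \<times> 'u \<times> 'u \<Rightarrow> 'o \<times> 'u \<times> 'u"
    where "act = (\<lambda>c a k (b, f, y). (b, Comp C a c b f k, y))"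
  obtain T e where T: "T \<in> Ob P" and e: "\<And>a. a \<in> Ob C \<Longrightarrow> bij_betw (e a) (X a) (fob T a)"
    and eact: "\<And>a b f x. \<lbrakk>a \<in> Ob C; b \<in> Ob C; f \<in> Hom C a b; x \<in> X b\<rbrakk> \<Longrightarrow> fmap T b a f (e b x) = e a (act b a f x)"
  proof (rule realise[of X act])
    show "small TYPE('u) (X a)" if "a \<in> Ob C" for a
      unfolding X_def using that A(2) AO small_fob[OF FO] by (intro small_Sigma[OF A(2)] small_Times small_Hom small_fob[OF FO])
    show "act b a f x \<in> X a" if "a \<in> Ob C" "b \<in> Ob C" "f \<in> Hom C a b" "x \<in> X b" for a b f x
      using that AO by (auto simp: X_def act_def)
    show "act a a (idn C a) x = x" if "a \<in> Ob C" "x \<in> X a" for a x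
      using that AO by (auto simp: X_def act_def)
    show "act c a (Comp C a b c g f) x = act b a f (act c b g x)"
      if "a \<in> Ob C" "b \<in> Ob C" "c \<in> Ob C" "f \<in> Hom C a b" "g \<in> Hom C b c" "x \<in> X c" for a b c f g x
      using that AO by (auto simp: X_def act_def assoc)
  qed blast
  have eq: "e a p = e a p' \<longleftrightarrow> p = p'" if "a \<in> Ob C" "p \<in> X a" "p' \<in> X a" for a p p'
    using inj_on_eq_iff[OF bij_betw_imp_inj_on[OF e[OF that(1)]] that(2,3)] .
  have ein: "e a p \<in> fob T a" if "a \<in> Ob C" "p \<in> X a" for a p
    using bij_betwE[OF e[OF that(1)]] that(2) by blast
  have esurj: "\<exists>b f y. b \<in> A \<and> f \<in> Hom C a b \<and> y \<in> fob F b \<and> z = e a (b, f, y)" if "a \<in> Ob C" "z \<in> fob T a" for a z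
    using e[OF that(1)] that(2) unfolding bij_betw_def X_def by blast
  define span where "span c b f y b' f' y' \<longleftrightarrow> (\<exists>r\<in>B. \<exists>s\<in>Hom C r b. \<exists>t\<in>Hom C r b'. \<exists>h\<in>Hom C c r.
    f = Comp C c r b s h \<and> f' = Comp C c r b' t h \<and> fmap F b r s y = fmap F b' r t y')" for c b f y b' f' y'
  have span_refl: "span c b f y b f y" if "c \<in> Ob C" "b \<in> A" "f \<in> Hom C c b" for c b f y
    unfolding span_def
    by (rule bexI[of _ b], rule bexI[of _ "idn C b"], rule bexI[of _ "idn C b"], rule bexI[of _ f])
      (use that AO B in auto)
  have span_sym: "span c b' f' y' b f y" if "span c b f y b' f' y'" for c b f y b' f' y'
    using that unfolding span_def by metis
  \<comment> \<open>Two spans are composed by the pullback of their legs into \<open>b2\<close>;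
    this is why the generators were enlarged to a lex-closed set.\<close>
  have span_trans: "span c b1 f1 y1 b3 f3 y3"
    if 1: "span c b1 f1 y1 b2 f2 y2" and 2: "span c b2 f2 y2 b3 f3 y3" and c: "c \<in> Ob C"
      and b: "b1 \<in> A" "b2 \<in> A" "b3 \<in> A" and y: "y1 \<in> fob F b1" "y2 \<in> fob F b2" "y3 \<in> fob F b3"
    for c b1 f1 y1 b2 f2 y2 b3 f3 y3
  proof -
    note bO = AO[OF b(1)] AO[OF b(2)] AO[OF b(3)]
    obtain r s t h where r: "r \<in> B" "s \<in> Hom C r b1" "t \<in> Hom C r b2" "h \<in> Hom C c r"
      "f1 = Comp C c r b1 s h" "f2 = Comp C c r b2 t h" "fmap F b1 r s y1 = fmap F b2 r t y2"
      using 1 unfolding span_def by blast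
    obtain r' s' t' h' where r': "r' \<in> B" "s' \<in> Hom C r' b2" "t' \<in> Hom C r' b3" "h' \<in> Hom C c r'"
      "f2 = Comp C c r' b2 s' h'" "f3 = Comp C c r' b3 t' h'" "fmap F b2 r' s' y2 = fmap F b3 r' t' y3"
      using 2 unfolding span_def by blast
    have b2: "b2 \<in> B" using b B by blast
    obtain p p1 p2 where p: "p \<in> B" "is_pullback C r r' b2 t s' p p1 p2"
      using B.pullback[OF r(1) r'(1) b2 r(3) r'(2)] .
    note pin = pullback_in[OF p(2)]
    have "Comp C c r b2 t h = Comp C c r' b2 s' h'" using r r' by simp
    then obtain l where l: "l \<in> Hom C c p" "Comp C c p r p1 l = h" "Comp C c p r' p2 l = h'"
      using pullback_ex[OF p(2) c r(4) r'(4)] by blast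
    have "fmap F b1 p (Comp C p r b1 s p1) y1 = fmap F r p p1 (fmap F b2 r t y2)"
      using act_Comp[OF FO pin(7) r(2) y(1)] pin bO r by simp
    also have "\<dots> = fmap F b2 p (Comp C p r' b2 s' p2) y2"
      using act_Comp[OF FO pin(7) r(3) y(2)] pin bO by simp
    also have "\<dots> = fmap F r' p p2 (fmap F b3 r' t' y3)"
      using act_Comp[OF FO pin(8) r'(2) y(2)] pin bO r' by simp
    also have "\<dots> = fmap F b3 p (Comp C p r' b3 t' p2) y3"
      using act_Comp[OF FO pin(8) r'(3) y(3)] pin bO by simp
    finally have a: "fmap F b1 p (Comp C p r b1 s p1) y1 = fmap F b3 p (Comp C p r' b3 t' p2) y3" .
    have b: "f1 = Comp C c p b1 (Comp C p r b1 s p1) l"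
      using r(2,5) l pin bO c by (simp flip: assoc)
    have d: "f3 = Comp C c p b3 (Comp C p r' b3 t' p2) l"
      using r'(3,6) l pin bO c by (simp flip: assoc)
    have "Comp C p r b1 s p1 \<in> Hom C p b1" "Comp C p r' b3 t' p2 \<in> Hom C p b3"
      using r r' pin bO by auto
    then show ?thesis unfolding span_def using a b d p(1) l(1) by blast
  qed
  define R where "R c = {(z, z'). \<exists>b f y b' f' y'. b \<in> A \<and> f \<in> Hom C c b \<and> y \<in> fob F b \<and>
    b' \<in> A \<and> f' \<in> Hom C c b' \<and> y' \<in> fob F b' \<and> z = e c (b, f, y) \<and> z' = e c (b', f', y') \<and> span c b f y b' f' y'}" for c
  have Xm: "(b, f, y) \<in> X c \<longleftrightarrow> b \<in> A \<and> f \<in> Hom C c b \<and> y \<in> fob F b" for b f y c by (simp add: X_def)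
  have RI: "(e c (b, f, y), e c (b', f', y')) \<in> R c \<longleftrightarrow> span c b f y b' f' y'"
    if "c \<in> Ob C" "(b, f, y) \<in> X c" "(b', f', y') \<in> X c" for c b f y b' f' y'
  proof
    assume "(e c (b, f, y), e c (b', f', y')) \<in> R c"
    then obtain b1 f1 y1 b2 f2 y2 where *: "(b1, f1, y1) \<in> X c" "(b2, f2, y2) \<in> X c"
      "e c (b, f, y) = e c (b1, f1, y1)" "e c (b', f', y') = e c (b2, f2, y2)" "span c b1 f1 y1 b2 f2 y2"
      unfolding R_def Xm by blast
    have "(b, f, y) = (b1, f1, y1)" "(b', f', y') = (b2, f2, y2)"
      using *(3,4) eq[OF that(1,2) *(1)] eq[OF that(1,3) *(2)] by auto
    then show "span c b f y b' f' y'" using *(5) by simp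
  next
    assume "span c b f y b' f' y'"
    then show "(e c (b, f, y), e c (b', f', y')) \<in> R c"
      using that(2,3) unfolding R_def Xm by blast
  qed
  obtain Q q where Q: "Q \<in> Ob P" and q: "q \<in> Hom P T Q" and qs: "\<And>a. a \<in> Ob C \<Longrightarrow> q a ` fob T a = fob Q a"
    and qR: "\<And>a x y. \<lbrakk>a \<in> Ob C; x \<in> fob T a; y \<in> fob T a\<rbrakk> \<Longrightarrow> q a x = q a y \<longleftrightarrow> (x, y) \<in> R a"
  proof (rule quotient_presheaf[OF T, of R])
    show "equiv (fob T c) (R c)" if c: "c \<in> Ob C" for c
    proof (rule equivI)
      show "R c \<subseteq> fob T c \<times> fob T c" using ein[OF c] by (auto simp: R_def X_def)
      show "refl_on (fob T c) (R c)"
      proof (rule refl_onI)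
        fix z assume "z \<in> fob T c"
        then obtain b f y where z: "b \<in> A" "f \<in> Hom C c b" "y \<in> fob F b" "z = e c (b, f, y)" using esurj[OF c] by blast
        then show "(z, z) \<in> R c" using RI[OF c] span_refl[OF c] by (simp add: Xm)
      qed
      show "sym (R c)"
      proof (rule symI)
        fix z z' assume "(z, z') \<in> R c"
        then show "(z', z) \<in> R c" using span_sym unfolding R_def by blast
      qed
      show "trans (R c)"
      proof (rule transI)
        fix z1 z2 z3 assume 1: "(z1, z2) \<in> R c" and 2: "(z2, z3) \<in> R c"
        obtain b1 f1 y1 b2 f2 y2 where z: "(b1, f1, y1) \<in> X c" "(b2, f2, y2) \<in> X c"
          "z1 = e c (b1, f1, y1)" "z2 = e c (b2, f2, y2)" using 1 unfolding R_def Xm by blast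
        obtain b3 f3 y3 where z3: "(b3, f3, y3) \<in> X c" "z3 = e c (b3, f3, y3)"
          using 2 unfolding R_def Xm by blast
        have "span c b1 f1 y1 b2 f2 y2" "span c b2 f2 y2 b3 f3 y3"
          using 1 2 RI[OF c] z z3 by simp_all
        from span_trans[OF this c] have "span c b1 f1 y1 b3 f3 y3" using z z3 by (simp add: Xm)
        then show "(z1, z3) \<in> R c" using RI[OF c z(1) z3(1)] z z3 by simp
      qed
    qed
    show "(fmap T c a k z, fmap T c a k z') \<in> R a"
      if a: "a \<in> Ob C" "c \<in> Ob C" "k \<in> Hom C a c" and zz: "(z, z') \<in> R c" for a c k z z'
    proof -
      obtain b f y b' f' y' where z: "(b, f, y) \<in> X c" "(b', f', y') \<in> X c"
          "z = e c (b, f, y)" "z' = e c (b', f', y')" "span c b f y b' f' y'" using zz unfolding R_def Xm by blast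
      have o: "b \<in> Ob C" "b' \<in> Ob C" using z AO by (auto simp: Xm)
      obtain r s t h where r: "r \<in> B" "s \<in> Hom C r b" "t \<in> Hom C r b'" "h \<in> Hom C c r"
        "f = Comp C c r b s h" "f' = Comp C c r b' t h" "fmap F b r s y = fmap F b' r t y'"
        using z(5) unfolding span_def by blast
      have rO: "r \<in> Ob C" using r B.B_Ob by blast
      have "Comp C a c b f k = Comp C a r b s (Comp C a c r h k)"
        "Comp C a c b' f' k = Comp C a r b' t (Comp C a c r h k)"
        using r o rO a by (simp_all add: assoc)
      then have "span a b (Comp C a c b f k) y b' (Comp C a c b' f' k) y'"
        unfolding span_def using r(1,2,3,7) Comp_in[OF a(3) r(4) a(1,2) rO] by blast
      moreover have "(b, Comp C a c b f k, y) \<in> X a" "(b', Comp C a c b' f' k, y') \<in> X a"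
        using z a o by (simp_all add: Xm)
      ultimately show ?thesis
        using RI[OF a(1)] eact[OF a z(1)] eact[OF a z(2)] z(3,4) by (simp add: act_def)
    qed
  qed blast
  define cl where "cl c b f y = q c (e c (b, f, y))" for c b f y
  have cl_in: "cl c b f y \<in> fob Q c" if "c \<in> Ob C" "b \<in> A" "f \<in> Hom C c b" "y \<in> fob F b" for c b f y
    unfolding cl_def using that ein[OF that(1)] q by (simp add: Xm)
  have cl_eq: "cl c b f y = cl c b' f' y' \<longleftrightarrow> span c b f y b' f' y'"
    if "c \<in> Ob C" "b \<in> A" "f \<in> Hom C c b" "y \<in> fob F b" "b' \<in> A" "f' \<in> Hom C c b'" "y' \<in> fob F b'" for c b f y b' f' y'
    unfolding cl_def using that ein[OF that(1)] RI[OF that(1)] qR[OF that(1)] by (simp add: Xm)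
  have cl_act: "fmap Q c a k (cl c b f y) = cl a b (Comp C a c b f k) y"
    if "a \<in> Ob C" "c \<in> Ob C" "k \<in> Hom C a c" "b \<in> A" "f \<in> Hom C c b" "y \<in> fob F b" for a c k b f y
    unfolding cl_def
    using that ein[OF that(2)] eact[OF that(1-3)] hom_act[OF q that(3) _ that(1,2), symmetric]
    by (simp add: Xm act_def)
  have cl_surj: "\<exists>b f y. b \<in> A \<and> f \<in> Hom C c b \<and> y \<in> fob F b \<and> z = cl c b f y" if "c \<in> Ob C" "z \<in> fob Q c" for c z
  proof -
    have "z \<in> q c ` fob T c" using qs that by simp
    then obtain w where "w \<in> fob T c" "z = q c w" by blast
    then show ?thesis using esurj[OF that(1)] unfolding cl_def by blast
  qed
  have nat: "cl b b (idn C b) (fmap F b' b f y) = fmap Q b' b f (cl b' b' (idn C b') y)"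
    if "b \<in> A" "b' \<in> A" "f \<in> Hom C b b'" "y \<in> fob F b'" for b b' f y
  proof -
    have o: "b \<in> Ob C" "b' \<in> Ob C" using that AO by auto
    have "span b b (idn C b) (fmap F b' b f y) b' f y"
      unfolding span_def
      by (rule bexI[of _ b], rule bexI[of _ "idn C b"], rule bexI[of _ f], rule bexI[of _ "idn C b"])
        (use that o B FO in auto)
    then have "cl b b (idn C b) (fmap F b' b f y) = cl b b' f y"
      using cl_eq[OF o(1) that(1) idn_in[OF o(1)] _ that(2,3,4)] FO that o by simp
    then show ?thesis
      using cl_act[OF o that(3,2) idn_in[OF o(2)] that(4)] that o by simp
  qed
  \<comment> \<open>The extension property of \<open>F\<close> is applied to the quotient
    \<open>Q\<close> and the family that sends \<open>y\<close> to the class of the formal element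
    \<open>(b, idn C b, y)\<close>.\<close>
  obtain \<alpha> where \<alpha>: "\<alpha> \<in> Hom P F Q" "\<forall>b\<in>A. \<forall>y\<in>fob F b. \<alpha> b y = cl b b (idn C b) y"
  proof (rule bexE[OF spec[OF bspec[OF ex Q], of "\<lambda>b. cl b b (idn C b)", THEN mp, THEN mp]])
    show "\<forall>b\<in>A. \<forall>y\<in>fob F b. cl b b (idn C b) y \<in> fob Q b" using cl_in AO by simp
    show "\<forall>b\<in>A. \<forall>b'\<in>A. \<forall>f\<in>Hom C b b'. \<forall>y\<in>fob F b'.
      cl b b (idn C b) (fmap F b' b f y) = fmap Q b' b f (cl b' b' (idn C b') y)" using nat by blast
  qed
  have \<alpha>f: "\<alpha> c (fmap F b c f y) = cl c b f y" if "c \<in> Ob C" "b \<in> A" "f \<in> Hom C c b" "y \<in> fob F b" for c b f y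
    using that AO hom_act[OF \<alpha>(1) that(3,4,1)] \<alpha>(2) cl_act[OF that(1) _ that(3,2) _ that(4)] by simp
  \<comment> \<open>Evaluation of formal elements. It respects classes, since a span restricts both
    elements to the same one over its vertex.\<close>
  obtain ev where ev: "\<And>c b f y. \<lbrakk>c \<in> Ob C; b \<in> A; f \<in> Hom C c b; y \<in> fob F b\<rbrakk> \<Longrightarrow> ev c (cl c b f y) = fmap F b c f y"
    and evin: "ev \<in> Hom P Q F"
  proof -
    let ?t = "\<lambda>c z. SOME w. \<exists>b\<in>A. \<exists>f\<in>Hom C c b. \<exists>y\<in>fob F b. z = cl c b f y \<and> w = fmap F b c f y"
    have t: "?t c (cl c b f y) = fmap F b c f y" if c: "c \<in> Ob C" and b: "b \<in> A" "f \<in> Hom C c b" "y \<in> fob F b" for c b f y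
    proof (rule someI2)
      show "\<exists>b'\<in>A. \<exists>f'\<in>Hom C c b'. \<exists>y'\<in>fob F b'. cl c b f y = cl c b' f' y' \<and> fmap F b c f y = fmap F b' c f' y'"
        using b by blast
    next
      fix w assume "\<exists>b'\<in>A. \<exists>f'\<in>Hom C c b'. \<exists>y'\<in>fob F b'. cl c b f y = cl c b' f' y' \<and> w = fmap F b' c f' y'"
      then obtain b' f' y' where b': "b' \<in> A" "f' \<in> Hom C c b'" "y' \<in> fob F b'" "cl c b f y = cl c b' f' y'"
        "w = fmap F b' c f' y'" by blast
      obtain r s t h where r: "r \<in> B" "s \<in> Hom C r b" "t \<in> Hom C r b'" "h \<in> Hom C c r"
        "f = Comp C c r b s h" "f' = Comp C c r b' t h" "fmap F b r s y = fmap F b' r t y'"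
        using b'(4) cl_eq[OF c b b'(1-3)] unfolding span_def by blast
      have o: "r \<in> Ob C" "b \<in> Ob C" "b' \<in> Ob C" using r B.B_Ob b b' AO by auto
      have "fmap F b c f y = fmap F r c h (fmap F b r s y)"
        unfolding r(5) by (rule act_Comp[OF FO r(4,2) b(3) c o(1,2)])
      also have "\<dots> = w"
        unfolding b'(5) r(6,7) by (rule act_Comp[OF FO r(4,3) b'(3) c o(1,3), symmetric])
      finally show "w = fmap F b c f y" by simp
    qed
    have "mk_hom Q ?t \<in> Hom P Q F"
    proof (rule mk_hom[OF Q])
      fix c z assume c: "c \<in> Ob C" and "z \<in> fob Q c"
      then obtain b f y where b: "b \<in> A" "f \<in> Hom C c b" "y \<in> fob F b" and z: "z = cl c b f y" using cl_surj by blast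
      show "?t c z \<in> fob F c" unfolding z t[OF c b] using b AO c FO by simp
    next
      fix a c k z assume a: "a \<in> Ob C" "c \<in> Ob C" "k \<in> Hom C a c" and "z \<in> fob Q c"
      then obtain b f y where b: "b \<in> A" "f \<in> Hom C c b" "y \<in> fob F b" and z: "z = cl c b f y" using cl_surj by blast
      have fk: "Comp C a c b f k \<in> Hom C a b" using a b AO by simp
      show "?t a (fmap Q c a k z) = fmap F c a k (?t c z)"
        unfolding z cl_act[OF a b] t[OF a(2) b] t[OF a(1) b(1) fk b(3)]
        by (rule act_Comp[OF FO a(3) b(2,3) a(1,2) AO[OF b(1)]])
    qed
    then show thesis by (rule that[rotated]) (use t cl_in in simp)
  qed
  have "presented A B F"
    unfolding presented_def
  proof (intro conjI ballI impI FO)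
    fix c z assume c: "c \<in> Ob C" and z: "z \<in> fob F c"
    \<comment> \<open>By uniqueness of extensions \<open>\<alpha>\<close> followed by
      \<open>ev\<close> is the identity of \<open>F\<close>, so every element of \<open>F\<close> is
      the value of a formal element; this gives the generators.\<close>
    have "Comp P F Q F ev \<alpha> = idn P F"
    proof (rule bspec[OF bspec[OF bspec[OF un FO]], THEN mp])
      show "\<forall>b\<in>A. \<forall>y\<in>fob F b. Comp P F Q F ev \<alpha> b y = idn P F b y"
        using AO \<alpha>(2) ev FO by simp
    qed (use \<alpha> evin FO psh_Comp_in psh_idn_in in auto)
    from fun_cong[OF fun_cong[OF this], of c z] have z': "z = ev c (\<alpha> c z)" using c z by simp
    have "\<alpha> c z \<in> fob Q c" using \<alpha> c z by simp
    then obtain b f y where "b \<in> A" "f \<in> Hom C c b" "y \<in> fob F b" "\<alpha> c z = cl c b f y" using cl_surj[OF c] by blast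
    then show "\<exists>b\<in>A. \<exists>f\<in>Hom C c b. \<exists>y\<in>fob F b. z = fmap F b c f y" using z' ev[OF c] by metis
  next
    fix c b b' f g y y' assume c: "c \<in> Ob C" and b: "b \<in> A" "b' \<in> A" and fg: "f \<in> Hom C c b" "g \<in> Hom C c b'"
      and y: "y \<in> fob F b" "y' \<in> fob F b'" and "fmap F b c f y = fmap F b' c g y'"
    \<comment> \<open>\<open>\<alpha>\<close> takes the restriction of a generator to the class of
      the corresponding formal element. An equality in \<open>F\<close> thus becomes an equality of
      classes, which by construction is a span.\<close>
    then have "cl c b f y = cl c b' g y'"
      using \<alpha>f[OF c b(1) fg(1) y(1)] \<alpha>f[OF c b(2) fg(2) y(2)] by simp
    then have "span c b f y b' g y'" using cl_eq[OF c b(1) fg(1) y(1) b(2) fg(2) y(2)] by simp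
    then show "\<exists>r\<in>B. \<exists>s\<in>Hom C r b. \<exists>t\<in>Hom C r b'. \<exists>h\<in>Hom C c r. f = Comp C c r b s h \<and>
           g = Comp C c r b' t h \<and> fmap F b r s y = fmap F b' r t y'" unfolding span_def .
  qed
  then show ?thesis using that B by blast
qed

text \<open>The identity of \<open>c\<close> generates \<open>W c\<close>, and an equation between
  composites with \<open>y\<close> and with \<open>y'\<close> factors through the pullback of
  \<open>y\<close> along \<open>y'\<close>.\<close>

lemma presented_W:
  assumes B: "lex_closed C B" and c: "c \<in> B"
  shows "presented B B (W c)"
  unfolding presented_def
proof (intro conjI ballI impI)
  interpret B: lexc C B by unfold_locales (fact B)
  have cO: "c \<in> Ob C" using c by (rule B.B_Ob)
  then show "W c \<in> Ob P" by simp
  show "\<exists>b\<in>B. \<exists>f\<in>Hom C a b. \<exists>y\<in>fob (W c) b. z = fmap (W c) b a f y" if "a \<in> Ob C" "z \<in> fob (W c) a" for a z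
    by (rule bexI[OF _ c], rule bexI[of _ z], rule bexI[of _ "idn C c"]) (use that cO in auto)
  fix a b b' f g y y' assume a: "a \<in> Ob C" "b \<in> B" "b' \<in> B" "f \<in> Hom C a b" "g \<in> Hom C a b'"
    "y \<in> fob (W c) b" "y' \<in> fob (W c) b'" "fmap (W c) b a f y = fmap (W c) b' a g y'"
  then have y: "y \<in> Hom C b c" "y' \<in> Hom C b' c" "Comp C a b c y f = Comp C a b' c y' g" by simp_all
  obtain p p1 p2 where p: "p \<in> B" "is_pullback C b b' c y y' p p1 p2"
    using B.pullback[OF a(2,3) c y(1,2)] .
  note pin = pullback_in[OF p(2)]
  obtain h where h: "h \<in> Hom C a p" "Comp C a p b p1 h = f" "Comp C a p b' p2 h = g"
    using pullback_ex[OF p(2) a(1,4,5) y(3)] .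
  have "fmap (W c) b p p1 y = fmap (W c) b' p p2 y'" using y pin by simp
  then show "\<exists>r\<in>B. \<exists>s\<in>Hom C r b. \<exists>t\<in>Hom C r b'. \<exists>h\<in>Hom C a r. f = Comp C a r b s h \<and>
      g = Comp C a r b' t h \<and> fmap (W c) b r s y = fmap (W c) b' r t y'"
    using p(1) pin(7,8) h by blast
qed

text \<open>Generators found separately for each \<open>j\<close> are restricted to the product of
  the objects over which they live, so that one arrow \<open>f\<close> serves all \<open>j\<close>.
  This is the source of generators for a limit, up to compatibility.\<close>

lemma presented_family:
  assumes I: "finite I" and B: "lex_closed C B" and F: "\<And>j. j \<in> I \<Longrightarrow> presented B B (F j)"
    and c: "c \<in> Ob C" and z: "\<And>j. j \<in> I \<Longrightarrow> z j \<in> fob (F j) c"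
  shows "\<exists>b\<in>B. \<exists>f\<in>Hom C c b. \<exists>y. \<forall>j\<in>I. y j \<in> fob (F j) b \<and> z j = fmap (F j) b c f (y j)"
  using I F z
proof (induction I rule: finite_induct)
  interpret B: lexc C B by unfold_locales (fact B)
  case empty
  obtain t where t: "t \<in> B" "terminal C t" by (rule B.terminal)
  then obtain h where "h \<in> Hom C c t" using c unfolding terminal_def by blast
  then show ?case using t by blast
next
  case (insert i I)
  interpret B: lexc C B by unfold_locales (fact B)
  obtain b f y where b: "b \<in> B" "f \<in> Hom C c b" "\<forall>j\<in>I. y j \<in> fob (F j) b \<and> z j = fmap (F j) b c f (y j)"
    using insert.IH insert.prems by auto
  obtain b' f' x where b': "b' \<in> B" "f' \<in> Hom C c b'" "x \<in> fob (F i) b'" "z i = fmap (F i) b' c f' x"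
    using presented_gen[of B B "F i" c "z i"] insert.prems c by auto
  obtain p p1 p2 where p: "p \<in> B" "is_product C b b' p p1 p2" using B.product[OF b(1) b'(1)] .
  note pin = product_in[OF p(2)]
  obtain h where h: "h \<in> Hom C c p" "Comp C c p b p1 h = f" "Comp C c p b' p2 h = f'"
    using product_ex[OF p(2) c b(2) b'(2)] .
  let ?y = "\<lambda>j. if j = i then fmap (F i) b' p p2 x else fmap (F j) b p p1 (y j)"
  have "?y j \<in> fob (F j) p \<and> z j = fmap (F j) p c h (?y j)" if j: "j \<in> insert i I" for j
  proof (cases "j = i")
    case True
    have "F i \<in> Ob P" using insert.prems presented_Ob by blast
    then show ?thesis using True b' h(3) pin act_Comp[OF _ h(1) pin(5) b'(3)] c by auto
  next
    case False
    then have "j \<in> I" using j by simp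
    moreover from this have "F j \<in> Ob P" using insert.prems(1)[of j] presented_Ob by blast
    ultimately show ?thesis using False b(3) h(2) pin act_Comp[OF _ h(1) pin(4)] c by auto
  qed
  then have "\<forall>j\<in>insert i I. ?y j \<in> fob (F j) p \<and> z j = fmap (F j) p c h (?y j)" by (rule ballI)
  then show ?case
    by (intro bexI[OF _ p(1)] bexI[OF _ h(1)] exI[of _ ?y])
qed

text \<open>An equation is witnessed by a span \<open>s\<close>, \<open>t\<close> through which the
  same arrow \<open>h\<close> factors on both sides; over the equaliser of \<open>s\<close> and
  \<open>t\<close> the two restrictions are along a single arrow. Finitely many equations are
  imposed one after the other, each refining the factorisation of \<open>f\<close>.\<close>

lemma presented_equations:
  assumes I: "finite I" and B: "lex_closed C B" and F: "\<And>j. j \<in> I \<Longrightarrow> presented B B (F j)"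
    and c: "c \<in> Ob C" and b: "b \<in> B" and f: "f \<in> Hom C c b"
    and y: "\<And>j. j \<in> I \<Longrightarrow> y j \<in> fob (F j) b \<and> y' j \<in> fob (F j) b \<and> fmap (F j) b c f (y j) = fmap (F j) b c f (y' j)"
  shows "\<exists>d\<in>B. \<exists>k\<in>Hom C d b. \<exists>h\<in>Hom C c d. f = Comp C c d b k h \<and>
    (\<forall>j\<in>I. fmap (F j) b d k (y j) = fmap (F j) b d k (y' j))"
  using I F y
proof (induction I rule: finite_induct)
  interpret B: lexc C B by unfold_locales (fact B)
  case empty
  have "b \<in> Ob C" using b by (rule B.B_Ob)
  then show ?case by (intro bexI[OF _ b] bexI[of _ "idn C b"] bexI[OF _ f]) (use f c in auto)
next
  case (insert i I)
  interpret B: lexc C B by unfold_locales (fact B)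
  have bO: "b \<in> Ob C" using b by (rule B.B_Ob)
  obtain d k h where d: "d \<in> B" "k \<in> Hom C d b" "h \<in> Hom C c d" "f = Comp C c d b k h"
    "\<forall>j\<in>I. fmap (F j) b d k (y j) = fmap (F j) b d k (y' j)"
    using insert.IH insert.prems by auto
  have dO: "d \<in> Ob C" using d(1) by (rule B.B_Ob)
  have Fi: "presented B B (F i)" and yi: "y i \<in> fob (F i) b" "y' i \<in> fob (F i) b"
    and eq: "fmap (F i) b c f (y i) = fmap (F i) b c f (y' i)"
    using insert.prems by auto
  have FO: "F i \<in> Ob P" using Fi by (rule presented_Ob)
  have ky: "fmap (F i) b d k (y i) \<in> fob (F i) d" "fmap (F i) b d k (y' i) \<in> fob (F i) d"
    using FO yi d dO bO by auto
  have "fmap (F i) d c h (fmap (F i) b d k (y i)) = fmap (F i) d c h (fmap (F i) b d k (y' i))"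
    using eq act_Comp[OF FO d(3,2) yi(1) c dO bO] act_Comp[OF FO d(3,2) yi(2) c dO bO] d(4) by simp
  then obtain r s t l where r: "r \<in> B" "s \<in> Hom C r d" "t \<in> Hom C r d" "l \<in> Hom C c r"
    "h = Comp C c r d s l" "h = Comp C c r d t l"
    "fmap (F i) d r s (fmap (F i) b d k (y i)) = fmap (F i) d r t (fmap (F i) b d k (y' i))"
    using presented_rel[OF Fi c d(1,1,3,3) ky] by metis
  have rO: "r \<in> Ob C" using r(1) by (rule B.B_Ob)
  obtain e m where e: "e \<in> B" "is_equaliser C r d s t e m" using B.equaliser[OF r(1) d(1) r(2,3)] .
  note ein = equaliser_in[OF e(2)]
  have "Comp C c r d s l = Comp C c r d t l" using r by simp
  then obtain n where n: "n \<in> Hom C c e" "Comp C c e r m n = l"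
    using equaliser_ex[OF e(2) c r(4)] by blast
  let ?k = "Comp C e d b k (Comp C e r d s m)"
  have sm: "Comp C e r d s m \<in> Hom C e d" using ein by simp
  have kk: "?k \<in> Hom C e b" using sm d dO bO ein by simp
  have act: "fmap (F j) b e ?k x = fmap (F j) r e m (fmap (F j) d r s (fmap (F j) b d k x))"
    if "F j \<in> Ob P" "x \<in> fob (F j) b" for j x
    using that d dO bO ein act_Comp[OF that(1) sm d(2) that(2)] act_Comp[OF that(1) ein(6,4)] by simp
  have act': "fmap (F j) b e ?k x = fmap (F j) r e m (fmap (F j) d r t (fmap (F j) b d k x))"
    if "F j \<in> Ob P" "x \<in> fob (F j) b" for j x
    using that d dO bO ein act_Comp[OF that(1) sm d(2) that(2)] act_Comp[OF that(1) ein(6,5)] by simp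
  have "f = Comp C c e b ?k n"
    using d(2,4) r(2,4,5) n ein(1-6) dO bO c by (simp flip: assoc)
  moreover have "fmap (F j) b e ?k (y j) = fmap (F j) b e ?k (y' j)" if j: "j \<in> insert i I" for j
  proof (cases "j = i")
    case True
    show ?thesis unfolding True act[OF FO yi(1)] act'[OF FO yi(2)] r(7) ..
  next
    case False
    then have jI: "j \<in> I" using j by simp
    then have *: "F j \<in> Ob P" "y j \<in> fob (F j) b" "y' j \<in> fob (F j) b"
      using insert.prems presented_Ob by blast+
    show ?thesis unfolding act[OF *(1,2)] act[OF *(1,3)] bspec[OF d(5) jI] ..
  qed
  ultimately show ?case using e(1) kk n(1) by blast
qed

text \<open>An equality in \<open>Q\<close> at \<open>c\<close> comes from an element
  \<open>w\<close> of \<open>R c\<close>, itself a restriction of some \<open>x\<close> over an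
  object \<open>d\<close> of \<open>B\<close>. The span comparing \<open>y\<close> with
  \<open>\<sigma> x\<close> and the span comparing \<open>\<tau> x\<close> with \<open>y'\<close>
  each have a leg into \<open>d\<close>; over the pullback of these legs the restriction of
  \<open>x\<close> relates \<open>y\<close> and \<open>y'\<close>.\<close>

lemma presented_quotient:
  assumes q: "pointwise_quotient R X \<sigma> \<tau> Q q" and B: "lex_closed C B"
    and R: "presented B B R" and X: "presented B B X"
  shows "presented B B Q"
  unfolding presented_def
proof (intro conjI ballI impI)
  interpret B: lexc C B by unfold_locales (fact B)
  have i: "R \<in> Ob P" "X \<in> Ob P" "Q \<in> Ob P" "\<sigma> \<in> Hom P R X" "\<tau> \<in> Hom P R X" "q \<in> Hom P X Q"
    and s: "\<And>a. a \<in> Ob C \<Longrightarrow> q a ` fob X a = fob Q a"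
    and k: "\<And>a x y. \<lbrakk>a \<in> Ob C; x \<in> fob X a; y \<in> fob X a\<rbrakk> \<Longrightarrow> q a x = q a y \<longleftrightarrow> (\<exists>w\<in>fob R a. \<sigma> a w = x \<and> \<tau> a w = y)"
    using q unfolding pointwise_quotient_def by blast+
  show "Q \<in> Ob P" by fact
  fix c assume c: "c \<in> Ob C"
  {
    fix z assume "z \<in> fob Q c"
    then have "z \<in> q c ` fob X c" using s c by simp
    then obtain x where x: "x \<in> fob X c" "z = q c x" by blast
    obtain b f y where b: "b \<in> B" "f \<in> Hom C c b" "y \<in> fob X b" "x = fmap X b c f y"
      using presented_gen[OF X c x(1)] .
    then have "z = fmap Q b c f (q b y)" "q b y \<in> fob Q b"
      using hom_act[OF i(6) b(2,3) c] x i B.B_Ob by auto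
    then show "\<exists>b\<in>B. \<exists>f\<in>Hom C c b. \<exists>y\<in>fob Q b. z = fmap Q b c f y" using b by blast
  }
  fix b b' f g v v' assume b: "b \<in> B" "b' \<in> B" and f: "f \<in> Hom C c b" and g: "g \<in> Hom C c b'"
    and v: "v \<in> fob Q b" "v' \<in> fob Q b'" and eq: "fmap Q b c f v = fmap Q b' c g v'"
  have bO: "b \<in> Ob C" "b' \<in> Ob C" using b B.B_Ob by auto
  have "v \<in> q b ` fob X b" "v' \<in> q b' ` fob X b'" using v s bO by auto
  then obtain y y' where y: "y \<in> fob X b" "v = q b y" and y': "y' \<in> fob X b'" "v' = q b' y'" by blast
  have "q c (fmap X b c f y) = q c (fmap X b' c g y')"
    using eq y y' hom_act[OF i(6)] f g c bO by simp
  then obtain w where w: "w \<in> fob R c" "\<sigma> c w = fmap X b c f y" "\<tau> c w = fmap X b' c g y'"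
    using k[OF c] f g y y' i c bO by auto
  obtain d h x where d: "d \<in> B" "h \<in> Hom C c d" "x \<in> fob R d" "w = fmap R d c h x"
    using presented_gen[OF R c w(1)] .
  have dO: "d \<in> Ob C" using d B.B_Ob by blast
  have sx: "\<sigma> d x \<in> fob X d" "\<tau> d x \<in> fob X d" using i d dO by auto
  have "fmap X b c f y = fmap X d c h (\<sigma> d x)" using w(2) d hom_act[OF i(4) d(2,3) c dO] by simp
  then obtain r1 s1 t1 h1 where r1: "r1 \<in> B" "s1 \<in> Hom C r1 b" "t1 \<in> Hom C r1 d" "h1 \<in> Hom C c r1"
    "f = Comp C c r1 b s1 h1" "h = Comp C c r1 d t1 h1" "fmap X b r1 s1 y = fmap X d r1 t1 (\<sigma> d x)"
    using presented_rel[OF X c b(1) d(1) f d(2) y(1) sx(1)] by metis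
  have "fmap X d c h (\<tau> d x) = fmap X b' c g y'" using w(3) d hom_act[OF i(5) d(2,3) c dO] by simp
  then obtain r2 s2 t2 h2 where r2: "r2 \<in> B" "s2 \<in> Hom C r2 d" "t2 \<in> Hom C r2 b'" "h2 \<in> Hom C c r2"
    "h = Comp C c r2 d s2 h2" "g = Comp C c r2 b' t2 h2" "fmap X d r2 s2 (\<tau> d x) = fmap X b' r2 t2 y'"
    using presented_rel[OF X c d(1) b(2) d(2) g sx(2) y'(1)] by metis
  obtain p p1 p2 where p: "p \<in> B" "is_pullback C r1 r2 d t1 s2 p p1 p2"
    using B.pullback[OF r1(1) r2(1) d(1) r1(3) r2(2)] .
  note pin = pullback_in[OF p(2)]
  have "Comp C c r1 d t1 h1 = Comp C c r2 d s2 h2" using r1 r2 by simp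
  then obtain l where l: "l \<in> Hom C c p" "Comp C c p r1 p1 l = h1" "Comp C c p r2 p2 l = h2"
    using pullback_ex[OF p(2) c r1(4) r2(4)] by blast
  let ?s = "Comp C p r1 b s1 p1" and ?t = "Comp C p r2 b' t2 p2" and ?u = "Comp C p r1 d t1 p1"
  have u: "?u \<in> Hom C p d" "?s \<in> Hom C p b" "?t \<in> Hom C p b'" using pin r1 r2 bO by auto
  have "fmap X b p ?s y = fmap X r1 p p1 (fmap X d r1 t1 (\<sigma> d x))"
    using act_Comp[OF i(2) pin(7) r1(2) y(1)] pin bO r1 by simp
  also have "\<dots> = fmap X d p ?u (\<sigma> d x)"
    using act_Comp[OF i(2) pin(7) r1(3) sx(1)] pin by simp
  finally have 1: "fmap X b p ?s y = \<sigma> p (fmap R d p ?u x)"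
    using hom_act[OF i(4) u(1) d(3)] pin by simp
  have "fmap X b' p ?t y' = fmap X r2 p p2 (fmap X d r2 s2 (\<tau> d x))"
    using act_Comp[OF i(2) pin(8) r2(3) y'(1)] pin bO r2 by simp
  also have "\<dots> = fmap X d p ?u (\<tau> d x)"
    using act_Comp[OF i(2) pin(8) r2(2) sx(2)] pin by simp
  finally have 2: "fmap X b' p ?t y' = \<tau> p (fmap R d p ?u x)"
    using hom_act[OF i(5) u(1) d(3)] pin by simp
  have "q p (fmap X b p ?s y) = q p (fmap X b' p ?t y')"
    using k[of p "fmap X b p ?s y" "fmap X b' p ?t y'"] 1 2 pin u d y y' bO i by auto
  then have "fmap Q b p ?s v = fmap Q b' p ?t v'"
    using hom_act[OF i(6) u(2) y(1)] hom_act[OF i(6) u(3) y'(1)] y y' pin bO by simp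
  moreover have "f = Comp C c p b ?s l" "g = Comp C c p b' ?t l"
    using r1(2,5) r2(3,6) l pin bO c by (simp_all flip: assoc)
  ultimately show "\<exists>r\<in>B. \<exists>s\<in>Hom C r b. \<exists>t\<in>Hom C r b'. \<exists>h\<in>Hom C c r. f = Comp C c r b s h \<and>
           g = Comp C c r b' t h \<and> fmap Q b r s v = fmap Q b' r t v'"
    using p(1) u(2,3) l(1) by blast
qed

end

section \<open>Smallness of quotients, representables and finite limits\<close>

locale lex_presheaves = presheaves C for C :: "('o, 'u) cat" +
  assumes fc: "finitely_complete C"
begin

abbreviation Sm :: "('o, 'u) presheaf set" where "Sm \<equiv> {F. small_presheaf C F}"

lemma small_psh_eq: "small_psh C = full_subcat P Sm"
  by (simp add: small_psh_def)

lemma Sm_Ob: "Sm \<subseteq> Ob P"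
  using small_presheaf_iff by blast

text \<open>Presentations over different sets are made comparable by closing the union of these sets
  under finite limits and enlarging every presentation to the result.\<close>

lemma small_family:
  assumes I: "finite I" and F: "\<And>j. j \<in> I \<Longrightarrow> small_presheaf C (F j)"
  obtains B where "B \<subseteq> Ob C" "small TYPE('u) B" "lex_closed C B" "\<And>j. j \<in> I \<Longrightarrow> presented B B (F j)"
proof -
  have "\<exists>A B. A \<subseteq> B \<and> small TYPE('u) B \<and> lex_closed C B \<and> presented A B (F j)" if "j \<in> I" for j
    using small_imp_presented[OF fc F[OF that]] by metis
  then obtain A B where AB: "\<And>j. j \<in> I \<Longrightarrow> A j \<subseteq> B j" "\<And>j. j \<in> I \<Longrightarrow> small TYPE('u) (B j)"
    "\<And>j. j \<in> I \<Longrightarrow> lex_closed C (B j)" "\<And>j. j \<in> I \<Longrightarrow> presented (A j) (B j) (F j)"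
    by metis
  have "(\<Union>j\<in>I. B j) \<subseteq> Ob C" using AB(3) unfolding lex_closed_def by blast
  moreover have "small TYPE('u) (\<Union>j\<in>I. B j)" by (rule small_Union[OF small_finite[OF I] AB(2)])
  ultimately obtain D where D: "(\<Union>j\<in>I. B j) \<subseteq> D" "small TYPE('u) D" "lex_closed C D"
    using small_lex_closure[OF fc] by blast
  show ?thesis
  proof (rule that[OF _ D(2,3)])
    show "D \<subseteq> Ob C" using D(3) by (simp add: lex_closed_def)
    show "presented D D (F j)" if "j \<in> I" for j
      by (rule presented_mono[OF AB(4)[OF that] _ _ D(3)]) (use AB(1) D(1) that in blast)+
  qed
qed

lemma small_quotient:
  assumes q: "pointwise_quotient R X \<sigma> \<tau> Q q" and R: "small_presheaf C R" and X: "small_presheaf C X"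
  shows "small_presheaf C Q"
proof -
  obtain B where B: "B \<subseteq> Ob C" "small TYPE('u) B" "lex_closed C B"
    "\<And>F. F \<in> {R, X} \<Longrightarrow> presented B B F"
    using small_family[of "{R, X}" "\<lambda>F. F"] R X by auto
  then show ?thesis using presented_imp_small[OF B(1,2)] presented_quotient[OF q B(3)] by simp
qed

lemma small_W:
  assumes c: "c \<in> Ob C"
  shows "small_presheaf C (W c)"
proof -
  obtain B where B: "{c} \<subseteq> B" "small TYPE('u) B" "lex_closed C B"
    using small_lex_closure[OF fc, of "{c}"] c small_finite[of "{c}"] by blast
  then show ?thesis using presented_imp_small[OF _ B(2) presented_W[OF B(3)]]
    by (simp add: lex_closed_def)
qed

lemma W_Sm: "W ` Ob C \<subseteq> Sm"
  using small_W by auto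

text \<open>The pointwise limit is small because both clauses of a presentation reduce to finitely
  many equations between elements of the presheaves \<open>D j\<close>.\<close>

lemma small_limit:
  assumes J: "finite_category J" and D: "is_functor J (small_psh C) D"
  obtains F \<pi> where "is_limit J (small_psh C) D F \<pi>"
proof -
  have D': "is_functor J (full_subcat P Sm) D" using D small_psh_eq by simp
  have fJ: "finite (Ob J)" using J by (simp add: finite_category_def)
  have Ds: "small_presheaf C (fob D j)" and Dj: "fob D j \<in> Ob P" if "j \<in> Ob J" for j
    using functor_ob[OF D' that] Sm_Ob by auto
  have Du: "fmap D i j u \<in> Hom P (fob D i) (fob D j)" if "i \<in> Ob J" "j \<in> Ob J" "u \<in> Hom J i j" for i j u
    using functor_hom[OF D' that(3,1,2)] by simp
  obtain B where B: "B \<subseteq> Ob C" "small TYPE('u) B" "lex_closed C B" and pres: "\<And>j. j \<in> Ob J \<Longrightarrow> presented B B (fob D j)"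
    using small_family[OF fJ, of "fob D"] Ds by metis
  interpret B: lexc C B by unfold_locales (fact B(3))
  \<comment> \<open>Families are taken extensional on \<open>Ob J\<close>, so that agreement on
    \<open>Ob J\<close> is equality.\<close>
  define X where "X a = {y \<in> Pi\<^sub>E (Ob J) (\<lambda>j. fob (fob D j) a). compatible J D a y}" for a
  define act where "act = (\<lambda>b a f y. \<lambda>j\<in>Ob J. fmap (fob D j) b a f (y j))"
  have Xj: "y j \<in> fob (fob D j) a" if "y \<in> X a" "j \<in> Ob J" for y j a using that by (auto simp: X_def)
  have actj: "act b a f y j = fmap (fob D j) b a f (y j)" if "j \<in> Ob J" for b a f y j
    using that by (simp add: act_def)
  have Xeq: "y = y'" if "y \<in> X a" "y' \<in> X a" "\<forall>j\<in>Ob J. y j = y' j" for y y' a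
    using that unfolding X_def by (intro PiE_ext[of y "Ob J" _ y']) auto
  have XI: "restrict y (Ob J) \<in> X a" if "compatible J D a y" for y a
    using that by (auto simp: X_def compatible_def)
  have act_in: "act b a f y \<in> X a" if o: "a \<in> Ob C" "b \<in> Ob C" "f \<in> Hom C a b" and y: "y \<in> X b" for a b f y
    unfolding act_def
  proof (rule XI)
    show "compatible J D a (\<lambda>j. fmap (fob D j) b a f (y j))"
      unfolding compatible_def
    proof (intro conjI ballI)
      show "fmap (fob D j) b a f (y j) \<in> fob (fob D j) a" if "j \<in> Ob J" for j
        using Dj that o Xj[OF y that] by simp
      fix i j u assume ij: "i \<in> Ob J" "j \<in> Ob J" "u \<in> Hom J i j"
      have "fmap D i j u b (y i) = y j" using y ij by (simp add: X_def compatible_def)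
      then show "fmap D i j u a (fmap (fob D i) b a f (y i)) = fmap (fob D j) b a f (y j)"
        using hom_act[OF Du[OF ij] o(3) Xj[OF y ij(1)] o(1,2)] by simp
    qed
  qed
  obtain F e where F: "F \<in> Ob P" and e: "\<And>a. a \<in> Ob C \<Longrightarrow> bij_betw (e a) (X a) (fob F a)"
    and eact: "\<And>a b f x. \<lbrakk>a \<in> Ob C; b \<in> Ob C; f \<in> Hom C a b; x \<in> X b\<rbrakk> \<Longrightarrow> fmap F b a f (e b x) = e a (act b a f x)"
  proof (rule realise[of X act])
    show "small TYPE('u) (X a)" if "a \<in> Ob C" for a
    proof (rule small_subset)
      show "small TYPE('u) (Pi\<^sub>E (Ob J) (\<lambda>j. fob (fob D j) a))"
        by (rule small_PiE[OF small_finite[OF fJ] small_fob[OF Dj that]])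
    qed (auto simp: X_def)
    show "act a a (idn C a) x = x" if "a \<in> Ob C" "x \<in> X a" for a x
      by (rule Xeq[OF act_in[OF that(1,1) idn_in[OF that(1)] that(2)] that(2)])
        (use that Dj Xj[OF that(2)] in \<open>simp add: actj\<close>)
    show "act c a (Comp C a b c g f) x = act b a f (act c b g x)"
      if o: "a \<in> Ob C" "b \<in> Ob C" "c \<in> Ob C" and f: "f \<in> Hom C a b" "g \<in> Hom C b c" and x: "x \<in> X c" for a b c f g x
    proof (rule Xeq)
      show "act c a (Comp C a b c g f) x \<in> X a" "act b a f (act c b g x) \<in> X a"
        using o f x by (auto intro!: act_in)
      show "\<forall>j\<in>Ob J. act c a (Comp C a b c g f) x j = act b a f (act c b g x) j"
        using act_Comp[OF Dj f Xj[OF x] o] by (simp add: actj)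
    qed
  qed (use act_in in blast)+
  have ein: "e a y \<in> fob F a" if "a \<in> Ob C" "y \<in> X a" for a y
    using bij_betwE[OF e[OF that(1)]] that(2) by blast
  have esurj: "\<exists>y\<in>X a. x = e a y" if "a \<in> Ob C" "x \<in> fob F a" for a x
    using e[OF that(1)] that(2) unfolding bij_betw_def by blast
  define \<pi> where "\<pi> j = mk_hom F (\<lambda>a x. the_inv_into (X a) (e a) x j)" for j
  have \<pi>e: "\<pi> j a (e a y) = y j" if "a \<in> Ob C" "y \<in> X a" for j a y
    using that ein the_inv_into_f_f[OF bij_betw_imp_inj_on[OF e[OF that(1)]] that(2)] by (simp add: \<pi>_def)
  have \<pi>: "\<pi> j \<in> Hom P F (fob D j)" if j: "j \<in> Ob J" for j
    unfolding \<pi>_def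
  proof (rule mk_hom[OF F])
    have inv: "the_inv_into (X a) (e a) (e a y) = y" if "a \<in> Ob C" "y \<in> X a" for a y
      using the_inv_into_f_f[OF bij_betw_imp_inj_on[OF e[OF that(1)]] that(2)] .
    show "the_inv_into (X a) (e a) x j \<in> fob (fob D j) a" if "a \<in> Ob C" "x \<in> fob F a" for a x
      using esurj[OF that] inv[OF that(1)] Xj j by auto
    show "the_inv_into (X a) (e a) (fmap F b a f x) j = fmap (fob D j) b a f (the_inv_into (X b) (e b) x j)"
      if "a \<in> Ob C" "b \<in> Ob C" "f \<in> Hom C a b" "x \<in> fob F b" for a b f x
      using esurj[OF that(2,4)] inv eact[OF that(1-3)] act_in[OF that(1-3)] that actj[OF j] by auto
  qed
  have "presented B B F"
    unfolding presented_def
  proof (intro conjI ballI impI F)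
    fix c assume c: "c \<in> Ob C"
    {
      fix z assume "z \<in> fob F c"
      then obtain x where x: "x \<in> X c" "z = e c x" using esurj[OF c] by blast
      have "\<exists>b\<in>B. \<exists>f\<in>Hom C c b. \<exists>y. \<forall>j\<in>Ob J. y j \<in> fob (fob D j) b \<and> x j = fmap (fob D j) b c f (y j)"
        by (rule presented_family[OF fJ B(3) pres c Xj[OF x(1)]])
      then obtain b f y where b: "b \<in> B" "f \<in> Hom C c b"
        and y: "\<forall>j\<in>Ob J. y j \<in> fob (fob D j) b \<and> x j = fmap (fob D j) b c f (y j)"
        by blast
      have bO: "b \<in> Ob C" using b B.B_Ob by blast
      let ?I = "SIGMA i:Ob J. SIGMA j:Ob J. Hom J i j"
      have fI: "finite ?I" using J by (simp add: finite_category_def)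
      \<comment> \<open>The lifts \<open>y j\<close> are known to be compatible only after
        restriction along \<open>f\<close>. One equation for each arrow of \<open>J\<close>, indexed
        by triples \<open>(i, j, u)\<close>, makes them compatible over some \<open>d\<close> in
        \<open>B\<close>.\<close>
      have "\<exists>d\<in>B. \<exists>k\<in>Hom C d b. \<exists>h\<in>Hom C c d. f = Comp C c d b k h \<and>
        (\<forall>l\<in>?I. fmap (fob D (fst (snd l))) b d k (fmap D (fst l) (fst (snd l)) (snd (snd l)) b (y (fst l)))
          = fmap (fob D (fst (snd l))) b d k (y (fst (snd l))))"
      proof (rule presented_equations[OF fI B(3) _ c b])
        show "presented B B (fob D (fst (snd l)))" if "l \<in> ?I" for l
          using that pres by auto
        fix l assume "l \<in> ?I"
        then obtain i j u where l: "l = (i, j, u)" and ij: "i \<in> Ob J" "j \<in> Ob J" "u \<in> Hom J i j" by auto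
        have "fmap D i j u c (x i) = x j" using x ij by (simp add: X_def compatible_def)
        then have "fmap (fob D j) b c f (fmap D i j u b (y i)) = fmap (fob D j) b c f (y j)"
          using y ij hom_act[OF Du[OF ij] b(2) _ c bO] by simp
        then show "fmap D (fst l) (fst (snd l)) (snd (snd l)) b (y (fst l)) \<in> fob (fob D (fst (snd l))) b \<and>
          y (fst (snd l)) \<in> fob (fob D (fst (snd l))) b \<and>
          fmap (fob D (fst (snd l))) b c f (fmap D (fst l) (fst (snd l)) (snd (snd l)) b (y (fst l))) =
          fmap (fob D (fst (snd l))) b c f (y (fst (snd l)))"
          using l y ij hom_in[OF Du[OF ij] bO] by simp
      qed
      then obtain d k h where d: "d \<in> B" "k \<in> Hom C d b" "h \<in> Hom C c d" "f = Comp C c d b k h"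
        and eq: "\<forall>l\<in>?I. fmap (fob D (fst (snd l))) b d k (fmap D (fst l) (fst (snd l)) (snd (snd l)) b (y (fst l)))
          = fmap (fob D (fst (snd l))) b d k (y (fst (snd l)))" by blast
      have dO: "d \<in> Ob C" using d B.B_Ob by blast
      have "compatible J D d (\<lambda>j. fmap (fob D j) b d k (y j))"
        unfolding compatible_def
      proof (intro conjI ballI)
        show "fmap (fob D j) b d k (y j) \<in> fob (fob D j) d" if "j \<in> Ob J" for j
          using y that d dO bO Dj by simp
        fix i j u assume ij: "i \<in> Ob J" "j \<in> Ob J" "u \<in> Hom J i j"
        then have "fmap (fob D j) b d k (fmap D i j u b (y i)) = fmap (fob D j) b d k (y j)"
          using bspec[OF eq, of "(i, j, u)"] by simp
        then show "fmap D i j u d (fmap (fob D i) b d k (y i)) = fmap (fob D j) b d k (y j)"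
          using hom_act[OF Du[OF ij] d(2) _ dO bO] y ij by simp
      qed
      then have Xd: "restrict (\<lambda>j. fmap (fob D j) b d k (y j)) (Ob J) \<in> X d" (is "?y \<in> _") by (rule XI)
      have "x = act d c h ?y"
      proof (rule Xeq[OF x(1) act_in[OF c dO d(3) Xd]])
        show "\<forall>j\<in>Ob J. x j = act d c h ?y j"
          using y act_Comp[OF Dj d(3,2) _ c dO bO] d(4) by (simp add: actj)
      qed
      then have "z = fmap F d c h (e d ?y)" using x eact[OF c dO d(3) Xd] by simp
      then show "\<exists>b\<in>B. \<exists>f\<in>Hom C c b. \<exists>y\<in>fob F b. z = fmap F b c f y"
        using d ein[OF dO Xd] by blast
    }
    fix b b' f g v v' assume b: "b \<in> B" "b' \<in> B" and f: "f \<in> Hom C c b" and g: "g \<in> Hom C c b'"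
      and v: "v \<in> fob F b" "v' \<in> fob F b'" and eq: "fmap F b c f v = fmap F b' c g v'"
    have bO: "b \<in> Ob C" "b' \<in> Ob C" using b B.B_Ob by auto
    obtain y where y: "y \<in> X b" "v = e b y" using esurj[OF bO(1) v(1)] by blast
    obtain y' where y': "y' \<in> X b'" "v' = e b' y'" using esurj[OF bO(2) v(2)] by blast
    have "e c (act b c f y) = e c (act b' c g y')"
      using eq y y' eact[OF c bO(1) f] eact[OF c bO(2) g] by simp
    then have "act b c f y = act b' c g y'"
      using inj_onD[OF bij_betw_imp_inj_on[OF e[OF c]]] act_in c bO f g y(1) y'(1) by blast
    then have eqj: "fmap (fob D j) b c f (y j) = fmap (fob D j) b' c g (y' j)" if "j \<in> Ob J" for j
      using actj[OF that] by metis
    obtain p p1 p2 where p: "p \<in> B" "is_product C b b' p p1 p2" using B.product[OF b] .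
    note pin = product_in[OF p(2)]
    obtain h where h: "h \<in> Hom C c p" "Comp C c p b p1 h = f" "Comp C c p b' p2 h = g"
      using product_ex[OF p(2) c f g] .
    \<comment> \<open>For the relations, both elements are moved to the product of \<open>b\<close>
      and \<open>b'\<close>, where their components are equated for each \<open>j\<close>. The two
      legs of the span are the projections after \<open>k\<close>.\<close>
    have "\<exists>d\<in>B. \<exists>k\<in>Hom C d p. \<exists>l\<in>Hom C c d. h = Comp C c d p k l \<and>
        (\<forall>j\<in>Ob J. fmap (fob D j) p d k (fmap (fob D j) b p p1 (y j)) = fmap (fob D j) p d k (fmap (fob D j) b' p p2 (y' j)))"
    proof (rule presented_equations[OF fJ B(3) pres c p(1) h(1)])
      fix j assume j: "j \<in> Ob J"
      show "fmap (fob D j) b p p1 (y j) \<in> fob (fob D j) p \<and> fmap (fob D j) b' p p2 (y' j) \<in> fob (fob D j) p \<and>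
        fmap (fob D j) p c h (fmap (fob D j) b p p1 (y j)) = fmap (fob D j) p c h (fmap (fob D j) b' p p2 (y' j))"
        using Dj[OF j] pin Xj[OF y(1) j] Xj[OF y'(1) j] act_Comp[OF Dj[OF j] h(1) pin(4) Xj[OF y(1) j]]
          act_Comp[OF Dj[OF j] h(1) pin(5) Xj[OF y'(1) j]] h eqj[OF j] c by simp
    qed
    then obtain d k l where d: "d \<in> B" "k \<in> Hom C d p" "l \<in> Hom C c d" "h = Comp C c d p k l"
      and eqd: "\<forall>j\<in>Ob J. fmap (fob D j) p d k (fmap (fob D j) b p p1 (y j)) = fmap (fob D j) p d k (fmap (fob D j) b' p p2 (y' j))"
      by blast
    have dO: "d \<in> Ob C" using d B.B_Ob by blast
    let ?s = "Comp C d p b p1 k" and ?t = "Comp C d p b' p2 k"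
    have s: "?s \<in> Hom C d b" "?t \<in> Hom C d b'" using d dO pin by auto
    have "act b d ?s y = act b' d ?t y'"
    proof (rule Xeq)
      show "act b d ?s y \<in> X d" "act b' d ?t y' \<in> X d" using act_in dO bO s y y' by auto
      show "\<forall>j\<in>Ob J. act b d ?s y j = act b' d ?t y' j"
      proof
        fix j assume j: "j \<in> Ob J"
        show "act b d ?s y j = act b' d ?t y' j"
          unfolding actj[OF j] act_Comp[OF Dj[OF j] d(2) pin(4) Xj[OF y(1) j] dO pin(3,1)]
            act_Comp[OF Dj[OF j] d(2) pin(5) Xj[OF y'(1) j] dO pin(3,2)]
          by (rule bspec[OF eqd j])
      qed
    qed
    then have "fmap F b d ?s v = fmap F b' d ?t v'"
      using eact[OF dO bO(1) s(1) y(1)] eact[OF dO bO(2) s(2) y'(1)] y y' by simp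
    moreover have "f = Comp C c d b ?s l" "g = Comp C c d b' ?t l"
      using h d pin dO c by (simp_all add: assoc)
    ultimately show "\<exists>r\<in>B. \<exists>s\<in>Hom C r b. \<exists>t\<in>Hom C r b'. \<exists>h\<in>Hom C c r. f = Comp C c r b s h \<and>
           g = Comp C c r b' t h \<and> fmap F b r s v = fmap F b' r t v'"
      using d(1,3) s by blast
  qed
  then have Fs: "F \<in> Sm" using presented_imp_small[OF B(1,2)] by simp
  have cone: "is_cone J (full_subcat P Sm) D F \<pi>"
    unfolding is_cone_def
  proof (intro conjI ballI)
    fix i j u assume ij: "i \<in> Ob J" "j \<in> Ob J" "u \<in> Hom J i j"
    have "Comp P F (fob D i) (fob D j) (fmap D i j u) (\<pi> i) = \<pi> j"
    proof (rule hom_eqI[OF psh_Comp_in[OF \<pi>[OF ij(1)] Du[OF ij] F] \<pi>[OF ij(2)]])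
      fix a x assume a: "a \<in> Ob C" "x \<in> fob F a"
      then obtain y where y: "y \<in> X a" "x = e a y" using esurj by blast
      then have "fmap D i j u a (y i) = y j" using ij by (simp add: X_def compatible_def)
      then show "Comp P F (fob D i) (fob D j) (fmap D i j u) (\<pi> i) a x = \<pi> j a x"
        using a y \<pi>e[OF a(1) y(1)] by simp
    qed
    then show "Comp (full_subcat P Sm) F (fob D i) (fob D j) (fmap D i j u) (\<pi> i) = \<pi> j" by simp
  qed (use Fs \<pi> in auto)
  have "pointwise_limit J D F \<pi>"
    unfolding pointwise_limit_def
  proof (intro ballI conjI allI impI)
    fix a assume a: "a \<in> Ob C"
    show "\<exists>x\<in>fob F a. \<forall>j\<in>Ob J. \<pi> j a x = y j" if "compatible J D a y" for y
      using XI[OF that] ein[OF a XI[OF that]] \<pi>e[OF a XI[OF that]]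
      by (intro bexI[of _ "e a (restrict y (Ob J))"]) auto
    fix x x' assume x: "x \<in> fob F a" "x' \<in> fob F a" "\<forall>j\<in>Ob J. \<pi> j a x = \<pi> j a x'"
    obtain y y' where y: "y \<in> X a" "x = e a y" "y' \<in> X a" "x' = e a y'"
      using esurj[OF a x(1)] esurj[OF a x(2)] by blast
    then have "y = y'" using x(3) \<pi>e[OF a] by (intro Xeq[of y a y']) auto
    then show "x = x'" using y by simp
  qed
  then have "is_limit J (full_subcat P Sm) D F \<pi>"
    by (rule pointwise_limit_imp_limit[OF Sm_Ob D' cone])
  then show ?thesis using that small_psh_eq by simp
qed

lemma finitely_complete_small_psh: "finitely_complete (small_psh C)"
  unfolding finitely_complete_def
  using small_limit category_full_subcat[OF category_psh Sm_Ob] small_psh_eq by metis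

lemma yoneda_functor_small: "is_functor C (small_psh C) (yoneda C)"
  unfolding small_psh_eq using W_Sm by (intro functor_to_full_subcat[OF yoneda_functor])

text \<open>A pointwise limit cone is a limit cone, and at stage \<open>a\<close> the claim is the
  universal property in \<open>C\<close> for cones with vertex \<open>a\<close>.\<close>

lemma yoneda_lex: "lex_functor C (small_psh C) (yoneda C)"
  unfolding lex_functor_def
proof (intro conjI allI impI fc finitely_complete_small_psh yoneda_functor_small)
  fix J :: "(nat, nat) cat" and D c \<pi>
  assume J: "finite_category J" and D: "is_functor J C D" and l: "is_limit J C D c \<pi>"
  have Dj: "fob D j \<in> Ob C" if "j \<in> Ob J" for j using functor_ob[OF D that] .
  have c: "c \<in> Ob C" "\<And>j. j \<in> Ob J \<Longrightarrow> \<pi> j \<in> Hom C c (fob D j)"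
    using is_limit_cone[OF l] by (auto simp: is_cone_def)
  have D': "is_functor J (full_subcat P Sm) (fcomp (yoneda C) D)"
    using is_functor_fcomp[OF D yoneda_functor_small] small_psh_eq by simp
  have Y: "is_functor C (full_subcat P Sm) (yoneda C)"
    using yoneda_functor_small small_psh_eq by simp
  have "is_cone J (full_subcat P Sm) (fcomp (yoneda C) D) (W c) (\<lambda>j. fmap (yoneda C) c (fob D j) (\<pi> j))"
    unfolding is_cone_def
  proof (intro conjI ballI)
    show "W c \<in> Ob (full_subcat P Sm)" using c W_Sm by auto
    show "fmap (yoneda C) c (fob D j) (\<pi> j) \<in> Hom (full_subcat P Sm) (W c) (fob (fcomp (yoneda C) D) j)"
      if "j \<in> Ob J" for j using c Dj that by simp
    fix i j u assume ij: "i \<in> Ob J" "j \<in> Ob J" "u \<in> Hom J i j"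
    have "Comp C c (fob D i) (fob D j) (fmap D i j u) (\<pi> i) = \<pi> j"
      using is_limit_cone[OF l] ij by (simp add: is_cone_def)
    then show "Comp (full_subcat P Sm) (W c) (fob (fcomp (yoneda C) D) i) (fob (fcomp (yoneda C) D) j)
       (fmap (fcomp (yoneda C) D) i j u) (fmap (yoneda C) c (fob D i) (\<pi> i)) = fmap (yoneda C) c (fob D j) (\<pi> j)"
      using functor_Comp[OF Y c(2)[OF ij(1)] functor_hom[OF D ij(3,1,2)] c(1) Dj[OF ij(1)] Dj[OF ij(2)]]
      by simp
  qed
  moreover have "pointwise_limit J (fcomp (yoneda C) D) (W c) (\<lambda>j. fmap (yoneda C) c (fob D j) (\<pi> j))"
    unfolding pointwise_limit_def
  proof (intro ballI conjI allI impI)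
    fix a assume a: "a \<in> Ob C"
    show "\<exists>x\<in>fob (W c) a. \<forall>j\<in>Ob J. fmap (yoneda C) c (fob D j) (\<pi> j) a x = y j"
      if y: "compatible J (fcomp (yoneda C) D) a y" for y
    proof -
      have "is_cone J C D a y"
        unfolding is_cone_def
      proof (intro conjI ballI a)
        show yj: "y j \<in> Hom C a (fob D j)" if "j \<in> Ob J" for j
          using y that by (simp add: compatible_def)
        fix i j u assume ij: "i \<in> Ob J" "j \<in> Ob J" "u \<in> Hom J i j"
        then have "fmap (yoneda C) (fob D i) (fob D j) (fmap D i j u) a (y i) = y j"
          using y by (simp add: compatible_def)
        then show "Comp C a (fob D i) (fob D j) (fmap D i j u) (y i) = y j"
          using yoneda_app[OF a yj[OF ij(1)]] by simp
      qed
      from is_limit_ex[OF l this] show ?thesis using a by auto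
    qed
    show "x = x'" if "x \<in> fob (W c) a" "x' \<in> fob (W c) a"
      "\<forall>j\<in>Ob J. fmap (yoneda C) c (fob D j) (\<pi> j) a x = fmap (yoneda C) c (fob D j) (\<pi> j) a x'" for x x'
      by (rule is_limit_uniq[OF D l]) (use that a in auto)
  qed
  ultimately have "is_limit J (full_subcat P Sm) (fcomp (yoneda C) D) (W c) (\<lambda>j. fmap (yoneda C) c (fob D j) (\<pi> j))"
    by (rule pointwise_limit_imp_limit[OF Sm_Ob D'])
  then show "is_limit J (small_psh C) (fcomp (yoneda C) D) (W c) (\<lambda>j. fmap (yoneda C) c (fob D j) (\<pi> j))"
    by (simp add: small_psh_eq)
qed

end

section \<open>The weight for coequalisers of equivalence relations\<close>

lemma full_subcat_Ob [simp]: "full_subcat C (Ob C) = C"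
  by (cases C) (simp add: full_subcat_def)

lemma full_subcat_full_subcat [simp]: "full_subcat (full_subcat C S) T = full_subcat C T"
  by (simp add: full_subcat_def)

context presheaves
begin

text \<open>The coequaliser in the definition of the weight and the one furnished by a weighted
  colimit are arbitrary. Being isomorphic to the pointwise quotient, they inherit its description by
  elements.\<close>

lemma coequaliser_imp_pointwise_quotient:
  assumes pq: "pointwise_quotient R X \<sigma> \<tau> Q q" and S: "R \<in> S" "X \<in> S" "Q \<in> S" "S \<subseteq> Ob P"
    and co: "is_coequaliser (full_subcat P S) R X \<sigma> \<tau> Q' q'"
  shows "pointwise_quotient R X \<sigma> \<tau> Q' q'"
proof -
  interpret S: cat_base "full_subcat P S"
    by unfold_locales (rule category_full_subcat[OF category_psh S(4)])
  obtain k where k: "is_iso (full_subcat P S) Q Q' k" "Comp (full_subcat P S) X Q Q' k q = q'"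
    using S.coequaliser_unique[OF pointwise_quotient_coequaliser[OF pq S] co] .
  have "is_iso P Q Q' k" using k(1) by (simp add: is_iso_def)
  then obtain m where m: "k \<in> Hom P Q Q'" "m \<in> Hom P Q' Q"
    "\<And>a x. \<lbrakk>a \<in> Ob C; x \<in> fob Q a\<rbrakk> \<Longrightarrow> m a (k a x) = x" "\<And>a x. \<lbrakk>a \<in> Ob C; x \<in> fob Q' a\<rbrakk> \<Longrightarrow> k a (m a x) = x"
    by (rule iso_app) (rule that)
  have i: "R \<in> Ob P" "X \<in> Ob P" "Q \<in> Ob P" "\<sigma> \<in> Hom P R X" "\<tau> \<in> Hom P R X" "q \<in> Hom P X Q"
    and s: "\<And>a. a \<in> Ob C \<Longrightarrow> q a ` fob X a = fob Q a"
    and kk: "\<And>a x y. \<lbrakk>a \<in> Ob C; x \<in> fob X a; y \<in> fob X a\<rbrakk> \<Longrightarrow> q a x = q a y \<longleftrightarrow> (\<exists>w\<in>fob R a. \<sigma> a w = x \<and> \<tau> a w = y)"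
    using pq unfolding pointwise_quotient_def by blast+
  have q': "q' \<in> Hom P X Q'" "Q' \<in> Ob P" using coequaliser_in[OF co] S by auto
  have q'a: "q' a x = k a (q a x)" if "a \<in> Ob C" "x \<in> fob X a" for a x
    using that k(2) psh_Comp_app[of a x X Q Q' k q] by simp
  show ?thesis
    unfolding pointwise_quotient_def
  proof (intro conjI ballI i q')
    fix a assume a: "a \<in> Ob C"
    show "q' a ` fob X a = fob Q' a"
    proof
      show "fob Q' a \<subseteq> q' a ` fob X a"
      proof
        fix y assume y: "y \<in> fob Q' a"
        then have "m a y \<in> q a ` fob X a" using s[OF a] m(2) a by simp
        then obtain x where "x \<in> fob X a" "m a y = q a x" by blast
        then show "y \<in> q' a ` fob X a" using q'a[OF a] m(4)[OF a y] by (metis image_eqI)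
      qed
    qed (use hom_in[OF q'(1) a] in blast)
    fix x y assume xy: "x \<in> fob X a" "y \<in> fob X a"
    have "q a x \<in> fob Q a" "q a y \<in> fob Q a" using xy i a by auto
    then have "q' a x = q' a y \<longleftrightarrow> q a x = q a y"
      unfolding q'a[OF a xy(1)] q'a[OF a xy(2)] using m(3)[OF a] by metis
    then show "q' a x = q' a y \<longleftrightarrow> (\<exists>w\<in>fob R a. \<sigma> a w = x \<and> \<tau> a w = y)"
      using kk[OF a xy] by simp
  qed
qed

lemma eqrel_pointwise_quotient:
  assumes e: "equivalence_relation C r x s t"
  obtains Q q where "pointwise_quotient (W r) (W x) (fmap (yoneda C) r x s) (fmap (yoneda C) r x t) Q q"
proof -
  note o = eqrel_in[OF e]
  show ?thesis
  proof (rule pointwise_quotient_ex[of "W r" "W x" "fmap (yoneda C) r x s" "fmap (yoneda C) r x t"])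
    fix a assume a: "a \<in> Ob C"
    have "(\<lambda>w. (fmap (yoneda C) r x s a w, fmap (yoneda C) r x t a w)) ` fob (W r) a
      = (\<lambda>f. (Comp C a r x s f, Comp C a r x t f)) ` Hom C a r"
      by (intro image_cong) (use a in auto)
    moreover have "equiv (Hom C a x) ((\<lambda>f. (Comp C a r x s f, Comp C a r x t f)) ` Hom C a r)"
      using e a unfolding equivalence_relation_def by blast
    ultimately show "equiv (fob (W x) a) ((\<lambda>w. (fmap (yoneda C) r x s a w, fmap (yoneda C) r x t a w)) ` fob (W r) a)"
      by simp
  qed (use o that in auto)
qed

text \<open>The following lemmas are applied to the free category on an equivalence relation as \<open>C\<close>.\<close>

lemma
  assumes pq: "pointwise_quotient (W r) (W x) (fmap (yoneda C) r x s) (fmap (yoneda C) r x t) \<phi> q"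
    and o: "r \<in> Ob C" "x \<in> Ob C" "s \<in> Hom C r x" "t \<in> Hom C r x"
    and E: "category E" and D: "is_functor C E D"
  shows weighted_colimit_of_coequaliser:
      "is_coequaliser E (fob D r) (fob D x) (fmap D r x s) (fmap D r x t) c e \<Longrightarrow>
        \<exists>\<eta>. is_weighted_colimit C \<phi> E D c \<eta>"
    and coequaliser_of_weighted_colimit:
      "is_weighted_colimit C \<phi> E D c \<eta> \<Longrightarrow>
        is_coequaliser E (fob D r) (fob D x) (fmap D r x s) (fmap D r x t) c (\<eta> x (q x (idn C x)))"
proof -
  interpret E: cat_base E by unfold_locales (fact E)
  note Do = functor_ob[OF D] and Dh = functor_hom[OF D]
  have qh: "q \<in> Hom P (W x) \<phi>" "\<phi> \<in> Ob P"
    and qs: "\<And>k. k \<in> Ob C \<Longrightarrow> q k ` Hom C k x = fob \<phi> k"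
    and qk: "\<And>k f g. \<lbrakk>k \<in> Ob C; f \<in> Hom C k x; g \<in> Hom C k x\<rbrakk> \<Longrightarrow> q k f = q k g \<longleftrightarrow>
      (\<exists>w\<in>Hom C k r. Comp C k r x s w = f \<and> Comp C k r x t w = g)"
    using pq o unfolding pointwise_quotient_def by auto
  have qin: "q k f \<in> fob \<phi> k" if "k \<in> Ob C" "f \<in> Hom C k x" for k f
    using hom_in[OF qh(1) that(1), of f] that by simp
  have qact: "q k (Comp C k l x f g) = fmap \<phi> l k g (q l f)"
    if "k \<in> Ob C" "l \<in> Ob C" "f \<in> Hom C l x" "g \<in> Hom C k l" for k l f g
    using hom_act[OF qh(1) that(4), of f] that by simp
  have surj: "\<exists>f\<in>Hom C k x. v = q k f" if "k \<in> Ob C" "v \<in> fob \<phi> k" for k v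
    using qs[OF that(1)] that(2) by blast
  \<comment> \<open>An arrow \<open>u\<close> coequalising \<open>D s\<close> and \<open>D t\<close>
    yields a cocylinder whose value at the class of \<open>f\<close> is \<open>u\<close> after
    \<open>D f\<close>. Equal classes are related by some \<open>w : k \<rightarrow> r\<close>, and
    then the values agree.\<close>
  have mk: "\<exists>\<alpha>. is_cocylinder C \<phi> E D z \<alpha> \<and>
      (\<forall>k\<in>Ob C. \<forall>f\<in>Hom C k x. \<alpha> k (q k f) = Comp E (fob D k) (fob D x) z u (fmap D k x f))"
    if z: "z \<in> Ob E" and u: "u \<in> Hom E (fob D x) z"
      and eq: "Comp E (fob D r) (fob D x) z u (fmap D r x s) = Comp E (fob D r) (fob D x) z u (fmap D r x t)" for z u
  proof -
    define \<alpha> where "\<alpha> k v = Comp E (fob D k) (fob D x) z u (fmap D k x (SOME f. f \<in> Hom C k x \<and> q k f = v))" for k v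
    have \<alpha>: "\<alpha> k (q k f) = Comp E (fob D k) (fob D x) z u (fmap D k x f)" if k: "k \<in> Ob C" and f: "f \<in> Hom C k x" for k f
      unfolding \<alpha>_def
    proof (rule someI2[of _ f])
      show "f \<in> Hom C k x \<and> q k f = q k f" using f by simp
      fix g assume g: "g \<in> Hom C k x \<and> q k g = q k f"
      then obtain w where w: "w \<in> Hom C k r" "Comp C k r x s w = g" "Comp C k r x t w = f"
        using qk[OF k _ f] by blast
      have "Comp E (fob D k) (fob D x) z u (fmap D k x (Comp C k r x m w))
        = Comp E (fob D k) (fob D r) z (Comp E (fob D r) (fob D x) z u (fmap D r x m)) (fmap D k r w)"
        if "m \<in> Hom C r x" for m
        using that w k o u z Do Dh by (simp add: functor_Comp[OF D] E.assoc)
      from this[OF o(3)] this[OF o(4)] show "Comp E (fob D k) (fob D x) z u (fmap D k x g)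
        = Comp E (fob D k) (fob D x) z u (fmap D k x f)" using w eq by simp
    qed
    have "is_cocylinder C \<phi> E D z \<alpha>"
      unfolding is_cocylinder_def
    proof (intro conjI ballI z)
      show "\<alpha> k v \<in> Hom E (fob D k) z" if "k \<in> Ob C" "v \<in> fob \<phi> k" for k v
        using surj[OF that] \<alpha> that u z o Do Dh by auto
      fix k l g v assume k: "k \<in> Ob C" "l \<in> Ob C" "g \<in> Hom C k l" and "v \<in> fob \<phi> l"
      then obtain f where f: "f \<in> Hom C l x" "v = q l f" using surj by blast
      have "\<alpha> k (fmap \<phi> l k g v) = \<alpha> k (q k (Comp C k l x f g))" using qact k f by simp
      also have "\<dots> = Comp E (fob D k) (fob D l) z (\<alpha> l v) (fmap D k l g)"
        using \<alpha> k f u z o Do Dh by (simp add: functor_Comp[OF D] E.assoc)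
      finally show "\<alpha> k (fmap \<phi> l k g v) = Comp E (fob D k) (fob D l) z (\<alpha> l v) (fmap D k l g)" .
    qed
    then show ?thesis using \<alpha> by blast
  qed
  \<comment> \<open>Conversely, a cocylinder is determined by its value at the class of the identity
    of \<open>x\<close>, as in the Yoneda lemma.\<close>
  have un: "\<alpha> x (q x (idn C x)) \<in> Hom E (fob D x) z"
      "Comp E (fob D r) (fob D x) z (\<alpha> x (q x (idn C x))) (fmap D r x s) = Comp E (fob D r) (fob D x) z (\<alpha> x (q x (idn C x))) (fmap D r x t)"
      "\<And>k f. \<lbrakk>k \<in> Ob C; f \<in> Hom C k x\<rbrakk> \<Longrightarrow> \<alpha> k (q k f) = Comp E (fob D k) (fob D x) z (\<alpha> x (q x (idn C x))) (fmap D k x f)"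
    if \<alpha>: "is_cocylinder C \<phi> E D z \<alpha>" for z \<alpha>
  proof -
    show "\<alpha> x (q x (idn C x)) \<in> Hom E (fob D x) z"
      using \<alpha> qin[of x "idn C x"] o unfolding is_cocylinder_def by simp
    show *: "\<alpha> k (q k f) = Comp E (fob D k) (fob D x) z (\<alpha> x (q x (idn C x))) (fmap D k x f)"
      if "k \<in> Ob C" "f \<in> Hom C k x" for k f
    proof -
      have "\<alpha> k (fmap \<phi> x k f (q x (idn C x))) = Comp E (fob D k) (fob D x) z (\<alpha> x (q x (idn C x))) (fmap D k x f)"
        using \<alpha> qin[of x "idn C x"] o that unfolding is_cocylinder_def by simp
      then show ?thesis using qact[of k x "idn C x" f] that o by simp
    qed
    have "q r s = q r t" using qk[of r s t] o by (auto intro!: bexI[of _ "idn C r"])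
    then show "Comp E (fob D r) (fob D x) z (\<alpha> x (q x (idn C x))) (fmap D r x s) = Comp E (fob D r) (fob D x) z (\<alpha> x (q x (idn C x))) (fmap D r x t)"
      using *[OF o(1,3)] *[OF o(1,4)] by simp
  qed
  have Did: "Comp E (fob D x) (fob D x) z u (fmap D x x (idn C x)) = u" if "u \<in> Hom E (fob D x) z" "z \<in> Ob E" for u z
    using that functor_idn[OF D o(2)] Do[OF o(2)] by simp
  have qid: "q x (idn C x) \<in> fob \<phi> x" using qin o by simp
  show "\<exists>\<eta>. is_weighted_colimit C \<phi> E D c \<eta>"
    if co: "is_coequaliser E (fob D r) (fob D x) (fmap D r x s) (fmap D r x t) c e"
  proof -
    note ci = coequaliser_in[OF co]
    obtain \<eta> where \<eta>: "is_cocylinder C \<phi> E D c \<eta>"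
      "\<forall>k\<in>Ob C. \<forall>f\<in>Hom C k x. \<eta> k (q k f) = Comp E (fob D k) (fob D x) c e (fmap D k x f)"
      using mk[OF ci(3,6,7)] by blast
    have \<eta>x: "\<eta> x (q x (idn C x)) = e" using \<eta>(2) o Did[OF ci(6,3)] by simp
    have "is_weighted_colimit C \<phi> E D c \<eta>"
      unfolding is_weighted_colimit_def
    proof (intro conjI allI impI \<eta>(1))
      fix z \<alpha> assume \<alpha>: "is_cocylinder C \<phi> E D z \<alpha>"
      then have z: "z \<in> Ob E" by (simp add: is_cocylinder_def)
      obtain h where h: "h \<in> Hom E c z" "Comp E (fob D x) c z h e = \<alpha> x (q x (idn C x))"
        using coequaliser_ex[OF co z un(1,2)[OF \<alpha>]] .
      show "\<exists>!h. h \<in> Hom E c z \<and> (\<forall>k\<in>Ob C. \<forall>v\<in>fob \<phi> k. Comp E (fob D k) c z h (\<eta> k v) = \<alpha> k v)"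
      proof (rule ex1I[of _ h])
        show "h \<in> Hom E c z \<and> (\<forall>k\<in>Ob C. \<forall>v\<in>fob \<phi> k. Comp E (fob D k) c z h (\<eta> k v) = \<alpha> k v)"
        proof (intro conjI ballI h(1))
          fix k v assume k: "k \<in> Ob C" and "v \<in> fob \<phi> k"
          then obtain f where f: "f \<in> Hom C k x" "v = q k f" using surj by blast
          show "Comp E (fob D k) c z h (\<eta> k v) = \<alpha> k v"
            using \<eta>(2) un(3)[OF \<alpha> k f(1)] h(2)[symmetric] k f h(1) z ci Dh o Do by (simp add: E.assoc)
        qed
        fix h' assume h': "h' \<in> Hom E c z \<and> (\<forall>k\<in>Ob C. \<forall>v\<in>fob \<phi> k. Comp E (fob D k) c z h' (\<eta> k v) = \<alpha> k v)"
        then have "Comp E (fob D x) c z h' (\<eta> x (q x (idn C x))) = \<alpha> x (q x (idn C x))" using qid o by blast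
        then show "h' = h" using E.coequaliser_uniq[OF co z] h' h \<eta>x by simp
      qed
    qed
    then show ?thesis by blast
  qed
  show "is_coequaliser E (fob D r) (fob D x) (fmap D r x s) (fmap D r x t) c (\<eta> x (q x (idn C x)))"
    if w: "is_weighted_colimit C \<phi> E D c \<eta>"
  proof -
    have \<eta>: "is_cocylinder C \<phi> E D c \<eta>" using w by (simp add: is_weighted_colimit_def)
    then have c: "c \<in> Ob E" by (simp add: is_cocylinder_def)
    note u = un[OF \<eta>]
    let ?e = "\<eta> x (q x (idn C x))"
    have \<eta>k: "Comp E (fob D k) c z h (\<eta> k (q k f)) = Comp E (fob D k) (fob D x) z (Comp E (fob D x) c z h ?e) (fmap D k x f)"
      if "h \<in> Hom E c z" "z \<in> Ob E" "k \<in> Ob C" "f \<in> Hom C k x" for h z k f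
      using that u(1) u(3)[OF that(3,4)] o Do Dh c by (simp add: E.assoc)
    show ?thesis
    proof (rule is_coequaliserI)
      fix z v assume z: "z \<in> Ob E" and v: "v \<in> Hom E (fob D x) z"
        "Comp E (fob D r) (fob D x) z v (fmap D r x s) = Comp E (fob D r) (fob D x) z v (fmap D r x t)"
      obtain \<alpha> where \<alpha>: "is_cocylinder C \<phi> E D z \<alpha>"
        "\<forall>k\<in>Ob C. \<forall>f\<in>Hom C k x. \<alpha> k (q k f) = Comp E (fob D k) (fob D x) z v (fmap D k x f)"
        using mk[OF z v] by blast
      obtain h where h: "h \<in> Hom E c z" "\<forall>k\<in>Ob C. \<forall>v\<in>fob \<phi> k. Comp E (fob D k) c z h (\<eta> k v) = \<alpha> k v"
        using w \<alpha>(1) unfolding is_weighted_colimit_def by blast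
      have "Comp E (fob D x) c z h ?e = v" using h(2) qid o \<alpha>(2) Did[OF v(1) z] by simp
      then show "\<exists>h\<in>Hom E c z. Comp E (fob D x) c z h ?e = v" using h(1) by blast
    next
      fix z h h' assume z: "z \<in> Ob E" and h: "h \<in> Hom E c z" "h' \<in> Hom E c z"
        "Comp E (fob D x) c z h ?e = Comp E (fob D x) c z h' ?e"
      let ?v = "Comp E (fob D x) c z h ?e"
      have v: "?v \<in> Hom E (fob D x) z" using h u(1) z c Do o by simp
      have "Comp E (fob D r) (fob D x) z ?v (fmap D r x s) = Comp E (fob D r) (fob D x) z ?v (fmap D r x t)"
        using u(1,2) h z c o Do Dh by (simp flip: E.assoc)
      then obtain \<alpha> where \<alpha>: "is_cocylinder C \<phi> E D z \<alpha>"
        "\<forall>k\<in>Ob C. \<forall>f\<in>Hom C k x. \<alpha> k (q k f) = Comp E (fob D k) (fob D x) z ?v (fmap D k x f)"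
        using mk[OF z v] by blast
      have all: "\<forall>k\<in>Ob C. \<forall>v\<in>fob \<phi> k. Comp E (fob D k) c z g (\<eta> k v) = \<eta>' k v"
        if "g \<in> Hom E c z" "Comp E (fob D x) c z g ?e = ?v" and \<eta>': "\<eta>' = \<alpha>" for g \<eta>'
      proof (intro ballI)
        fix k v assume k: "k \<in> Ob C" and "v \<in> fob \<phi> k"
        then obtain f where f: "f \<in> Hom C k x" "v = q k f" using surj by blast
        show "Comp E (fob D k) c z g (\<eta> k v) = \<eta>' k v"
          unfolding f(2) \<eta>' \<eta>k[OF that(1) z k f(1)] that(2) using \<alpha>(2) k f(1) by simp
      qed
      from all[OF h(1) refl refl] all[OF h(2) h(3)[symmetric] refl] show "h = h'"
        using w \<alpha>(1) h(1,2) unfolding is_weighted_colimit_def by blast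
    qed (use u(1,2) c o Do Dh in auto)
  qed
qed

end

section \<open>The category \<open>\<Phi>\<^sub>l C\<close>\<close>

context lex_presheaves
begin

abbreviation PL :: "'u lex_weight set \<Rightarrow> ('o, 'u) presheaf set" where "PL \<Phi> \<equiv> Phi_l_objects \<Phi> C"

lemma Phi_l_eq: "Phi_l \<Phi> C = full_subcat P (PL \<Phi>)"
  by (simp add: Phi_l_def small_psh_eq)

lemma PL_least:
  assumes "S \<subseteq> Sm" "replete (small_psh C) S" "W ` Ob C \<subseteq> S" "closed_finite_limits (small_psh C) S"
    "closed_lex_colimits \<Phi> (small_psh C) S"
  shows "PL \<Phi> \<subseteq> S"
  using assms unfolding Phi_l_objects_def small_psh_eq by auto

text \<open>\<open>Sm\<close> itself belongs to the family whose intersection defines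
  \<open>PL \<Phi>\<close>, so this is not an intersection over the empty family.\<close>

lemma PL_Sm: "PL \<Phi> \<subseteq> Sm"
proof (rule PL_least)
  show "replete (small_psh C) Sm" by (simp add: replete_def small_psh_eq)
  show "closed_finite_limits (small_psh C) Sm"
    by (auto simp: closed_finite_limits_def is_limit_def is_cone_def small_psh_eq)
  show "closed_lex_colimits \<Phi> (small_psh C) Sm"
    by (auto simp: closed_lex_colimits_def is_weighted_colimit_def is_cocylinder_def small_psh_eq)
qed (use W_Sm in auto)

lemma PL_Ob: "PL \<Phi> \<subseteq> Ob P"
  using PL_Sm Sm_Ob by blast

lemma W_PL: "W ` Ob C \<subseteq> PL \<Phi>"
  unfolding Phi_l_objects_def by blast

lemma PL_I:
  assumes "F \<in> Sm" "\<And>S. \<lbrakk>S \<subseteq> Sm; replete (small_psh C) S; W ` Ob C \<subseteq> S;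
    closed_finite_limits (small_psh C) S; closed_lex_colimits \<Phi> (small_psh C) S\<rbrakk> \<Longrightarrow> F \<in> S"
  shows "F \<in> PL \<Phi>"
  using assms unfolding Phi_l_objects_def small_psh_eq by auto

lemma PL_closed_limits: "closed_finite_limits (small_psh C) (PL \<Phi>)"
  unfolding closed_finite_limits_def
proof (intro allI impI)
  fix J :: "(nat, nat) cat" and D c \<pi>
  assume J: "finite_category J" "is_functor J (small_psh C) D" "fob D ` Ob J \<subseteq> PL \<Phi>" "is_limit J (small_psh C) D c \<pi>"
  show "c \<in> PL \<Phi>"
  proof (rule PL_I)
    show "c \<in> Sm" using is_limit_cone[OF J(4)] by (simp add: is_cone_def small_psh_eq)
    fix S assume S: "S \<subseteq> Sm" "replete (small_psh C) S" "W ` Ob C \<subseteq> S"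
      "closed_finite_limits (small_psh C) S" "closed_lex_colimits \<Phi> (small_psh C) S"
    have "fob D ` Ob J \<subseteq> S" using J(3) PL_least[OF S] by blast
    then show "c \<in> S" using S(4) J unfolding closed_finite_limits_def by blast
  qed
qed

lemma finitely_complete_Phi_l: "finitely_complete (full_subcat P (PL \<Phi>))"
proof -
  have cs: "category (small_psh C)" using finitely_complete_small_psh by (simp add: finitely_complete_def)
  have "finitely_complete (induced (small_psh C) (\<lambda>F. F) (PL \<Phi>))"
  proof (rule induced_lex(1)[OF cs])
    show "(\<lambda>F. F) ` PL \<Phi> \<subseteq> Ob (small_psh C)" using PL_Sm by (simp add: small_psh_eq)
    fix J :: "(nat, nat) cat" and D
    assume J: "finite_category J" and "is_functor J (induced (small_psh C) (\<lambda>F. F) (PL \<Phi>)) D"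
    then have D: "is_functor J (full_subcat (small_psh C) (PL \<Phi>)) D" by (simp add: full_subcat_induced)
    have D': "is_functor J (small_psh C) D"
      using is_functor_full_subcat[OF D] PL_Sm by (simp add: small_psh_eq)
    obtain F \<pi> where l: "is_limit J (small_psh C) D F \<pi>" using small_limit[OF J D'] .
    have "fob D ` Ob J \<subseteq> PL \<Phi>" using functor_ob[OF D] by auto
    then have "F \<in> PL \<Phi>" using PL_closed_limits J D' l unfolding closed_finite_limits_def by blast
    moreover have "fcomp (induced_functor (\<lambda>F. F)) D = D"
      by (cases D) (simp add: fcomp_def induced_functor_def)
    ultimately show "\<exists>F\<in>PL \<Phi>. \<exists>\<pi>. is_limit J (small_psh C) (fcomp (induced_functor (\<lambda>F. F)) D) F \<pi>"
      using l by metis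
  qed
  then show ?thesis by (simp add: full_subcat_induced[symmetric] small_psh_eq)
qed

end

section \<open>Barr-exact categories are exact for the weight\<close>

subsection \<open>Covers\<close>

lemma regular_epi_in:
  assumes "regular_epi C b a e"
  shows "a \<in> Ob C" "b \<in> Ob C" "e \<in> Hom C b a"
  using assms by (auto simp: regular_epi_def is_coequaliser_def)

context cat_base
begin

lemma regular_epi_epi:
  assumes e: "regular_epi C b a e" and h: "z \<in> Ob C" "h \<in> Hom C a z" "h' \<in> Hom C a z"
    "Comp C b a z h e = Comp C b a z h' e"
  shows "h = h'"
  using assms coequaliser_uniq unfolding regular_epi_def by blast

lemma regular_epi_factor:
  assumes e: "regular_epi C b a e" and u: "z \<in> Ob C" "u \<in> Hom C b z"
    and k: "\<And>w f g. \<lbrakk>w \<in> Ob C; f \<in> Hom C w b; g \<in> Hom C w b; Comp C w b a e f = Comp C w b a e g\<rbrakk> \<Longrightarrow>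
      Comp C w b z u f = Comp C w b z u g"
  obtains h where "h \<in> Hom C a z" "Comp C b a z h e = u"
proof -
  obtain d f g where c: "is_coequaliser C d b f g a e" using e unfolding regular_epi_def by blast
  note ci = coequaliser_in[OF c]
  have "Comp C d b z u f = Comp C d b z u g" by (rule k) (use ci in auto)
  then show ?thesis using coequaliser_ex[OF c u] that by blast
qed

lemma regular_epi_coequaliser_kernel:
  assumes e: "regular_epi C b a e" and k: "is_kernel_pair C b a e r s t"
  shows "is_coequaliser C r b s t a e"
proof (rule is_coequaliserI)
  have p: "is_pullback C b b a e e r s t" using k by (simp add: is_kernel_pair_def)
  note pin = pullback_in[OF p]
  show "r \<in> Ob C" "b \<in> Ob C" "a \<in> Ob C" "s \<in> Hom C r b" "t \<in> Hom C r b" "e \<in> Hom C b a"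
    "Comp C r b a e s = Comp C r b a e t" using pin by auto
  show "\<exists>h\<in>Hom C a z. Comp C b a z h e = u"
    if u: "z \<in> Ob C" "u \<in> Hom C b z" "Comp C r b z u s = Comp C r b z u t" for z u
  proof -
    have "Comp C w b z u f = Comp C w b z u g"
      if w: "w \<in> Ob C" "f \<in> Hom C w b" "g \<in> Hom C w b" "Comp C w b a e f = Comp C w b a e g" for w f g
    proof -
      obtain h where h: "h \<in> Hom C w r" "Comp C w r b s h = f" "Comp C w r b t h = g"
        using pullback_ex[OF p w] .
      then show ?thesis
        using assoc[OF h(1) pin(7) u(2)] assoc[OF h(1) pin(8) u(2)] u w pin by simp
    qed
    from regular_epi_factor[OF e u(1,2) this] show ?thesis by blast
  qed
  show "h = h'" if "z \<in> Ob C" "h \<in> Hom C a z" "h' \<in> Hom C a z" "Comp C b a z h e = Comp C b a z h' e" for z h h'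
    by (rule regular_epi_epi[OF e that])
qed

lemma regular_epi_idn: "a \<in> Ob C \<Longrightarrow> regular_epi C a a (idn C a)"
  unfolding regular_epi_def
  by (intro exI[of _ a] exI[of _ "idn C a"] exI[of _ "idn C a"] is_coequaliserI) auto

end

locale regular = cat_base C for C :: "('o, 'm) cat" +
  assumes regular: "regular_category C"
begin

lemma regular_fc: "finitely_complete C"
  using regular by (simp add: regular_category_def)

lemma regular_epi_pullback:
  assumes e: "regular_epi C b a e" and g: "g \<in> Hom C a' a" "a' \<in> Ob C"
  obtains b' e' g' where "b' \<in> Ob C" "regular_epi C b' a' e'" "g' \<in> Hom C b' b" "Comp C b' b a e g' = Comp C b' a' a g e'"
proof -
  note ein = regular_epi_in[OF e]
  obtain b' g' e' where p: "is_pullback C b a' a e g b' g' e'"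
    using finitely_complete_pullback[OF regular_fc ein(2) g(2) ein(1,3) g(1)] .
  then have "regular_epi C b' a' e'" using e regular unfolding regular_category_def by blast
  then show ?thesis using that pullback_in[OF p] by blast
qed

text \<open>Shown directly for the kernel-pair of the composite \<open>?m\<close>. A map
  \<open>f\<close> coequalising it descends along \<open>d\<close> to some \<open>g\<close>. For
  \<open>g\<close> to descend along \<open>e\<close>, a pair \<open>u\<close>, \<open>v\<close>
  identified by \<open>e\<close> is lifted along \<open>d\<close> on a cover, where \<open>f\<close>
  is known to identify the lifts.\<close>

lemma regular_epi_Comp:
  assumes d: "regular_epi C c b d" and e: "regular_epi C b a e"
  shows "regular_epi C c a (Comp C c b a e d)"
proof -
  note din = regular_epi_in[OF d] and ein = regular_epi_in[OF e]
  let ?m = "Comp C c b a e d"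
  have m: "?m \<in> Hom C c a" using din ein by simp
  obtain r s t where p: "is_pullback C c c a ?m ?m r s t"
    using finitely_complete_pullback[OF regular_fc din(2) din(2) ein(1) m m] .
  note pin = pullback_in[OF p]
  have "is_coequaliser C r c s t a ?m"
  proof (rule is_coequaliserI)
    fix z f assume z: "z \<in> Ob C" and f: "f \<in> Hom C c z" and eq: "Comp C r c z f s = Comp C r c z f t"
    have ker: "Comp C w c z f u = Comp C w c z f v"
      if w: "w \<in> Ob C" "u \<in> Hom C w c" "v \<in> Hom C w c" "Comp C w c a ?m u = Comp C w c a ?m v" for w u v
    proof -
      obtain h where h: "h \<in> Hom C w r" "Comp C w r c s h = u" "Comp C w r c t h = v"
        using pullback_ex[OF p w] .
      then show ?thesis
        using assoc[OF h(1) pin(7) f] assoc[OF h(1) pin(8) f] eq w z pin by simp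
    qed
    obtain g where g: "g \<in> Hom C b z" "Comp C c b z g d = f"
    proof (rule regular_epi_factor[OF d z f])
      fix w u v assume w: "w \<in> Ob C" "u \<in> Hom C w c" "v \<in> Hom C w c" "Comp C w c b d u = Comp C w c b d v"
      show "Comp C w c z f u = Comp C w c z f v"
        by (rule ker) (use w din ein in \<open>simp_all flip: assoc\<close>)
    qed
    obtain h where h: "h \<in> Hom C a z" "Comp C b a z h e = g"
    proof (rule regular_epi_factor[OF e z g(1)])
      fix w u v assume w: "w \<in> Ob C" "u \<in> Hom C w b" "v \<in> Hom C w b" and uv: "Comp C w b a e u = Comp C w b a e v"
      \<comment> \<open>Pulling \<open>d\<close> back along \<open>u\<close>, and again along the
        restriction of \<open>v\<close>, gives a cover of \<open>w\<close> in two steps on which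
        both lift.\<close>
      obtain w1 p1 u' where w1: "w1 \<in> Ob C" "regular_epi C w1 w p1" "u' \<in> Hom C w1 c" "Comp C w1 c b d u' = Comp C w1 w b u p1"
        using regular_epi_pullback[OF d w(2,1)] .
      note p1 = regular_epi_in[OF w1(2)]
      have vp: "Comp C w1 w b v p1 \<in> Hom C w1 b" using w p1 din by simp
      obtain w2 p2 v' where w2: "w2 \<in> Ob C" "regular_epi C w2 w1 p2" "v' \<in> Hom C w2 c"
        "Comp C w2 c b d v' = Comp C w2 w1 b (Comp C w1 w b v p1) p2"
        using regular_epi_pullback[OF d vp w1(1)] .
      note p2 = regular_epi_in[OF w2(2)]
      let ?u = "Comp C w2 w1 c u' p2"
      have u2: "Comp C w2 c b d ?u = Comp C w2 w1 b (Comp C w1 w b u p1) p2"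
        using assoc[OF p2(3) w1(3) din(3)] w1 p2 w2 din by simp
      have eu: "Comp C w2 b a e (Comp C w2 w1 b (Comp C w1 w b x p1) p2) = Comp C w2 w1 a (Comp C w1 w a (Comp C w b a e x) p1) p2"
        if "x \<in> Hom C w b" for x
        using that w p1 p2 ein by (simp add: assoc)
      have "Comp C w2 c z f ?u = Comp C w2 c z f v'"
      proof (rule ker)
        show "Comp C w2 c a ?m ?u = Comp C w2 c a ?m v'"
          using assoc[of ?u w2 c d b e a, symmetric] assoc[OF w2(3) din(3) ein(3), symmetric]
            u2 w2 eu[OF w(2)] eu[OF w(3)] uv w1 p2 din ein by simp
      qed (use w1 p2 w2 din in auto)
      then have "Comp C w2 b z g (Comp C w2 c b d ?u) = Comp C w2 b z g (Comp C w2 c b d v')"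
        using assoc[of ?u w2 c d b g z] assoc[OF w2(3) din(3) g(1)] g w1 p2 w2 din z by simp
      then have "Comp C w2 w1 z (Comp C w1 w z (Comp C w b z g u) p1) p2
        = Comp C w2 w1 z (Comp C w1 w z (Comp C w b z g v) p1) p2"
        unfolding u2 w2(4) using w p1 p2 g z din by (simp add: assoc)
      then have "Comp C w1 w z (Comp C w b z g u) p1 = Comp C w1 w z (Comp C w b z g v) p1"
        by (rule regular_epi_epi[OF w2(2) z, rotated 2]) (use w p1 g z din in auto)
      then show "Comp C w b z g u = Comp C w b z g v"
        by (rule regular_epi_epi[OF w1(2) z, rotated 2]) (use w p1 g z din in auto)
    qed
    have "Comp C c a z h ?m = f" using assoc[OF din(3) ein(3) h(1)] h g din ein z by simp
    then show "\<exists>h\<in>Hom C a z. Comp C c a z h ?m = f" using h(1) by blast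
  next
    fix z h h' assume z: "z \<in> Ob C" and h: "h \<in> Hom C a z" "h' \<in> Hom C a z" "Comp C c a z h ?m = Comp C c a z h' ?m"
    have "Comp C b a z h e = Comp C b a z h' e"
      by (rule regular_epi_epi[OF d z]) (use h z din ein assoc[OF din(3) ein(3)] in auto)
    then show "h = h'" using regular_epi_epi[OF e z] h by blast
  qed (use pin in auto)
  then show ?thesis unfolding regular_epi_def by blast
qed

text \<open>Two covers are refined by pulling one back along the other and composing.
  \<open>Q i b e\<close> is any local property that survives refinement; only finitely many can be
  met at once, which is why the argument concerns finite limits.\<close>

lemma common_cover:
  assumes I: "finite I" and a: "a \<in> Ob C"
    and ex: "\<And>i. i \<in> I \<Longrightarrow> \<exists>b e. regular_epi C b a e \<and> Q i b e"
    and st: "\<And>i b e b' g. \<lbrakk>i \<in> I; b \<in> Ob C; e \<in> Hom C b a; Q i b e; b' \<in> Ob C; g \<in> Hom C b' b\<rbrakk> \<Longrightarrow> Q i b' (Comp C b' b a e g)"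
  obtains b e where "regular_epi C b a e" "\<And>i. i \<in> I \<Longrightarrow> Q i b e"
proof -
  have "\<exists>b e. regular_epi C b a e \<and> (\<forall>i\<in>I. Q i b e)"
    using I ex st
  proof (induction I rule: finite_induct)
    case empty
    then show ?case using regular_epi_idn[OF a] by blast
  next
    case (insert i I)
    have "\<exists>b e. regular_epi C b a e \<and> (\<forall>i\<in>I. Q i b e)"
    proof (rule insert.IH)
      show "\<exists>b e. regular_epi C b a e \<and> Q j b e" if "j \<in> I" for j using insert.prems(1) that by simp
      show "Q j b' (Comp C b' b a e g)"
        if "j \<in> I" "b \<in> Ob C" "e \<in> Hom C b a" "Q j b e" "b' \<in> Ob C" "g \<in> Hom C b' b" for j b e b' g
        using insert.prems(2)[of j b e b' g] that by simp
    qed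
    then obtain b e where b: "regular_epi C b a e" "\<forall>i\<in>I. Q i b e" by blast
    obtain d f where d: "regular_epi C d a f" "Q i d f" using insert.prems(1) by blast
    note bin = regular_epi_in[OF b(1)] and din = regular_epi_in[OF d(1)]
    obtain w p g where w: "w \<in> Ob C" "regular_epi C w d p" "g \<in> Hom C w b" "Comp C w b a e g = Comp C w d a f p"
      using regular_epi_pullback[OF b(1) din(3,2)] .
    note pin = regular_epi_in[OF w(2)]
    have "regular_epi C w a (Comp C w d a f p)" by (rule regular_epi_Comp[OF w(2) d(1)])
    moreover have "Q j w (Comp C w d a f p)" if j: "j \<in> insert i I" for j
    proof (cases "j = i")
      case True
      then show ?thesis using insert.prems(2)[of i d f w p] d(2) din pin by simp
    next
      case False
      then show ?thesis using insert.prems(2)[of j b e w g] b(2) bin w j by simp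
    qed
    ultimately show ?case by blast
  qed
  then show ?thesis using that by blast
qed

end

subsection \<open>Locally bijective maps\<close>

locale barr_presheaves = presheaves C for C :: "('o, 'u) cat" +
  assumes barr: "barr_exact C"
begin

sublocale regular C
  by unfold_locales (use barr in \<open>simp add: barr_exact_def\<close>)

sublocale lex_presheaves C
  by unfold_locales (rule regular_fc)

text \<open>Local surjectivity and local injectivity of \<open>\<eta>\<close> for the regular
  topology; in other words, \<open>\<eta>\<close> exhibits \<open>c\<close> as representing the
  sheaf associated with \<open>F\<close>.\<close>

definition lbij :: "('o, 'u) presheaf \<Rightarrow> 'o \<Rightarrow> ('o \<Rightarrow> 'u \<Rightarrow> 'u) \<Rightarrow> bool" where
  "lbij F c \<eta> \<longleftrightarrow> F \<in> Ob P \<and> c \<in> Ob C \<and> \<eta> \<in> Hom P F (W c) \<and>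
     (\<forall>a\<in>Ob C. \<forall>z\<in>Hom C a c. \<exists>b e. regular_epi C b a e \<and> (\<exists>w\<in>fob F b. \<eta> b w = Comp C b a c z e)) \<and>
     (\<forall>a\<in>Ob C. \<forall>w\<in>fob F a. \<forall>w'\<in>fob F a. \<eta> a w = \<eta> a w' \<longrightarrow>
        (\<exists>b e. regular_epi C b a e \<and> fmap F a b e w = fmap F a b e w'))"

lemma lbij_in: "lbij F c \<eta> \<Longrightarrow> F \<in> Ob P" "lbij F c \<eta> \<Longrightarrow> c \<in> Ob C" "lbij F c \<eta> \<Longrightarrow> \<eta> \<in> Hom P F (W c)"
  by (auto simp: lbij_def)

lemma lbij_app: "lbij F c \<eta> \<Longrightarrow> a \<in> Ob C \<Longrightarrow> w \<in> fob F a \<Longrightarrow> \<eta> a w \<in> Hom C a c"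
  using hom_in[of \<eta> F "W c" a w] by (simp add: lbij_in)

lemma lbij_act:
  "\<lbrakk>lbij F c \<eta>; f \<in> Hom C a b; w \<in> fob F b; a \<in> Ob C; b \<in> Ob C\<rbrakk> \<Longrightarrow> \<eta> a (fmap F b a f w) = Comp C a b c (\<eta> b w) f"
  using hom_act[of \<eta> F "W c" f a b w] lbij_app[of F c \<eta> b w] by (simp add: lbij_in)

lemma lbij_surj:
  assumes "lbij F c \<eta>" "a \<in> Ob C" "z \<in> Hom C a c"
  obtains b e w where "regular_epi C b a e" "w \<in> fob F b" "\<eta> b w = Comp C b a c z e"
  using assms unfolding lbij_def by blast

lemma lbij_inj:
  assumes "lbij F c \<eta>" "a \<in> Ob C" "w \<in> fob F a" "w' \<in> fob F a" "\<eta> a w = \<eta> a w'"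
  obtains b e where "regular_epi C b a e" "fmap F a b e w = fmap F a b e w'"
  using assms unfolding lbij_def by blast

lemma lbij_W: "c \<in> Ob C \<Longrightarrow> lbij (W c) c (idn P (W c))"
  unfolding lbij_def
proof (intro conjI ballI impI)
  assume c: "c \<in> Ob C"
  show "\<exists>b e. regular_epi C b a e \<and> (\<exists>w\<in>fob (W c) b. idn P (W c) b w = Comp C b a c z e)"
    if a: "a \<in> Ob C" "z \<in> Hom C a c" for a z
    using a c regular_epi_idn[OF a(1)]
    by (intro exI[of _ a] exI[of _ "idn C a"] conjI bexI[of _ z]) simp_all
  show "\<exists>b e. regular_epi C b a e \<and> fmap (W c) a b e w = fmap (W c) a b e w'"
    if a: "a \<in> Ob C" "w \<in> fob (W c) a" "w' \<in> fob (W c) a" "idn P (W c) a w = idn P (W c) a w'" for a w w'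
    using a regular_epi_idn[OF a(1)] by auto
qed (auto intro: psh_idn_in)

lemma lbij_iso:
  assumes l: "lbij F c \<eta>" and k: "is_iso P G F k" and G: "G \<in> Ob P"
  shows "lbij G c (Comp P G F (W c) \<eta> k)"
proof -
  obtain m where m: "k \<in> Hom P G F" "m \<in> Hom P F G" "\<And>a x. \<lbrakk>a \<in> Ob C; x \<in> fob G a\<rbrakk> \<Longrightarrow> m a (k a x) = x"
    "\<And>a x. \<lbrakk>a \<in> Ob C; x \<in> fob F a\<rbrakk> \<Longrightarrow> k a (m a x) = x"
    using k by (rule iso_app) (rule that)
  note lin = lbij_in[OF l]
  show ?thesis
    unfolding lbij_def
  proof (intro conjI ballI impI)
    show "Comp P G F (W c) \<eta> k \<in> Hom P G (W c)" using psh_Comp_in[OF m(1) lin(3) G] .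
    show "\<exists>b e. regular_epi C b a e \<and> (\<exists>w\<in>fob G b. Comp P G F (W c) \<eta> k b w = Comp C b a c z e)"
      if a: "a \<in> Ob C" "z \<in> Hom C a c" for a z
    proof -
      obtain b e w where b: "regular_epi C b a e" "w \<in> fob F b" "\<eta> b w = Comp C b a c z e"
        using lbij_surj[OF l a] .
      have bO: "b \<in> Ob C" using regular_epi_in[OF b(1)] by blast
      have "m b w \<in> fob G b" using m bO b by simp
      moreover from this have "Comp P G F (W c) \<eta> k b (m b w) = Comp C b a c z e" using m(4) bO b by simp
      ultimately show ?thesis using b(1) by blast
    qed
    fix a w w' assume a: "a \<in> Ob C" "w \<in> fob G a" "w' \<in> fob G a" "Comp P G F (W c) \<eta> k a w = Comp P G F (W c) \<eta> k a w'"
    then have kw: "k a w \<in> fob F a" "k a w' \<in> fob F a" "\<eta> a (k a w) = \<eta> a (k a w')" using m by simp_all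
    obtain b e where b: "regular_epi C b a e" "fmap F a b e (k a w) = fmap F a b e (k a w')"
      using lbij_inj[OF l a(1) kw] .
    note bin = regular_epi_in[OF b(1)]
    have "m b (fmap F a b e (k a w)) = m b (fmap F a b e (k a w'))" using b by simp
    then have "fmap G a b e w = fmap G a b e w'"
      using hom_act[OF m(2) bin(3) kw(1) bin(2,1)] hom_act[OF m(2) bin(3) kw(2) bin(2,1)] m(3) a by simp
    then show "\<exists>b e. regular_epi C b a e \<and> fmap G a b e w = fmap G a b e w'" using b(1) by blast
  qed (use lin G in auto)
qed

text \<open>Representables are sheaves, so they do not distinguish locally isomorphic presheaves.\<close>

lemma lbij_universal:
  assumes l: "lbij F c \<eta>" and d: "d \<in> Ob C" and \<beta>: "\<beta> \<in> Hom P F (W d)"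
  obtains h where "h \<in> Hom C c d" "\<And>a w. \<lbrakk>a \<in> Ob C; w \<in> fob F a\<rbrakk> \<Longrightarrow> Comp C a c d h (\<eta> a w) = \<beta> a w"
proof -
  note lin = lbij_in[OF l]
  have \<beta>in: "\<beta> a w \<in> Hom C a d" if "a \<in> Ob C" "w \<in> fob F a" for a w
    using hom_in[OF \<beta> that] by simp
  have \<beta>act: "\<beta> a (fmap F b a f w) = Comp C a b d (\<beta> b w) f"
    if "a \<in> Ob C" "b \<in> Ob C" "f \<in> Hom C a b" "w \<in> fob F b" for a b f w
    using hom_act[OF \<beta> that(3,4,1,2)] \<beta>in[OF that(2,4)] by simp
  \<comment> \<open>Local surjectivity at the identity of \<open>c\<close>: an element
    \<open>w\<close> over a cover \<open>e\<close> of \<open>c\<close> whose image is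
    \<open>e\<close> itself. The required \<open>h\<close> will be the descent of
    \<open>\<beta> b w\<close> along \<open>e\<close>.\<close>
  obtain b e w where b: "regular_epi C b c e" "w \<in> fob F b" "\<eta> b w = Comp C b c c (idn C c) e"
    using lbij_surj[OF l lin(2) idn_in[OF lin(2)]] .
  note ein = regular_epi_in[OF b(1)]
  have \<eta>w: "\<eta> b w = e" using b ein by simp
  \<comment> \<open>Elements with equal image under \<open>\<eta>\<close> agree on a cover. Their
    images under \<open>\<beta>\<close> agree there too, hence everywhere, as covers are
    epimorphisms.\<close>
  have eq\<beta>: "\<beta> x v = \<beta> x v'" if x: "x \<in> Ob C" "v \<in> fob F x" "v' \<in> fob F x" "\<eta> x v = \<eta> x v'" for x v v'
  proof -
    obtain y p where y: "regular_epi C y x p" "fmap F x y p v = fmap F x y p v'" using lbij_inj[OF l x] .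
    note pin = regular_epi_in[OF y(1)]
    have "Comp C y x d (\<beta> x v) p = Comp C y x d (\<beta> x v') p"
      using \<beta>act[OF pin(2,1,3) x(2)] \<beta>act[OF pin(2,1,3) x(3)] y by simp
    then show ?thesis by (rule regular_epi_epi[OF y(1) d \<beta>in[OF x(1,2)] \<beta>in[OF x(1,3)]])
  qed
  obtain h where h: "h \<in> Hom C c d" "Comp C b c d h e = \<beta> b w"
  proof (rule regular_epi_factor[OF b(1) d \<beta>in[OF ein(2) b(2)]])
    fix x u v assume x: "x \<in> Ob C" "u \<in> Hom C x b" "v \<in> Hom C x b" "Comp C x b c e u = Comp C x b c e v"
    have "\<beta> x (fmap F b x u w) = \<beta> x (fmap F b x v w)"
      by (rule eq\<beta>) (use x ein b lin \<eta>w lbij_act[OF l] in auto)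
    then show "Comp C x b d (\<beta> b w) u = Comp C x b d (\<beta> b w) v"
      using \<beta>act x ein b by simp
  qed
  have "Comp C a c d h (\<eta> a v) = \<beta> a v" if a: "a \<in> Ob C" "v \<in> fob F a" for a v
  proof -
    note \<eta>v = lbij_app[OF l a]
    \<comment> \<open>An arbitrary \<open>v\<close> is compared with \<open>w\<close> on the
      pullback of \<open>e\<close> along \<open>\<eta> a v\<close>, where their restrictions have
      the same image under \<open>\<eta>\<close>.\<close>
    obtain b' e' g where b': "b' \<in> Ob C" "regular_epi C b' a e'" "g \<in> Hom C b' b" "Comp C b' b c e g = Comp C b' a c (\<eta> a v) e'"
      using regular_epi_pullback[OF b(1) \<eta>v a(1)] .
    note e'in = regular_epi_in[OF b'(2)]
    have "\<beta> b' (fmap F b b' g w) = \<beta> b' (fmap F a b' e' v)"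
      by (rule eq\<beta>) (use b' ein e'in b a lin \<eta>w lbij_act[OF l] in auto)
    then have "Comp C b' b d (\<beta> b w) g = Comp C b' a d (\<beta> a v) e'"
      using \<beta>act b' ein e'in b a by simp
    moreover have "Comp C b' b d (\<beta> b w) g = Comp C b' a d (Comp C a c d h (\<eta> a v)) e'"
      using assoc[OF b'(3) ein(3) h(1)] assoc[OF e'in(3) \<eta>v h(1)] b'(4) h(2) b' ein a d by simp
    ultimately have "Comp C b' a d (Comp C a c d h (\<eta> a v)) e' = Comp C b' a d (\<beta> a v) e'" by simp
    then show ?thesis
      by (rule regular_epi_epi[OF b'(2) d, rotated 2]) (use h \<eta>v a lin d \<beta>in in auto)
  qed
  then show ?thesis using h(1) that by blast
qed

lemma lbij_uniq:
  assumes l: "lbij F c \<eta>" and d: "d \<in> Ob C" and h: "h \<in> Hom C c d" "h' \<in> Hom C c d"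
    and eq: "\<And>a w. \<lbrakk>a \<in> Ob C; w \<in> fob F a\<rbrakk> \<Longrightarrow> Comp C a c d h (\<eta> a w) = Comp C a c d h' (\<eta> a w)"
  shows "h = h'"
proof -
  note lin = lbij_in[OF l]
  obtain b e w where b: "regular_epi C b c e" "w \<in> fob F b" "\<eta> b w = Comp C b c c (idn C c) e"
    using lbij_surj[OF l lin(2) idn_in[OF lin(2)]] .
  note ein = regular_epi_in[OF b(1)]
  show ?thesis
    by (rule regular_epi_epi[OF b(1) d h]) (use eq[OF ein(2) b(2)] b ein in simp)
qed

subsection \<open>The reflection\<close>

text \<open>Plays the role of \<open>S\<close> in \<open>PL_least\<close>. Membership asserts mere
  existence of a locally bijective map; its target and the map are picked afterwards by
  \<open>Lo\<close> and \<open>unit\<close>.\<close>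

definition T :: "('o, 'u) presheaf set" where
  "T = {F \<in> Sm. \<exists>c \<eta>. lbij F c \<eta>}"

definition Lo :: "('o, 'u) presheaf \<Rightarrow> 'o" where
  "Lo F = (SOME c. \<exists>\<eta>. lbij F c \<eta>)"

definition unit :: "('o, 'u) presheaf \<Rightarrow> 'o \<Rightarrow> 'u \<Rightarrow> 'u" where
  "unit F = (SOME \<eta>. lbij F (Lo F) \<eta>)"

definition Lm :: "('o, 'u) presheaf \<Rightarrow> ('o, 'u) presheaf \<Rightarrow> ('o \<Rightarrow> 'u \<Rightarrow> 'u) \<Rightarrow> 'u" where
  "Lm F G \<alpha> = (SOME h. h \<in> Hom C (Lo F) (Lo G) \<and>
     (\<forall>a\<in>Ob C. \<forall>w\<in>fob F a. Comp C a (Lo F) (Lo G) h (unit F a w) = unit G a (\<alpha> a w)))"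

definition L :: "(('o, 'u) presheaf, 'o \<Rightarrow> 'u \<Rightarrow> 'u, 'o, 'u) ftor" where
  "L = \<lparr>fob = Lo, fmap = Lm\<rparr>"

lemma L_simps [simp]: "fob L F = Lo F" "fmap L F G \<alpha> = Lm F G \<alpha>"
  by (simp_all add: L_def)

lemma T_Sm: "T \<subseteq> Sm" and T_Ob: "T \<subseteq> Ob P"
  using Sm_Ob by (auto simp: T_def)

lemma lbij_unit: "F \<in> T \<Longrightarrow> lbij F (Lo F) (unit F)"
proof -
  assume "F \<in> T"
  then have "\<exists>c \<eta>. lbij F c \<eta>" by (simp add: T_def)
  then have "\<exists>\<eta>. lbij F (Lo F) \<eta>" unfolding Lo_def by (rule someI_ex)
  then show ?thesis unfolding unit_def by (rule someI_ex)
qed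

lemma Lo_Ob [simp]: "F \<in> T \<Longrightarrow> Lo F \<in> Ob C"
  using lbij_in(2)[OF lbij_unit] .

lemma unit_in [simp]: "\<lbrakk>F \<in> T; a \<in> Ob C; w \<in> fob F a\<rbrakk> \<Longrightarrow> unit F a w \<in> Hom C a (Lo F)"
  using lbij_app[OF lbij_unit] .

lemma
  assumes F: "F \<in> T" and G: "G \<in> T" and \<alpha>: "\<alpha> \<in> Hom P F G"
  shows Lm_in [simp]: "Lm F G \<alpha> \<in> Hom C (Lo F) (Lo G)"
    and Lm_unit: "\<lbrakk>a \<in> Ob C; w \<in> fob F a\<rbrakk> \<Longrightarrow> Comp C a (Lo F) (Lo G) (Lm F G \<alpha>) (unit F a w) = unit G a (\<alpha> a w)"
proof -
  note lF = lbij_unit[OF F] and lG = lbij_unit[OF G]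
  have FO: "F \<in> Ob P" using lbij_in(1)[OF lF] .
  have c: "Comp P F G (W (Lo G)) (unit G) \<alpha> \<in> Hom P F (W (Lo G))"
    using psh_Comp_in[OF \<alpha> lbij_in(3)[OF lG] FO] .
  obtain h where "h \<in> Hom C (Lo F) (Lo G)"
    "\<And>a w. \<lbrakk>a \<in> Ob C; w \<in> fob F a\<rbrakk> \<Longrightarrow> Comp C a (Lo F) (Lo G) h (unit F a w) = Comp P F G (W (Lo G)) (unit G) \<alpha> a w"
    using lbij_universal[OF lF lbij_in(2)[OF lG] c] by metis
  then have "h \<in> Hom C (Lo F) (Lo G) \<and>
     (\<forall>a\<in>Ob C. \<forall>w\<in>fob F a. Comp C a (Lo F) (Lo G) h (unit F a w) = unit G a (\<alpha> a w))" by simp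
  then have "Lm F G \<alpha> \<in> Hom C (Lo F) (Lo G) \<and>
     (\<forall>a\<in>Ob C. \<forall>w\<in>fob F a. Comp C a (Lo F) (Lo G) (Lm F G \<alpha>) (unit F a w) = unit G a (\<alpha> a w))"
    unfolding Lm_def by (rule someI)
  then show "Lm F G \<alpha> \<in> Hom C (Lo F) (Lo G)"
    "\<lbrakk>a \<in> Ob C; w \<in> fob F a\<rbrakk> \<Longrightarrow> Comp C a (Lo F) (Lo G) (Lm F G \<alpha>) (unit F a w) = unit G a (\<alpha> a w)"
    by blast+
qed

lemma L_functor: "is_functor (full_subcat P T) C L"
  unfolding is_functor_def
proof (intro conjI ballI)
  show "fmap L F F (idn (full_subcat P T) F) = idn C (fob L F)" if "F \<in> Ob (full_subcat P T)" for F
  proof -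
    have F: "F \<in> T" "F \<in> Ob P" using that T_Ob by auto
    have i: "idn P F \<in> Hom P F F" using F by (simp add: psh_idn_in)
    have "Lm F F (idn P F) = idn C (Lo F)"
    proof (rule lbij_uniq[OF lbij_unit[OF F(1)]])
      fix a w assume a: "a \<in> Ob C" "w \<in> fob F a"
      show "Comp C a (Lo F) (Lo F) (Lm F F (idn P F)) (unit F a w) = Comp C a (Lo F) (Lo F) (idn C (Lo F)) (unit F a w)"
        using Lm_unit[OF F(1,1) i a] F a by simp
    qed (use F i in auto)
    then show ?thesis by simp
  qed
  show "fmap L F H (Comp (full_subcat P T) F G H \<beta> \<alpha>) = Comp C (fob L F) (fob L G) (fob L H) (fmap L G H \<beta>) (fmap L F G \<alpha>)"
    if "F \<in> Ob (full_subcat P T)" "G \<in> Ob (full_subcat P T)" "H \<in> Ob (full_subcat P T)"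
      "\<alpha> \<in> Hom (full_subcat P T) F G" "\<beta> \<in> Hom (full_subcat P T) G H" for F G H \<alpha> \<beta>
  proof -
    have F: "F \<in> T" "G \<in> T" "H \<in> T" "F \<in> Ob P" and \<alpha>: "\<alpha> \<in> Hom P F G" "\<beta> \<in> Hom P G H" using that T_Ob by auto
    have c: "Comp P F G H \<beta> \<alpha> \<in> Hom P F H" using psh_Comp_in[OF \<alpha> F(4)] .
    have "Lm F H (Comp P F G H \<beta> \<alpha>) = Comp C (Lo F) (Lo G) (Lo H) (Lm G H \<beta>) (Lm F G \<alpha>)"
    proof (rule lbij_uniq[OF lbij_unit[OF F(1)]])
      fix a w assume a: "a \<in> Ob C" "w \<in> fob F a"
      have "Comp C a (Lo F) (Lo H) (Comp C (Lo F) (Lo G) (Lo H) (Lm G H \<beta>) (Lm F G \<alpha>)) (unit F a w)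
        = Comp C a (Lo G) (Lo H) (Lm G H \<beta>) (Comp C a (Lo F) (Lo G) (Lm F G \<alpha>) (unit F a w))"
        using a F \<alpha> by (simp add: assoc)
      also have "\<dots> = unit H a (\<beta> a (\<alpha> a w))"
        using Lm_unit[OF F(1,2) \<alpha>(1) a] Lm_unit[OF F(2,3) \<alpha>(2) a(1) hom_in[OF \<alpha>(1) a]] by simp
      finally show "Comp C a (Lo F) (Lo H) (Lm F H (Comp P F G H \<beta> \<alpha>)) (unit F a w)
        = Comp C a (Lo F) (Lo H) (Comp C (Lo F) (Lo G) (Lo H) (Lm G H \<beta>) (Lm F G \<alpha>)) (unit F a w)"
        using Lm_unit[OF F(1,3) c a] a by simp
    qed (use F \<alpha> c in auto)
    then show ?thesis by simp
  qed
qed auto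

text \<open>\<open>\<eta>\<close> is induced by the cone of composites of \<open>\<pi> j\<close>
  with the units. Local surjectivity takes two refinements, since locally chosen preimages need not
  be compatible; local injectivity takes one. Compatibility of \<open>\<eta>\<close> with the
  projections is recorded as well, because it identifies the reflection of the limit.\<close>

lemma lbij_limit:
  assumes J: "finite_category J" and D: "is_functor J (full_subcat P T) D" and F: "F \<in> Ob P"
    and \<pi>: "\<And>j. j \<in> Ob J \<Longrightarrow> \<pi> j \<in> Hom P F (fob D j)"
    and cone: "\<And>i j u. \<lbrakk>i \<in> Ob J; j \<in> Ob J; u \<in> Hom J i j\<rbrakk> \<Longrightarrow> Comp P F (fob D i) (fob D j) (fmap D i j u) (\<pi> i) = \<pi> j"
    and pl: "pointwise_limit J D F \<pi>" and l: "is_limit J C (fcomp L D) c \<rho>"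
  obtains \<eta> where "lbij F c \<eta>"
    "\<And>a x j. \<lbrakk>a \<in> Ob C; x \<in> fob F a; j \<in> Ob J\<rbrakk> \<Longrightarrow> Comp C a c (Lo (fob D j)) (\<rho> j) (\<eta> a x) = unit (fob D j) a (\<pi> j a x)"
proof -
  have fJ: "finite (Ob J)" using J by (simp add: finite_category_def)
  let ?I = "SIGMA i:Ob J. SIGMA j:Ob J. Hom J i j"
  have fI: "finite ?I" using J by (simp add: finite_category_def)
  have Dj: "fob D j \<in> T" "fob D j \<in> Ob P" if "j \<in> Ob J" for j
    using functor_ob[OF D that] T_Ob by auto
  note lD = lbij_unit[OF Dj(1)]
  have Du: "fmap D i j u \<in> Hom P (fob D i) (fob D j)" if "i \<in> Ob J" "j \<in> Ob J" "u \<in> Hom J i j" for i j u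
    using functor_hom[OF D that(3,1,2)] by simp
  have LD: "is_functor J C (fcomp L D)" using is_functor_fcomp[OF D L_functor] .
  have c: "c \<in> Ob C" and \<rho>: "\<And>j. j \<in> Ob J \<Longrightarrow> \<rho> j \<in> Hom C c (Lo (fob D j))"
    and \<rho>u: "\<And>i j u. \<lbrakk>i \<in> Ob J; j \<in> Ob J; u \<in> Hom J i j\<rbrakk> \<Longrightarrow>
      Comp C c (Lo (fob D i)) (Lo (fob D j)) (Lm (fob D i) (fob D j) (fmap D i j u)) (\<rho> i) = \<rho> j"
    using is_limit_cone[OF l] by (auto simp: is_cone_def)
  have uniq: "h = h'" if "a \<in> Ob C" "h \<in> Hom C a c" "h' \<in> Hom C a c"
    "\<And>j. j \<in> Ob J \<Longrightarrow> Comp C a c (Lo (fob D j)) (\<rho> j) h = Comp C a c (Lo (fob D j)) (\<rho> j) h'" for a h h'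
    by (rule is_limit_uniq[OF LD l that(2,3,1)]) (use that(4) in simp)
  have \<pi>u: "fmap D i j u a (\<pi> i a x) = \<pi> j a x" if "i \<in> Ob J" "j \<in> Ob J" "u \<in> Hom J i j" "a \<in> Ob C" "x \<in> fob F a" for i j u a x
    using fun_cong[OF fun_cong[OF cone[OF that(1-3)]], of a x] that by simp
  have "\<exists>h. h \<in> Hom C a c \<and> (\<forall>j\<in>Ob J. Comp C a c (Lo (fob D j)) (\<rho> j) h = unit (fob D j) a (\<pi> j a x))"
    if a: "a \<in> Ob C" "x \<in> fob F a" for a x
  proof -
    have "is_cone J C (fcomp L D) a (\<lambda>j. unit (fob D j) a (\<pi> j a x))"
      unfolding is_cone_def
    proof (intro conjI ballI)
      show "unit (fob D j) a (\<pi> j a x) \<in> Hom C a (fob (fcomp L D) j)" if "j \<in> Ob J" for j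
        using a Dj[OF that] hom_in[OF \<pi>[OF that] a] by simp
      show "Comp C a (fob (fcomp L D) i) (fob (fcomp L D) j) (fmap (fcomp L D) i j u) (unit (fob D i) a (\<pi> i a x))
          = unit (fob D j) a (\<pi> j a x)" if "i \<in> Ob J" "j \<in> Ob J" "u \<in> Hom J i j" for i j u
        using Lm_unit[OF Dj(1)[OF that(1)] Dj(1)[OF that(2)] Du[OF that] a(1) hom_in[OF \<pi>[OF that(1)] a]] \<pi>u[OF that a] by simp
    qed (rule a(1))
    from is_limit_ex[OF l this] show ?thesis by auto
  qed
  then obtain t where t: "\<And>a x. \<lbrakk>a \<in> Ob C; x \<in> fob F a\<rbrakk> \<Longrightarrow> t a x \<in> Hom C a c"
    "\<And>a x j. \<lbrakk>a \<in> Ob C; x \<in> fob F a; j \<in> Ob J\<rbrakk> \<Longrightarrow> Comp C a c (Lo (fob D j)) (\<rho> j) (t a x) = unit (fob D j) a (\<pi> j a x)"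
    by metis
  have tact: "t a (fmap F b a f x) = Comp C a b c (t b x) f"
    if o: "a \<in> Ob C" "b \<in> Ob C" "f \<in> Hom C a b" "x \<in> fob F b" for a b f x
  proof (rule uniq[OF o(1)])
    have fx: "fmap F b a f x \<in> fob F a" using o F by simp
    show "t a (fmap F b a f x) \<in> Hom C a c" using t(1)[OF o(1) fx] .
    show "Comp C a b c (t b x) f \<in> Hom C a c" using t(1)[OF o(2,4)] o c by simp
    fix j assume j: "j \<in> Ob J"
    have "Comp C a c (Lo (fob D j)) (\<rho> j) (Comp C a b c (t b x) f) = Comp C a b (Lo (fob D j)) (unit (fob D j) b (\<pi> j b x)) f"
      using assoc[OF o(3) t(1)[OF o(2,4)] \<rho>[OF j] o(1,2) c Lo_Ob[OF Dj(1)[OF j]]] t(2)[OF o(2,4) j] by simp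
    also have "\<dots> = unit (fob D j) a (\<pi> j a (fmap F b a f x))"
      using lbij_act[OF lD[OF j] o(3) hom_in[OF \<pi>[OF j] o(2,4)] o(1,2)] hom_act[OF \<pi>[OF j] o(3,4,1,2)] by simp
    finally show "Comp C a c (Lo (fob D j)) (\<rho> j) (t a (fmap F b a f x)) = Comp C a c (Lo (fob D j)) (\<rho> j) (Comp C a b c (t b x) f)"
      using t(2)[OF o(1) fx j] by simp
  qed
  have \<eta>: "mk_hom F t \<in> Hom P F (W c)"
    by (rule mk_hom[OF F]) (use t tact in auto)
  have "lbij F c (mk_hom F t)"
    unfolding lbij_def
  proof (intro conjI ballI impI F c \<eta>)
    fix a z assume a: "a \<in> Ob C" and z: "z \<in> Hom C a c"
    have \<rho>z: "Comp C a c (Lo (fob D j)) (\<rho> j) z \<in> Hom C a (Lo (fob D j))" if "j \<in> Ob J" for j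
      using that a z c \<rho> Dj by simp
    \<comment> \<open>First refinement: over \<open>b\<close> every component of \<open>z\<close>
      has a preimage under the unit of \<open>D j\<close>.\<close>
    obtain b e where b: "regular_epi C b a e"
      and ex: "\<And>j. j \<in> Ob J \<Longrightarrow> \<exists>w\<in>fob (fob D j) b. unit (fob D j) b w = Comp C b a (Lo (fob D j)) (Comp C a c (Lo (fob D j)) (\<rho> j) z) e"
    proof (rule common_cover[OF fJ a, where Q = "\<lambda>j b e. \<exists>w\<in>fob (fob D j) b. unit (fob D j) b w = Comp C b a (Lo (fob D j)) (Comp C a c (Lo (fob D j)) (\<rho> j) z) e"])
      show "\<exists>b e. regular_epi C b a e \<and> (\<exists>w\<in>fob (fob D j) b. unit (fob D j) b w = Comp C b a (Lo (fob D j)) (Comp C a c (Lo (fob D j)) (\<rho> j) z) e)"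
        if j: "j \<in> Ob J" for j
        using lbij_surj[OF lD[OF j] a \<rho>z[OF j]] by metis
      fix j b e b' g assume j: "j \<in> Ob J" and b: "b \<in> Ob C" "e \<in> Hom C b a" "b' \<in> Ob C" "g \<in> Hom C b' b"
        and "\<exists>w\<in>fob (fob D j) b. unit (fob D j) b w = Comp C b a (Lo (fob D j)) (Comp C a c (Lo (fob D j)) (\<rho> j) z) e"
      then obtain w where w: "w \<in> fob (fob D j) b" "unit (fob D j) b w = Comp C b a (Lo (fob D j)) (Comp C a c (Lo (fob D j)) (\<rho> j) z) e" by blast
      have "unit (fob D j) b' (fmap (fob D j) b b' g w)
        = Comp C b' a (Lo (fob D j)) (Comp C a c (Lo (fob D j)) (\<rho> j) z) (Comp C b' b a e g)"
        using lbij_act[OF lD[OF j] b(4) w(1) b(3,1)] w(2) assoc[OF b(4,2) \<rho>z[OF j] b(3,1) a Lo_Ob[OF Dj(1)[OF j]]] by simp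
      moreover have "fmap (fob D j) b b' g w \<in> fob (fob D j) b'" using w b Dj[OF j] by simp
      ultimately show "\<exists>w\<in>fob (fob D j) b'. unit (fob D j) b' w
        = Comp C b' a (Lo (fob D j)) (Comp C a c (Lo (fob D j)) (\<rho> j) z) (Comp C b' b a e g)" by blast
    qed blast
    note ein = regular_epi_in[OF b]
    have "\<forall>j\<in>Ob J. \<exists>w. w \<in> fob (fob D j) b \<and> unit (fob D j) b w = Comp C b a (Lo (fob D j)) (Comp C a c (Lo (fob D j)) (\<rho> j) z) e"
      using ex by blast
    then obtain y where y: "\<And>j. j \<in> Ob J \<Longrightarrow> y j \<in> fob (fob D j) b"
      "\<And>j. j \<in> Ob J \<Longrightarrow> unit (fob D j) b (y j) = Comp C b a (Lo (fob D j)) (Comp C a c (Lo (fob D j)) (\<rho> j) z) e"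
      by metis
    \<comment> \<open>Second refinement, with one condition for each arrow of \<open>J\<close>: the
      preimages \<open>y\<close> match only after the units are applied, so local injectivity is
      used to make them match over \<open>b'\<close>.\<close>
    obtain b' e' where b': "regular_epi C b' b e'"
      and eq: "\<And>l. l \<in> ?I \<Longrightarrow> fmap (fob D (fst (snd l))) b b' e' (fmap D (fst l) (fst (snd l)) (snd (snd l)) b (y (fst l)))
          = fmap (fob D (fst (snd l))) b b' e' (y (fst (snd l)))"
    proof (rule common_cover[OF fI ein(2), where Q = "\<lambda>l b' e'. fmap (fob D (fst (snd l))) b b' e' (fmap D (fst l) (fst (snd l)) (snd (snd l)) b (y (fst l)))
          = fmap (fob D (fst (snd l))) b b' e' (y (fst (snd l)))"])
      fix l assume "l \<in> ?I"
      then obtain i j u where l: "l = (i, j, u)" and ij: "i \<in> Ob J" "j \<in> Ob J" "u \<in> Hom J i j" by auto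
      have Dy: "fmap D i j u b (y i) \<in> fob (fob D j) b" using hom_in[OF Du[OF ij] ein(2) y(1)[OF ij(1)]] .
      note Lij = Lm_in[OF Dj(1)[OF ij(1)] Dj(1)[OF ij(2)] Du[OF ij]]
      have "unit (fob D j) b (fmap D i j u b (y i)) = Comp C b (Lo (fob D i)) (Lo (fob D j)) (Lm (fob D i) (fob D j) (fmap D i j u)) (Comp C b a (Lo (fob D i)) (Comp C a c (Lo (fob D i)) (\<rho> i) z) e)"
        using Lm_unit[OF Dj(1)[OF ij(1)] Dj(1)[OF ij(2)] Du[OF ij] ein(2) y(1)[OF ij(1)]] y(2)[OF ij(1)] by simp
      also have "\<dots> = Comp C b a (Lo (fob D j)) (Comp C a c (Lo (fob D j)) (Comp C c (Lo (fob D i)) (Lo (fob D j)) (Lm (fob D i) (fob D j) (fmap D i j u)) (\<rho> i)) z) e"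
        using Lij ein z \<rho> ij Dj c by (simp add: assoc)
      also have "\<dots> = unit (fob D j) b (y j)" using \<rho>u[OF ij] y(2)[OF ij(2)] by simp
      finally have "unit (fob D j) b (fmap D i j u b (y i)) = unit (fob D j) b (y j)" .
      then obtain b' e' where "regular_epi C b' b e'" "fmap (fob D j) b b' e' (fmap D i j u b (y i)) = fmap (fob D j) b b' e' (y j)"
        using lbij_inj[OF lD[OF ij(2)] ein(2) Dy y(1)[OF ij(2)]] by blast
      then show "\<exists>b' e'. regular_epi C b' b e' \<and>
        fmap (fob D (fst (snd l))) b b' e' (fmap D (fst l) (fst (snd l)) (snd (snd l)) b (y (fst l)))
          = fmap (fob D (fst (snd l))) b b' e' (y (fst (snd l)))" using l by auto
    next
      fix l b1 e1 b2 g assume "l \<in> ?I" and b1: "b1 \<in> Ob C" "e1 \<in> Hom C b1 b" "b2 \<in> Ob C" "g \<in> Hom C b2 b1"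
        and eq: "fmap (fob D (fst (snd l))) b b1 e1 (fmap D (fst l) (fst (snd l)) (snd (snd l)) b (y (fst l)))
          = fmap (fob D (fst (snd l))) b b1 e1 (y (fst (snd l)))"
      then obtain i j u where l: "l = (i, j, u)" and ij: "i \<in> Ob J" "j \<in> Ob J" "u \<in> Hom J i j" by auto
      have Dy: "fmap D i j u b (y i) \<in> fob (fob D j) b" using hom_in[OF Du[OF ij] ein(2) y(1)[OF ij(1)]] .
      show "fmap (fob D (fst (snd l))) b b2 (Comp C b2 b1 b e1 g) (fmap D (fst l) (fst (snd l)) (snd (snd l)) b (y (fst l)))
          = fmap (fob D (fst (snd l))) b b2 (Comp C b2 b1 b e1 g) (y (fst (snd l)))"
        using eq act_Comp[OF Dj(2)[OF ij(2)] b1(4,2) Dy b1(3,1) ein(2)]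
          act_Comp[OF Dj(2)[OF ij(2)] b1(4,2) y(1)[OF ij(2)] b1(3,1) ein(2)] l by simp
    qed blast
    note e'in = regular_epi_in[OF b']
    have "compatible J D b' (\<lambda>j. fmap (fob D j) b b' e' (y j))"
      unfolding compatible_def
    proof (intro conjI ballI)
      show "fmap (fob D j) b b' e' (y j) \<in> fob (fob D j) b'" if "j \<in> Ob J" for j
        using Dj[OF that] y(1)[OF that] e'in by simp
      fix i j u assume ij: "i \<in> Ob J" "j \<in> Ob J" "u \<in> Hom J i j"
      then have "fmap (fob D j) b b' e' (fmap D i j u b (y i)) = fmap (fob D j) b b' e' (y j)"
        using eq[of "(i, j, u)"] by simp
      then show "fmap D i j u b' (fmap (fob D i) b b' e' (y i)) = fmap (fob D j) b b' e' (y j)"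
        using hom_act[OF Du[OF ij] e'in(3) y(1)[OF ij(1)] e'in(2,1)] by simp
    qed
    then obtain x where x: "x \<in> fob F b'" "\<forall>j\<in>Ob J. \<pi> j b' x = fmap (fob D j) b b' e' (y j)"
      using pl e'in(2) unfolding pointwise_limit_def by blast
    let ?e = "Comp C b' b a e e'"
    have "t b' x = Comp C b' a c z ?e"
    proof (rule uniq[OF e'in(2) t(1)[OF e'in(2) x(1)]])
      show "Comp C b' a c z ?e \<in> Hom C b' c" using e'in ein z a c by simp
      fix j assume j: "j \<in> Ob J"
      have "Comp C b' c (Lo (fob D j)) (\<rho> j) (t b' x) = Comp C b' b (Lo (fob D j)) (unit (fob D j) b (y j)) e'"
        using t(2)[OF e'in(2) x(1) j] x(2) j lbij_act[OF lD[OF j] e'in(3) y(1)[OF j] e'in(2,1)] by simp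
      also have "\<dots> = Comp C b' c (Lo (fob D j)) (\<rho> j) (Comp C b' a c z ?e)"
        unfolding y(2)[OF j] using e'in ein z a c \<rho>[OF j] Dj[OF j] by (simp add: assoc)
      finally show "Comp C b' c (Lo (fob D j)) (\<rho> j) (t b' x) = Comp C b' c (Lo (fob D j)) (\<rho> j) (Comp C b' a c z ?e)" .
    qed
    then have "mk_hom F t b' x = Comp C b' a c z ?e" using x e'in by simp
    then show "\<exists>b e. regular_epi C b a e \<and> (\<exists>w\<in>fob F b. mk_hom F t b w = Comp C b a c z e)"
      using regular_epi_Comp[OF b' b] x(1) by blast
  next
    fix a x x' assume a: "a \<in> Ob C" and x: "x \<in> fob F a" "x' \<in> fob F a" and eq: "mk_hom F t a x = mk_hom F t a x'"
    \<comment> \<open>One cover on which all components of \<open>x\<close> and \<open>x'\<close>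
      agree; elements of a pointwise limit are separated by the projections.\<close>
    obtain b e where b: "regular_epi C b a e" "\<And>j. j \<in> Ob J \<Longrightarrow> fmap (fob D j) a b e (\<pi> j a x) = fmap (fob D j) a b e (\<pi> j a x')"
    proof (rule common_cover[OF fJ a, where Q = "\<lambda>j b e. fmap (fob D j) a b e (\<pi> j a x) = fmap (fob D j) a b e (\<pi> j a x')"])
      fix j assume j: "j \<in> Ob J"
      have "unit (fob D j) a (\<pi> j a x) = unit (fob D j) a (\<pi> j a x')"
        using t(2)[OF a x(1) j] t(2)[OF a x(2) j] eq a x by simp
      then show "\<exists>b e. regular_epi C b a e \<and> fmap (fob D j) a b e (\<pi> j a x) = fmap (fob D j) a b e (\<pi> j a x')"
        using lbij_inj[OF lD[OF j] a hom_in[OF \<pi>[OF j] a x(1)] hom_in[OF \<pi>[OF j] a x(2)]] by metis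
      fix b e b' g assume b: "b \<in> Ob C" "e \<in> Hom C b a" "b' \<in> Ob C" "g \<in> Hom C b' b"
        and eq: "fmap (fob D j) a b e (\<pi> j a x) = fmap (fob D j) a b e (\<pi> j a x')"
      show "fmap (fob D j) a b' (Comp C b' b a e g) (\<pi> j a x) = fmap (fob D j) a b' (Comp C b' b a e g) (\<pi> j a x')"
        using eq act_Comp[OF Dj(2)[OF j] b(4,2) hom_in[OF \<pi>[OF j] a x(1)] b(3,1) a]
          act_Comp[OF Dj(2)[OF j] b(4,2) hom_in[OF \<pi>[OF j] a x(2)] b(3,1) a] by simp
    qed blast
    note ein = regular_epi_in[OF b(1)]
    have "\<pi> j b (fmap F a b e x) = \<pi> j b (fmap F a b e x')" if j: "j \<in> Ob J" for j
      using b(2)[OF j] hom_act[OF \<pi>[OF j] ein(3) x(1) ein(2,1)] hom_act[OF \<pi>[OF j] ein(3) x(2) ein(2,1)] by simp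
    moreover have "fmap F a b e x \<in> fob F b" "fmap F a b e x' \<in> fob F b" using F ein x by auto
    ultimately have "fmap F a b e x = fmap F a b e x'"
      using pl ein(2) unfolding pointwise_limit_def by blast
    then show "\<exists>b e. regular_epi C b a e \<and> fmap F a b e x = fmap F a b e x'" using b(1) by blast
  qed
  then show ?thesis by (rule that) (use t(2) in simp)
qed

text \<open>The reflections of \<open>\<sigma>\<close> and \<open>\<tau>\<close> form an equivalence
  relation in \<open>C\<close>. By exactness it is the kernel-pair of its coequaliser
  \<open>p\<close>, and the map \<open>Q \<rightarrow> W c\<close> is locally bijective because the
  units of \<open>R\<close> and \<open>X\<close> are. Throughout, arrows of \<open>C\<close> are
  lifted to elements of presheaves on a cover and the outcome is descended.\<close>

lemma lbij_quotient:
  assumes pq: "pointwise_quotient R X \<sigma> \<tau> Q q" and T: "R \<in> T" "X \<in> T"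
    and inj: "\<And>a. a \<in> Ob C \<Longrightarrow> inj_on (\<lambda>w. (\<sigma> a w, \<tau> a w)) (fob R a)"
  shows "\<exists>c \<eta>. lbij Q c \<eta>"
proof -
  have i: "R \<in> Ob P" "X \<in> Ob P" "Q \<in> Ob P" "\<sigma> \<in> Hom P R X" "\<tau> \<in> Hom P R X" "q \<in> Hom P X Q"
    and qs: "\<And>a. a \<in> Ob C \<Longrightarrow> q a ` fob X a = fob Q a"
    and qk: "\<And>a x y. \<lbrakk>a \<in> Ob C; x \<in> fob X a; y \<in> fob X a\<rbrakk> \<Longrightarrow> q a x = q a y \<longleftrightarrow> (\<exists>w\<in>fob R a. \<sigma> a w = x \<and> \<tau> a w = y)"
    using pq unfolding pointwise_quotient_def by blast+
  note lR = lbij_unit[OF T(1)] and lX = lbij_unit[OF T(2)]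
  let ?r = "Lo R" and ?x = "Lo X" and ?s = "Lm R X \<sigma>" and ?t = "Lm R X \<tau>"
  have o: "?r \<in> Ob C" "?x \<in> Ob C" "?s \<in> Hom C ?r ?x" "?t \<in> Hom C ?r ?x" using T i by simp_all
  note su = Lm_unit[OF T i(4)] and tu = Lm_unit[OF T i(5)]
  have loc: "unit X b (fmap X a b e v) = Comp C b a ?x (unit X a v) e"
    if "e \<in> Hom C b a" "v \<in> fob X a" "b \<in> Ob C" "a \<in> Ob C" for a b e v
    using lbij_act[OF lX that] .
  have locR: "unit R b (fmap R a b e v) = Comp C b a ?r (unit R a v) e"
    if "e \<in> Hom C b a" "v \<in> fob R a" "b \<in> Ob C" "a \<in> Ob C" for a b e v
    using lbij_act[OF lR that] .
  \<comment> \<open>\<open>h\<close> and \<open>h'\<close> are represented by elements of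
    \<open>R\<close> over \<open>b2\<close>. Two further covers make their images under
    \<open>\<sigma>\<close> and under \<open>\<tau>\<close> equal, \<open>inj\<close> identifies the
    elements, and the four covers are cancelled in turn.\<close>
  have jm: "h = h'" if a: "a \<in> Ob C" and h: "h \<in> Hom C a ?r" "h' \<in> Hom C a ?r"
      and s: "Comp C a ?r ?x ?s h = Comp C a ?r ?x ?s h'" and t: "Comp C a ?r ?x ?t h = Comp C a ?r ?x ?t h'" for a h h'
  proof -
    obtain b e w where b: "regular_epi C b a e" "w \<in> fob R b" "unit R b w = Comp C b a ?r h e"
      using lbij_surj[OF lR a h(1)] .
    note ein = regular_epi_in[OF b(1)]
    have he: "Comp C b a ?r h' e \<in> Hom C b ?r" using h ein o by simp
    obtain b2 e2 w' where b2: "regular_epi C b2 b e2" "w' \<in> fob R b2" "unit R b2 w' = Comp C b2 b ?r (Comp C b a ?r h' e) e2"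
      using lbij_surj[OF lR ein(2) he] .
    note e2 = regular_epi_in[OF b2(1)]
    let ?w = "fmap R b b2 e2 w"
    have w: "?w \<in> fob R b2" "unit R b2 ?w = Comp C b2 b ?r (Comp C b a ?r h e) e2"
      using i e2 b locR by auto
    have eqs: "unit X b2 (\<sigma> b2 ?w) = unit X b2 (\<sigma> b2 w')"
      using su[OF e2(2) w(1)] su[OF e2(2) b2(2)] w(2) b2(3) s h e2 ein o by (simp add: assoc)
    have eqt: "unit X b2 (\<tau> b2 ?w) = unit X b2 (\<tau> b2 w')"
      using tu[OF e2(2) w(1)] tu[OF e2(2) b2(2)] w(2) b2(3) t h e2 ein o by (simp add: assoc)
    obtain b3 e3 where b3: "regular_epi C b3 b2 e3" "fmap X b2 b3 e3 (\<sigma> b2 ?w) = fmap X b2 b3 e3 (\<sigma> b2 w')"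
      using lbij_inj[OF lX e2(2) _ _ eqs] i e2 w b2 by auto
    note e3 = regular_epi_in[OF b3(1)]
    have "unit X b3 (fmap X b2 b3 e3 (\<tau> b2 ?w)) = unit X b3 (fmap X b2 b3 e3 (\<tau> b2 w'))"
      using loc[OF e3(3) _ e3(2,1)] eqt i e2 w b2 by simp
    then obtain b4 e4 where b4: "regular_epi C b4 b3 e4"
      "fmap X b3 b4 e4 (fmap X b2 b3 e3 (\<tau> b2 ?w)) = fmap X b3 b4 e4 (fmap X b2 b3 e3 (\<tau> b2 w'))"
      using lbij_inj[OF lX e3(2)] i e2 e3 w b2 by (metis act_in hom_in)
    note e4 = regular_epi_in[OF b4(1)]
    let ?v = "fmap R b3 b4 e4 (fmap R b2 b3 e3 ?w)" and ?v' = "fmap R b3 b4 e4 (fmap R b2 b3 e3 w')"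
    have v: "?v \<in> fob R b4" "?v' \<in> fob R b4" using i e2 e3 e4 w b2 by auto
    have "\<sigma> b4 ?v = \<sigma> b4 ?v'" "\<tau> b4 ?v = \<tau> b4 ?v'"
      using b3 b4 i e2 e3 e4 w b2 by (simp_all add: hom_act[OF i(4)] hom_act[OF i(5)])
    then have "?v = ?v'" using inj_onD[OF inj[OF e4(2)] _ v] by simp
    moreover have "unit R b4 ?v = Comp C b4 b3 ?r (Comp C b3 b2 ?r (Comp C b2 b ?r (Comp C b a ?r h e) e2) e3) e4"
      using locR e2 e3 e4 w i by simp
    moreover have "unit R b4 ?v' = Comp C b4 b3 ?r (Comp C b3 b2 ?r (Comp C b2 b ?r (Comp C b a ?r h' e) e2) e3) e4"
      using locR e2 e3 e4 b2 i by simp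
    ultimately have "Comp C b4 b3 ?r (Comp C b3 b2 ?r (Comp C b2 b ?r (Comp C b a ?r h e) e2) e3) e4
      = Comp C b4 b3 ?r (Comp C b3 b2 ?r (Comp C b2 b ?r (Comp C b a ?r h' e) e2) e3) e4" by simp
    then have "Comp C b3 b2 ?r (Comp C b2 b ?r (Comp C b a ?r h e) e2) e3 = Comp C b3 b2 ?r (Comp C b2 b ?r (Comp C b a ?r h' e) e2) e3"
      by (rule regular_epi_epi[OF b4(1) o(1), rotated 2]) (use h ein e2 e3 o in auto)
    then have "Comp C b2 b ?r (Comp C b a ?r h e) e2 = Comp C b2 b ?r (Comp C b a ?r h' e) e2"
      by (rule regular_epi_epi[OF b3(1) o(1), rotated 2]) (use h ein e2 o in auto)
    then have "Comp C b a ?r h e = Comp C b a ?r h' e"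
      by (rule regular_epi_epi[OF b2(1) o(1), rotated 2]) (use h ein o in auto)
    then show ?thesis by (rule regular_epi_epi[OF b(1) o(1) h])
  qed
  \<comment> \<open>To relate \<open>f\<close> and \<open>g\<close> over \<open>a\<close> it is
    enough to relate them by an element of \<open>R\<close> on a cover: the image \<open>?h\<close>
    of that element under the unit descends along \<open>e\<close>, the descent condition being an
    instance of \<open>jm\<close>.\<close>
  have desc: "\<exists>h\<in>Hom C a ?r. Comp C a ?r ?x ?s h = f \<and> Comp C a ?r ?x ?t h = g"
    if a: "a \<in> Ob C" and f: "f \<in> Hom C a ?x" and g: "g \<in> Hom C a ?x" and b: "regular_epi C b a e"
      and w: "w \<in> fob R b" "unit X b (\<sigma> b w) = Comp C b a ?x f e" "unit X b (\<tau> b w) = Comp C b a ?x g e" for a f g b e w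
  proof -
    note ein = regular_epi_in[OF b]
    let ?h = "unit R b w"
    have h': "?h \<in> Hom C b ?r" using T ein w by simp
    have sh: "Comp C b ?r ?x ?s ?h = Comp C b a ?x f e" "Comp C b ?r ?x ?t ?h = Comp C b a ?x g e"
      using su[OF ein(2) w(1)] tu[OF ein(2) w(1)] w by simp_all
    obtain h where h: "h \<in> Hom C a ?r" "Comp C b a ?r h e = ?h"
    proof (rule regular_epi_factor[OF b o(1) h'])
      fix z u v assume z: "z \<in> Ob C" "u \<in> Hom C z b" "v \<in> Hom C z b" "Comp C z b a e u = Comp C z b a e v"
      show "Comp C z b ?r ?h u = Comp C z b ?r ?h v"
      proof (rule jm[OF z(1)])
        have *: "Comp C z ?r ?x m (Comp C z b ?r ?h y) = Comp C z a ?x k (Comp C z b a e y)"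
          if "m \<in> Hom C ?r ?x" "k \<in> Hom C a ?x" "Comp C b ?r ?x m ?h = Comp C b a ?x k e" "y \<in> Hom C z b" for m k y
          using assoc[OF that(4) h' that(1) z(1) ein(2) o(1,2)] assoc[OF that(4) ein(3) that(2) z(1) ein(2,1) o(2)] that(3)
          by simp
        show "Comp C z ?r ?x ?s (Comp C z b ?r ?h u) = Comp C z ?r ?x ?s (Comp C z b ?r ?h v)"
          unfolding *[OF o(3) f sh(1) z(2)] *[OF o(3) f sh(1) z(3)] z(4) ..
        show "Comp C z ?r ?x ?t (Comp C z b ?r ?h u) = Comp C z ?r ?x ?t (Comp C z b ?r ?h v)"
          unfolding *[OF o(4) g sh(2) z(2)] *[OF o(4) g sh(2) z(3)] z(4) ..
      qed (use z h' o ein in auto)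
    qed
    have "Comp C b a ?x (Comp C a ?r ?x ?s h) e = Comp C b a ?x f e"
      using assoc[OF ein(3) h(1) o(3) ein(2,1) o(1,2)] sh h by simp
    then have 1: "Comp C a ?r ?x ?s h = f"
      by (rule regular_epi_epi[OF b o(2), rotated 2]) (use h o a f in auto)
    have "Comp C b a ?x (Comp C a ?r ?x ?t h) e = Comp C b a ?x g e"
      using assoc[OF ein(3) h(1) o(4) ein(2,1) o(1,2)] sh h by simp
    then have "Comp C a ?r ?x ?t h = g"
      by (rule regular_epi_epi[OF b o(2), rotated 2]) (use h o a g in auto)
    then show ?thesis using 1 h(1) by blast
  qed
  \<comment> \<open>Symmetry, like reflexivity and transitivity below, is read off from equality of
    images under \<open>q\<close>.\<close>
  have qsym: "\<exists>w'\<in>fob R a. \<sigma> a w' = \<tau> a w \<and> \<tau> a w' = \<sigma> a w" if "a \<in> Ob C" "w \<in> fob R a" for a w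
  proof -
    have "\<sigma> a w \<in> fob X a" "\<tau> a w \<in> fob X a" using that i by auto
    then show ?thesis using qk[OF that(1)] that(2) by metis
  qed
  have eqr: "equivalence_relation C ?r ?x ?s ?t"
    unfolding equivalence_relation_def
  proof (intro conjI ballI o)
    fix a assume a: "a \<in> Ob C"
    let ?f = "\<lambda>h. (Comp C a ?r ?x ?s h, Comp C a ?r ?x ?t h)"
    show "inj_on ?f (Hom C a ?r)" using jm[OF a] by (auto simp: inj_on_def)
    have mem: "(f, g) \<in> ?f ` Hom C a ?r" if "\<exists>h\<in>Hom C a ?r. Comp C a ?r ?x ?s h = f \<and> Comp C a ?r ?x ?t h = g" for f g
      using that by auto
    show "equiv (Hom C a ?x) (?f ` Hom C a ?r)"
    proof (rule equivI)
      show "?f ` Hom C a ?r \<subseteq> Hom C a ?x \<times> Hom C a ?x" using a o by auto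
      show "refl_on (Hom C a ?x) (?f ` Hom C a ?r)"
      proof (rule refl_onI)
        fix f assume f: "f \<in> Hom C a ?x"
        obtain b e v where b: "regular_epi C b a e" "v \<in> fob X b" "unit X b v = Comp C b a ?x f e"
          using lbij_surj[OF lX a f] .
        have bO: "b \<in> Ob C" using regular_epi_in[OF b(1)] by blast
        obtain w where w: "w \<in> fob R b" "\<sigma> b w = v" "\<tau> b w = v" using qk[OF bO b(2,2)] by auto
        show "(f, f) \<in> ?f ` Hom C a ?r"
          by (rule mem[OF desc[OF a f f b(1) w(1)]]) (use w b in simp_all)
      qed
      show "sym (?f ` Hom C a ?r)"
      proof (rule symI)
        fix f g assume "(f, g) \<in> ?f ` Hom C a ?r"
        then obtain h where h: "h \<in> Hom C a ?r" "f = Comp C a ?r ?x ?s h" "g = Comp C a ?r ?x ?t h" by auto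
        obtain b e w where b: "regular_epi C b a e" "w \<in> fob R b" "unit R b w = Comp C b a ?r h e"
          using lbij_surj[OF lR a h(1)] .
        note ein = regular_epi_in[OF b(1)]
        obtain w' where w': "w' \<in> fob R b" "\<sigma> b w' = \<tau> b w" "\<tau> b w' = \<sigma> b w" using qsym[OF ein(2) b(2)] by blast
        show "(g, f) \<in> ?f ` Hom C a ?r"
        proof (rule mem[OF desc[OF a _ _ b(1) w'(1)]])
          show "f \<in> Hom C a ?x" "g \<in> Hom C a ?x" using h a o by auto
          show "unit X b (\<sigma> b w') = Comp C b a ?x g e"
            using w'(2) tu[OF ein(2) b(2)] b(3) h ein o by (simp add: assoc)
          show "unit X b (\<tau> b w') = Comp C b a ?x f e"
            using w'(3) su[OF ein(2) b(2)] b(3) h ein o by (simp add: assoc)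
        qed
      qed
      show "trans (?f ` Hom C a ?r)"
      proof (rule transI)
        fix f g m assume "(f, g) \<in> ?f ` Hom C a ?r" "(g, m) \<in> ?f ` Hom C a ?r"
        then obtain h k where h: "h \<in> Hom C a ?r" "f = Comp C a ?r ?x ?s h" "g = Comp C a ?r ?x ?t h"
          and k: "k \<in> Hom C a ?r" "g = Comp C a ?r ?x ?s k" "m = Comp C a ?r ?x ?t k" by auto
        obtain b e w where b: "regular_epi C b a e" "w \<in> fob R b" "unit R b w = Comp C b a ?r h e"
          using lbij_surj[OF lR a h(1)] .
        note ein = regular_epi_in[OF b(1)]
        have ke: "Comp C b a ?r k e \<in> Hom C b ?r" using k ein o by simp
        obtain b2 e2 w' where b2: "regular_epi C b2 b e2" "w' \<in> fob R b2" "unit R b2 w' = Comp C b2 b ?r (Comp C b a ?r k e) e2"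
          using lbij_surj[OF lR ein(2) ke] .
        note e2 = regular_epi_in[OF b2(1)]
        let ?w = "fmap R b b2 e2 w"
        have w: "?w \<in> fob R b2" "unit R b2 ?w = Comp C b2 b ?r (Comp C b a ?r h e) e2"
          using i e2 b locR by auto
        have eqs: "unit X b2 (\<tau> b2 ?w) = unit X b2 (\<sigma> b2 w')"
          using tu[OF e2(2) w(1)] su[OF e2(2) b2(2)] w(2) b2(3) h k e2 ein o by (simp add: assoc)
        obtain b3 e3 where b3: "regular_epi C b3 b2 e3" "fmap X b2 b3 e3 (\<tau> b2 ?w) = fmap X b2 b3 e3 (\<sigma> b2 w')"
          using lbij_inj[OF lX e2(2) _ _ eqs] i e2 w b2 by auto
        note e3 = regular_epi_in[OF b3(1)]
        let ?v = "fmap R b2 b3 e3 ?w" and ?v' = "fmap R b2 b3 e3 w'"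
        have v: "?v \<in> fob R b3" "?v' \<in> fob R b3" using i e2 e3 w b2 by auto
        have vX: "\<sigma> b3 ?v \<in> fob X b3" "\<tau> b3 ?v \<in> fob X b3" "\<sigma> b3 ?v' \<in> fob X b3" "\<tau> b3 ?v' \<in> fob X b3" using i v e3 by auto
        have "\<tau> b3 ?v = \<sigma> b3 ?v'"
          using b3 i e2 e3 w b2 by (simp add: hom_act[OF i(4)] hom_act[OF i(5)])
        then have "q b3 (\<sigma> b3 ?v) = q b3 (\<tau> b3 ?v')"
          using qk[OF e3(2) vX(1,2)] qk[OF e3(2) vX(3,4)] v by auto
        then obtain w3 where w3: "w3 \<in> fob R b3" "\<sigma> b3 w3 = \<sigma> b3 ?v" "\<tau> b3 w3 = \<tau> b3 ?v'"
          using qk[OF e3(2) vX(1,4)] by blast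
        let ?e = "Comp C b3 b2 a (Comp C b2 b a e e2) e3"
        have cov: "regular_epi C b3 a ?e"
          using regular_epi_Comp[OF b3(1) regular_epi_Comp[OF b2(1) b(1)]] .
        show "(f, m) \<in> ?f ` Hom C a ?r"
        proof (rule mem[OF desc[OF a _ _ cov w3(1)]])
          show "f \<in> Hom C a ?x" "m \<in> Hom C a ?x" using h k a o by auto
          have "unit X b3 (\<sigma> b3 w3) = Comp C b3 ?r ?x ?s (Comp C b3 b2 ?r (unit R b2 ?w) e3)"
            using w3(2) su[OF e3(2) v(1)] locR[OF e3(3) w(1) e3(2,1)] by simp
          then show "unit X b3 (\<sigma> b3 w3) = Comp C b3 a ?x f ?e"
            using w(2) h ein e2 e3 o by (simp add: assoc)
          have "unit X b3 (\<tau> b3 w3) = Comp C b3 ?r ?x ?t (Comp C b3 b2 ?r (unit R b2 w') e3)"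
            using w3(3) tu[OF e3(2) v(2)] locR[OF e3(3) b2(2) e3(2,1)] by simp
          then show "unit X b3 (\<tau> b3 w3) = Comp C b3 a ?x m ?e"
            using b2(3) k ein e2 e3 o by (simp add: assoc)
        qed
      qed
    qed
  qed
  obtain y0 f0 where k0: "is_kernel_pair C ?x y0 f0 ?r ?s ?t" using eqr barr unfolding barr_exact_def by blast
  then obtain c p where co: "is_coequaliser C ?r ?x ?s ?t c p"
    using regular unfolding regular_category_def by blast
  have pb: "is_pullback C ?x ?x y0 f0 f0 ?r ?s ?t" using k0 by (simp add: is_kernel_pair_def)
  note pbin = pullback_in[OF pb] and cin = coequaliser_in[OF co]
  have pe: "regular_epi C ?x c p" unfolding regular_epi_def using co by blast
  \<comment> \<open>\<open>f0\<close> is some map with the given relation as kernel-pair. It factors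
    through the coequaliser \<open>p\<close>, so pairs identified by \<open>p\<close> are identified
    by \<open>f0\<close> and hence lie in the relation.\<close>
  have ker: "\<exists>h\<in>Hom C a ?r. Comp C a ?r ?x ?s h = u \<and> Comp C a ?r ?x ?t h = v"
    if a: "a \<in> Ob C" and u: "u \<in> Hom C a ?x" "v \<in> Hom C a ?x" and eq: "Comp C a ?x c p u = Comp C a ?x c p v" for a u v
  proof -
    obtain k where k: "k \<in> Hom C c y0" "Comp C ?x c y0 k p = f0" using coequaliser_ex[OF co pbin(3,5,9)] .
    have "Comp C a ?x y0 f0 u = Comp C a ?x y0 f0 v"
      using assoc[OF u(1) cin(6) k(1) a cin(2,3) pbin(3)] assoc[OF u(2) cin(6) k(1) a cin(2,3) pbin(3)] k eq by simp
    then show ?thesis using pullback_ex[OF pb a u] by metis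
  qed
  define \<beta> where "\<beta> = mk_hom X (\<lambda>a v. Comp C a ?x c p (unit X a v))"
  have \<beta>in: "\<beta> \<in> Hom P X (W c)"
    unfolding \<beta>_def
  proof (rule mk_hom[OF i(2)])
    show "Comp C a ?x c p (unit X a v) \<in> fob (W c) a" if "a \<in> Ob C" "v \<in> fob X a" for a v
      using that T cin by simp
    show "Comp C a ?x c p (unit X a (fmap X b a f v)) = fmap (W c) b a f (Comp C b ?x c p (unit X b v))"
      if "a \<in> Ob C" "b \<in> Ob C" "f \<in> Hom C a b" "v \<in> fob X b" for a b f v
      using that T cin loc by (simp add: assoc)
  qed
  have \<beta>: "\<beta> a v = Comp C a ?x c p (unit X a v)" if "a \<in> Ob C" "v \<in> fob X a" for a v
    using that by (simp add: \<beta>_def)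
  have "\<beta> a u = \<beta> a v" if a: "a \<in> Ob C" "u \<in> fob X a" "v \<in> fob X a" "q a u = q a v" for a u v
  proof -
    have "\<exists>w\<in>fob R a. \<sigma> a w = u \<and> \<tau> a w = v" using qk[OF a(1-3)] a(4) by simp
    then obtain w where w: "w \<in> fob R a" "\<sigma> a w = u" "\<tau> a w = v" by blast
    have ur: "unit R a w \<in> Hom C a ?r" using T a w by simp
    have "unit X a u = Comp C a ?r ?x ?s (unit R a w)" "unit X a v = Comp C a ?r ?x ?t (unit R a w)"
      using su[OF a(1) w(1)] tu[OF a(1) w(1)] w by simp_all
    then show ?thesis
      unfolding \<beta>[OF a(1,2)] \<beta>[OF a(1,3)] using a(1) ur o cin by (simp add: assoc)
  qed
  then obtain \<eta> where \<eta>: "\<eta> \<in> Hom P Q (W c)" "\<And>a v. \<lbrakk>a \<in> Ob C; v \<in> fob X a\<rbrakk> \<Longrightarrow> \<eta> a (q a v) = \<beta> a v"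
    using factor_surj[OF i(6,2,3) qs \<beta>in] by metis
  have "lbij Q c \<eta>"
    unfolding lbij_def
  proof (intro conjI ballI impI i cin \<eta>)
    fix a z assume a: "a \<in> Ob C" and z: "z \<in> Hom C a c"
    obtain a1 e1 g where a1: "a1 \<in> Ob C" "regular_epi C a1 a e1" "g \<in> Hom C a1 ?x" "Comp C a1 ?x c p g = Comp C a1 a c z e1"
      using regular_epi_pullback[OF pe z a] .
    note e1 = regular_epi_in[OF a1(2)]
    obtain a2 e2 v where a2: "regular_epi C a2 a1 e2" "v \<in> fob X a2" "unit X a2 v = Comp C a2 a1 ?x g e2"
      using lbij_surj[OF lX a1(1,3)] .
    note e2 = regular_epi_in[OF a2(1)]
    have "\<eta> a2 (q a2 v) = Comp C a2 ?x c p (Comp C a2 a1 ?x g e2)" using \<eta>(2) \<beta> e2 a2 by simp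
    also have "\<dots> = Comp C a2 a c z (Comp C a2 a1 a e1 e2)"
      using a1 e1 e2 cin z a by (simp add: assoc)
    finally have "\<eta> a2 (q a2 v) = Comp C a2 a c z (Comp C a2 a1 a e1 e2)" .
    moreover have "q a2 v \<in> fob Q a2" using i e2 a2 by simp
    ultimately show "\<exists>b e. regular_epi C b a e \<and> (\<exists>w\<in>fob Q b. \<eta> b w = Comp C b a c z e)"
      using regular_epi_Comp[OF a2(1) a1(2)] by blast
  next
    fix a y y' assume a: "a \<in> Ob C" and y: "y \<in> fob Q a" "y' \<in> fob Q a" and eq: "\<eta> a y = \<eta> a y'"
    have "y \<in> q a ` fob X a" "y' \<in> q a ` fob X a" using y qs a by auto
    then obtain v v' where v: "v \<in> fob X a" "y = q a v" "v' \<in> fob X a" "y' = q a v'" by blast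
    have uv: "unit X a v \<in> Hom C a ?x" "unit X a v' \<in> Hom C a ?x" using T a v by auto
    have "Comp C a ?x c p (unit X a v) = Comp C a ?x c p (unit X a v')"
      using eq v \<eta>(2) \<beta> a by simp
    then obtain h where h: "h \<in> Hom C a ?r" "Comp C a ?r ?x ?s h = unit X a v" "Comp C a ?r ?x ?t h = unit X a v'"
      using ker[OF a uv] by blast
    \<comment> \<open>The arrow \<open>h\<close> into the relation is represented by
      \<open>w\<close> in \<open>R\<close> on a cover. The images of \<open>\<sigma> w\<close> and
      \<open>\<tau> w\<close> under the unit are those of the restrictions of \<open>v\<close> and
      \<open>v'\<close>, so after two more covers the elements coincide, and \<open>w\<close> shows
      that \<open>v\<close> and \<open>v'\<close> have the same class there.\<close>
    obtain b e w where b: "regular_epi C b a e" "w \<in> fob R b" "unit R b w = Comp C b a ?r h e"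
      using lbij_surj[OF lR a h(1)] .
    note ein = regular_epi_in[OF b(1)]
    have ev: "fmap X a b e v \<in> fob X b" "fmap X a b e v' \<in> fob X b" "\<sigma> b w \<in> fob X b" "\<tau> b w \<in> fob X b"
      using i ein v b by auto
    have eq1: "unit X b (\<sigma> b w) = unit X b (fmap X a b e v)"
      using su[OF ein(2) b(2)] b(3) h ein o loc[OF ein(3) v(1) ein(2,1)] by (simp add: assoc)
    have eq2: "unit X b (\<tau> b w) = unit X b (fmap X a b e v')"
      using tu[OF ein(2) b(2)] b(3) h ein o loc[OF ein(3) v(3) ein(2,1)] by (simp add: assoc)
    obtain b1 e1 where b1: "regular_epi C b1 b e1" "fmap X b b1 e1 (\<sigma> b w) = fmap X b b1 e1 (fmap X a b e v)"
      using lbij_inj[OF lX ein(2) ev(3,1) eq1] .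
    note e1 = regular_epi_in[OF b1(1)]
    have ev1: "fmap X b b1 e1 (\<tau> b w) \<in> fob X b1" "fmap X b b1 e1 (fmap X a b e v') \<in> fob X b1" using i e1 ev by auto
    have "unit X b1 (fmap X b b1 e1 (\<tau> b w)) = unit X b1 (fmap X b b1 e1 (fmap X a b e v'))"
      using loc[OF e1(3) ev(4) e1(2,1)] loc[OF e1(3) ev(2) e1(2,1)] eq2 by simp
    then obtain b2 e2 where b2: "regular_epi C b2 b1 e2"
      "fmap X b1 b2 e2 (fmap X b b1 e1 (\<tau> b w)) = fmap X b1 b2 e2 (fmap X b b1 e1 (fmap X a b e v'))"
      using lbij_inj[OF lX e1(2) ev1] by blast
    note e2 = regular_epi_in[OF b2(1)]
    let ?e = "Comp C b2 b1 a (Comp C b1 b a e e1) e2"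
    have act3: "fmap F a b2 ?e u = fmap F b1 b2 e2 (fmap F b b1 e1 (fmap F a b e u))" if "F \<in> Ob P" "u \<in> fob F a" for F u
      using that ein e1 e2 by (simp add: act_Comp[OF that(1)])
    let ?w = "fmap R b1 b2 e2 (fmap R b b1 e1 w)"
    have w: "?w \<in> fob R b2" using i b e1 e2 ein by simp
    have "\<sigma> b2 ?w = fmap X a b2 ?e v" "\<tau> b2 ?w = fmap X a b2 ?e v'"
      using b1(2) b2(2) act3[OF i(2) v(1)] act3[OF i(2) v(3)] i b e1 e2 ein
      by (simp_all add: hom_act[OF i(4)] hom_act[OF i(5)])
    moreover have "fmap X a b2 ?e v \<in> fob X b2" "fmap X a b2 ?e v' \<in> fob X b2" using act3[OF i(2)] i v ein e1 e2 by auto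
    ultimately have "q b2 (fmap X a b2 ?e v) = q b2 (fmap X a b2 ?e v')"
      using qk[OF e2(2)] w by blast
    moreover have eh: "?e \<in> Hom C b2 a" using ein e1 e2 by simp
    ultimately have "fmap Q a b2 ?e y = fmap Q a b2 ?e y'"
      using hom_act[OF i(6) eh v(1) e2(2) a] hom_act[OF i(6) eh v(3) e2(2) a] v by simp
    then show "\<exists>b e. regular_epi C b a e \<and> fmap Q a b e y = fmap Q a b e y'"
      using regular_epi_Comp[OF b2(1) regular_epi_Comp[OF b1(1) b(1)]] by blast
  qed
  then show ?thesis by blast
qed

subsection \<open>The reflection exists on \<open>\<Phi>\<^sub>l C\<close> and preserves finite limits\<close>

lemma W_T: "W ` Ob C \<subseteq> T"
  using lbij_W small_W by (auto simp: T_def)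

lemma replete_T: "replete (small_psh C) T"
  unfolding replete_def
proof (intro ballI impI)
  fix F G assume F: "F \<in> T" and G: "G \<in> Ob (small_psh C)" and "isomorphic (small_psh C) F G"
  then obtain k m where "k \<in> Hom P F G" "m \<in> Hom P G F" "Comp P F G F m k = idn P F" "Comp P G F G k m = idn P G"
    unfolding isomorphic_def is_iso_def small_psh_eq by auto
  then have m: "is_iso P G F m" unfolding is_iso_def by blast
  have "G \<in> Sm" using G by (simp add: small_psh_eq)
  moreover from this have "G \<in> Ob P" using Sm_Ob by blast
  ultimately show "G \<in> T" using lbij_iso[OF lbij_unit[OF F] m] by (auto simp: T_def)
qed

lemma closed_limits_T: "closed_finite_limits (small_psh C) T"
  unfolding closed_finite_limits_def small_psh_eq
proof (intro allI impI)
  fix J :: "(nat, nat) cat" and D F \<pi>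
  assume J: "finite_category J" and D: "is_functor J (full_subcat P Sm) D" and DT: "fob D ` Ob J \<subseteq> T"
    and l: "is_limit J (full_subcat P Sm) D F \<pi>"
  have DT': "is_functor J (full_subcat P T) D"
    using functor_to_full_subcat[OF is_functor_full_subcat[OF D Sm_Ob] DT] .
  have c: "is_cone J (full_subcat P Sm) D F \<pi>" using is_limit_cone[OF l] .
  then have F: "F \<in> Sm" by (simp add: is_cone_def)
  obtain c \<rho> where c': "is_limit J C (fcomp L D) c \<rho>"
    using regular_fc J is_functor_fcomp[OF DT' L_functor] unfolding finitely_complete_def by blast
  have "\<exists>c \<eta>. lbij F c \<eta>"
  proof (rule lbij_limit[OF J DT' _ _ _ limit_imp_pointwise_limit[OF Sm_Ob W_Sm D l] c'])
    show "F \<in> Ob P" using F Sm_Ob by blast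
  qed (use c in \<open>auto simp: is_cone_def\<close>)
  then show "F \<in> T" using F by (simp add: T_def)
qed

text \<open>The weight \<open>\<phi>\<close> is a pointwise quotient of representables on
  \<open>K\<close>, so a colimit weighted by it is a coequaliser of \<open>D s\<close> and
  \<open>D t\<close>. As \<open>D\<close> is lex, these form an equivalence relation of small
  presheaves, which is one at each stage; the colimit is therefore a pointwise quotient, to which
  \<open>lbij_quotient\<close> applies.\<close>

lemma closed_colimits_T:
  fixes \<Phi> :: "'u lex_weight set"
  assumes "is_Phi_ex \<Phi>"
  shows "closed_lex_colimits \<Phi> (small_psh C) T"
proof -
  obtain K r x s t \<phi> q where K: "free_on_equivalence_relation K r x s t"
    and co: "is_coequaliser (psh K) (fob (yoneda K) r) (fob (yoneda K) x)
       (fmap (yoneda K) r x s) (fmap (yoneda K) r x t) \<phi> q" and \<Phi>: "\<Phi> = {(K, \<phi>)}"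
    using assms unfolding is_Phi_ex_def by blast
  have sK: "small_category K" and e: "equivalence_relation K r x s t"
    using K by (auto simp: free_on_equivalence_relation_def)
  interpret K: presheaves K
    by unfold_locales (use sK set_universe in \<open>auto simp: small_category_def\<close>)
  note o = K.eqrel_in[OF e]
  obtain \<phi>' q' where pq': "K.pointwise_quotient (fob (yoneda K) r) (fob (yoneda K) x)
       (fmap (yoneda K) r x s) (fmap (yoneda K) r x t) \<phi>' q'"
    using K.eqrel_pointwise_quotient[OF e] .
  have pq: "K.pointwise_quotient (fob (yoneda K) r) (fob (yoneda K) x)
       (fmap (yoneda K) r x s) (fmap (yoneda K) r x t) \<phi> q"
    by (rule K.coequaliser_imp_pointwise_quotient[OF pq', of "Ob K.P"])
      (use o co pq' in \<open>auto simp: K.pointwise_quotient_def\<close>)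
  show ?thesis
    unfolding closed_lex_colimits_def \<Phi>
  proof clarsimp
    fix D Q \<eta> assume D: "lex_functor K (small_psh C) D" and DT: "fob D ` Ob K \<subseteq> T"
      and w: "is_weighted_colimit K \<phi> (small_psh C) D Q \<eta>"
    have DF: "is_functor K (small_psh C) D" and "category (small_psh C)"
      using D by (auto simp: lex_functor_def finitely_complete_def)
    then have "is_coequaliser (full_subcat P Sm) (fob D r) (fob D x) (fmap D r x s) (fmap D r x t) Q (\<eta> x (q x (idn K x)))"
      using K.coequaliser_of_weighted_colimit[OF pq o _ DF w] by (simp add: small_psh_eq)
    note coQ = this
    have eR: "equivalence_relation (full_subcat P Sm) (fob D r) (fob D x) (fmap D r x s) (fmap D r x t)"
      using lex_functor_eqrel[OF D e] by (simp add: small_psh_eq)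
    have RX: "fob D r \<in> Sm" "fob D x \<in> Sm" "fmap D r x s \<in> Hom P (fob D r) (fob D x)" "fmap D r x t \<in> Hom P (fob D r) (fob D x)"
      using eR by (auto simp: equivalence_relation_def)
    obtain Q' p' where Q': "pointwise_quotient (fob D r) (fob D x) (fmap D r x s) (fmap D r x t) Q' p'"
    proof (rule pointwise_quotient_ex[OF _ _ RX(3,4)])
      show "fob D r \<in> Ob P" "fob D x \<in> Ob P" using RX Sm_Ob by auto
      show "equiv (fob (fob D x) a) ((\<lambda>w. (fmap D r x s a w, fmap D r x t a w)) ` fob (fob D r) a)" if "a \<in> Ob C" for a
        by (rule eqrel_imp_pointwise(2)[OF Sm_Ob W_Sm eR that])
    qed
    have "Q' \<in> Sm" using small_quotient[OF Q'] RX by simp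
    then have "pointwise_quotient (fob D r) (fob D x) (fmap D r x s) (fmap D r x t) Q (\<eta> x (q x (idn K x)))"
      using coequaliser_imp_pointwise_quotient[OF Q' RX(1,2) _ Sm_Ob coQ] by blast
    then have "\<exists>c \<eta>. lbij Q c \<eta>"
      by (rule lbij_quotient) (use DT o eqrel_imp_pointwise(1)[OF Sm_Ob W_Sm eR] in auto)
    then show "Q \<in> T" using coequaliser_in(3)[OF coQ] by (simp add: T_def)
  qed
qed

lemma PL_T: "is_Phi_ex (\<Phi> :: 'u lex_weight set) \<Longrightarrow> PL \<Phi> \<subseteq> T"
  by (intro PL_least T_Sm replete_T W_T closed_limits_T closed_colimits_T)

text \<open>For a limit \<open>F\<close> in \<open>\<Phi>\<^sub>l C\<close>,
  \<open>lbij_limit\<close> gives a locally bijective map to the limit \<open>c\<close> of the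
  reflected diagram, while the chosen unit of \<open>F\<close> is another such map. Both are
  universal, so \<open>Lo F\<close> and \<open>c\<close> are isomorphic compatibly with the
  projections. This makes \<open>L\<close> left exact, and the transpose of an arrow
  \<open>h\<close> is \<open>h\<close> after the unit.\<close>

theorem barr_imp_Phi_exact:
  fixes \<Phi> :: "'u lex_weight set"
  assumes \<Phi>: "is_Phi_ex \<Phi>"
  shows "Phi_exact \<Phi> C"
proof -
  note PT = PL_T[OF \<Phi>]
  have PLT: "F \<in> T" "F \<in> Ob P" if "F \<in> PL \<Phi>" for F using that PT T_Ob by auto
  have Lf: "is_functor (full_subcat P (PL \<Phi>)) C L"
    using L_functor PT unfolding is_functor_def by (simp add: subset_iff)
  have "lex_functor (full_subcat P (PL \<Phi>)) C L"
    unfolding lex_functor_def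
  proof (intro conjI allI impI finitely_complete_Phi_l regular_fc Lf)
    fix J :: "(nat, nat) cat" and D F \<pi>
    assume J: "finite_category J" and D: "is_functor J (full_subcat P (PL \<Phi>)) D"
      and l: "is_limit J (full_subcat P (PL \<Phi>)) D F \<pi>"
    have DT: "is_functor J (full_subcat P T) D"
      using functor_to_full_subcat[OF is_functor_full_subcat[OF D PL_Ob]] functor_ob[OF D] PT by auto
    have LD: "is_functor J C (fcomp L D)" using is_functor_fcomp[OF DT L_functor] .
    have c: "is_cone J (full_subcat P (PL \<Phi>)) D F \<pi>" using is_limit_cone[OF l] .
    then have F: "F \<in> PL \<Phi>" and \<pi>: "\<And>j. j \<in> Ob J \<Longrightarrow> \<pi> j \<in> Hom P F (fob D j)" by (auto simp: is_cone_def)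
    have Dj: "fob D j \<in> T" if "j \<in> Ob J" for j using functor_ob[OF DT that] by simp
    obtain c \<rho> where lc: "is_limit J C (fcomp L D) c \<rho>"
      using regular_fc J LD unfolding finitely_complete_def by blast
    have \<rho>: "\<And>j. j \<in> Ob J \<Longrightarrow> \<rho> j \<in> Hom C c (Lo (fob D j))" using is_limit_cone[OF lc] by (simp add: is_cone_def)
    obtain \<eta> where \<eta>: "lbij F c \<eta>"
      "\<And>a x j. \<lbrakk>a \<in> Ob C; x \<in> fob F a; j \<in> Ob J\<rbrakk> \<Longrightarrow> Comp C a c (Lo (fob D j)) (\<rho> j) (\<eta> a x) = unit (fob D j) a (\<pi> j a x)"
    proof (rule lbij_limit[OF J DT PLT(2)[OF F] \<pi> _ limit_imp_pointwise_limit[OF PL_Ob W_PL D l] lc])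
      show "Comp P F (fob D i) (fob D j) (fmap D i j u) (\<pi> i) = \<pi> j" if "i \<in> Ob J" "j \<in> Ob J" "u \<in> Hom J i j" for i j u
        using c that by (simp add: is_cone_def)
    qed blast+
    note lF = lbij_unit[OF PLT(1)[OF F]]
    note o = lbij_in(2)[OF lF] lbij_in(2)[OF \<eta>(1)]
    obtain k where k: "k \<in> Hom C (Lo F) c" "\<And>a w. \<lbrakk>a \<in> Ob C; w \<in> fob F a\<rbrakk> \<Longrightarrow> Comp C a (Lo F) c k (unit F a w) = \<eta> a w"
      using lbij_universal[OF lF o(2) lbij_in(3)[OF \<eta>(1)]] by blast
    obtain m where m: "m \<in> Hom C c (Lo F)" "\<And>a w. \<lbrakk>a \<in> Ob C; w \<in> fob F a\<rbrakk> \<Longrightarrow> Comp C a c (Lo F) m (\<eta> a w) = unit F a w"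
      using lbij_universal[OF \<eta>(1) o(1) lbij_in(3)[OF lF]] by blast
    have \<eta>in: "\<eta> a w \<in> Hom C a c" if "a \<in> Ob C" "w \<in> fob F a" for a w using lbij_app[OF \<eta>(1) that] .
    have uin: "unit F a w \<in> Hom C a (Lo F)" if "a \<in> Ob C" "w \<in> fob F a" for a w using lbij_app[OF lF that] .
    have "Comp C (Lo F) c (Lo F) m k = idn C (Lo F)"
      by (rule lbij_uniq[OF lF o(1)]) (use k m o uin in \<open>simp_all flip: assoc\<close>)
    moreover have "Comp C c (Lo F) c k m = idn C c"
      by (rule lbij_uniq[OF \<eta>(1) o(2)]) (use k m o \<eta>in in \<open>simp_all flip: assoc\<close>)
    ultimately have iso: "is_iso C (Lo F) c k" unfolding is_iso_def using k m by blast
    have "is_limit J C (fcomp L D) (Lo F) (\<lambda>j. Lm F (fob D j) (\<pi> j))"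
    proof (rule is_limit_iso[OF LD lc iso o(1)])
      show "\<forall>j\<in>Ob J. Comp C (Lo F) c (fob (fcomp L D) j) (\<rho> j) k = Lm F (fob D j) (\<pi> j)"
      proof
        fix j assume j: "j \<in> Ob J"
        have "Comp C (Lo F) c (Lo (fob D j)) (\<rho> j) k = Lm F (fob D j) (\<pi> j)"
        proof (rule lbij_uniq[OF lF Lo_Ob[OF Dj[OF j]]])
          show "Lm F (fob D j) (\<pi> j) \<in> Hom C (Lo F) (Lo (fob D j))" using PLT(1)[OF F] Dj[OF j] \<pi>[OF j] by simp
          show "Comp C (Lo F) c (Lo (fob D j)) (\<rho> j) k \<in> Hom C (Lo F) (Lo (fob D j))" using k o \<rho>[OF j] Dj[OF j] by simp
          fix a w assume a: "a \<in> Ob C" "w \<in> fob F a"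
          have "Comp C a (Lo F) (Lo (fob D j)) (Comp C (Lo F) c (Lo (fob D j)) (\<rho> j) k) (unit F a w) = Comp C a c (Lo (fob D j)) (\<rho> j) (\<eta> a w)"
            using assoc[OF uin[OF a] k(1) \<rho>[OF j] a(1) o Lo_Ob[OF Dj[OF j]]] k(2)[OF a] by simp
          then show "Comp C a (Lo F) (Lo (fob D j)) (Comp C (Lo F) c (Lo (fob D j)) (\<rho> j) k) (unit F a w)
            = Comp C a (Lo F) (Lo (fob D j)) (Lm F (fob D j) (\<pi> j)) (unit F a w)"
            using \<eta>(2)[OF a j] Lm_unit[OF PLT(1)[OF F] Dj[OF j] \<pi>[OF j] a] by simp
        qed
        then show "Comp C (Lo F) c (fob (fcomp L D) j) (\<rho> j) k = Lm F (fob D j) (\<pi> j)" by simp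
      qed
    qed
    then show "is_limit J C (fcomp L D) (fob L F) (\<lambda>j. fmap L F (fob D j) (\<pi> j))" by simp
  qed
  moreover have "is_left_adjoint (full_subcat P (PL \<Phi>)) C L (yoneda C)"
    unfolding is_left_adjoint_def
  proof (intro conjI exI ballI Lf)
    show "is_functor C (full_subcat P (PL \<Phi>)) (yoneda C)"
      using functor_to_full_subcat[OF yoneda_functor W_PL] .
    let ?\<theta> = "\<lambda>F c h. mk_hom F (\<lambda>a w. Comp C a (Lo F) c h (unit F a w))"
    have \<theta>: "?\<theta> F c h \<in> Hom P F (W c)" if F: "F \<in> PL \<Phi>" and c: "c \<in> Ob C" and h: "h \<in> Hom C (Lo F) c" for F c h
    proof (rule mk_hom[OF PLT(2)[OF F]])
      note lF = lbij_unit[OF PLT(1)[OF F]]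
      show "Comp C a (Lo F) c h (unit F a w) \<in> fob (W c) a" if "a \<in> Ob C" "w \<in> fob F a" for a w
        using that PLT(1)[OF F] c h by simp
      show "Comp C a (Lo F) c h (unit F a (fmap F b a f w)) = fmap (W c) b a f (Comp C b (Lo F) c h (unit F b w))"
        if o: "a \<in> Ob C" "b \<in> Ob C" "f \<in> Hom C a b" "w \<in> fob F b" for a b f w
        using lbij_act[OF lF o(3,4,1,2)] o PLT(1)[OF F] c h by (simp add: assoc)
    qed
    fix F c assume "F \<in> Ob (full_subcat P (PL \<Phi>))" and c: "c \<in> Ob C"
    then have F: "F \<in> PL \<Phi>" by simp
    note lF = lbij_unit[OF PLT(1)[OF F]]
    show "bij_betw (?\<theta> F c) (Hom C (fob L F) c) (Hom (full_subcat P (PL \<Phi>)) F (fob (yoneda C) c))"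
      unfolding bij_betw_def
    proof
      show "inj_on (?\<theta> F c) (Hom C (fob L F) c)"
      proof (rule inj_onI)
        fix h h' assume h: "h \<in> Hom C (fob L F) c" "h' \<in> Hom C (fob L F) c" and eq: "?\<theta> F c h = ?\<theta> F c h'"
        show "h = h'"
        proof (rule lbij_uniq[OF lF c])
          fix a w assume "a \<in> Ob C" "w \<in> fob F a"
          then show "Comp C a (Lo F) c h (unit F a w) = Comp C a (Lo F) c h' (unit F a w)"
            using fun_cong[OF fun_cong[OF eq], of a w] by simp
        qed (use h in auto)
      qed
      show "?\<theta> F c ` Hom C (fob L F) c = Hom (full_subcat P (PL \<Phi>)) F (W c)"
      proof
        show "?\<theta> F c ` Hom C (fob L F) c \<subseteq> Hom (full_subcat P (PL \<Phi>)) F (W c)" using \<theta>[OF F c] by auto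
        show "Hom (full_subcat P (PL \<Phi>)) F (W c) \<subseteq> ?\<theta> F c ` Hom C (fob L F) c"
        proof
          fix \<beta> assume "\<beta> \<in> Hom (full_subcat P (PL \<Phi>)) F (W c)"
          then have \<beta>: "\<beta> \<in> Hom P F (W c)" by simp
          obtain h where h: "h \<in> Hom C (Lo F) c" "\<And>a w. \<lbrakk>a \<in> Ob C; w \<in> fob F a\<rbrakk> \<Longrightarrow> Comp C a (Lo F) c h (unit F a w) = \<beta> a w"
            using lbij_universal[OF lF c \<beta>] by blast
          have "\<beta> = ?\<theta> F c h"
            by (rule hom_eqI[OF \<beta> \<theta>[OF F c h(1)]]) (use h in simp)
          then show "\<beta> \<in> ?\<theta> F c ` Hom C (fob L F) c" using h by auto
        qed
      qed
    qed
    fix F' c' \<alpha> v h assume "F' \<in> Ob (full_subcat P (PL \<Phi>))" and c': "c' \<in> Ob C"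
      and "\<alpha> \<in> Hom (full_subcat P (PL \<Phi>)) F' F" and v: "v \<in> Hom C c c'" and "h \<in> Hom C (fob L F) c"
    then have F': "F' \<in> PL \<Phi>" and \<alpha>: "\<alpha> \<in> Hom P F' F" and h: "h \<in> Hom C (Lo F) c" by simp_all
    let ?k = "Comp C (Lo F') c c' v (Comp C (Lo F') (Lo F) c h (Lm F' F \<alpha>))"
    have L\<alpha>: "Lm F' F \<alpha> \<in> Hom C (Lo F') (Lo F)" using PLT F F' \<alpha> by simp
    have o: "Lo F \<in> Ob C" "Lo F' \<in> Ob C" using PLT F F' by auto
    have k: "?k \<in> Hom C (Lo F') c'" using L\<alpha> o h v c c' by simp
    have "?\<theta> F' c' ?k = Comp P F' (W c) (W c') (fmap (yoneda C) c c' v) (Comp P F' F (W c) (?\<theta> F c h) \<alpha>)"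
    proof (rule hom_eqI[OF \<theta>[OF F' c' k] psh_Comp_in[OF psh_Comp_in[OF \<alpha> \<theta>[OF F c h]] yoneda_in[OF c c' v]]])
      fix a w assume a: "a \<in> Ob C" "w \<in> fob F' a"
      have \<alpha>w: "\<alpha> a w \<in> fob F a" using \<alpha> a by simp
      have "?\<theta> F' c' ?k a w = Comp C a c c' v (Comp C a (Lo F) c h (Comp C a (Lo F') (Lo F) (Lm F' F \<alpha>) (unit F' a w)))"
        using a L\<alpha> o h v c c' PLT(1)[OF F'] by (simp add: assoc)
      then show "?\<theta> F' c' ?k a w = Comp P F' (W c) (W c') (fmap (yoneda C) c c' v) (Comp P F' F (W c) (?\<theta> F c h) \<alpha>) a w"
        using a \<alpha>w Lm_unit[OF PLT(1)[OF F'] PLT(1)[OF F] \<alpha> a] PLT(1)[OF F] h c o by simp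
    qed (use PLT F' in auto)
    then show "?\<theta> F' c' (Comp C (fob L F') c c' v (Comp C (fob L F') (fob L F) c h (fmap L F' F \<alpha>))) =
       Comp (full_subcat P (PL \<Phi>)) F' (W c) (W c') (fmap (yoneda C) c c' v) (Comp (full_subcat P (PL \<Phi>)) F' F (W c) (?\<theta> F c h) \<alpha>)"
      by simp
  qed
  ultimately show ?thesis
    unfolding Phi_exact_def Phi_l_eq using regular_fc by blast
qed

end

section \<open>Exact categories for the weight are Barr-exact\<close>

context cat_base
begin

text \<open>The lex functor obtained from the universal property of \<open>K\<close> takes the
  generic equivalence relation to a given one only up to isomorphism; the coequaliser has to be
  moved accordingly.\<close>

lemma coequaliser_iso:
  assumes c: "is_coequaliser C a b f g q e" and \<alpha>: "is_iso C a' a \<alpha>" and \<beta>: "is_iso C b' b \<beta>"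
    and o: "a' \<in> Ob C" "b' \<in> Ob C" "f' \<in> Hom C a' b'" "g' \<in> Hom C a' b'"
    and eq: "Comp C a' a b f \<alpha> = Comp C a' b' b \<beta> f'" "Comp C a' a b g \<alpha> = Comp C a' b' b \<beta> g'"
  shows "is_coequaliser C a' b' f' g' q (Comp C b' b q e \<beta>)"
proof -
  note i = coequaliser_in[OF c]
  obtain \<alpha>i where \<alpha>i: "\<alpha> \<in> Hom C a' a" "\<alpha>i \<in> Hom C a a'" "Comp C a a' a \<alpha> \<alpha>i = idn C a"
    using \<alpha> unfolding is_iso_def by blast
  obtain \<beta>i where \<beta>i: "\<beta> \<in> Hom C b' b" "\<beta>i \<in> Hom C b b'" "Comp C b' b b' \<beta>i \<beta> = idn C b'" "Comp C b b' b \<beta> \<beta>i = idn C b"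
    using \<beta> unfolding is_iso_def by blast
  show ?thesis
  proof (rule is_coequaliserI)
    have "Comp C a' b' q (Comp C b' b q e \<beta>) f' = Comp C a' a q (Comp C a b q e f) \<alpha>"
      using assoc[OF o(3) \<beta>i(1) i(6)] assoc[OF \<alpha>i(1) i(4) i(6)] eq i o by simp
    also have "\<dots> = Comp C a' b' q (Comp C b' b q e \<beta>) g'"
      using assoc[OF o(4) \<beta>i(1) i(6)] assoc[OF \<alpha>i(1) i(5) i(6)] eq i o by simp
    finally show "Comp C a' b' q (Comp C b' b q e \<beta>) f' = Comp C a' b' q (Comp C b' b q e \<beta>) g'" .
    fix z assume z: "z \<in> Ob C"
    {
      fix u assume u: "u \<in> Hom C b' z" "Comp C a' b' z u f' = Comp C a' b' z u g'"
      let ?u = "Comp C b b' z u \<beta>i"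
      have ui: "?u \<in> Hom C b z" using u \<beta>i i o z by simp
      have *: "Comp C a b z ?u m = Comp C a a' z (Comp C a' b' z u m') \<alpha>i"
        if m: "m \<in> Hom C a b" "m' \<in> Hom C a' b'" "Comp C a' a b m \<alpha> = Comp C a' b' b \<beta> m'" for m m'
      proof -
        have "m = Comp C a a' b (Comp C a' a b m \<alpha>) \<alpha>i"
          using assoc[OF \<alpha>i(2,1) m(1)] \<alpha>i(3) m(1) i o by simp
        also have "\<dots> = Comp C a a' b (Comp C a' b' b \<beta> m') \<alpha>i" using m(3) by simp
        finally have "Comp C a b b' \<beta>i m = Comp C a b b' \<beta>i (Comp C a a' b (Comp C a' b' b \<beta> m') \<alpha>i)" by simp
        also have "\<dots> = Comp C a a' b' m' \<alpha>i"
          using m \<alpha>i \<beta>i i o by (simp add: assoc)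
        finally show ?thesis using m \<alpha>i \<beta>i u i o z by (simp flip: assoc)
      qed
      have "Comp C a b z ?u f = Comp C a b z ?u g"
        using *[OF i(4) o(3) eq(1)] *[OF i(5) o(4) eq(2)] u(2) by simp
      then obtain h where h: "h \<in> Hom C q z" "Comp C b q z h e = ?u"
        using coequaliser_ex[OF c z ui] by blast
      have "Comp C b' q z h (Comp C b' b q e \<beta>) = Comp C b' b z ?u \<beta>"
        using assoc[OF \<beta>i(1) i(6) h(1)] h i o z by simp
      also have "\<dots> = u" using assoc[OF \<beta>i(1,2) u(1)] \<beta>i(3) u i o z by simp
      finally show "\<exists>h\<in>Hom C q z. Comp C b' q z h (Comp C b' b q e \<beta>) = u" using h(1) by blast
    }
    fix h h' assume h: "h \<in> Hom C q z" "h' \<in> Hom C q z"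
      and e: "Comp C b' q z h (Comp C b' b q e \<beta>) = Comp C b' q z h' (Comp C b' b q e \<beta>)"
    have *: "Comp C b b' z (Comp C b' q z k (Comp C b' b q e \<beta>)) \<beta>i = Comp C b q z k e" if "k \<in> Hom C q z" for k
      using that \<beta>i i o z by (simp flip: assoc)
    have "Comp C b q z h e = Comp C b q z h' e"
      using *[OF h(1)] *[OF h(2)] e by simp
    then show "h = h'" using coequaliser_uniq[OF c z h] by simp
  qed (use i o \<beta>i in auto)
qed

lemma coequaliser_iso_target:
  assumes c: "is_coequaliser C a b f g q e" and k: "is_iso C q q' k" and q': "q' \<in> Ob C"
  shows "is_coequaliser C a b f g q' (Comp C b q q' k e)"
proof -
  note i = coequaliser_in[OF c]
  obtain m where m: "k \<in> Hom C q q'" "m \<in> Hom C q' q" "Comp C q q' q m k = idn C q" "Comp C q' q q' k m = idn C q'"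
    using k unfolding is_iso_def by blast
  show ?thesis
  proof (rule is_coequaliserI)
    show "Comp C a b q' (Comp C b q q' k e) f = Comp C a b q' (Comp C b q q' k e) g"
      using assoc[OF i(4,6) m(1)] assoc[OF i(5,6) m(1)] i q' by simp
    fix z assume z: "z \<in> Ob C"
    show "\<exists>h\<in>Hom C q' z. Comp C b q' z h (Comp C b q q' k e) = u"
      if u: "u \<in> Hom C b z" "Comp C a b z u f = Comp C a b z u g" for u
    proof -
      obtain h where h: "h \<in> Hom C q z" "Comp C b q z h e = u" using coequaliser_ex[OF c z u] .
      have "Comp C b q' z (Comp C q' q z h m) (Comp C b q q' k e) = Comp C b q z (Comp C q q z h (Comp C q q' q m k)) e"
        using h m(1,2) i z q' by (simp add: assoc)
      then show ?thesis using h m i z q' by (intro bexI[of _ "Comp C q' q z h m"]) auto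
    qed
    fix h h' assume h: "h \<in> Hom C q' z" "h' \<in> Hom C q' z"
      and e: "Comp C b q' z h (Comp C b q q' k e) = Comp C b q' z h' (Comp C b q q' k e)"
    have "Comp C q q' z h k = Comp C q q' z h' k"
      by (rule coequaliser_uniq[OF c z]) (use e h m i z q' in \<open>simp_all add: assoc\<close>)
    then have "Comp C q' q z (Comp C q q' z h k) m = Comp C q' q z (Comp C q q' z h' k) m" by simp
    then show "h = h'" using h m i z q' by (simp flip: assoc)
  qed (use i m q' in auto)
qed

lemma iso_square:
  assumes k: "k \<in> Hom C a a'" "i \<in> Hom C a' a" "Comp C a' a a' k i = idn C a'"
    and l: "l \<in> Hom C c c'" "j \<in> Hom C c' c" "Comp C c c' c j l = idn C c"
    and f: "f \<in> Hom C a c" "f' \<in> Hom C a' c'" "Comp C a a' c' f' k = Comp C a c c' l f"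
    and o: "a \<in> Ob C" "a' \<in> Ob C" "c \<in> Ob C" "c' \<in> Ob C"
  shows "Comp C a' a c f i = Comp C a' c' c j f'"
proof -
  have "f' = Comp C a' a c' (Comp C a a' c' f' k) i" using k f(1,2) o by (simp flip: assoc)
  also have "\<dots> = Comp C a' c c' l (Comp C a' a c f i)" using k l f o by (simp add: assoc)
  finally have "Comp C a' c' c j f' = Comp C a' c' c j (Comp C a' c c' l (Comp C a' a c f i))" by simp
  also have "\<dots> = Comp C a' a c f i" using k l f(1) o by (simp add: assoc[of _ _ _ l])
  finally show ?thesis by simp
qed

text \<open>Lets the pullback produced by a lex reflection be rewritten in terms of reflections that
  were exhibited by hand.\<close>

lemma pullback_iso:
  assumes p: "is_pullback C a b c f g p p1 p2"
    and ka: "is_iso C a a' ka" and kb: "is_iso C b b' kb" and kc: "is_iso C c c' kc" and kp: "is_iso C p p' kp"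
    and o: "a' \<in> Ob C" "b' \<in> Ob C" "c' \<in> Ob C" "p' \<in> Ob C" "f' \<in> Hom C a' c'" "g' \<in> Hom C b' c'"
      "p1' \<in> Hom C p' a'" "p2' \<in> Hom C p' b'"
    and eq: "Comp C a a' c' f' ka = Comp C a c c' kc f" "Comp C b b' c' g' kb = Comp C b c c' kc g"
      "Comp C p p' a' p1' kp = Comp C p a a' ka p1" "Comp C p p' b' p2' kp = Comp C p b b' kb p2"
  shows "is_pullback C a' b' c' f' g' p' p1' p2'"
proof -
  note i = pullback_in[OF p]
  obtain ia where a: "ka \<in> Hom C a a'" "ia \<in> Hom C a' a" "Comp C a a' a ia ka = idn C a" "Comp C a' a a' ka ia = idn C a'"
    using ka unfolding is_iso_def by blast
  obtain ib where b: "kb \<in> Hom C b b'" "ib \<in> Hom C b' b" "Comp C b b' b ib kb = idn C b" "Comp C b' b b' kb ib = idn C b'"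
    using kb unfolding is_iso_def by blast
  obtain ic where c: "kc \<in> Hom C c c'" "ic \<in> Hom C c' c" "Comp C c c' c ic kc = idn C c"
    using kc unfolding is_iso_def by blast
  obtain ip where ip: "kp \<in> Hom C p p'" "ip \<in> Hom C p' p" "Comp C p' p p' kp ip = idn C p'"
    using kp unfolding is_iso_def by blast
  have fi: "Comp C a' a c f ia = Comp C a' c' c ic f'"
    by (rule iso_square[OF a(1,2,4) c i(5) o(5) eq(1) i(1) o(1) i(3) o(3)])
  have gi: "Comp C b' b c g ib = Comp C b' c' c ic g'"
    by (rule iso_square[OF b(1,2,4) c i(6) o(6) eq(2) i(2) o(2) i(3) o(3)])
  have p1i: "Comp C p' p a p1 ip = Comp C p' a' a ia p1'"
    by (rule iso_square[OF ip a(1-3) i(7) o(7) eq(3) i(4) o(4) i(1) o(1)])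
  have p2i: "Comp C p' p b p2 ip = Comp C p' b' b ib p2'"
    by (rule iso_square[OF ip b(1-3) i(8) o(8) eq(4) i(4) o(4) i(2) o(2)])
  show ?thesis
  proof (rule is_pullbackI[OF o(1-8)])
    have "Comp C p' a' c' f' p1' = Comp C p' a' c' f' (Comp C p' a a' ka (Comp C p' p a p1 ip))"
      unfolding p1i using a o i by (simp add: assoc)
    also have "\<dots> = Comp C p' p c' (Comp C p c c' kc (Comp C p a c f p1)) ip"
      using a o i(1-8) ip(2) c eq(1) by (simp add: assoc)
    also have "\<dots> = Comp C p' p c' (Comp C p c c' kc (Comp C p b c g p2)) ip" using i(9) by simp
    also have "\<dots> = Comp C p' b' c' g' (Comp C p' b b' kb (Comp C p' p b p2 ip))"
      using b o i(1-8) ip(2) c eq(2) by (simp add: assoc)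
    also have "\<dots> = Comp C p' b' c' g' p2'"
      unfolding p2i using b o i by (simp add: assoc)
    finally show "Comp C p' a' c' f' p1' = Comp C p' b' c' g' p2'" .
    fix z assume z: "z \<in> Ob C"
    {
      fix u v assume uv: "u \<in> Hom C z a'" "v \<in> Hom C z b'" "Comp C z a' c' f' u = Comp C z b' c' g' v"
      have "Comp C z a c f (Comp C z a' a ia u) = Comp C z c' c ic (Comp C z a' c' f' u)"
        using assoc[OF uv(1) a(2) i(5)] assoc[OF uv(1) o(5) c(2)] fi z o i by simp
      also have "\<dots> = Comp C z b c g (Comp C z b' b ib v)"
        using assoc[OF uv(2) b(2) i(6)] assoc[OF uv(2) o(6) c(2)] gi uv(3) z o i by simp
      finally have eqz: "Comp C z a c f (Comp C z a' a ia u) = Comp C z b c g (Comp C z b' b ib v)" .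
      have "Comp C z a' a ia u \<in> Hom C z a" "Comp C z b' b ib v \<in> Hom C z b" using uv a b z o i by auto
      then obtain h where h: "h \<in> Hom C z p" "Comp C z p a p1 h = Comp C z a' a ia u" "Comp C z p b p2 h = Comp C z b' b ib v"
        using pullback_ex[OF p z _ _ eqz] by blast
      have "Comp C z p' a' p1' (Comp C z p p' kp h) = Comp C z a a' ka (Comp C z p a p1 h)"
        using assoc[OF h(1) ip(1) o(7)] assoc[OF h(1) i(7) a(1)] eq(3) z o i by simp
      also have "\<dots> = u" unfolding h(2) using assoc[OF uv(1) a(2,1)] a(4) uv(1) z o i by simp
      finally have 1: "Comp C z p' a' p1' (Comp C z p p' kp h) = u" .
      have "Comp C z p' b' p2' (Comp C z p p' kp h) = Comp C z b b' kb (Comp C z p b p2 h)"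
        using assoc[OF h(1) ip(1) o(8)] assoc[OF h(1) i(8) b(1)] eq(4) z o i by simp
      also have "\<dots> = v" unfolding h(3) using assoc[OF uv(2) b(2,1)] b(4) uv(2) z o i by simp
      finally show "\<exists>h\<in>Hom C z p'. Comp C z p' a' p1' h = u \<and> Comp C z p' b' p2' h = v"
        using 1 Comp_in[OF h(1) ip(1) z i(4) o(4)] by blast
    }
    fix h h' assume h: "h \<in> Hom C z p'" "h' \<in> Hom C z p'"
      and e: "Comp C z p' a' p1' h = Comp C z p' a' p1' h'" "Comp C z p' b' p2' h = Comp C z p' b' p2' h'"
    have 1: "Comp C z p a p1 (Comp C z p' p ip m) = Comp C z a' a ia (Comp C z p' a' p1' m)"
      "Comp C z p b p2 (Comp C z p' p ip m) = Comp C z b' b ib (Comp C z p' b' p2' m)" if "m \<in> Hom C z p'" for m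
      using that assoc[OF that ip(2) i(7)] assoc[OF that ip(2) i(8)] assoc[OF that o(7) a(2)] assoc[OF that o(8) b(2)]
        p1i p2i z o i by simp_all
    have "Comp C z p' p ip h = Comp C z p' p ip h'"
      by (rule pullback_uniq[OF p z]) (use 1 h e ip z o i in auto)
    then have "Comp C z p p' kp (Comp C z p' p ip h) = Comp C z p p' kp (Comp C z p' p ip h')" by simp
    then show "h = h'" using assoc[OF h(1) ip(2,1)] assoc[OF h(2) ip(2,1)] ip(3) h z o i by simp
  qed
qed

text \<open>At stage \<open>z\<close> the relation is equality after composition with
  \<open>f\<close>, which is visibly an equivalence.\<close>

lemma kernel_pair_eqrel:
  assumes k: "is_kernel_pair C x y f r s t"
  shows "equivalence_relation C r x s t"
proof -
  have p: "is_pullback C x x y f f r s t" using k by (simp add: is_kernel_pair_def)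
  note i = pullback_in[OF p]
  have mem: "(u, v) \<in> (\<lambda>h. (Comp C z r x s h, Comp C z r x t h)) ` Hom C z r \<longleftrightarrow>
    u \<in> Hom C z x \<and> v \<in> Hom C z x \<and> Comp C z x y f u = Comp C z x y f v" if z: "z \<in> Ob C" for z u v
  proof
    assume "(u, v) \<in> (\<lambda>h. (Comp C z r x s h, Comp C z r x t h)) ` Hom C z r"
    then obtain h where h: "h \<in> Hom C z r" "u = Comp C z r x s h" "v = Comp C z r x t h" by auto
    then show "u \<in> Hom C z x \<and> v \<in> Hom C z x \<and> Comp C z x y f u = Comp C z x y f v"
      using assoc[OF h(1) i(7,5)] assoc[OF h(1) i(8,5)] i z by simp
  next
    assume "u \<in> Hom C z x \<and> v \<in> Hom C z x \<and> Comp C z x y f u = Comp C z x y f v"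
    then obtain h where "h \<in> Hom C z r" "Comp C z r x s h = u" "Comp C z r x t h = v"
      using pullback_ex[OF p z] by blast
    then show "(u, v) \<in> (\<lambda>h. (Comp C z r x s h, Comp C z r x t h)) ` Hom C z r" by blast
  qed
  show ?thesis
    unfolding equivalence_relation_def
  proof (intro conjI ballI)
    fix z assume z: "z \<in> Ob C"
    show "inj_on (\<lambda>h. (Comp C z r x s h, Comp C z r x t h)) (Hom C z r)"
      using pullback_uniq[OF p z] by (auto simp: inj_on_def)
    show "equiv (Hom C z x) ((\<lambda>h. (Comp C z r x s h, Comp C z r x t h)) ` Hom C z r)"
    proof (rule equivI)
      show "(\<lambda>h. (Comp C z r x s h, Comp C z r x t h)) ` Hom C z r \<subseteq> Hom C z x \<times> Hom C z x"
        using i z by auto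
      show "refl_on (Hom C z x) ((\<lambda>h. (Comp C z r x s h, Comp C z r x t h)) ` Hom C z r)"
        by (rule refl_onI) (simp add: mem[OF z])
      show "sym ((\<lambda>h. (Comp C z r x s h, Comp C z r x t h)) ` Hom C z r)"
        by (rule symI) (simp add: mem[OF z])
      show "trans ((\<lambda>h. (Comp C z r x s h, Comp C z r x t h)) ` Hom C z r)"
        by (rule transI) (simp add: mem[OF z])
    qed
  qed (use i in auto)
qed

end

lemma functor_iso:
  assumes F: "is_functor A B F" and k: "is_iso A a b k" and o: "a \<in> Ob A" "b \<in> Ob A"
  shows "is_iso B (fob F a) (fob F b) (fmap F a b k)"
proof -
  obtain m where m: "k \<in> Hom A a b" "m \<in> Hom A b a" "Comp A a b a m k = idn A a" "Comp A b a b k m = idn A b"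
    using k unfolding is_iso_def by blast
  show ?thesis
    unfolding is_iso_def
    using functor_hom[OF F m(1) o] functor_hom[OF F m(2) o(2,1)]
      functor_Comp[OF F m(1,2) o o(1)] functor_Comp[OF F m(2,1) o(2,1,2)] m functor_idn[OF F] o by metis
qed

section \<open>Pointwise pullbacks and universal arrows to the Yoneda embedding\<close>

context presheaves
begin

lemma pointwise_pullback:
  assumes S: "S \<subseteq> Ob P" "F1 \<in> S" "F2 \<in> S" "F3 \<in> S" "F \<in> S"
    and \<alpha>: "\<alpha>1 \<in> Hom P F1 F3" "\<alpha>2 \<in> Hom P F2 F3" and p: "p1 \<in> Hom P F F1" "p2 \<in> Hom P F F2"
    and eq: "\<And>a w. \<lbrakk>a \<in> Ob C; w \<in> fob F a\<rbrakk> \<Longrightarrow> \<alpha>1 a (p1 a w) = \<alpha>2 a (p2 a w)"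
    and ex: "\<And>a x y. \<lbrakk>a \<in> Ob C; x \<in> fob F1 a; y \<in> fob F2 a; \<alpha>1 a x = \<alpha>2 a y\<rbrakk> \<Longrightarrow> \<exists>w\<in>fob F a. p1 a w = x \<and> p2 a w = y"
    and un: "\<And>a w w'. \<lbrakk>a \<in> Ob C; w \<in> fob F a; w' \<in> fob F a; p1 a w = p1 a w'; p2 a w = p2 a w'\<rbrakk> \<Longrightarrow> w = w'"
  shows "is_pullback (full_subcat P S) F1 F2 F3 \<alpha>1 \<alpha>2 F p1 p2"
proof (rule is_pullbackI)
  have O: "F1 \<in> Ob P" "F2 \<in> Ob P" "F3 \<in> Ob P" "F \<in> Ob P" using S by auto
  have "Comp P F F1 F3 \<alpha>1 p1 = Comp P F F2 F3 \<alpha>2 p2"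
    by (rule hom_eqI[OF psh_Comp_in[OF p(1) \<alpha>(1) O(4)] psh_Comp_in[OF p(2) \<alpha>(2) O(4)]]) (use eq in simp)
  then show "Comp (full_subcat P S) F F1 F3 \<alpha>1 p1 = Comp (full_subcat P S) F F2 F3 \<alpha>2 p2" by simp
  fix G assume "G \<in> Ob (full_subcat P S)"
  then have G: "G \<in> Ob P" using S by auto
  {
    fix u v assume "u \<in> Hom (full_subcat P S) G F1" "v \<in> Hom (full_subcat P S) G F2"
      and "Comp (full_subcat P S) G F1 F3 \<alpha>1 u = Comp (full_subcat P S) G F2 F3 \<alpha>2 v"
    then have u: "u \<in> Hom P G F1" and v: "v \<in> Hom P G F2" and e: "Comp P G F1 F3 \<alpha>1 u = Comp P G F2 F3 \<alpha>2 v" by simp_all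
    have "\<exists>w. w \<in> fob F a \<and> p1 a w = u a x \<and> p2 a w = v a x" if "a \<in> Ob C" "x \<in> fob G a" for a x
    proof -
      have "\<alpha>1 a (u a x) = \<alpha>2 a (v a x)" using fun_cong[OF fun_cong[OF e], of a x] that by simp
      then show ?thesis using ex[OF that(1) hom_in[OF u that] hom_in[OF v that]] by blast
    qed
    then obtain t where t: "\<And>a x. \<lbrakk>a \<in> Ob C; x \<in> fob G a\<rbrakk> \<Longrightarrow> t a x \<in> fob F a"
      "\<And>a x. \<lbrakk>a \<in> Ob C; x \<in> fob G a\<rbrakk> \<Longrightarrow> p1 a (t a x) = u a x" "\<And>a x. \<lbrakk>a \<in> Ob C; x \<in> fob G a\<rbrakk> \<Longrightarrow> p2 a (t a x) = v a x"
      by metis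
    have h: "mk_hom G t \<in> Hom P G F"
    proof (rule mk_hom[OF G])
      show "t a (fmap G b a f x) = fmap F b a f (t b x)"
        if o: "a \<in> Ob C" "b \<in> Ob C" "f \<in> Hom C a b" "x \<in> fob G b" for a b f x
      proof (rule un[OF o(1)])
        have fx: "fmap G b a f x \<in> fob G a" using G o by simp
        show "t a (fmap G b a f x) \<in> fob F a" using t(1)[OF o(1) fx] .
        show "fmap F b a f (t b x) \<in> fob F a" using t(1)[OF o(2,4)] O o by simp
        show "p1 a (t a (fmap G b a f x)) = p1 a (fmap F b a f (t b x))"
          using t(2)[OF o(1) fx] t(2)[OF o(2,4)] hom_act[OF p(1) o(3) t(1)[OF o(2,4)] o(1,2)] hom_act[OF u o(3,4,1,2)] by simp
        show "p2 a (t a (fmap G b a f x)) = p2 a (fmap F b a f (t b x))"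
          using t(3)[OF o(1) fx] t(3)[OF o(2,4)] hom_act[OF p(2) o(3) t(1)[OF o(2,4)] o(1,2)] hom_act[OF v o(3,4,1,2)] by simp
      qed
    qed (rule t(1))
    have "Comp P G F F1 p1 (mk_hom G t) = u"
      by (rule hom_eqI[OF psh_Comp_in[OF h p(1) G] u]) (use t in simp)
    moreover have "Comp P G F F2 p2 (mk_hom G t) = v"
      by (rule hom_eqI[OF psh_Comp_in[OF h p(2) G] v]) (use t in simp)
    ultimately show "\<exists>h\<in>Hom (full_subcat P S) G F. Comp (full_subcat P S) G F F1 p1 h = u \<and> Comp (full_subcat P S) G F F2 p2 h = v"
      using h by auto
  }
  fix h h' assume "h \<in> Hom (full_subcat P S) G F" "h' \<in> Hom (full_subcat P S) G F"
    and "Comp (full_subcat P S) G F F1 p1 h = Comp (full_subcat P S) G F F1 p1 h'"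
      "Comp (full_subcat P S) G F F2 p2 h = Comp (full_subcat P S) G F F2 p2 h'"
  then have h: "h \<in> Hom P G F" "h' \<in> Hom P G F" and e: "Comp P G F F1 p1 h = Comp P G F F1 p1 h'"
      "Comp P G F F2 p2 h = Comp P G F F2 p2 h'" by simp_all
  show "h = h'"
  proof (rule hom_eqI[OF h])
    fix a x assume a: "a \<in> Ob C" "x \<in> fob G a"
    show "h a x = h' a x"
      by (rule un[OF a(1) hom_in[OF h(1) a] hom_in[OF h(2) a]])
        (use fun_cong[OF fun_cong[OF e(1)], of a x] fun_cong[OF fun_cong[OF e(2)], of a x] a in simp_all)
  qed
qed (use S \<alpha> p in auto)

text \<open>A universal arrow from \<open>F\<close> to the Yoneda embedding, in elementwise form.
  Such arrows can be exhibited directly, for instance for representables, and are then compared with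
  the abstract left adjoint by uniqueness.\<close>

definition universal :: "('o, 'u) presheaf \<Rightarrow> 'o \<Rightarrow> ('o \<Rightarrow> 'u \<Rightarrow> 'u) \<Rightarrow> bool" where
  "universal F c \<eta> \<longleftrightarrow> c \<in> Ob C \<and> \<eta> \<in> Hom P F (W c) \<and>
     (\<forall>d\<in>Ob C. \<forall>\<beta>\<in>Hom P F (W d). \<exists>!h. h \<in> Hom C c d \<and> (\<forall>a\<in>Ob C. \<forall>w\<in>fob F a. Comp C a c d h (\<eta> a w) = \<beta> a w))"

lemma universal_in:
  "universal F c \<eta> \<Longrightarrow> c \<in> Ob C" "universal F c \<eta> \<Longrightarrow> \<eta> \<in> Hom P F (W c)"
  by (simp_all add: universal_def)

lemma universal_app: "\<lbrakk>universal F c \<eta>; a \<in> Ob C; w \<in> fob F a\<rbrakk> \<Longrightarrow> \<eta> a w \<in> Hom C a c"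
  using hom_in[of \<eta> F "W c" a w] by (simp add: universal_in)

lemma universal_ex:
  assumes "universal F c \<eta>" "d \<in> Ob C" "\<beta> \<in> Hom P F (W d)"
  obtains h where "h \<in> Hom C c d" "\<forall>a\<in>Ob C. \<forall>w\<in>fob F a. Comp C a c d h (\<eta> a w) = \<beta> a w"
  using assms unfolding universal_def by blast

lemma universal_uniq:
  assumes u: "universal F c \<eta>" and F: "F \<in> Ob P" and d: "d \<in> Ob C" "h \<in> Hom C c d" "h' \<in> Hom C c d"
    and eq: "\<And>a w. \<lbrakk>a \<in> Ob C; w \<in> fob F a\<rbrakk> \<Longrightarrow> Comp C a c d h (\<eta> a w) = Comp C a c d h' (\<eta> a w)"
  shows "h = h'"
proof -
  note i = universal_in[OF u]
  let ?\<beta> = "Comp P F (W c) (W d) (fmap (yoneda C) c d h) \<eta>"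
  have \<beta>: "?\<beta> \<in> Hom P F (W d)" using i d F by (intro psh_Comp_in) auto
  have "?\<beta> a w = Comp C a c d h (\<eta> a w)" if "a \<in> Ob C" "w \<in> fob F a" for a w
    using that universal_app[OF u that] by simp
  then have "h \<in> Hom C c d \<and> (\<forall>a\<in>Ob C. \<forall>w\<in>fob F a. Comp C a c d h (\<eta> a w) = ?\<beta> a w)"
    "h' \<in> Hom C c d \<and> (\<forall>a\<in>Ob C. \<forall>w\<in>fob F a. Comp C a c d h' (\<eta> a w) = ?\<beta> a w)"
    using eq d by simp_all
  moreover have "\<exists>!h. h \<in> Hom C c d \<and> (\<forall>a\<in>Ob C. \<forall>w\<in>fob F a. Comp C a c d h (\<eta> a w) = ?\<beta> a w)"
    using u d(1) \<beta> unfolding universal_def by blast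
  ultimately show ?thesis by blast
qed

lemma universal_W:
  assumes c: "c \<in> Ob C"
  shows "universal (W c) c (idn P (W c))"
  unfolding universal_def
proof (intro conjI ballI c)
  show "idn P (W c) \<in> Hom P (W c) (W c)" using c by (simp add: psh_idn_in)
  fix d \<beta> assume d: "d \<in> Ob C" and \<beta>: "\<beta> \<in> Hom P (W c) (W d)"
  have \<beta>c: "\<beta> c (idn C c) \<in> Hom C c d" using hom_in[OF \<beta> c, of "idn C c"] c by simp
  show "\<exists>!h. h \<in> Hom C c d \<and> (\<forall>a\<in>Ob C. \<forall>w\<in>fob (W c) a. Comp C a c d h (idn P (W c) a w) = \<beta> a w)"
  proof (rule ex1I[of _ "\<beta> c (idn C c)"])
    show "\<beta> c (idn C c) \<in> Hom C c d \<and> (\<forall>a\<in>Ob C. \<forall>w\<in>fob (W c) a. Comp C a c d (\<beta> c (idn C c)) (idn P (W c) a w) = \<beta> a w)"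
      using \<beta>c yoneda_lemma[OF \<beta> c] by simp
    show "h = \<beta> c (idn C c)" if "h \<in> Hom C c d \<and> (\<forall>a\<in>Ob C. \<forall>w\<in>fob (W c) a. Comp C a c d h (idn P (W c) a w) = \<beta> a w)" for h
      using that c d by (auto dest!: bspec[of _ _ c] bspec[of _ _ "idn C c"])
  qed
qed

lemma universal_iso:
  assumes u: "universal F c \<eta>" "universal F c' \<eta>'" and F: "F \<in> Ob P"
  obtains k where "is_iso C c c' k" "\<forall>a\<in>Ob C. \<forall>w\<in>fob F a. Comp C a c c' k (\<eta> a w) = \<eta>' a w"
proof -
  note i = universal_in[OF u(1)] and i' = universal_in[OF u(2)]
  note \<eta>in = universal_app[OF u(1)] and \<eta>'in = universal_app[OF u(2)]
  obtain k where k: "k \<in> Hom C c c'" "\<forall>a\<in>Ob C. \<forall>w\<in>fob F a. Comp C a c c' k (\<eta> a w) = \<eta>' a w"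
    using universal_ex[OF u(1) i'] .
  obtain m where m: "m \<in> Hom C c' c" "\<forall>a\<in>Ob C. \<forall>w\<in>fob F a. Comp C a c' c m (\<eta>' a w) = \<eta> a w"
    using universal_ex[OF u(2) i] .
  have "Comp C c c' c m k = idn C c"
    by (rule universal_uniq[OF u(1) F i(1)]) (use k m i i' \<eta>in \<eta>'in in \<open>simp_all flip: assoc\<close>)
  moreover have "Comp C c' c c' k m = idn C c'"
    by (rule universal_uniq[OF u(2) F i'(1)]) (use k m i i' \<eta>in \<eta>'in in \<open>simp_all flip: assoc\<close>)
  ultimately have "is_iso C c c' k" unfolding is_iso_def using k m by blast
  then show ?thesis using k that by blast
qed

end

lemma is_equivalence_ess_surj:
  assumes "is_equivalence A B F" "b \<in> Ob B"
  obtains a where "a \<in> Ob A" "isomorphic B (fob F a) b"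
  using assms unfolding is_equivalence_def by blast

context lex_presheaves
begin

text \<open>The universal property of the free category \<open>K\<close> only concerns categories whose objects form a
  subset of the universe type; hence it is applied to a small full subcategory of \<open>C\<close> closed under
  finite limits, with objects renamed.\<close>

lemma quotient_in_PL:
  fixes \<Phi> :: "'u lex_weight set"
  assumes \<Phi>: "is_Phi_ex \<Phi>" and e: "equivalence_relation C r x s t"
    and pq: "pointwise_quotient (W r) (W x) (fmap (yoneda C) r x s) (fmap (yoneda C) r x t) Q q"
  shows "Q \<in> PL \<Phi>"
proof (rule PL_I)
  note o = eqrel_in[OF e]
  have WSm: "W r \<in> Sm" "W x \<in> Sm" using o small_W by auto
  show QSm: "Q \<in> Sm" using small_quotient[OF pq] WSm by simp
  fix S assume S: "S \<subseteq> Sm" "replete (small_psh C) S" "W ` Ob C \<subseteq> S"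
    "closed_finite_limits (small_psh C) S" "closed_lex_colimits \<Phi> (small_psh C) S"
  obtain K r0 x0 s0 t0 \<phi> p where K: "free_on_equivalence_relation K r0 x0 s0 t0"
    and co: "is_coequaliser (psh K) (fob (yoneda K) r0) (fob (yoneda K) x0)
       (fmap (yoneda K) r0 x0 s0) (fmap (yoneda K) r0 x0 t0) \<phi> p" and \<Phi>K: "\<Phi> = {(K, \<phi>)}"
    using \<Phi> unfolding is_Phi_ex_def by blast
  have sK: "small_category K" and e0: "equivalence_relation K r0 x0 s0 t0"
    and free: "\<And>E :: ('u, 'u) cat. locally_small E \<Longrightarrow> finitely_complete E \<Longrightarrow>
        is_equivalence (lex_cat K E) (eqrel_cat E) (eval_eqrel r0 x0 s0 t0)"
    using K unfolding free_on_equivalence_relation_def by blast+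
  interpret K: presheaves K
    by unfold_locales (use sK set_universe in \<open>auto simp: small_category_def\<close>)
  note o0 = K.eqrel_in[OF e0]
  obtain \<phi>' p' where pq': "K.pointwise_quotient (fob (yoneda K) r0) (fob (yoneda K) x0)
       (fmap (yoneda K) r0 x0 s0) (fmap (yoneda K) r0 x0 t0) \<phi>' p'"
    using K.eqrel_pointwise_quotient[OF e0] .
  have pqK: "K.pointwise_quotient (fob (yoneda K) r0) (fob (yoneda K) x0)
       (fmap (yoneda K) r0 x0 s0) (fmap (yoneda K) r0 x0 t0) \<phi> p"
    by (rule K.coequaliser_imp_pointwise_quotient[OF pq', of "Ob K.P"])
      (use o0 co pq' in \<open>auto simp: K.pointwise_quotient_def\<close>)
  obtain B where B: "{r, x} \<subseteq> B" "small TYPE('u) B" "lex_closed C B"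
    using small_lex_closure[OF fc, of "{r, x}"] o small_finite[of "{r, x}"] by blast
  interpret B: lexc C B by unfold_locales (fact B(3))
  obtain c :: "'o \<Rightarrow> 'u" where c: "inj_on c B" using B(2) by (rule small_inj)
  define I where "I = the_inv_into B c"
  have I: "I (c b) = b" if "b \<in> B" for b using the_inv_into_f_f[OF c that] by (simp add: I_def)
  let ?A = "c ` B"
  have IA: "I ` ?A \<subseteq> Ob C" "I ` ?A \<subseteq> B" using I B.B_Ob by auto
  let ?E = "induced C I ?A" and ?I = "induced_functor I :: ('u, 'u, 'o, 'u) ftor"
  have lim: "\<exists>a\<in>?A. \<exists>\<pi>. is_limit J C (fcomp ?I D) (I a) \<pi>"
    if J: "finite_category J" and D: "is_functor J ?E D" for J :: "(nat, nat) cat" and D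
  proof -
    have D': "is_functor J C (fcomp ?I D)"
      using is_functor_fcomp[OF D is_functor_induced[OF category IA(1)]] .
    have "fob (fcomp ?I D) ` Ob J \<subseteq> B" using functor_ob[OF D] IA(2) by auto
    then obtain b \<pi> where "b \<in> B" "is_limit J C (fcomp ?I D) b \<pi>" using B.finite_limit[OF J D'] by blast
    then show ?thesis using I by (intro bexI[of _ "c b"]) auto
  qed
  have Ef: "finitely_complete ?E" and IL: "lex_functor ?E C ?I"
    using induced_lex[OF category IA(1) lim] fc by blast+
  have El: "locally_small ?E"
    unfolding locally_small_def using category_induced[OF category IA(1)] small_Hom B.B_Ob by (auto simp: I)
  have rx: "r \<in> B" "x \<in> B" using B(1) by auto
  have "equivalence_relation ?E (c r) (c x) s t"
    using e rx B.B_Ob unfolding equivalence_relation_def by (auto simp: I)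
  then have "(c r, c x, s, t) \<in> Ob (eqrel_cat ?E)" by (simp add: eqrel_cat_def)
  \<comment> \<open>Essential surjectivity of evaluation yields a lex functor on \<open>K\<close>
    that takes the generic equivalence relation to an isomorphic copy of the given one.\<close>
  then obtain D0 where D0: "D0 \<in> Ob (lex_cat K ?E)"
    and iso: "isomorphic (eqrel_cat ?E) (fob (eval_eqrel r0 x0 s0 t0) D0) (c r, c x, s, t)"
    using is_equivalence_ess_surj[OF free[OF El Ef]] by blast
  have D0L: "lex_functor K ?E D0" using D0 by (simp add: lex_cat_def)
  have D0F: "is_functor K ?E D0" using D0L by (simp add: lex_functor_def)
  have D0o: "I (fob D0 k) \<in> Ob C" if "k \<in> Ob K" for k
    using functor_ob[OF D0F that] by (intro subsetD[OF IA(1)] imageI) simp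
  let ?r = "I (fob D0 r0)" and ?x = "I (fob D0 x0)" and ?s = "fmap D0 r0 x0 s0" and ?t = "fmap D0 r0 x0 t0"
  have o1: "?r \<in> Ob C" "?x \<in> Ob C" "?s \<in> Hom C ?r ?x" "?t \<in> Hom C ?r ?x"
    using D0o functor_hom[OF D0F] o0 by auto
  obtain g f g' f' where gf: "g \<in> Hom C ?r r" "f \<in> Hom C ?x x" "Comp C ?r r x s g = Comp C ?r ?x x f ?s"
      "Comp C ?r r x t g = Comp C ?r ?x x f ?t" "g' \<in> Hom C r ?r" "f' \<in> Hom C x ?x"
      "Comp C ?r r ?r g' g = idn C ?r" "Comp C r ?r r g g' = idn C r"
      "Comp C ?x x ?x f' f = idn C ?x" "Comp C x ?x x f f' = idn C x"
    using iso I rx unfolding isomorphic_def is_iso_def eqrel_cat_def eval_eqrel_def by auto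
  have giso: "is_iso C ?r r g" "is_iso C ?x x f" using gf unfolding is_iso_def by blast+
  \<comment> \<open>\<open>?D\<close> passes from \<open>K\<close> through the small subcategory and
    \<open>C\<close> to presheaves. All its values are representable, so closure of \<open>S\<close>
    under lex-colimits applies to it, whatever \<open>S\<close> is.\<close>
  let ?D = "fcomp (yoneda C) (fcomp ?I D0)"
  have DL: "lex_functor K (small_psh C) ?D"
    by (intro lex_functor_fcomp[OF _ yoneda_lex] lex_functor_fcomp[OF D0L IL])
  have DF: "is_functor K (small_psh C) ?D" using DL by (simp add: lex_functor_def)
  have YF: "is_functor C (full_subcat P Sm) (yoneda C)"
    using yoneda_functor_small small_psh_eq by simp
  interpret Sm: cat_base "full_subcat P Sm"
    by unfold_locales (rule category_full_subcat[OF category_psh Sm_Ob])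
  have "is_coequaliser (full_subcat P Sm) (W r) (W x) (fmap (yoneda C) r x s) (fmap (yoneda C) r x t) Q q"
    by (rule pointwise_quotient_coequaliser[OF pq WSm QSm Sm_Ob])
  then have "is_coequaliser (full_subcat P Sm) (W ?r) (W ?x) (fmap (yoneda C) ?r ?x ?s) (fmap (yoneda C) ?r ?x ?t) Q
    (Comp (full_subcat P Sm) (W ?x) (W x) Q q (fmap (yoneda C) ?x x f))"
  proof (rule Sm.coequaliser_iso)
    show "is_iso (full_subcat P Sm) (W ?r) (W r) (fmap (yoneda C) ?r r g)"
      by (rule functor_iso[OF YF giso(1) o1(1) o(1)])
    show "is_iso (full_subcat P Sm) (W ?x) (W x) (fmap (yoneda C) ?x x f)"
      by (rule functor_iso[OF YF giso(2) o1(2) o(2)])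
    show "W ?r \<in> Ob (full_subcat P Sm)" "W ?x \<in> Ob (full_subcat P Sm)" using o1 W_Sm by auto
    show "fmap (yoneda C) ?r ?x ?s \<in> Hom (full_subcat P Sm) (W ?r) (W ?x)"
      "fmap (yoneda C) ?r ?x ?t \<in> Hom (full_subcat P Sm) (W ?r) (W ?x)" using o1 by simp_all
    show "Comp (full_subcat P Sm) (W ?r) (W r) (W x) (fmap (yoneda C) r x s) (fmap (yoneda C) ?r r g)
      = Comp (full_subcat P Sm) (W ?r) (W ?x) (W x) (fmap (yoneda C) ?x x f) (fmap (yoneda C) ?r ?x ?s)"
      using functor_Comp[OF YF gf(1) o(3) o1(1) o(1,2)] functor_Comp[OF YF o1(3) gf(2) o1(1,2) o(2)] gf(3) by simp
    show "Comp (full_subcat P Sm) (W ?r) (W r) (W x) (fmap (yoneda C) r x t) (fmap (yoneda C) ?r r g)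
      = Comp (full_subcat P Sm) (W ?r) (W ?x) (W x) (fmap (yoneda C) ?x x f) (fmap (yoneda C) ?r ?x ?t)"
      using functor_Comp[OF YF gf(1) o(4) o1(1) o(1,2)] functor_Comp[OF YF o1(4) gf(2) o1(1,2) o(2)] gf(4) by simp
  qed
  then have coD: "is_coequaliser (small_psh C) (fob ?D r0) (fob ?D x0) (fmap ?D r0 x0 s0) (fmap ?D r0 x0 t0) Q
    (Comp (full_subcat P Sm) (W ?x) (W x) Q q (fmap (yoneda C) ?x x f))"
    by (simp add: small_psh_eq)
  have "category (small_psh C)" using finitely_complete_small_psh by (simp add: finitely_complete_def)
  then obtain \<eta> where \<eta>: "is_weighted_colimit K \<phi> (small_psh C) ?D Q \<eta>"
    using K.weighted_colimit_of_coequaliser[OF pqK o0 _ DF coD] by blast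
  have DS: "fob ?D ` Ob K \<subseteq> S"
    using D0o S(3) by (auto simp: image_subset_iff)
  have "\<forall>D c \<eta>. lex_functor K (small_psh C) D \<longrightarrow> fob D ` Ob K \<subseteq> S \<longrightarrow>
      is_weighted_colimit K \<phi> (small_psh C) D c \<eta> \<longrightarrow> c \<in> S"
    using S(5) unfolding closed_lex_colimits_def \<Phi>K by simp
  from this[rule_format, OF DL DS \<eta>] show "Q \<in> S" .
qed

end

section \<open>Consequences of a left exact reflection\<close>

locale exact_presheaves = lex_presheaves C for C :: "('o, 'u) cat" +
  fixes \<Phi> :: "'u lex_weight set"
  assumes Phi_ex: "is_Phi_ex \<Phi>" and Phi_exact: "Phi_exact \<Phi> C"
begin

abbreviation E :: "(('o, 'u) presheaf, 'o \<Rightarrow> 'u \<Rightarrow> 'u) cat" where "E \<equiv> full_subcat P (PL \<Phi>)"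

text \<open>The hom-bijection \<open>\<theta>\<close> is exchanged for its unit, the transpose of
  the identity of \<open>L F\<close>; naturality shows that \<open>\<theta> F c h\<close> is
  \<open>h\<close> after this unit.\<close>

lemma reflection:
  obtains L \<eta> where "lex_functor E C L" "\<And>F. F \<in> PL \<Phi> \<Longrightarrow> universal F (fob L F) (\<eta> F)"
    "\<And>F G \<alpha> a w. \<lbrakk>F \<in> PL \<Phi>; G \<in> PL \<Phi>; \<alpha> \<in> Hom P F G; a \<in> Ob C; w \<in> fob F a\<rbrakk> \<Longrightarrow>
      Comp C a (fob L F) (fob L G) (fmap L F G \<alpha>) (\<eta> F a w) = \<eta> G a (\<alpha> a w)"
proof -
  obtain L where L: "lex_functor E C L" and adj: "is_left_adjoint E C L (yoneda C)"
    using Phi_exact unfolding Phi_exact_def Phi_l_eq by blast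
  have LF: "is_functor E C L" using L by (simp add: lex_functor_def)
  have Lo: "fob L F \<in> Ob C" if "F \<in> PL \<Phi>" for F using functor_ob[OF LF, of F] that by simp
  have Lm: "fmap L F G \<alpha> \<in> Hom C (fob L F) (fob L G)" if "F \<in> PL \<Phi>" "G \<in> PL \<Phi>" "\<alpha> \<in> Hom P F G" for F G \<alpha>
    using functor_hom[OF LF, of \<alpha> F G] that by simp
  have PLO: "F \<in> Ob P" if "F \<in> PL \<Phi>" for F using that PL_Ob by blast
  obtain \<theta> where \<theta>: "\<And>F c. \<lbrakk>F \<in> PL \<Phi>; c \<in> Ob C\<rbrakk> \<Longrightarrow> bij_betw (\<theta> F c) (Hom C (fob L F) c) (Hom P F (W c))"
    and nat: "\<And>F F' c c' u v h. \<lbrakk>F \<in> PL \<Phi>; F' \<in> PL \<Phi>; c \<in> Ob C; c' \<in> Ob C; u \<in> Hom P F' F; v \<in> Hom C c c'; h \<in> Hom C (fob L F) c\<rbrakk> \<Longrightarrow>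
      \<theta> F' c' (Comp C (fob L F') c c' v (Comp C (fob L F') (fob L F) c h (fmap L F' F u))) =
      Comp P F' (W c) (W c') (fmap (yoneda C) c c' v) (Comp P F' F (W c) (\<theta> F c h) u)"
    using adj unfolding is_left_adjoint_def full_subcat_simps by blast
  define \<eta> where "\<eta> F = \<theta> F (fob L F) (idn C (fob L F))" for F
  have \<eta>: "\<eta> F \<in> Hom P F (W (fob L F))" if "F \<in> PL \<Phi>" for F
    unfolding \<eta>_def using bij_betwE[OF \<theta>[OF that Lo[OF that]]] Lo[OF that] by simp
  have \<eta>in: "\<eta> F a w \<in> Hom C a (fob L F)" if "F \<in> PL \<Phi>" "a \<in> Ob C" "w \<in> fob F a" for F a w
    using hom_in[OF \<eta>[OF that(1)] that(2,3)] by simp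
  have \<theta>\<eta>: "\<theta> F c h a w = Comp C a (fob L F) c h (\<eta> F a w)"
    if F: "F \<in> PL \<Phi>" and c: "c \<in> Ob C" and h: "h \<in> Hom C (fob L F) c" and a: "a \<in> Ob C" "w \<in> fob F a" for F c h a w
  proof -
    have "fmap L F F (idn P F) = idn C (fob L F)" using functor_idn[OF LF, of F] F by simp
    then have "\<theta> F c h = Comp P F (W (fob L F)) (W c) (fmap (yoneda C) (fob L F) c h) (Comp P F F (W (fob L F)) (\<eta> F) (idn P F))"
      using nat[OF F F Lo[OF F] c psh_idn_in[OF PLO[OF F]] h idn_in[OF Lo[OF F]]] Lo[OF F] h c by (simp add: \<eta>_def)
    then show ?thesis using a \<eta>in[OF F a] by simp
  qed
  show ?thesis
  proof (rule that[OF L])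
    fix F assume F: "F \<in> PL \<Phi>"
    show "universal F (fob L F) (\<eta> F)"
      unfolding universal_def
    proof (intro conjI ballI Lo[OF F] \<eta>[OF F])
      fix d \<beta> assume d: "d \<in> Ob C" and \<beta>: "\<beta> \<in> Hom P F (W d)"
      have "\<beta> \<in> \<theta> F d ` Hom C (fob L F) d" using \<theta>[OF F d] \<beta> by (simp add: bij_betw_def)
      then obtain h where h: "h \<in> Hom C (fob L F) d" "\<beta> = \<theta> F d h" by blast
      show "\<exists>!h. h \<in> Hom C (fob L F) d \<and> (\<forall>a\<in>Ob C. \<forall>w\<in>fob F a. Comp C a (fob L F) d h (\<eta> F a w) = \<beta> a w)"
      proof (rule ex1I[of _ h])
        show "h \<in> Hom C (fob L F) d \<and> (\<forall>a\<in>Ob C. \<forall>w\<in>fob F a. Comp C a (fob L F) d h (\<eta> F a w) = \<beta> a w)"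
          using h \<theta>\<eta>[OF F d h(1)] by simp
        fix k assume k: "k \<in> Hom C (fob L F) d \<and> (\<forall>a\<in>Ob C. \<forall>w\<in>fob F a. Comp C a (fob L F) d k (\<eta> F a w) = \<beta> a w)"
        have "\<theta> F d k \<in> Hom P F (W d)" using bij_betwE[OF \<theta>[OF F d]] k by blast
        then have "\<theta> F d k = \<beta>"
          by (rule hom_eqI[OF _ \<beta>]) (use k \<theta>\<eta>[OF F d] in simp)
        then show "k = h"
          using inj_onD[OF bij_betw_imp_inj_on[OF \<theta>[OF F d]]] h k by simp
      qed
    qed
  next
    fix F G \<alpha> a w assume F: "F \<in> PL \<Phi>" and G: "G \<in> PL \<Phi>" and \<alpha>: "\<alpha> \<in> Hom P F G" and a: "a \<in> Ob C" "w \<in> fob F a"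
    note o = Lo[OF F] Lo[OF G] Lm[OF F G \<alpha>]
    have "\<theta> F (fob L G) (fmap L F G \<alpha>) = Comp P F (W (fob L G)) (W (fob L G)) (fmap (yoneda C) (fob L G) (fob L G) (idn C (fob L G)))
      (Comp P F G (W (fob L G)) (\<eta> G) \<alpha>)"
      using nat[OF G F o(2) o(2) \<alpha> idn_in[OF o(2)] idn_in[OF o(2)]] o by (simp add: \<eta>_def)
    then have "\<theta> F (fob L G) (fmap L F G \<alpha>) a w = \<eta> G a (\<alpha> a w)"
      using a \<alpha> \<eta>in[OF G a(1) hom_in[OF \<alpha> a]] o by simp
    then show "Comp C a (fob L F) (fob L G) (fmap L F G \<alpha>) (\<eta> F a w) = \<eta> G a (\<alpha> a w)"
      using \<theta>\<eta>[OF F o(2,3) a] by simp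
  qed
qed

lemma universal_ex_PL:
  assumes "F \<in> PL \<Phi>" obtains c \<eta> where "universal F c \<eta>"
  by (rule reflection) (use assms that in blast)

text \<open>Left exactness of the reflection, phrased for arbitrary universal arrows.\<close>

lemma universal_pullback:
  assumes p: "is_pullback E F1 F2 F3 \<alpha>1 \<alpha>2 F p1 p2"
    and u: "universal F1 c1 \<eta>1" "universal F2 c2 \<eta>2" "universal F3 c3 \<eta>3" "universal F c \<eta>"
    and f: "f1 \<in> Hom C c1 c3" "f2 \<in> Hom C c2 c3" "k1 \<in> Hom C c c1" "k2 \<in> Hom C c c2"
    and f1: "\<And>a w. \<lbrakk>a \<in> Ob C; w \<in> fob F1 a\<rbrakk> \<Longrightarrow> Comp C a c1 c3 f1 (\<eta>1 a w) = \<eta>3 a (\<alpha>1 a w)"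
    and f2: "\<And>a w. \<lbrakk>a \<in> Ob C; w \<in> fob F2 a\<rbrakk> \<Longrightarrow> Comp C a c2 c3 f2 (\<eta>2 a w) = \<eta>3 a (\<alpha>2 a w)"
    and k1: "\<And>a w. \<lbrakk>a \<in> Ob C; w \<in> fob F a\<rbrakk> \<Longrightarrow> Comp C a c c1 k1 (\<eta> a w) = \<eta>1 a (p1 a w)"
    and k2: "\<And>a w. \<lbrakk>a \<in> Ob C; w \<in> fob F a\<rbrakk> \<Longrightarrow> Comp C a c c2 k2 (\<eta> a w) = \<eta>2 a (p2 a w)"
  shows "is_pullback C c1 c2 c3 f1 f2 c k1 k2"
proof -
  obtain L \<epsilon> where L: "lex_functor E C L" and \<epsilon>: "\<And>F. F \<in> PL \<Phi> \<Longrightarrow> universal F (fob L F) (\<epsilon> F)"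
    and nat: "\<And>F G \<alpha> a w. \<lbrakk>F \<in> PL \<Phi>; G \<in> PL \<Phi>; \<alpha> \<in> Hom P F G; a \<in> Ob C; w \<in> fob F a\<rbrakk> \<Longrightarrow>
      Comp C a (fob L F) (fob L G) (fmap L F G \<alpha>) (\<epsilon> F a w) = \<epsilon> G a (\<alpha> a w)"
    using reflection by blast
  have LF: "is_functor E C L" using L by (simp add: lex_functor_def)
  have PLO: "F \<in> Ob P" if "F \<in> PL \<Phi>" for F using that PL_Ob by blast
  have i: "F1 \<in> PL \<Phi>" "F2 \<in> PL \<Phi>" "F3 \<in> PL \<Phi>" "F \<in> PL \<Phi>" "\<alpha>1 \<in> Hom P F1 F3" "\<alpha>2 \<in> Hom P F2 F3"
    "p1 \<in> Hom P F F1" "p2 \<in> Hom P F F2"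
    using pullback_in[OF p] by simp_all
  have pL: "is_pullback C (fob L F1) (fob L F2) (fob L F3) (fmap L F1 F3 \<alpha>1) (fmap L F2 F3 \<alpha>2) (fob L F)
    (fmap L F F1 p1) (fmap L F F2 p2)"
    by (rule lex_functor_pullback[OF L p])
  \<comment> \<open>Naturality of the comparison isomorphisms between the values of \<open>L\<close>
    and the given universal arrows. By uniqueness it may be checked after composition with the
    unit.\<close>
  have sq: "Comp C (fob L G) d d' f \<kappa> = Comp C (fob L G) (fob L H) d' \<kappa>' (fmap L G H \<alpha>)"
    if G: "G \<in> PL \<Phi>" and H: "H \<in> PL \<Phi>" and \<alpha>: "\<alpha> \<in> Hom P G H" and d: "universal G d \<delta>" "universal H d' \<delta>'"
      and \<kappa>: "\<kappa> \<in> Hom C (fob L G) d" "\<kappa>' \<in> Hom C (fob L H) d'" and f: "f \<in> Hom C d d'"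
      and fd: "\<And>a w. \<lbrakk>a \<in> Ob C; w \<in> fob G a\<rbrakk> \<Longrightarrow> Comp C a d d' f (\<delta> a w) = \<delta>' a (\<alpha> a w)"
      and \<kappa>d: "\<forall>a\<in>Ob C. \<forall>w\<in>fob G a. Comp C a (fob L G) d \<kappa> (\<epsilon> G a w) = \<delta> a w"
        "\<forall>a\<in>Ob C. \<forall>w\<in>fob H a. Comp C a (fob L H) d' \<kappa>' (\<epsilon> H a w) = \<delta>' a w"
    for G H \<alpha> d d' \<delta> \<delta>' \<kappa> \<kappa>' f
  proof (rule universal_uniq[OF \<epsilon>[OF G] PLO[OF G]])
    note dO = universal_in(1)[OF d(1)] universal_in(1)[OF d(2)]
    note LO = universal_in(1)[OF \<epsilon>[OF G]] universal_in(1)[OF \<epsilon>[OF H]]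
    have La: "fmap L G H \<alpha> \<in> Hom C (fob L G) (fob L H)" using functor_hom[OF LF, of \<alpha> G H] G H \<alpha> by simp
    show "d' \<in> Ob C" "Comp C (fob L G) d d' f \<kappa> \<in> Hom C (fob L G) d'"
      "Comp C (fob L G) (fob L H) d' \<kappa>' (fmap L G H \<alpha>) \<in> Hom C (fob L G) d'"
      using dO LO La \<kappa> f by auto
    fix a w assume a: "a \<in> Ob C" "w \<in> fob G a"
    note \<epsilon>w = universal_app[OF \<epsilon>[OF G] a]
    have \<alpha>w: "\<alpha> a w \<in> fob H a" using \<alpha> a by simp
    have "Comp C a (fob L G) d' (Comp C (fob L G) d d' f \<kappa>) (\<epsilon> G a w) = Comp C a d d' f (Comp C a (fob L G) d \<kappa> (\<epsilon> G a w))"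
      using assoc[OF \<epsilon>w \<kappa>(1) f a(1) LO(1) dO] by simp
    also have "\<dots> = \<delta>' a (\<alpha> a w)" using \<kappa>d(1) a fd by simp
    also have "\<dots> = Comp C a (fob L H) d' \<kappa>' (Comp C a (fob L G) (fob L H) (fmap L G H \<alpha>) (\<epsilon> G a w))"
      using nat[OF G H \<alpha> a] \<kappa>d(2) a \<alpha>w by simp
    also have "\<dots> = Comp C a (fob L G) d' (Comp C (fob L G) (fob L H) d' \<kappa>' (fmap L G H \<alpha>)) (\<epsilon> G a w)"
      using assoc[OF \<epsilon>w La \<kappa>(2) a(1) LO dO(2)] by simp
    finally show "Comp C a (fob L G) d' (Comp C (fob L G) d d' f \<kappa>) (\<epsilon> G a w)
      = Comp C a (fob L G) d' (Comp C (fob L G) (fob L H) d' \<kappa>' (fmap L G H \<alpha>)) (\<epsilon> G a w)" .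
  qed
  obtain m1 where m1: "is_iso C (fob L F1) c1 m1" "\<forall>a\<in>Ob C. \<forall>w\<in>fob F1 a. Comp C a (fob L F1) c1 m1 (\<epsilon> F1 a w) = \<eta>1 a w"
    using universal_iso[OF \<epsilon>[OF i(1)] u(1) PLO[OF i(1)]] .
  obtain m2 where m2: "is_iso C (fob L F2) c2 m2" "\<forall>a\<in>Ob C. \<forall>w\<in>fob F2 a. Comp C a (fob L F2) c2 m2 (\<epsilon> F2 a w) = \<eta>2 a w"
    using universal_iso[OF \<epsilon>[OF i(2)] u(2) PLO[OF i(2)]] .
  obtain m3 where m3: "is_iso C (fob L F3) c3 m3" "\<forall>a\<in>Ob C. \<forall>w\<in>fob F3 a. Comp C a (fob L F3) c3 m3 (\<epsilon> F3 a w) = \<eta>3 a w"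
    using universal_iso[OF \<epsilon>[OF i(3)] u(3) PLO[OF i(3)]] .
  obtain m where m: "is_iso C (fob L F) c m" "\<forall>a\<in>Ob C. \<forall>w\<in>fob F a. Comp C a (fob L F) c m (\<epsilon> F a w) = \<eta> a w"
    using universal_iso[OF \<epsilon>[OF i(4)] u(4) PLO[OF i(4)]] .
  have mh: "m1 \<in> Hom C (fob L F1) c1" "m2 \<in> Hom C (fob L F2) c2" "m3 \<in> Hom C (fob L F3) c3" "m \<in> Hom C (fob L F) c"
    using m1 m2 m3 m by (auto simp: is_iso_def)
  show ?thesis
  proof (rule pullback_iso[OF pL m1(1) m2(1) m3(1) m(1) universal_in(1)[OF u(1)] universal_in(1)[OF u(2)]
        universal_in(1)[OF u(3)] universal_in(1)[OF u(4)] f])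
    show "Comp C (fob L F1) c1 c3 f1 m1 = Comp C (fob L F1) (fob L F3) c3 m3 (fmap L F1 F3 \<alpha>1)"
      by (rule sq[OF i(1,3,5) u(1,3) mh(1,3) f(1) f1 m1(2) m3(2)])
    show "Comp C (fob L F2) c2 c3 f2 m2 = Comp C (fob L F2) (fob L F3) c3 m3 (fmap L F2 F3 \<alpha>2)"
      by (rule sq[OF i(2,3,6) u(2,3) mh(2,3) f(2) f2 m2(2) m3(2)])
    show "Comp C (fob L F) c c1 k1 m = Comp C (fob L F) (fob L F1) c1 m1 (fmap L F F1 p1)"
      by (rule sq[OF i(4,1,7) u(4,1) mh(4,1) f(3) k1 m(2) m1(2)])
    show "Comp C (fob L F) c c2 k2 m = Comp C (fob L F) (fob L F2) c2 m2 (fmap L F F2 p2)"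
      by (rule sq[OF i(4,2,8) u(4,2) mh(4,2) f(4) k2 m(2) m2(2)])
  qed
qed

lemma WPL: "c \<in> Ob C \<Longrightarrow> W c \<in> PL \<Phi>"
  using W_PL by blast

lemma quotient_facts:
  assumes pq: "pointwise_quotient (W r) (W x) (fmap (yoneda C) r x s) (fmap (yoneda C) r x t) Q q"
    and o: "r \<in> Ob C" "x \<in> Ob C"
  shows "Q \<in> Ob P" "q \<in> Hom P (W x) Q" "\<And>a f. \<lbrakk>a \<in> Ob C; f \<in> Hom C a x\<rbrakk> \<Longrightarrow> q a f \<in> fob Q a"
    "\<And>a f g. \<lbrakk>a \<in> Ob C; f \<in> Hom C a x; g \<in> Hom C a x\<rbrakk> \<Longrightarrow>
      q a f = q a g \<longleftrightarrow> (\<exists>w\<in>Hom C a r. Comp C a r x s w = f \<and> Comp C a r x t w = g)"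
    "\<And>a y. \<lbrakk>a \<in> Ob C; y \<in> fob Q a\<rbrakk> \<Longrightarrow> \<exists>f\<in>Hom C a x. y = q a f"
    "\<And>a. a \<in> Ob C \<Longrightarrow> q a ` fob (W x) a = fob Q a"
proof -
  show *: "Q \<in> Ob P" "q \<in> Hom P (W x) Q" "\<And>a. a \<in> Ob C \<Longrightarrow> q a ` fob (W x) a = fob Q a"
    using pq unfolding pointwise_quotient_def by auto
  show "q a f \<in> fob Q a" if "a \<in> Ob C" "f \<in> Hom C a x" for a f
    using hom_in[OF *(2) that(1), of f] that by simp
  show "q a f = q a g \<longleftrightarrow> (\<exists>w\<in>Hom C a r. Comp C a r x s w = f \<and> Comp C a r x t w = g)"
    if "a \<in> Ob C" "f \<in> Hom C a x" "g \<in> Hom C a x" for a f g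
    using pq that unfolding pointwise_quotient_def by simp
  show "\<exists>f\<in>Hom C a x. y = q a f" if "a \<in> Ob C" "y \<in> fob Q a" for a y
    using *(3)[OF that(1)] that by auto
qed

text \<open>As \<open>c\<close> is the reflection of the pointwise quotient \<open>Q\<close>, arrows
  \<open>c \<rightarrow> z\<close> are arrows \<open>Q \<rightarrow> W z\<close>, that is, arrows
  from \<open>x\<close> that coequalise \<open>s\<close> and \<open>t\<close>. Moreover
  \<open>W r\<close> is the pullback of \<open>q\<close> along itself, and left exactness carries
  this square to the kernel-pair square in \<open>C\<close>.\<close>

lemma quotient_coequaliser:
  assumes e: "equivalence_relation C r x s t"
    and pq: "pointwise_quotient (W r) (W x) (fmap (yoneda C) r x s) (fmap (yoneda C) r x t) Q q"
    and u: "universal Q c \<eta>"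
  shows "is_coequaliser C r x s t c (\<eta> x (q x (idn C x)))"
    and "is_kernel_pair C x c (\<eta> x (q x (idn C x))) r s t"
proof -
  note o = eqrel_in[OF e] and qf = quotient_facts[OF pq eqrel_in(1,2)[OF e]]
  note ui = universal_in[OF u]
  let ?e = "\<eta> x (q x (idn C x))"
  have QPL: "Q \<in> PL \<Phi>" by (rule quotient_in_PL[OF Phi_ex e pq])
  have ein: "?e \<in> Hom C x c" using universal_app[OF u o(2)] qf(3) o by simp
  have \<eta>q: "\<eta> a (q a f) = Comp C a x c ?e f" if "a \<in> Ob C" "f \<in> Hom C a x" for a f
  proof -
    have "q a f = fmap Q x a f (q x (idn C x))"
      using hom_act[OF qf(2) that(2), of "idn C x"] that o by simp
    then show ?thesis
      using hom_act[OF ui(2) that(2) qf(3)[OF o(2) idn_in[OF o(2)]] that(1) o(2)] ein by simp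
  qed
  have "q r s = q r t" using qf(4)[OF o(1,3,4)] o by (auto intro!: bexI[of _ "idn C r"])
  then have es: "Comp C r x c ?e s = Comp C r x c ?e t"
    using \<eta>q[OF o(1,3)] \<eta>q[OF o(1,4)] by simp
  show co: "is_coequaliser C r x s t c ?e"
  proof (rule is_coequaliserI)
    fix z v assume z: "z \<in> Ob C" and v: "v \<in> Hom C x z" "Comp C r x z v s = Comp C r x z v t"
    have y: "fmap (yoneda C) x z v \<in> Hom P (W x) (W z)" using o z v by simp
    have "fmap (yoneda C) x z v a f = fmap (yoneda C) x z v a g"
      if a: "a \<in> Ob C" "f \<in> fob (W x) a" "g \<in> fob (W x) a" "q a f = q a g" for a f g
    proof -
      obtain w where w: "w \<in> Hom C a r" "Comp C a r x s w = f" "Comp C a r x t w = g"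
        using qf(4)[of a f g] a by auto
      then show ?thesis
        using assoc[OF w(1) o(3) v(1)] assoc[OF w(1) o(4) v(1)] v(2) a o z by simp
    qed
    then obtain \<beta> where \<beta>: "\<beta> \<in> Hom P Q (W z)" "\<And>a f. \<lbrakk>a \<in> Ob C; f \<in> fob (W x) a\<rbrakk> \<Longrightarrow> \<beta> a (q a f) = fmap (yoneda C) x z v a f"
      using factor_surj[OF qf(2) W_Ob[OF o(2)] qf(1) qf(6) y] by metis
    obtain h where h: "h \<in> Hom C c z" "\<forall>a\<in>Ob C. \<forall>w\<in>fob Q a. Comp C a c z h (\<eta> a w) = \<beta> a w"
      using universal_ex[OF u z \<beta>(1)] .
    have "Comp C x c z h ?e = v" using h(2) qf(3)[OF o(2)] \<beta>(2)[OF o(2), of "idn C x"] o v z by simp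
    then show "\<exists>h\<in>Hom C c z. Comp C x c z h ?e = v" using h(1) by blast
  next
    fix z h h' assume z: "z \<in> Ob C" and h: "h \<in> Hom C c z" "h' \<in> Hom C c z" and eq: "Comp C x c z h ?e = Comp C x c z h' ?e"
    show "h = h'"
    proof (rule universal_uniq[OF u qf(1) z h])
      fix a w assume a: "a \<in> Ob C" "w \<in> fob Q a"
      then obtain f where f: "f \<in> Hom C a x" "w = q a f" using qf(5) by blast
      show "Comp C a c z h (\<eta> a w) = Comp C a c z h' (\<eta> a w)"
        unfolding f(2) \<eta>q[OF a(1) f(1)] using assoc[OF f(1) ein h(1)] assoc[OF f(1) ein h(2)] eq a o ui z by simp
    qed
  qed (use o ui ein es in auto)
  have "is_pullback C x x c ?e ?e r s t"
  proof (rule universal_pullback[OF _ universal_W[OF o(2)] universal_W[OF o(2)] u universal_W[OF o(1)] ein ein o(3,4)])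
    show "is_pullback E (W x) (W x) Q q q (W r) (fmap (yoneda C) r x s) (fmap (yoneda C) r x t)"
    proof (rule pointwise_pullback[OF PL_Ob WPL[OF o(2)] WPL[OF o(2)] QPL WPL[OF o(1)] qf(2,2)])
      fix a assume a: "a \<in> Ob C"
      show "q a (fmap (yoneda C) r x s a w) = q a (fmap (yoneda C) r x t a w)" if "w \<in> fob (W r) a" for w
        using qf(4)[of a "Comp C a r x s w" "Comp C a r x t w"] that a o by auto
      show "\<exists>w\<in>fob (W r) a. fmap (yoneda C) r x s a w = f \<and> fmap (yoneda C) r x t a w = g"
        if fg: "f \<in> fob (W x) a" "g \<in> fob (W x) a" "q a f = q a g" for f g
        using qf(4)[of a f g] fg a by auto
      show "w = w'" if "w \<in> fob (W r) a" "w' \<in> fob (W r) a" "fmap (yoneda C) r x s a w = fmap (yoneda C) r x s a w'"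
        "fmap (yoneda C) r x t a w = fmap (yoneda C) r x t a w'" for w w'
        using eqrel_jm[OF e a, of w w'] that a by simp
    qed (use o in auto)
  qed (use o in \<open>auto simp flip: \<eta>q\<close>)
  then show "is_kernel_pair C x c ?e r s t" by (simp add: is_kernel_pair_def)
qed

lemma eqrel_effective:
  assumes e: "equivalence_relation C r x s t"
  obtains c e where "is_coequaliser C r x s t c e" "is_kernel_pair C x c e r s t"
proof -
  obtain Q q where pq: "pointwise_quotient (W r) (W x) (fmap (yoneda C) r x s) (fmap (yoneda C) r x t) Q q"
    using eqrel_pointwise_quotient[OF e] .
  obtain c \<eta> where "universal Q c \<eta>"
    using universal_ex_PL[OF quotient_in_PL[OF Phi_ex e pq]] .
  then show ?thesis using quotient_coequaliser[OF e pq] that by blast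
qed

text \<open>\<open>Q\<close> is the image of \<open>W f\<close> in \<open>W c\<close>,
  \<open>Q'\<close> is the image of \<open>W p2\<close> in \<open>W b\<close>, and the latter is the
  pullback of the former along \<open>W g\<close>. As \<open>f\<close> is a regular epimorphism, the
  reflection of \<open>Q\<close> is \<open>c\<close> itself. Left exactness makes the reflection of
  \<open>Q'\<close> a pullback of an identity, hence isomorphic to \<open>b\<close>, and this
  reflection is also the coequaliser of the kernel-pair of \<open>p2\<close>.\<close>

lemma regular_epi_stable:
  assumes p: "is_pullback C a b c f g p p1 p2" and fe: "regular_epi C a c f"
  shows "regular_epi C p b p2"
proof -
  note i = pullback_in[OF p]
  obtain r s t where kf: "is_kernel_pair C a c f r s t"
    using finitely_complete_pullback[OF fc i(1,1,3,5,5)] unfolding is_kernel_pair_def by metis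
  obtain r' s' t' where kp: "is_kernel_pair C p b p2 r' s' t'"
    using finitely_complete_pullback[OF fc i(4,4,2,8,8)] unfolding is_kernel_pair_def by metis
  have pf: "is_pullback C a a c f f r s t" and pp: "is_pullback C p p b p2 p2 r' s' t'"
    using kf kp by (simp_all add: is_kernel_pair_def)
  note e = kernel_pair_eqrel[OF kf] and e' = kernel_pair_eqrel[OF kp]
  note o = eqrel_in[OF e] and o' = eqrel_in[OF e']
  have cf: "is_coequaliser C r a s t c f" by (rule regular_epi_coequaliser_kernel[OF fe kf])
  obtain Q q where pq: "pointwise_quotient (W r) (W a) (fmap (yoneda C) r a s) (fmap (yoneda C) r a t) Q q"
    using eqrel_pointwise_quotient[OF e] .
  obtain Q' q' where pq': "pointwise_quotient (W r') (W p) (fmap (yoneda C) r' p s') (fmap (yoneda C) r' p t') Q' q'"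
    using eqrel_pointwise_quotient[OF e'] .
  note qf = quotient_facts[OF pq o(1,2)] and qf' = quotient_facts[OF pq' o'(1,2)]
  have QPL: "Q \<in> PL \<Phi>" "Q' \<in> PL \<Phi>" using quotient_in_PL[OF Phi_ex] e e' pq pq' by blast+
  \<comment> \<open>\<open>Q\<close> identifies exactly what \<open>f\<close> identifies, so the map
    \<open>m\<close> from \<open>Q\<close> to \<open>W c\<close> obtained below is injective at each
    stage; likewise for \<open>Q'\<close> and \<open>p2\<close>.\<close>
  have qeq: "q z u = q z v \<longleftrightarrow> Comp C z a c f u = Comp C z a c f v"
    if z: "z \<in> Ob C" "u \<in> Hom C z a" "v \<in> Hom C z a" for z u v
  proof
    assume "q z u = q z v"
    then obtain w where w: "w \<in> Hom C z r" "Comp C z r a s w = u" "Comp C z r a t w = v" using qf(4)[OF z] by blast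
    then show "Comp C z a c f u = Comp C z a c f v"
      using assoc[OF w(1) o(3) i(5)] assoc[OF w(1) o(4) i(5)] pullback_in(9)[OF pf] z i o by simp
  next
    assume "Comp C z a c f u = Comp C z a c f v"
    then show "q z u = q z v" using pullback_ex[OF pf z] qf(4)[OF z] by metis
  qed
  have qeq': "q' z u = q' z v \<longleftrightarrow> Comp C z p b p2 u = Comp C z p b p2 v"
    if z: "z \<in> Ob C" "u \<in> Hom C z p" "v \<in> Hom C z p" for z u v
  proof
    assume "q' z u = q' z v"
    then obtain w where w: "w \<in> Hom C z r'" "Comp C z r' p s' w = u" "Comp C z r' p t' w = v" using qf'(4)[OF z] by blast
    then show "Comp C z p b p2 u = Comp C z p b p2 v"
      using assoc[OF w(1) o'(3) i(8)] assoc[OF w(1) o'(4) i(8)] pullback_in(9)[OF pp] z i o' by simp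
  next
    assume "Comp C z p b p2 u = Comp C z p b p2 v"
    then show "q' z u = q' z v" using pullback_ex[OF pp z] qf'(4)[OF z] by metis
  qed
  obtain m where m: "m \<in> Hom P Q (W c)" "\<And>z u. \<lbrakk>z \<in> Ob C; u \<in> Hom C z a\<rbrakk> \<Longrightarrow> m z (q z u) = Comp C z a c f u"
  proof -
    have y: "fmap (yoneda C) a c f \<in> Hom P (W a) (W c)" using i by simp
    have "fmap (yoneda C) a c f z u = fmap (yoneda C) a c f z v"
      if "z \<in> Ob C" "u \<in> fob (W a) z" "v \<in> fob (W a) z" "q z u = q z v" for z u v
      using qeq[of z u v] that by simp
    then obtain m where "m \<in> Hom P Q (W c)" "\<And>z u. \<lbrakk>z \<in> Ob C; u \<in> fob (W a) z\<rbrakk> \<Longrightarrow> m z (q z u) = fmap (yoneda C) a c f z u"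
      using factor_surj[OF qf(2) W_Ob[OF i(1)] qf(1) qf(6) y] by metis
    then show ?thesis using that by simp
  qed
  \<comment> \<open>\<open>m\<close> is already universal: maps from \<open>Q\<close> to a
    representable are arrows from \<open>a\<close> coequalising the kernel-pair of \<open>f\<close>,
    and \<open>f\<close> is the coequaliser of that pair.\<close>
  have uQ: "universal Q c m"
    unfolding universal_def
  proof (intro conjI ballI i m)
    fix d \<beta> assume d: "d \<in> Ob C" and \<beta>: "\<beta> \<in> Hom P Q (W d)"
    let ?u = "\<beta> a (q a (idn C a))"
    have qi: "q a (idn C a) \<in> fob Q a" using qf(3) i by simp
    have u: "?u \<in> Hom C a d" using hom_in[OF \<beta> i(1) qi] by simp
    have \<beta>q: "\<beta> z (q z w) = Comp C z a d ?u w" if "z \<in> Ob C" "w \<in> Hom C z a" for z w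
    proof -
      have "q z w = fmap Q a z w (q a (idn C a))"
        using hom_act[OF qf(2) that(2), of "idn C a"] that i by simp
      then show ?thesis using hom_act[OF \<beta> that(2) qi that(1) i(1)] u by simp
    qed
    have "q r s = q r t" using qeq[OF o(1,3,4)] pullback_in(9)[OF pf] by simp
    then have "Comp C r a d ?u s = Comp C r a d ?u t" using \<beta>q[OF o(1,3)] \<beta>q[OF o(1,4)] by simp
    then obtain h where h: "h \<in> Hom C c d" "Comp C a c d h f = ?u" using coequaliser_ex[OF cf d u] by blast
    show "\<exists>!h. h \<in> Hom C c d \<and> (\<forall>z\<in>Ob C. \<forall>w\<in>fob Q z. Comp C z c d h (m z w) = \<beta> z w)"
    proof (rule ex1I[of _ h])
      show "h \<in> Hom C c d \<and> (\<forall>z\<in>Ob C. \<forall>w\<in>fob Q z. Comp C z c d h (m z w) = \<beta> z w)"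
      proof (intro conjI ballI h(1))
        fix z w assume z: "z \<in> Ob C" "w \<in> fob Q z"
        then obtain v where v: "v \<in> Hom C z a" "w = q z v" using qf(5) by blast
        show "Comp C z c d h (m z w) = \<beta> z w"
          unfolding v(2) m(2)[OF z(1) v(1)] \<beta>q[OF z(1) v(1)] using assoc[OF v(1) i(5) h(1)] h(2) z i d by simp
      qed
      fix k assume k: "k \<in> Hom C c d \<and> (\<forall>z\<in>Ob C. \<forall>w\<in>fob Q z. Comp C z c d k (m z w) = \<beta> z w)"
      then have "Comp C a c d k f = ?u" using m(2)[OF i(1) idn_in[OF i(1)]] qi i by force
      then show "k = h" using coequaliser_uniq[OF cf d, of k h] h k by simp
    qed
  qed
  obtain m1 where m1: "m1 \<in> Hom P Q' Q" "\<And>z u. \<lbrakk>z \<in> Ob C; u \<in> Hom C z p\<rbrakk> \<Longrightarrow> m1 z (q' z u) = q z (Comp C z p a p1 u)"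
  proof -
    let ?\<beta> = "Comp P (W p) (W a) Q q (fmap (yoneda C) p a p1)"
    have y: "?\<beta> \<in> Hom P (W p) Q" using i qf(2) by (intro psh_Comp_in) auto
    have "?\<beta> z u = ?\<beta> z v"
      if z: "z \<in> Ob C" "u \<in> fob (W p) z" "v \<in> fob (W p) z" "q' z u = q' z v" for z u v
    proof -
      have uv: "u \<in> Hom C z p" "v \<in> Hom C z p" using z by simp_all
      have "Comp C z p b p2 u = Comp C z p b p2 v" using qeq'[OF z(1) uv] z by simp
      then have "Comp C z a c f (Comp C z p a p1 u) = Comp C z a c f (Comp C z p a p1 v)"
        using assoc[OF uv(1) i(7,5)] assoc[OF uv(2) i(7,5)] assoc[OF uv(1) i(8,6)] assoc[OF uv(2) i(8,6)] i z(1) by simp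
      then show ?thesis using qeq[of z "Comp C z p a p1 u" "Comp C z p a p1 v"] uv z i by simp
    qed
    then obtain m where "m \<in> Hom P Q' Q" "\<And>z u. \<lbrakk>z \<in> Ob C; u \<in> fob (W p) z\<rbrakk> \<Longrightarrow> m z (q' z u) = ?\<beta> z u"
      using factor_surj[OF qf'(2) W_Ob[OF i(4)] qf'(1) qf'(6) y] by metis
    then show ?thesis using that by simp
  qed
  obtain m2 where m2: "m2 \<in> Hom P Q' (W b)" "\<And>z u. \<lbrakk>z \<in> Ob C; u \<in> Hom C z p\<rbrakk> \<Longrightarrow> m2 z (q' z u) = Comp C z p b p2 u"
  proof -
    have y: "fmap (yoneda C) p b p2 \<in> Hom P (W p) (W b)" using i by simp
    have "fmap (yoneda C) p b p2 z u = fmap (yoneda C) p b p2 z v"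
      if "z \<in> Ob C" "u \<in> fob (W p) z" "v \<in> fob (W p) z" "q' z u = q' z v" for z u v
      using qeq'[of z u v] that by simp
    then obtain m where "m \<in> Hom P Q' (W b)" "\<And>z u. \<lbrakk>z \<in> Ob C; u \<in> fob (W p) z\<rbrakk> \<Longrightarrow> m z (q' z u) = fmap (yoneda C) p b p2 z u"
      using factor_surj[OF qf'(2) W_Ob[OF i(4)] qf'(1) qf'(6) y] by metis
    then show ?thesis using that by simp
  qed
  have gy: "fmap (yoneda C) b c g \<in> Hom P (W b) (W c)" using i by simp
  \<comment> \<open>At each stage existence comes from the pullback \<open>p\<close> in
    \<open>C\<close>, and uniqueness from injectivity of \<open>m2\<close>.\<close>
  have pbE: "is_pullback E Q (W b) (W c) m (fmap (yoneda C) b c g) Q' m1 m2"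
  proof (rule pointwise_pullback[OF PL_Ob QPL(1) WPL[OF i(2)] WPL[OF i(3)] QPL(2) m(1) gy m1(1) m2(1)])
    fix z assume z: "z \<in> Ob C"
    show "m z (m1 z w) = fmap (yoneda C) b c g z (m2 z w)" if w: "w \<in> fob Q' z" for w
    proof -
      obtain u where u: "u \<in> Hom C z p" "w = q' z u" using qf'(5)[OF z w] by blast
      show ?thesis
        unfolding u(2) m1(2)[OF z u(1)] m2(2)[OF z u(1)]
        using m(2)[OF z, of "Comp C z p a p1 u"] assoc[OF u(1) i(7,5)] assoc[OF u(1) i(8,6)] u i z by simp
    qed
    show "\<exists>w\<in>fob Q' z. m1 z w = y \<and> m2 z w = v"
      if y: "y \<in> fob Q z" and v: "v \<in> fob (W b) z" and eq: "m z y = fmap (yoneda C) b c g z v" for y v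
    proof -
      obtain u where u: "u \<in> Hom C z a" "y = q z u" using qf(5)[OF z y] by blast
      have v': "v \<in> Hom C z b" using v by simp
      have "Comp C z a c f u = Comp C z b c g v" using eq u m(2)[OF z u(1)] z v' by simp
      then obtain h where h: "h \<in> Hom C z p" "Comp C z p a p1 h = u" "Comp C z p b p2 h = v"
        using pullback_ex[OF p z u(1) v'] by blast
      then show ?thesis using m1(2)[OF z h(1)] m2(2)[OF z h(1)] u qf'(3)[OF z h(1)] by auto
    qed
    show "w = w'" if w: "w \<in> fob Q' z" "w' \<in> fob Q' z" "m2 z w = m2 z w'" for w w'
    proof -
      obtain u u' where u: "u \<in> Hom C z p" "w = q' z u" "u' \<in> Hom C z p" "w' = q' z u'"
        using qf'(5)[OF z w(1)] qf'(5)[OF z w(2)] by blast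
      then show ?thesis using w(3) m2(2)[OF z u(1)] m2(2)[OF z u(3)] qeq'[OF z u(1,3)] by simp
    qed
  qed
  obtain c' \<eta>' where uQ': "universal Q' c' \<eta>'" using universal_ex_PL[OF QPL(2)] .
  note c' = universal_in(1)[OF uQ']
  let ?e = "\<eta>' p (q' p (idn C p))"
  have co: "is_coequaliser C r' p s' t' c' ?e" by (rule quotient_coequaliser(1)[OF e' pq' uQ'])
  have mm: "Comp P Q' Q (W c) m m1 \<in> Hom P Q' (W c)" using psh_Comp_in[OF m1(1) m(1) qf'(1)] .
  obtain k1 where k1: "k1 \<in> Hom C c' c" "\<forall>z\<in>Ob C. \<forall>w\<in>fob Q' z. Comp C z c' c k1 (\<eta>' z w) = Comp P Q' Q (W c) m m1 z w"
    using universal_ex[OF uQ' i(3) mm] .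
  obtain k2 where k2: "k2 \<in> Hom C c' b" "\<forall>z\<in>Ob C. \<forall>w\<in>fob Q' z. Comp C z c' b k2 (\<eta>' z w) = m2 z w"
    using universal_ex[OF uQ' i(2) m2(1)] .
  \<comment> \<open>With \<open>c\<close> and \<open>b\<close> as reflections of \<open>Q\<close>
    and of \<open>W b\<close>, the reflected square has the identity of \<open>c\<close> opposite to
    \<open>k2\<close>; hence \<open>k2\<close> is invertible, with inverse the arrow
    \<open>h\<close> found next.\<close>
  have pbC: "is_pullback C c b c (idn C c) g c' k1 k2"
  proof (rule universal_pullback[OF pbE uQ universal_W[OF i(2)] universal_W[OF i(3)] uQ' idn_in[OF i(3)] i(6) k1(1) k2(1)])
    fix z assume z: "z \<in> Ob C"
    show "Comp C z c c (idn C c) (m z w) = idn P (W c) z (m z w)" if "w \<in> fob Q z" for w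
      using hom_in[OF m(1) z that] z i by simp
    show "Comp C z b c g (idn P (W b) z w) = idn P (W c) z (fmap (yoneda C) b c g z w)" if "w \<in> fob (W b) z" for w
      using that z i by simp
    show "Comp C z c' c k1 (\<eta>' z w) = m z (m1 z w)" if "w \<in> fob Q' z" for w using k1(2) z that by simp
    show "Comp C z c' b k2 (\<eta>' z w) = idn P (W b) z (m2 z w)" if "w \<in> fob Q' z" for w
      using k2(2) z that hom_in[OF m2(1) z that] by simp
  qed
  have "Comp C b c c (idn C c) g = Comp C b b c g (idn C b)" using i by simp
  then obtain h where h: "h \<in> Hom C b c'" "Comp C b c' c k1 h = g" "Comp C b c' b k2 h = idn C b"
    using pullback_ex[OF pbC i(2,6) idn_in[OF i(2)]] by blast
  have k1g: "k1 = Comp C c' b c g k2" using pullback_in(9)[OF pbC] k1(1) c' i by simp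
  have "Comp C c' b c' h k2 = idn C c'"
  proof (rule pullback_uniq[OF pbC c'])
    show "Comp C c' c' c k1 (Comp C c' b c' h k2) = Comp C c' c' c k1 (idn C c')"
      using assoc[OF k2(1) h(1) k1(1)] h(2) k1g k1(1) c' i by simp
    show "Comp C c' c' b k2 (Comp C c' b c' h k2) = Comp C c' c' b k2 (idn C c')"
      using assoc[OF k2(1) h(1) k2(1)] h(3) k2(1) c' i by simp
  qed (use h k2 c' i in auto)
  then have "is_iso C c' b k2" unfolding is_iso_def using k2(1) h by blast
  then have "is_coequaliser C r' p s' t' b (Comp C p c' b k2 ?e)"
    by (rule coequaliser_iso_target[OF co _ i(2)])
  moreover have "Comp C p c' b k2 ?e = p2"
    using k2(2) qf'(3)[OF i(4) idn_in[OF i(4)]] m2(2)[OF i(4) idn_in[OF i(4)]] i by simp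
  ultimately show ?thesis unfolding regular_epi_def by metis
qed

theorem barr_exact: "barr_exact C"
  unfolding barr_exact_def regular_category_def
proof (intro conjI allI impI fc)
  show "\<exists>q e. is_coequaliser C r x s t q e" if "is_kernel_pair C x y f r s t" for x y f r s t
    using eqrel_effective[OF kernel_pair_eqrel[OF that]] by blast
  show "regular_epi C p b p2" if "is_pullback C a b c f g p p1 p2" "regular_epi C a c f" for a b c f g p p1 p2
    using regular_epi_stable[OF that] .
  show "\<exists>y f. is_kernel_pair C x y f r s t" if "equivalence_relation C r x s t" for r x s t
    using eqrel_effective[OF that] by blast
qed

end

theorem mainTheorem6:
  fixes C :: "('o, 'u) cat" and \<Phi> :: "'u lex_weight set"
  assumes "set_universe TYPE('u)"
    and "locally_small C"
    and "is_Phi_ex \<Phi>"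
  shows "Phi_exact \<Phi> C \<longleftrightarrow> finitely_complete C \<and> barr_exact C"
proof
  assume ex: "Phi_exact \<Phi> C"
  then have fc: "finitely_complete C" by (simp add: Phi_exact_def)
  interpret exact_presheaves C \<Phi>
    by unfold_locales (fact assms fc ex)+
  show "finitely_complete C \<and> barr_exact C" using fc barr_exact by blast
next
  assume b: "finitely_complete C \<and> barr_exact C"
  interpret barr_presheaves C
    by unfold_locales (simp_all add: assms b)
  show "Phi_exact \<Phi> C" by (rule barr_imp_Phi_exact[OF assms(3)])
qed

end
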